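(* Let $n\ge1$, $c\ge0$ and consider the quaternionic Kähler manifold $(\bar N_n/\Gamma,g^c)$, where $\Gamma$ is a discrete group of isometries of $(\bar N_n,g^c)$ obtained from a lattice in $\mathrm{SU}(1,n-1)\ltimes\mathrm{Heis}_{2n+1}$ as described in the context. Then for each $\rho_0\in\mathbb{R}_{>0}$ we have $$\mathrm{vol}(\bar N_{\rho\ge\rho_0}/\Gamma)<\infty$$ and $$\mathrm{vol}(\bar N_{[\rho,\rho_0]}/\Gamma)\to\infty\quad\text{as }\rho\to0.$$
   Context: Indices: $a,b$ run over $1,\dots,n-1$ and $k$ over $0,\dots,n-1$; empty sums are $0$. Metric. $\bar N_n=\{(X,w,\tilde\phi,\rho)\in\mathbb{C}^{n-1}\times\mathbb{C}^n\times\mathbb{R}\times\mathbb{R}_{>0}:\|X\|<1\}$ with the complete quaternionic Kähler metric $$\begin{aligned}g^c&=\tfrac{\rho+c}{\rho}\,g_{\mathbb{C}\mathrm{H}^{n-1}}+\tfrac{1}{4\rho^2}\tfrac{\rho+2c}{\rho+c}d\rho^2-\tfrac1\rho\Big(|dw^0|^2-\sum_a|dw^a|^2\Big)+\tfrac{\rho+c}{\rho^2}\tfrac{2}{1-\|X\|^2}\Big|dw^0+\sum_aX^adw^a\Big|^2\\&\quad+\tfrac1{4\rho^2}\tfrac{\rho+c}{\rho+2c}\Big(d\tilde\phi-2\operatorname{Im}\big(\bar w^0dw^0-\sum_a\bar w^adw^a\big)+\tfrac{2c}{1-\|X\|^2}\operatorname{Im}\sum_a\bar X^adX^a\Big)^2,\end{aligned}$$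 $g_{\mathbb{C}\mathrm{H}^{n-1}}=\frac1{1-\|X\|^2}\big(\sum_a|dX^a|^2+\frac1{1-\|X\|^2}|\sum_a\bar X^adX^a|^2\big)$. For $\rho_0>0$ and $0<\rho_1<\rho_0$, $\bar N_{\rho\ge\rho_0}$ is the set of points of $\bar N_n$ with $\rho$-coordinate $\ge\rho_0$ and $\bar N_{[\rho_1,\rho_0]}$ that of points with $\rho$-coordinate in $[\rho_1,\rho_0]$; $\Gamma$ preserves the function $\rho$. Volumes are with respect to the metric induced by $g^c$. Action. $\mathfrak{u}(1,n-1)$ is the fixed-point set in $\mathfrak{gl}(n,\mathbb{C})$ of $\sigma(A)=-I\bar A^\top I$, $I=\mathrm{diag}(-1,1,\dots,1)$. $\mathfrak{gl}(n,\mathbb{C})$ is generated by $C=i\mathbb{1}_n$, $U_a$ (single nonzero entry $1$ in row $0$, column $a$) and $U_a^\sigma=\sigma(U_a)$. $\mathfrak{heis}_{2n+1}$ has basis $e_k,f_k,T$ with nonzero brackets $[e_0,f_0]=T$, $[e_a,f_a]=-T$; $A\in\mathfrak{u}(1,n-1)$ acts by $T\mapsto0$, $v\mapsto-A^\top v$ on $\mathrm{span}(e_k,f_k)\cong\mathbb{C}^n$ ($f_k\leftrightarrow ie_k$). The injective Lie algebra anti-homomorphism $\alpha$ from $\mathfrak{u}(1,n-1)\ltimes\mathfrak{heis}_{2n+1}$ into Killing fields of $(\bar N_n,g^c)$ has complex-linear extension $C\mapsto Y_C$, $U_a\mapsto Y_a$, $U_a^\sigma\mapsto\bar Y_a$,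 $e_k-if_k\mapsto V_k$, $e_k+if_k\mapsto\bar V_k$, $T\mapsto\frac{\partial}{\partial\tilde\phi}$, where $$Y_C=-i\sum_k\Big(w^k\tfrac{\partial}{\partial w^k}-\bar w^k\tfrac{\partial}{\partial\bar w^k}\Big)-2c\tfrac{\partial}{\partial\tilde\phi},\quad Y_a=\tfrac{\partial}{\partial\bar X^a}-X^a\sum_bX^b\tfrac{\partial}{\partial X^b}-w^0\tfrac{\partial}{\partial w^a}-\bar w^a\tfrac{\partial}{\partial\bar w^0}+icX^a\tfrac{\partial}{\partial\tilde\phi},$$ $V_0=\frac{\partial}{\partial w^0}+i\bar w^0\frac{\partial}{\partial\tilde\phi}$, $V_a=\frac{\partial}{\partial w^a}-i\bar w^a\frac{\partial}{\partial\tilde\phi}$. It integrates to a homomorphism $\beta:\widetilde{\mathrm{U}}(1,n-1)\ltimes\mathrm{Heis}_{2n+1}\to\mathrm{Isom}(\bar N_n,g^c)$ (simply connected groups). Let $\mathcal{H}=\beta(\mathrm{Heis}_{2n+1})\cong\mathrm{Heis}_{2n+1}$ and, for $n\ge2$, $\mathcal{C}=\beta(\widetilde{\mathrm{SU}}(1,n-1))\cap\mathcal{H}$; for $n=1$, $\mathcal{C}=\beta(\widetilde{\mathrm{U}}(1))\cap\mathcal{H}$. $\mathcal{C}$ is central in $\mathcal{H}$ and trivial if $c=0$. Set $\hat N_n^c=\bar N_n/\mathcal{C}$. The action of $\widetilde{\mathrm{SU}}(1,n-1)\ltimes\mathrm{Heis}_{2n+1}$ descends to an effective isometric action of $\mathrm{SU}(1,n-1)\ltimes(\mathrm{Heis}_{2n+1}/\mathcal{C})$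 on $\hat N_n^c$ ($\mathrm{SU}(1,0)$ is trivial). The group $\Gamma$. Let $\tilde\Gamma\subset\mathrm{SU}(1,n-1)\ltimes\mathrm{Heis}_{2n+1}$ be a lattice (discrete subgroup of finite co-volume) whose image $\hat\Gamma$ in $\mathrm{SU}(1,n-1)\ltimes(\mathrm{Heis}_{2n+1}/\mathcal{C})$ is discrete and acts freely on $\hat N_n^c$. $\Gamma$ is the group of all isometries in $\beta(\widetilde{\mathrm{SU}}(1,n-1)\ltimes\mathrm{Heis}_{2n+1})\cdot\mathcal{C}$ lifting elements of $\hat\Gamma$ to $\bar N_n$, so that $\bar N_n/\Gamma=\hat N_n^c/\hat\Gamma$. The level sets of $\rho$ in $\bar N_n/\Gamma$ are locally homogeneous and of finite volume. *)

theory Defs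
  imports "HOL-Analysis.Analysis" "HOL-Algebra.Bij" "HOL-Algebra.Coset" "HOL-Algebra.Generated_Groups" "Jordan_Normal_Form.Determinant"
begin

hide_const (open) Determinants.det Finite_Cartesian_Product.mat Finite_Cartesian_Product.vec
  Finite_Cartesian_Product.row Finite_Cartesian_Product.column Finite_Cartesian_Product.transpose
  Determinants.trace
hide_type (open) Finite_Cartesian_Product.vec
unbundle no vec_syntax


section \<open>The manifold and its metric\<close>

text \<open>
  A quadruple \<open>(X, w, \<phi>, \<rho>)\<close> is a point, or a tangent vector \<open>(dX, dw, d\<phi>, d\<rho>)\<close>. The coordinates
  \<open>X\<^sup>a\<close> have \<open>1 \<le> a < n\<close>, the coordinates \<open>w\<^sup>k\<close> have \<open>0 \<le> k < n\<close>. Points are extensional functions, so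
  that they form a subset of the space of a product measure; in a tangent vector the entries
  outside of the index ranges are irrelevant.
\<close>

type_synonym coords = "(nat \<Rightarrow> complex) \<times> (nat \<Rightarrow> complex) \<times> real \<times> real"

fun coord_X :: "coords \<Rightarrow> nat \<Rightarrow> complex" where "coord_X (X, w, \<phi>, \<rho>) = X"
fun coord_w :: "coords \<Rightarrow> nat \<Rightarrow> complex" where "coord_w (X, w, \<phi>, \<rho>) = w"
fun coord_phi :: "coords \<Rightarrow> real" where "coord_phi (X, w, \<phi>, \<rho>) = \<phi>"
fun coord_rho :: "coords \<Rightarrow> real" where "coord_rho (X, w, \<phi>, \<rho>) = \<rho>"

definition Nbar :: "nat \<Rightarrow> coords set" where
  "Nbar n = {(X, w, \<phi>, \<rho>). X \<in> extensional {1..<n} \<and> w \<in> extensional {..<n} \<and>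
     (\<Sum>a\<in>{1..<n}. (cmod (X a))\<^sup>2) < 1 \<and> 0 < \<rho>}"

definition one_minus_normX2 :: "nat \<Rightarrow> (nat \<Rightarrow> complex) \<Rightarrow> real" where
  "one_minus_normX2 n X = 1 - (\<Sum>a\<in>{1..<n}. (cmod (X a))\<^sup>2)"

text \<open>The real part of the Hermitian product: the polarisation of \<open>\<bar>z\<bar>\<^sup>2\<close>.\<close>

definition rdot :: "complex \<Rightarrow> complex \<Rightarrow> real" where
  "rdot z z' = Re (z * cnj z')"

definition Xbar_dX :: "nat \<Rightarrow> (nat \<Rightarrow> complex) \<Rightarrow> (nat \<Rightarrow> complex) \<Rightarrow> complex" where
  "Xbar_dX n X dX = (\<Sum>a\<in>{1..<n}. cnj (X a) * dX a)"

definition g_CH :: "nat \<Rightarrow> (nat \<Rightarrow> complex) \<Rightarrow> (nat \<Rightarrow> complex) \<Rightarrow> (nat \<Rightarrow> complex) \<Rightarrow> real" where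
  "g_CH n X dX dX' =
     1 / one_minus_normX2 n X *
       ((\<Sum>a\<in>{1..<n}. rdot (dX a) (dX' a))
        + 1 / one_minus_normX2 n X * rdot (Xbar_dX n X dX) (Xbar_dX n X dX'))"

definition dw0_plus_Xdw :: "nat \<Rightarrow> (nat \<Rightarrow> complex) \<Rightarrow> (nat \<Rightarrow> complex) \<Rightarrow> complex" where
  "dw0_plus_Xdw n X dw = dw 0 + (\<Sum>a\<in>{1..<n}. X a * dw a)"

fun phi_form :: "nat \<Rightarrow> real \<Rightarrow> coords \<Rightarrow> coords \<Rightarrow> real" where
  "phi_form n c (X, w, \<phi>, \<rho>) (dX, dw, d\<phi>, d\<rho>) =
     d\<phi> - 2 * Im (cnj (w 0) * dw 0 - (\<Sum>a\<in>{1..<n}. cnj (w a) * dw a))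
     + 2 * c / one_minus_normX2 n X * Im (Xbar_dX n X dX)"

text \<open>The metric \<open>g\<^sup>c\<close> as a bilinear form; its quadratic form is spelled out in \<open>qk_metric_quadratic\<close>.\<close>

fun qk_metric :: "nat \<Rightarrow> real \<Rightarrow> coords \<Rightarrow> coords \<Rightarrow> coords \<Rightarrow> real" where
  "qk_metric n c (X, w, \<phi>, \<rho>) (dX, dw, d\<phi>, d\<rho>) (dX', dw', d\<phi>', d\<rho>') =
     (\<rho> + c) / \<rho> * g_CH n X dX dX'
     + 1 / (4 * \<rho>\<^sup>2) * ((\<rho> + 2 * c) / (\<rho> + c)) * (d\<rho> * d\<rho>')
     - 1 / \<rho> * (rdot (dw 0) (dw' 0) - (\<Sum>a\<in>{1..<n}. rdot (dw a) (dw' a)))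
     + (\<rho> + c) / \<rho>\<^sup>2 * (2 / one_minus_normX2 n X)
         * rdot (dw0_plus_Xdw n X dw) (dw0_plus_Xdw n X dw')
     + 1 / (4 * \<rho>\<^sup>2) * ((\<rho> + c) / (\<rho> + 2 * c))
         * (phi_form n c (X, w, \<phi>, \<rho>) (dX, dw, d\<phi>, d\<rho>)
            * phi_form n c (X, w, \<phi>, \<rho>) (dX', dw', d\<phi>', d\<rho>'))"

lemma qk_metric_quadratic:
  "qk_metric n c (X, w, \<phi>, \<rho>) (dX, dw, d\<phi>, d\<rho>) (dX, dw, d\<phi>, d\<rho>) =
     (let r2 = \<Sum>a\<in>{1..<n}. (cmod (X a))\<^sup>2;
          gCH = 1 / (1 - r2) * ((\<Sum>a\<in>{1..<n}. (cmod (dX a))\<^sup>2)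
                  + 1 / (1 - r2) * (cmod (\<Sum>a\<in>{1..<n}. cnj (X a) * dX a))\<^sup>2)
      in (\<rho> + c) / \<rho> * gCH + 1 / (4 * \<rho>\<^sup>2) * ((\<rho> + 2 * c) / (\<rho> + c)) * d\<rho>\<^sup>2
         - 1 / \<rho> * ((cmod (dw 0))\<^sup>2 - (\<Sum>a\<in>{1..<n}. (cmod (dw a))\<^sup>2))
         + (\<rho> + c) / \<rho>\<^sup>2 * (2 / (1 - r2)) * (cmod (dw 0 + (\<Sum>a\<in>{1..<n}. X a * dw a)))\<^sup>2
         + 1 / (4 * \<rho>\<^sup>2) * ((\<rho> + c) / (\<rho> + 2 * c))
           * (d\<phi> - 2 * Im (cnj (w 0) * dw 0 - (\<Sum>a\<in>{1..<n}. cnj (w a) * dw a))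
              + 2 * c / (1 - r2) * Im (\<Sum>a\<in>{1..<n}. cnj (X a) * dX a))\<^sup>2)"
proof -
  have r: "rdot z z = (cmod z)\<^sup>2" for z
    by (simp add: rdot_def complex_mult_cnj cmod_power2 flip: power2_eq_square)
  show ?thesis
    by (simp add: Let_def g_CH_def one_minus_normX2_def Xbar_dX_def dw0_plus_Xdw_def r
        flip: power2_eq_square)
qed


section \<open>Volumes\<close>

text \<open>The \<open>4n\<close> real coordinate vector fields.\<close>

definition coord_frame :: "nat \<Rightarrow> coords list" where
  "coord_frame n =
     concat (map (\<lambda>a. [((\<lambda>_. 0)(a := 1), \<lambda>_. 0, 0, 0), ((\<lambda>_. 0)(a := \<i>), \<lambda>_. 0, 0, 0)]) [1..<n])
     @ concat (map (\<lambda>k. [(\<lambda>_. 0, (\<lambda>_. 0)(k := 1), 0, 0), (\<lambda>_. 0, (\<lambda>_. 0)(k := \<i>), 0, 0)]) [0..<n])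
     @ [(\<lambda>_. 0, \<lambda>_. 0, 1, 0), (\<lambda>_. 0, \<lambda>_. 0, 0, 1)]"

definition gram_matrix :: "nat \<Rightarrow> real \<Rightarrow> coords \<Rightarrow> real mat" where
  "gram_matrix n c p =
     mat (length (coord_frame n)) (length (coord_frame n))
       (\<lambda>(i, j). qk_metric n c p (coord_frame n ! i) (coord_frame n ! j))"

definition coord_lebesgue :: "nat \<Rightarrow> coords measure" where
  "coord_lebesgue n =
     (\<Pi>\<^sub>M a\<in>{1..<n}. lborel) \<Otimes>\<^sub>M ((\<Pi>\<^sub>M k\<in>{..<n}. lborel) \<Otimes>\<^sub>M (lborel \<Otimes>\<^sub>M lborel))"

definition riemannian_volume :: "nat \<Rightarrow> real \<Rightarrow> coords measure" where
  "riemannian_volume n c =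
     density (restrict_space (coord_lebesgue n) (Nbar n))
       (\<lambda>p. ennreal (sqrt (det (gram_matrix n c p))))"

text \<open>
  The volume induced on a quotient by a measure \<open>M\<close> on the covering space: \<open>\<pi>\<close> is the
  projection and \<open>B\<close> a set of points of the quotient. If \<open>\<pi>\<close> is the projection to the orbits of a
  countable group that acts freely and preserves \<open>M\<close>, with Borel fundamental domain \<open>F\<close>, this is
  the measure of \<open>F \<inter> \<pi>\<^sup>-\<^sup>1 B\<close>; in particular it is the volume of the quotient metric if \<open>M\<close> is the
  Riemannian volume and the action is free, properly discontinuous and isometric.
\<close>

definition quotient_volume :: "'a measure \<Rightarrow> ('a \<Rightarrow> 'b) \<Rightarrow> 'b set \<Rightarrow> ennreal" where
  "quotient_volume M \<pi> B =
     (SUP U\<in>{U \<in> sets M. inj_on \<pi> U \<and> \<pi> ` U \<subseteq> B}. emeasure M U)"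

definition orbit_of :: "('a \<Rightarrow> 'a) set \<Rightarrow> 'a \<Rightarrow> 'a set" where
  "orbit_of S p = (\<lambda>\<psi>. \<psi> p) ` S"


section \<open>Groups and Lie algebras\<close>

definition I_form :: "nat \<Rightarrow> complex mat" where
  "I_form n = mat n n (\<lambda>(i, j). if i = j then (if i = 0 then - 1 else 1) else 0)"

definition conj_transpose :: "complex mat \<Rightarrow> complex mat" where
  "conj_transpose A = transpose_mat (map_mat cnj A)"

definition sigma_inv :: "nat \<Rightarrow> complex mat \<Rightarrow> complex mat" where
  "sigma_inv n A = - (I_form n * conj_transpose A * I_form n)"

definition lie_u :: "nat \<Rightarrow> complex mat set" where
  "lie_u n = {A \<in> carrier_mat n n. sigma_inv n A = A}"

definition lie_su :: "nat \<Rightarrow> complex mat set" where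
  "lie_su n = {A \<in> lie_u n. (\<Sum>i<n. A $$ (i, i)) = 0}"

definition U_group :: "nat \<Rightarrow> complex mat monoid" where
  "U_group n = \<lparr>carrier = {g \<in> carrier_mat n n. conj_transpose g * I_form n * g = I_form n},
     mult = (*), one = 1\<^sub>m n\<rparr>"

definition SU_group :: "nat \<Rightarrow> complex mat monoid" where
  "SU_group n = (U_group n)\<lparr>carrier := {g \<in> carrier (U_group n). det g = 1}\<rparr>"

text \<open>
  The pair \<open>(v, t)\<close> stands for \<open>\<Sum>\<^sub>k (Re v\<^sub>k e\<^sub>k + Im v\<^sub>k f\<^sub>k) + t T\<close>, and also for its exponential, so that
  the product in \<open>Heis_group\<close> is given by the Baker--Campbell--Hausdorff formula.
  \<open>[(v, t), (v', t')] = omega v v' T\<close>.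
\<close>

type_synonym heis = "complex vec \<times> real"

definition omega :: "nat \<Rightarrow> complex vec \<Rightarrow> complex vec \<Rightarrow> real" where
  "omega n v v' = Im (cnj (v $ 0) * v' $ 0) - (\<Sum>a\<in>{1..<n}. Im (cnj (v $ a) * v' $ a))"

definition Heis_group :: "nat \<Rightarrow> heis monoid" where
  "Heis_group n = \<lparr>carrier = carrier_vec n \<times> UNIV,
     mult = (\<lambda>(v, t) (v', t'). (v + v', t + t' + omega n v v' / 2)),
     one = (0\<^sub>v n, 0)\<rparr>"

text \<open>Integrates the action \<open>v \<mapsto> - A\<^sup>T v\<close> of the Lie algebra.\<close>

definition Heis_act :: "nat \<Rightarrow> complex mat \<Rightarrow> heis \<Rightarrow> heis" where
  "Heis_act n g = (\<lambda>(v, t). (transpose_mat (inv\<^bsub>U_group n\<^esub> g) *\<^sub>v v, t))"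

definition semidirect ::
  "'g monoid \<Rightarrow> ('g \<Rightarrow> 'h \<Rightarrow> 'h) \<Rightarrow> 'h monoid \<Rightarrow> ('g \<times> 'h) monoid" where
  "semidirect K \<theta> H = \<lparr>carrier = carrier K \<times> carrier H,
     mult = (\<lambda>(k, h) (k', h'). (k \<otimes>\<^bsub>K\<^esub> k', h \<otimes>\<^bsub>H\<^esub> \<theta> k h')),
     one = (\<one>\<^bsub>K\<^esub>, \<one>\<^bsub>H\<^esub>)\<rparr>"

definition UHeis :: "nat \<Rightarrow> (complex mat \<times> heis) monoid" where
  "UHeis n = semidirect (U_group n) (Heis_act n) (Heis_group n)"

definition SUHeis :: "nat \<Rightarrow> (complex mat \<times> heis) monoid" where
  "SUHeis n = semidirect (SU_group n) (Heis_act n) (Heis_group n)"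

definition SU_top :: "nat \<Rightarrow> complex mat topology" where
  "SU_top n = pullback_topology (carrier (SU_group n))
     (\<lambda>g. \<lambda>ij\<in>{..<n} \<times> {..<n}. g $$ ij) euclidean"

definition Heis_top :: "nat \<Rightarrow> heis topology" where
  "Heis_top n = pullback_topology (carrier (Heis_group n))
     (\<lambda>(v, t). (\<lambda>k\<in>{..<n}. v $ k, t)) euclidean"

definition SUHeis_top :: "nat \<Rightarrow> (complex mat \<times> heis) topology" where
  "SUHeis_top n = prod_topology (SU_top n) (Heis_top n)"


section \<open>The infinitesimal action\<close>

text \<open>
  The vector field \<open>\<alpha>(A, (v, t))\<close>. Writing \<open>Z = (1, X\<^sup>1, \<dots>, X\<^sup>n\<^sup>-\<^sup>1)\<close>, it is
  \<open>dX\<^sup>b = (A Z)\<^sup>b - X\<^sup>b (A Z)\<^sup>0\<close>, \<open>dw = - A\<^sup>T w + v/2\<close>, \<open>d\<phi> = - 2 c Im (A Z)\<^sup>0 + omega v w + t\<close>. This is the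
  anti-homomorphism determined by the values of its complex-linear extension on the
  generators: see \<open>alpha_C\<close>, \<open>alpha_U\<close>, \<open>alpha_ef\<close>, \<open>alpha_T\<close> and \<open>alpha_anti_hom\<close>.
\<close>

definition mat_Z :: "nat \<Rightarrow> complex mat \<Rightarrow> (nat \<Rightarrow> complex) \<Rightarrow> nat \<Rightarrow> complex" where
  "mat_Z n A X i = (\<Sum>j<n. A $$ (i, j) * (if j = 0 then 1 else X j))"

fun alpha :: "nat \<Rightarrow> real \<Rightarrow> complex mat \<times> heis \<Rightarrow> coords \<Rightarrow> coords" where
  "alpha n c (A, (v, t)) (X, w, \<phi>, \<rho>) =
     (\<lambda>b. mat_Z n A X b - X b * mat_Z n A X 0,
      \<lambda>k. v $ k / 2 - (\<Sum>j<n. A $$ (j, k) * w j),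
      omega n v (vec n w) + t - 2 * c * Im (mat_Z n A X 0),
      0)"


text \<open>The coefficient of \<open>\<partial>/\<partial>X\<^sup>b\<close> in a real vector field is \<open>dX\<^sup>b\<close>, that of its conjugate is
  \<open>cnj dX\<^sup>b\<close>, and similarly for \<open>w\<close>. The lemmas compute the values \<open>alpha \<xi> + \<i> alpha \<eta>\<close> of the
  complex-linear extension at \<open>\<xi> + \<i> \<eta>\<close>.\<close>

definition elem_mat :: "nat \<Rightarrow> complex \<Rightarrow> nat \<Rightarrow> nat \<Rightarrow> complex mat" where
  "elem_mat n z i j = mat n n (\<lambda>ij. if ij = (i, j) then z else 0)"

lemma sigma_inv_entry:
  assumes "A \<in> carrier_mat n n" "i < n" "j < n"
  shows "sigma_inv n A $$ (i, j) =
    - (if i = 0 then - 1 else 1) * cnj (A $$ (j, i)) * (if j = 0 then - 1 else 1)"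
proof -
  let ?B = "conj_transpose A"
  have c: "?B \<in> carrier_mat n n" "I_form n \<in> carrier_mat n n"
    using assms by (auto simp: conj_transpose_def I_form_def)
  have mm: "(M * N) $$ (i, k) = (\<Sum>l<n. M $$ (i, l) * N $$ (l, k))"
    if "M \<in> carrier_mat n n" "N \<in> carrier_mat n n" "k < n" for M N :: "complex mat" and k
    using that assms by (simp add: scalar_prod_def atLeast0LessThan)
  have 1: "(I_form n * ?B) $$ (i, k) = (if i = 0 then - 1 else 1) * ?B $$ (i, k)" if "k < n" for k
  proof -
    have "(I_form n * ?B) $$ (i, k) =
        (\<Sum>l<n. if l = i then (if i = 0 then - 1 else 1) * ?B $$ (i, k) else 0)"
      unfolding mm[OF c(2,1) that] using assms by (intro sum.cong) (auto simp: I_form_def)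
    then show ?thesis
      using assms by simp
  qed
  have "(I_form n * ?B * I_form n) $$ (i, j) =
      (\<Sum>k<n. (I_form n * ?B) $$ (i, k) * I_form n $$ (k, j))"
    using c assms by (intro mm) auto
  also have "\<dots> = (\<Sum>k<n. if k = j then (I_form n * ?B) $$ (i, j) * (if j = 0 then - 1 else 1) else 0)"
    using assms by (intro sum.cong) (auto simp: I_form_def)
  finally show ?thesis
    using assms c 1[of j] by (simp add: sigma_inv_def) (simp add: conj_transpose_def)
qed

lemma lie_u_iff:
  "A \<in> lie_u n \<longleftrightarrow> A \<in> carrier_mat n n \<and>
    (\<forall>i<n. \<forall>j<n. A $$ (i, j) =
       - (if i = 0 then - 1 else 1) * cnj (A $$ (j, i)) * (if j = 0 then - 1 else 1))"
    (is "_ \<longleftrightarrow> _ \<and> ?P")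
proof (cases "A \<in> carrier_mat n n")
  case True
  then have "sigma_inv n A = A \<longleftrightarrow> (\<forall>i<n. \<forall>j<n. sigma_inv n A $$ (i, j) = A $$ (i, j))"
    by (auto simp: mat_eq_iff sigma_inv_def I_form_def)
  then have "sigma_inv n A = A \<longleftrightarrow> ?P"
    using sigma_inv_entry[OF True] by (metis (no_types, lifting))
  then show ?thesis
    using True by (simp add: lie_u_def)
qed (simp add: lie_u_def)

lemma mat_Z_elem_mat:
  assumes "i < n" "l < n"
  shows "mat_Z n (elem_mat n z k l) X i = (if i = k then z * (if l = 0 then 1 else X l) else 0)"
proof -
  have "mat_Z n (elem_mat n z k l) X i =
      (\<Sum>j<n. if j = l then (if i = k then z * (if l = 0 then 1 else X l) else 0) else 0)"
    unfolding mat_Z_def using assms by (intro sum.cong) (auto simp: elem_mat_def)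
  then show ?thesis
    using assms by simp
qed

lemma mat_Z_add:
  assumes "A \<in> carrier_mat n n" "B \<in> carrier_mat n n" "i < n"
  shows "mat_Z n (A + B) X i = mat_Z n A X i + mat_Z n B X i"
  using assms by (auto simp: mat_Z_def sum.distrib[symmetric] algebra_simps intro!: sum.cong)

lemma mat_Z_zero: "i < n \<Longrightarrow> mat_Z n (0\<^sub>m n n) X i = 0"
  by (simp add: mat_Z_def)

lemma omega_zero: "1 \<le> n \<Longrightarrow> omega n (0\<^sub>v n) v = 0"
  by (simp add: omega_def)

lemma elem_mat_carrier [simp]: "elem_mat n z i j \<in> carrier_mat n n"
  by (simp add: elem_mat_def)

lemma sigma_inv_elem_mat:
  assumes "1 \<le> a" "a < n"
  shows "sigma_inv n (elem_mat n z 0 a) = elem_mat n (cnj z) a 0"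
proof (rule eq_matI)
  fix i j assume "i < dim_row (elem_mat n (cnj z) a 0)" "j < dim_col (elem_mat n (cnj z) a 0)"
  then have "i < n" "j < n"
    by (auto simp: elem_mat_def)
  then show "sigma_inv n (elem_mat n z 0 a) $$ (i, j) = elem_mat n (cnj z) a 0 $$ (i, j)"
    using assms by (auto simp: sigma_inv_entry) (auto simp: elem_mat_def)
qed (auto simp: sigma_inv_def I_form_def elem_mat_def)

definition scalar_i :: "nat \<Rightarrow> complex mat" where
  "scalar_i n = \<i> \<cdot>\<^sub>m 1\<^sub>m n"

lemma alpha_C:
  assumes "1 \<le> n"
  shows "scalar_i n \<in> lie_u n"
    and "b < n \<Longrightarrow> 1 \<le> b \<Longrightarrow> coord_X (alpha n c (scalar_i n, (0\<^sub>v n, 0)) (X, w, \<phi>, \<rho>)) b = 0"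
    and "k < n \<Longrightarrow> coord_w (alpha n c (scalar_i n, (0\<^sub>v n, 0)) (X, w, \<phi>, \<rho>)) k = - \<i> * w k"
    and "coord_phi (alpha n c (scalar_i n, (0\<^sub>v n, 0)) (X, w, \<phi>, \<rho>)) = - 2 * c"
proof -
  have Z: "mat_Z n (scalar_i n) X i = \<i> * (if i = 0 then 1 else X i)" if "i < n" for i
  proof -
    have "mat_Z n (scalar_i n) X i = (\<Sum>j<n. if j = i then \<i> * (if i = 0 then 1 else X i) else 0)"
      unfolding mat_Z_def using that by (intro sum.cong) (auto simp: scalar_i_def)
    then show ?thesis
      using that by simp
  qed
  have W: "(\<Sum>j<n. scalar_i n $$ (j, k) * w j) = \<i> * w k" if "k < n" for k
  proof -
    have "(\<Sum>j<n. scalar_i n $$ (j, k) * w j) = (\<Sum>j<n. if j = k then \<i> * w k else 0)"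
      using that by (intro sum.cong) (auto simp: scalar_i_def)
    then show ?thesis
      using that by simp
  qed
  show "scalar_i n \<in> lie_u n"
    by (auto simp: lie_u_iff) (auto simp: scalar_i_def)
  show "b < n \<Longrightarrow> 1 \<le> b \<Longrightarrow> coord_X (alpha n c (scalar_i n, (0\<^sub>v n, 0)) (X, w, \<phi>, \<rho>)) b = 0"
    using assms by (simp add: Z)
  show "k < n \<Longrightarrow> coord_w (alpha n c (scalar_i n, (0\<^sub>v n, 0)) (X, w, \<phi>, \<rho>)) k = - \<i> * w k"
    by (simp add: W)
  show "coord_phi (alpha n c (scalar_i n, (0\<^sub>v n, 0)) (X, w, \<phi>, \<rho>)) = - 2 * c"
    using assms by (simp add: Z omega_zero)
qed

text \<open>\<open>U\<^sub>a = A\<^sub>1 + \<i> A\<^sub>2\<close> with \<open>A\<^sub>1 = (U\<^sub>a + \<sigma> U\<^sub>a) / 2\<close> and \<open>A\<^sub>2 = (U\<^sub>a - \<sigma> U\<^sub>a) / (2\<i>)\<close>.\<close>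

lemma alpha_U:
  fixes X w :: "nat \<Rightarrow> complex" and c \<phi> \<rho> :: real
  assumes a: "1 \<le> a" "a < n"
  defines "A\<^sub>1 \<equiv> elem_mat n (1/2) 0 a + elem_mat n (1/2) a 0"
    and "A\<^sub>2 \<equiv> elem_mat n (- \<i>/2) 0 a + elem_mat n (\<i>/2) a 0"
  defines "v\<^sub>1 \<equiv> alpha n c (A\<^sub>1, (0\<^sub>v n, 0)) (X, w, \<phi>, \<rho>)"
    and "v\<^sub>2 \<equiv> alpha n c (A\<^sub>2, (0\<^sub>v n, 0)) (X, w, \<phi>, \<rho>)"
  shows "A\<^sub>1 \<in> lie_u n" and "A\<^sub>2 \<in> lie_u n" and "A\<^sub>1 + \<i> \<cdot>\<^sub>m A\<^sub>2 = elem_mat n 1 0 a"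
    and "b < n \<Longrightarrow> 1 \<le> b \<Longrightarrow> coord_X v\<^sub>1 b + \<i> * coord_X v\<^sub>2 b = - X a * X b"
    and "b < n \<Longrightarrow> 1 \<le> b \<Longrightarrow>
           cnj (coord_X v\<^sub>1 b) + \<i> * cnj (coord_X v\<^sub>2 b) = (if b = a then 1 else 0)"
    and "k < n \<Longrightarrow> coord_w v\<^sub>1 k + \<i> * coord_w v\<^sub>2 k = (if k = a then - w 0 else 0)"
    and "k < n \<Longrightarrow> cnj (coord_w v\<^sub>1 k) + \<i> * cnj (coord_w v\<^sub>2 k) = (if k = 0 then - cnj (w a) else 0)"
    and "complex_of_real (coord_phi v\<^sub>1) + \<i> * complex_of_real (coord_phi v\<^sub>2) = \<i> * c * X a"
proof -
  have n: "0 < n"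
    using a by simp
  define A where "A z = elem_mat n z 0 a + elem_mat n (cnj z) a 0" for z
  have A12: "A\<^sub>1 = A (1/2)" "A\<^sub>2 = A (- \<i>/2)"
    by (simp_all add: A_def A\<^sub>1_def A\<^sub>2_def)
  have u: "A z \<in> lie_u n" for z
    using a by (auto simp: lie_u_iff A_def) (auto simp: elem_mat_def)
  show "A\<^sub>1 \<in> lie_u n" "A\<^sub>2 \<in> lie_u n"
    by (simp_all add: A12 u)
  show "A\<^sub>1 + \<i> \<cdot>\<^sub>m A\<^sub>2 = elem_mat n 1 0 a"
    by (rule eq_matI) (auto simp: A\<^sub>1_def A\<^sub>2_def elem_mat_def)
  have Z: "mat_Z n (A z) X i = (if i = 0 then z * X a else if i = a then cnj z else 0)" if "i < n" for z i
    using a n that by (simp add: A_def mat_Z_add mat_Z_elem_mat)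
  have W: "(\<Sum>j<n. A z $$ (j, k) * w j) = (if k = a then z * w 0 else if k = 0 then cnj z * w a else 0)"
    if k: "k < n" for z k
  proof -
    have "(\<Sum>j<n. A z $$ (j, k) * w j) =
        (\<Sum>j<n. (if j = 0 then (if k = a then z * w 0 else 0) else 0)
               + (if j = a then (if k = 0 then cnj z * w a else 0) else 0))"
      using a k n by (intro sum.cong) (auto simp: A_def elem_mat_def)
    then show ?thesis
      using a n by (auto simp: sum.distrib)
  qed
  have X: "coord_X (alpha n c (A z, (0\<^sub>v n, 0)) (X, w, \<phi>, \<rho>)) b = (if b = a then cnj z else 0) - X b * (z * X a)"
    if "b < n" "1 \<le> b" for z b
    using that n by (simp add: Z)
  have w: "coord_w (alpha n c (A z, (0\<^sub>v n, 0)) (X, w, \<phi>, \<rho>)) k =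
      - (if k = a then z * w 0 else if k = 0 then cnj z * w a else 0)" if "k < n" for z k
    using that by (simp add: W)
  have p: "coord_phi (alpha n c (A z, (0\<^sub>v n, 0)) (X, w, \<phi>, \<rho>)) = - 2 * c * Im (z * X a)" for z
    using n by (simp add: Z omega_zero)
  show "coord_X v\<^sub>1 b + \<i> * coord_X v\<^sub>2 b = - X a * X b" if "b < n" "1 \<le> b"
    unfolding v\<^sub>1_def v\<^sub>2_def A12 X[OF that] by (simp add: algebra_simps)
  show "cnj (coord_X v\<^sub>1 b) + \<i> * cnj (coord_X v\<^sub>2 b) = (if b = a then 1 else 0)" if "b < n" "1 \<le> b"
    unfolding v\<^sub>1_def v\<^sub>2_def A12 X[OF that] by (simp add: algebra_simps)
  show "coord_w v\<^sub>1 k + \<i> * coord_w v\<^sub>2 k = (if k = a then - w 0 else 0)" if "k < n"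
    unfolding v\<^sub>1_def v\<^sub>2_def A12 w[OF that] using a by (simp add: algebra_simps)
  show "cnj (coord_w v\<^sub>1 k) + \<i> * cnj (coord_w v\<^sub>2 k) = (if k = 0 then - cnj (w a) else 0)" if "k < n"
    unfolding v\<^sub>1_def v\<^sub>2_def A12 w[OF that] using a by (simp add: algebra_simps)
  show "complex_of_real (coord_phi v\<^sub>1) + \<i> * complex_of_real (coord_phi v\<^sub>2) = \<i> * c * X a"
    unfolding v\<^sub>1_def v\<^sub>2_def A12 p by (simp add: complex_eq_iff)
qed

lemma alpha_ef:
  fixes X w :: "nat \<Rightarrow> complex" and c \<phi> \<rho> :: real
  assumes k: "k < n"
  defines "v\<^sub>e \<equiv> alpha n c (0\<^sub>m n n, (unit_vec n k, 0)) (X, w, \<phi>, \<rho>)"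
    and "v\<^sub>f \<equiv> alpha n c (0\<^sub>m n n, (\<i> \<cdot>\<^sub>v unit_vec n k, 0)) (X, w, \<phi>, \<rho>)"
  shows "b < n \<Longrightarrow> coord_X v\<^sub>e b = 0" and "b < n \<Longrightarrow> coord_X v\<^sub>f b = 0"
    and "j < n \<Longrightarrow> coord_w v\<^sub>e j - \<i> * coord_w v\<^sub>f j = (if j = k then 1 else 0)"
    and "j < n \<Longrightarrow> cnj (coord_w v\<^sub>e j) - \<i> * cnj (coord_w v\<^sub>f j) = 0"
    and "complex_of_real (coord_phi v\<^sub>e) - \<i> * complex_of_real (coord_phi v\<^sub>f)
           = (if k = 0 then \<i> * cnj (w 0) else - \<i> * cnj (w k))"
proof -
  have n: "0 < n"
    using k by simp
  have om: "omega n (z \<cdot>\<^sub>v unit_vec n k) (vec n w) =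
      (if k = 0 then Im (cnj z * w 0) else - Im (cnj z * w k))" for z
  proof -
    have "(\<Sum>a\<in>{1..<n}. Im (cnj ((z \<cdot>\<^sub>v unit_vec n k) $ a) * vec n w $ a)) =
        (\<Sum>a\<in>{1..<n}. if a = k then Im (cnj z * w k) else 0)"
      using k by (intro sum.cong) auto
    then show ?thesis
      using k n by (auto simp: omega_def)
  qed
  have om1: "omega n (unit_vec n k) (vec n w) = (if k = 0 then Im (w 0) else - Im (w k))"
    using om[of 1] by simp
  show "b < n \<Longrightarrow> coord_X v\<^sub>e b = 0" "b < n \<Longrightarrow> coord_X v\<^sub>f b = 0"
    using n by (simp_all add: v\<^sub>e_def v\<^sub>f_def mat_Z_zero)
  show "coord_w v\<^sub>e j - \<i> * coord_w v\<^sub>f j = (if j = k then 1 else 0)" if "j < n"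
    using that k by (simp add: v\<^sub>e_def v\<^sub>f_def)
  show "cnj (coord_w v\<^sub>e j) - \<i> * cnj (coord_w v\<^sub>f j) = 0" if "j < n"
    using that k by (simp add: v\<^sub>e_def v\<^sub>f_def)
  show "complex_of_real (coord_phi v\<^sub>e) - \<i> * complex_of_real (coord_phi v\<^sub>f)
      = (if k = 0 then \<i> * cnj (w 0) else - \<i> * cnj (w k))"
    using n by (simp add: v\<^sub>e_def v\<^sub>f_def om om1 mat_Z_zero complex_eq_iff)
qed

lemma alpha_T:
  assumes "1 \<le> n"
  shows "b < n \<Longrightarrow> coord_X (alpha n c (0\<^sub>m n n, (0\<^sub>v n, 1)) (X, w, \<phi>, \<rho>)) b = 0"
    and "k < n \<Longrightarrow> coord_w (alpha n c (0\<^sub>m n n, (0\<^sub>v n, 1)) (X, w, \<phi>, \<rho>)) k = 0"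
    and "coord_phi (alpha n c (0\<^sub>m n n, (0\<^sub>v n, 1)) (X, w, \<phi>, \<rho>)) = 1"
  using assms by (simp_all add: mat_Z_zero omega_zero)

fun lie_bracket :: "nat \<Rightarrow> complex mat \<times> heis \<Rightarrow> complex mat \<times> heis \<Rightarrow> complex mat \<times> heis" where
  "lie_bracket n (A, (v, t)) (B, (u, s)) =
     (A * B - B * A, (transpose_mat B *\<^sub>v v - transpose_mat A *\<^sub>v u, omega n v u))"

fun move :: "coords \<Rightarrow> coords \<Rightarrow> real \<Rightarrow> coords" where
  "move (X, w, \<phi>, \<rho>) (dX, dw, d\<phi>, d\<rho>) s =
     (\<lambda>b. X b + s * dX b, \<lambda>k. w k + s * dw k, \<phi> + s * d\<phi>, \<rho> + s * d\<rho>)"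

text \<open>Components of the bracket \<open>[V, W]\<close>: the derivative of \<open>W\<close> along \<open>V\<close> minus that of \<open>V\<close> along \<open>W\<close>.\<close>

definition field_bracket :: "(coords \<Rightarrow> coords) \<Rightarrow> (coords \<Rightarrow> coords) \<Rightarrow> coords \<Rightarrow>
    (coords \<Rightarrow> 'a :: real_normed_vector) \<Rightarrow> 'a" where
  "field_bracket V W p f =
     vector_derivative (\<lambda>s. f (W (move p (V p) s))) (at 0)
     - vector_derivative (\<lambda>s. f (V (move p (W p) s))) (at 0)"

lemma alpha_anti_hom:
  fixes t s :: real
  assumes n: "1 \<le> n" and A: "A \<in> lie_u n" and B: "B \<in> lie_u n"
    and v: "v \<in> carrier_vec n" and u: "u \<in> carrier_vec n"
  defines "\<xi> \<equiv> (A, (v, t))" and "\<eta> \<equiv> (B, (u, s))"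
  shows "b < n \<Longrightarrow> 1 \<le> b \<Longrightarrow> field_bracket (alpha n c \<xi>) (alpha n c \<eta>) p (\<lambda>y. coord_X y b)
           = - coord_X (alpha n c (lie_bracket n \<xi> \<eta>) p) b"
    and "k < n \<Longrightarrow> field_bracket (alpha n c \<xi>) (alpha n c \<eta>) p (\<lambda>y. coord_w y k)
           = - coord_w (alpha n c (lie_bracket n \<xi> \<eta>) p) k"
    and "field_bracket (alpha n c \<xi>) (alpha n c \<eta>) p coord_phi
           = - coord_phi (alpha n c (lie_bracket n \<xi> \<eta>) p)"
proof -
  obtain X w \<phi> \<rho> where p: "p = (X, w, \<phi>, \<rho>)"
    by (cases p) auto
  have Ac: "A \<in> carrier_mat n n" and Bc: "B \<in> carrier_mat n n"
    using A B by (auto simp: lie_u_def)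
  define Z where "Z j = (if j = 0 then 1 else X j)" for j
  define P where "P M N i = (\<Sum>j<n. M $$ (i, j) * mat_Z n N X j)" for M N i
  have comm: "mat_Z n (A * B - B * A) X i = P A B i - P B A i" if i: "i < n" for i
  proof -
    have prod: "mat_Z n (M * N) X i = P M N i"
      if "M \<in> carrier_mat n n" "N \<in> carrier_mat n n" for M N
    proof -
      have "mat_Z n (M * N) X i = (\<Sum>j<n. \<Sum>k<n. M $$ (i, k) * N $$ (k, j) * Z j)"
        unfolding mat_Z_def Z_def using that i
        by (intro sum.cong) (auto simp: scalar_prod_def sum_distrib_right atLeast0LessThan)
      also have "\<dots> = P M N i"
        by (subst sum.swap) (simp add: P_def mat_Z_def Z_def sum_distrib_left mult.assoc)
      finally show ?thesis .
    qed
    have "mat_Z n (A * B - B * A) X i = mat_Z n (A * B) X i - mat_Z n (B * A) X i"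
      unfolding mat_Z_def using i Ac Bc
      by (auto simp: sum_subtractf[symmetric] algebra_simps intro!: sum.cong)
    then show ?thesis
      using prod[OF Ac Bc] prod[OF Bc Ac] by simp
  qed
  define d where "d N b = mat_Z n N X b - X b * mat_Z n N X 0" for N b
  define e where "e N v k = v $ k / 2 - (\<Sum>j<n. N $$ (j, k) * w j)" for N v k
  have mov: "move p (alpha n c (N, (y, r)) p) s =
      (\<lambda>b. X b + complex_of_real s * d N b, \<lambda>k. w k + complex_of_real s * e N y k,
       \<phi> + s * (omega n y (vec n w) + r - 2 * c * Im (mat_Z n N X 0)), \<rho>)" for N y r s
    by (simp add: p d_def e_def)
  define L where "L M N i = P M N i - mat_Z n M X i * mat_Z n N X 0" for M N i
  have mv: "mat_Z n M (\<lambda>b. X b + complex_of_real s * d N b) i = mat_Z n M X i + s * L M N i" for M N i s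
  proof -
    have "mat_Z n M (\<lambda>b. X b + complex_of_real s * d N b) i =
        (\<Sum>j<n. M $$ (i, j) * Z j + s * (M $$ (i, j) * mat_Z n N X j - M $$ (i, j) * Z j * mat_Z n N X 0))"
      unfolding mat_Z_def[of n M] by (intro sum.cong) (auto simp: Z_def d_def algebra_simps)
    also have "\<dots> = mat_Z n M X i + s * L M N i"
      unfolding L_def P_def mat_Z_def[of n M]
      by (simp add: Z_def sum.distrib sum_subtractf sum_distrib_right sum_distrib_left[symmetric])
    finally show ?thesis .
  qed
  have vdX: "vector_derivative
      (\<lambda>s. (f + complex_of_real s * l) - (x + complex_of_real s * y) * (q + complex_of_real s * m)) (at 0)
        = l - y * q - x * m" for f l x y q m
    by (rule vector_derivative_at) (auto intro!: derivative_eq_intros simp: algebra_simps)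
  show "field_bracket (alpha n c \<xi>) (alpha n c \<eta>) p (\<lambda>y. coord_X y b)
      = - coord_X (alpha n c (lie_bracket n \<xi> \<eta>) p) b" if "b < n" "1 \<le> b"
    using that n unfolding field_bracket_def \<xi>_def \<eta>_def mov
    by (simp add: mv vdX comm p) (simp add: d_def L_def algebra_simps)
  have vdw: "vector_derivative (\<lambda>s. z - (\<Sum>j<n. f j * (x j + complex_of_real s * y j))) (at 0)
      = - (\<Sum>j<n. f j * y j)" for z f x y
    by (rule vector_derivative_at) (auto intro!: derivative_eq_intros simp: algebra_simps)
  show "field_bracket (alpha n c \<xi>) (alpha n c \<eta>) p (\<lambda>y. coord_w y k)
      = - coord_w (alpha n c (lie_bracket n \<xi> \<eta>) p) k" if k: "k < n"
  proof -
    have tr: "(transpose_mat M *\<^sub>v y) $ k = (\<Sum>j<n. M $$ (j, k) * y $ j)"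
      if "M \<in> carrier_mat n n" "y \<in> carrier_vec n" for M and y :: "complex vec"
      using that k by (simp add: scalar_prod_def atLeast0LessThan)
    have pr: "(\<Sum>j<n. (M * N) $$ (j, k) * w j) = (\<Sum>j<n. N $$ (j, k) * (\<Sum>i<n. M $$ (i, j) * w i))"
      if "M \<in> carrier_mat n n" "N \<in> carrier_mat n n" for M N
    proof -
      have "(\<Sum>j<n. (M * N) $$ (j, k) * w j) = (\<Sum>j<n. \<Sum>i<n. M $$ (j, i) * N $$ (i, k) * w j)"
        using that k by (intro sum.cong) (auto simp: scalar_prod_def sum_distrib_right atLeast0LessThan)
      also have "\<dots> = (\<Sum>j<n. N $$ (j, k) * (\<Sum>i<n. M $$ (i, j) * w i))"
        by (subst sum.swap) (simp add: sum_distrib_left mult_ac)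
      finally show ?thesis .
    qed
    have cm: "(\<Sum>j<n. (A * B - B * A) $$ (j, k) * w j) =
        (\<Sum>j<n. (A * B) $$ (j, k) * w j) - (\<Sum>j<n. (B * A) $$ (j, k) * w j)"
      using Ac Bc k by (auto simp: sum_subtractf[symmetric] algebra_simps intro!: sum.cong)
    have dist: "(\<Sum>j<n. M $$ (j, k) * e N y j) =
        (\<Sum>j<n. M $$ (j, k) * y $ j) / 2 - (\<Sum>j<n. M $$ (j, k) * (\<Sum>i<n. N $$ (i, j) * w i))" for M N y
      by (simp add: e_def algebra_simps sum_subtractf sum_divide_distrib)
    have "field_bracket (alpha n c \<xi>) (alpha n c \<eta>) p (\<lambda>y. coord_w y k)
        = - (\<Sum>j<n. B $$ (j, k) * e A v j) + (\<Sum>j<n. A $$ (j, k) * e B u j)"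
      unfolding field_bracket_def \<xi>_def \<eta>_def mov by (simp add: vdw)
    also have "\<dots> = - coord_w (alpha n c (lie_bracket n \<xi> \<eta>) p) k"
      unfolding \<xi>_def \<eta>_def p dist using k Ac Bc v u
      by (simp add: tr[OF Ac u] tr[OF Bc v] cm pr[OF Ac Bc] pr[OF Bc Ac]
          del: index_mult_mat_vec index_mult_mat)
         (simp add: algebra_simps diff_divide_distrib)
    finally show ?thesis .
  qed
  define sg :: "nat \<Rightarrow> complex" where "sg k = (if k = 0 then - 1 else 1)" for k
  have omega_sg: "omega n x y = - Im (\<Sum>k<n. sg k * (cnj (x $ k) * y $ k))" for x y
  proof -
    have "{..<n} = insert 0 {1..<n}"
      using n by auto
    then show ?thesis
      by (simp add: omega_def sg_def Im_sum)
  qed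
  have om_skew: "omega n (transpose_mat M *\<^sub>v x) y = - omega n x (transpose_mat M *\<^sub>v y)"
    if M: "M \<in> lie_u n" and x: "x \<in> carrier_vec n" and y: "y \<in> carrier_vec n" for M x y
  proof -
    have Mc: "M \<in> carrier_mat n n"
      using M by (simp add: lie_u_def)
    have tr: "(transpose_mat M *\<^sub>v z) $ k = (\<Sum>j<n. M $$ (j, k) * z $ j)"
      if "z \<in> carrier_vec n" "k < n" for z k
      using that Mc by (simp add: scalar_prod_def atLeast0LessThan)
    have sk: "sg k * cnj (M $$ (j, k)) = - sg j * M $$ (k, j)" if "k < n" "j < n" for j k
    proof -
      have eq: "M $$ (k, j) =
          - (if k = 0 then - 1 else 1) * cnj (M $$ (j, k)) * (if j = 0 then - 1 else 1)"
        using M that unfolding lie_u_iff by blast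
      show ?thesis
        by (subst eq) (simp add: sg_def)
    qed
    have "(\<Sum>k<n. sg k * (cnj ((transpose_mat M *\<^sub>v x) $ k) * y $ k)) =
        (\<Sum>k<n. \<Sum>j<n. sg k * cnj (M $$ (j, k)) * (cnj (x $ j) * y $ k))"
      using x by (intro sum.cong) (auto simp: tr sum_distrib_left sum_distrib_right mult_ac)
    also have "\<dots> = (\<Sum>k<n. \<Sum>j<n. - sg j * M $$ (k, j) * (cnj (x $ j) * y $ k))"
      by (intro sum.cong) (auto simp: sk)
    also have "\<dots> = - (\<Sum>j<n. \<Sum>k<n. sg j * M $$ (k, j) * (cnj (x $ j) * y $ k))"
      by (subst sum.swap) (simp add: sum_negf)
    also have "\<dots> = - (\<Sum>j<n. sg j * (cnj (x $ j) * (transpose_mat M *\<^sub>v y) $ j))"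
      using y by (intro arg_cong[where f = uminus] sum.cong)
        (auto simp: tr sum_distrib_left sum_distrib_right mult_ac)
    finally show ?thesis
      by (simp add: omega_sg)
  qed
  have om_lin: "omega n x (vec n (\<lambda>k. w k + complex_of_real s * y k)) =
      omega n x (vec n w) + s * omega n x (vec n y)" for x s y
    using n by (simp add: omega_def algebra_simps sum.distrib sum_distrib_left sum_subtractf)
  have vdp: "vector_derivative (\<lambda>s. a + s * b + t - 2 * c * Im (f + complex_of_real s * l)) (at 0)
      = b - 2 * c * Im l" for a b t :: real and f l :: complex
    by (rule vector_derivative_at)
       (auto simp: has_real_derivative_iff_has_vector_derivative[symmetric]
         intro!: derivative_eq_intros)
  have om_e: "omega n x (vec n (e N y)) =
      omega n x y / 2 - omega n x (transpose_mat N *\<^sub>v vec n w)"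
    if N: "N \<in> carrier_mat n n" and y: "y \<in> carrier_vec n" for N x y
  proof -
    have "vec n (e N y) $ k = y $ k / 2 - (transpose_mat N *\<^sub>v vec n w) $ k" if "k < n" for k
      using that N by (simp add: e_def scalar_prod_def atLeast0LessThan)
    then have "(\<Sum>k<n. sg k * (cnj (x $ k) * vec n (e N y) $ k)) =
        (\<Sum>k<n. sg k * (cnj (x $ k) * y $ k) / 2 - sg k * (cnj (x $ k) * (transpose_mat N *\<^sub>v vec n w) $ k))"
      by (intro sum.cong) (auto simp: right_diff_distrib simp del: index_vec index_mult_mat_vec)
    also have "\<dots> = (\<Sum>k<n. sg k * (cnj (x $ k) * y $ k)) / 2
        - (\<Sum>k<n. sg k * (cnj (x $ k) * (transpose_mat N *\<^sub>v vec n w) $ k))"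
      by (simp only: sum_subtractf sum_divide_distrib)
    finally show ?thesis
      unfolding omega_sg by (simp del: Im_sum)
  qed
  have om_anti: "omega n u v = - omega n v u"
    by (simp add: omega_def algebra_simps sum_subtractf)
  have om_sub: "omega n (x - y) z = omega n x z - omega n y z"
    if "x \<in> carrier_vec n" "y \<in> carrier_vec n" for x y z
    using that n by (simp add: omega_def algebra_simps sum.distrib sum_subtractf)
  have "field_bracket (alpha n c \<xi>) (alpha n c \<eta>) p coord_phi =
      (omega n u (vec n (e A v)) - 2 * c * Im (L B A 0)) - (omega n v (vec n (e B u)) - 2 * c * Im (L A B 0))"
    unfolding field_bracket_def \<xi>_def \<eta>_def mov
    by (simp add: mv om_lin vdp del: plus_complex.sel)
  also have "\<dots> = - coord_phi (alpha n c (lie_bracket n \<xi> \<eta>) p)"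
    using n Ac Bc v u unfolding \<xi>_def \<eta>_def p
    by (simp add: om_e comm om_sub om_skew[OF A u] om_skew[OF B v] om_anti L_def algebra_simps)
  finally show "field_bracket (alpha n c \<xi>) (alpha n c \<eta>) p coord_phi =
      - coord_phi (alpha n c (lie_bracket n \<xi> \<eta>) p)" .
qed


section \<open>The integrated action\<close>

definition has_velocity ::
  "nat \<Rightarrow> (real \<Rightarrow> coords) \<Rightarrow> coords \<Rightarrow> real \<Rightarrow> real set \<Rightarrow> bool" where
  "has_velocity n \<gamma> v s S \<longleftrightarrow>
     (\<forall>a\<in>{1..<n}. ((\<lambda>r. coord_X (\<gamma> r) a) has_vector_derivative coord_X v a) (at s within S)) \<and>
     (\<forall>k<n. ((\<lambda>r. coord_w (\<gamma> r) k) has_vector_derivative coord_w v k) (at s within S)) \<and>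
     ((\<lambda>r. coord_phi (\<gamma> r)) has_real_derivative coord_phi v) (at s within S) \<and>
     ((\<lambda>r. coord_rho (\<gamma> r)) has_real_derivative coord_rho v) (at s within S)"

definition time_one_map :: "nat \<Rightarrow> (coords \<Rightarrow> coords) \<Rightarrow> (coords \<Rightarrow> coords) \<Rightarrow> bool" where
  "time_one_map n V \<psi> \<longleftrightarrow> \<psi> \<in> Bij (Nbar n) \<and>
     (\<forall>p\<in>Nbar n. \<exists>\<gamma>. \<gamma> 0 = p \<and> \<gamma> 1 = \<psi> p \<and>
        (\<forall>s\<in>{0..1}. \<gamma> s \<in> Nbar n \<and> has_velocity n \<gamma> (V (\<gamma> s)) s {0..1}))"

definition mat_exp :: "nat \<Rightarrow> complex mat \<Rightarrow> complex mat" where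
  "mat_exp n A = mat n n (\<lambda>ij. \<Sum>k. (A ^\<^sub>m k) $$ ij / fact k)"

text \<open>
  A simply connected group \<open>G\<close> over a subgroup of \<open>U(1,n-1) \<ltimes> Heis\<close> is connected, hence generated by
  exponentials, and \<open>\<beta>\<close> is determined by \<open>\<beta>(exp \<xi>) =\<close> time-one map of \<open>alpha \<xi>\<close>. So the image of \<open>G\<close>
  under the homomorphism \<open>g \<mapsto> (projection of g, \<beta>(g))\<close> is the subgroup generated by the pairs
  \<open>(exp \<xi>, time-one map of alpha \<xi>)\<close>; an isometry \<open>\<psi>\<close> is \<open>\<beta>\<close> of some element over \<open>g\<close> if and only if
  \<open>(g, \<psi>)\<close> belongs to it. If the Lie algebra of \<open>G\<close> is \<open>\<aa> \<ltimes> \<hh>\<close>, it suffices to take \<open>\<xi>\<close> in one of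
  the two factors; \<open>\<hh> = {}\<close> or \<open>\<aa> = {}\<close> omits a factor.
\<close>

definition beta_graph ::
  "nat \<Rightarrow> real \<Rightarrow> complex mat set \<Rightarrow> heis set \<Rightarrow> ((complex mat \<times> heis) \<times> (coords \<Rightarrow> coords)) set" where
  "beta_graph n c \<aa> \<hh> = generate (UHeis n \<times>\<times> BijGroup (Nbar n))
     ({((mat_exp n A, \<one>\<^bsub>Heis_group n\<^esub>), \<psi>) | A \<psi>.
         A \<in> \<aa> \<and> time_one_map n (alpha n c (A, (0\<^sub>v n, 0))) \<psi>}
      \<union> {((1\<^sub>m n, h), \<psi>) | h \<psi>. h \<in> \<hh> \<and> time_one_map n (alpha n c (0\<^sub>m n n, h)) \<psi>})"

abbreviation beta_SUHeis where
  "beta_SUHeis n c \<equiv> beta_graph n c (lie_su n) (carrier (Heis_group n))"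

definition H_group :: "nat \<Rightarrow> real \<Rightarrow> (coords \<Rightarrow> coords) set" where
  "H_group n c = snd ` beta_graph n c {} (carrier (Heis_group n))"

definition C_group :: "nat \<Rightarrow> real \<Rightarrow> (coords \<Rightarrow> coords) set" where
  "C_group n c = snd ` beta_graph n c (if n = 1 then lie_u n else lie_su n) {} \<inter> H_group n c"

text \<open>The subgroup of \<open>Heis\<close> corresponding to \<open>C_group\<close> under the isomorphism \<open>\<beta>\<close> from \<open>Heis\<close> to \<open>H_group\<close>.\<close>

definition C_heis :: "nat \<Rightarrow> real \<Rightarrow> heis set" where
  "C_heis n c = {h. \<exists>\<psi>\<in>C_group n c. ((1\<^sub>m n, h), \<psi>) \<in> beta_graph n c {} (carrier (Heis_group n))}"

definition Nhat :: "nat \<Rightarrow> real \<Rightarrow> coords set set" where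
  "Nhat n c = orbit_of (C_group n c) ` Nbar n"

definition SUHeis_mod_C :: "nat \<Rightarrow> real \<Rightarrow> (complex mat \<times> heis set) monoid" where
  "SUHeis_mod_C n c =
     semidirect (SU_group n) (\<lambda>g S. Heis_act n g ` S) (Heis_group n Mod C_heis n c)"

definition quotient_top :: "('g, 'b) monoid_scheme \<Rightarrow> 'g topology \<Rightarrow> 'g set \<Rightarrow> 'g set topology" where
  "quotient_top G T N = topology (\<lambda>V. V \<subseteq> carrier (G Mod N) \<and> openin T (\<Union>V))"

definition SUHeis_mod_C_top :: "nat \<Rightarrow> real \<Rightarrow> (complex mat \<times> heis set) topology" where
  "SUHeis_mod_C_top n c =
     prod_topology (SU_top n) (quotient_top (Heis_group n) (Heis_top n) (C_heis n c))"

text \<open>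
  The action on \<open>Nhat\<close> of \<open>(g, S)\<close>, where \<open>S\<close> is a coset of \<open>C_heis\<close>: all lifts \<open>\<psi>\<close> of \<open>(g, h)\<close> with
  \<open>h \<in> S\<close> induce the same map on \<open>Nhat\<close>, so that the image of the orbit \<open>x\<close> is the union of all \<open>\<psi> ` x\<close>.
\<close>

definition hat_action ::
  "nat \<Rightarrow> real \<Rightarrow> complex mat \<times> heis set \<Rightarrow> coords set \<Rightarrow> coords set" where
  "hat_action n c \<gamma> x =
     {\<psi> p | \<psi> p h. p \<in> x \<and> h \<in> snd \<gamma> \<and> ((fst \<gamma>, h), \<psi>) \<in> beta_SUHeis n c}"


section \<open>Lattices and the group \<open>\<Gamma>\<close>\<close>

definition discrete_subgroup :: "'g monoid \<Rightarrow> 'g topology \<Rightarrow> 'g set \<Rightarrow> bool" where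
  "discrete_subgroup G T D \<longleftrightarrow> subgroup D G \<and> subtopology T D = discrete_topology D"

definition haar_measure :: "'g monoid \<Rightarrow> 'g topology \<Rightarrow> 'g measure \<Rightarrow> bool" where
  "haar_measure G T \<mu> \<longleftrightarrow>
     space \<mu> = carrier G \<and> sets \<mu> = sigma_sets (carrier G) {U. openin T U} \<and>
     (\<forall>g\<in>carrier G. \<forall>E\<in>sets \<mu>. emeasure \<mu> (g <#\<^bsub>G\<^esub> E) = emeasure \<mu> E) \<and>
     (\<forall>K. compactin T K \<longrightarrow> emeasure \<mu> K < \<infinity>) \<and>
     emeasure \<mu> (carrier G) \<noteq> 0"

definition lattice_subgroup :: "'g monoid \<Rightarrow> 'g topology \<Rightarrow> 'g set \<Rightarrow> bool" where
  "lattice_subgroup G T D \<longleftrightarrow> discrete_subgroup G T D \<and>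
     (\<exists>\<mu>. haar_measure G T \<mu> \<and> quotient_volume \<mu> (\<lambda>g. D #>\<^bsub>G\<^esub> g) (rcosets\<^bsub>G\<^esub> D) < \<infinity>)"

definition Gamma_hat ::
  "nat \<Rightarrow> real \<Rightarrow> (complex mat \<times> heis) set \<Rightarrow> (complex mat \<times> heis set) set" where
  "Gamma_hat n c \<Gamma>\<^sub>t = (\<lambda>(g, h). (g, C_heis n c #>\<^bsub>Heis_group n\<^esub> h)) ` \<Gamma>\<^sub>t"

definition acts_freely_on_Nhat :: "nat \<Rightarrow> real \<Rightarrow> (complex mat \<times> heis set) set \<Rightarrow> bool" where
  "acts_freely_on_Nhat n c D \<longleftrightarrow>
     (\<forall>\<gamma>\<in>D. \<gamma> \<noteq> \<one>\<^bsub>SUHeis_mod_C n c\<^esub> \<longrightarrow> (\<forall>x\<in>Nhat n c. hat_action n c \<gamma> x \<noteq> x))"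

text \<open>The elements of \<open>beta_SUHeis\<close> and \<open>C_group\<close> are compositions of flows of Killing fields, hence isometries.\<close>

definition Gamma_group :: "nat \<Rightarrow> real \<Rightarrow> (complex mat \<times> heis) set \<Rightarrow> (coords \<Rightarrow> coords) set" where
  "Gamma_group n c \<Gamma>\<^sub>t =
     {\<psi> \<in> snd ` beta_SUHeis n c <#>\<^bsub>BijGroup (Nbar n)\<^esub> C_group n c.
        \<exists>\<gamma>\<in>Gamma_hat n c \<Gamma>\<^sub>t. \<forall>p\<in>Nbar n.
          orbit_of (C_group n c) (\<psi> p) = hat_action n c \<gamma> (orbit_of (C_group n c) p)}"

text \<open>The volume of the image in \<open>Nbar n / \<Gamma>\<close> of the set of all points with \<open>\<rho> \<in> R\<close>.\<close>

definition vol_rho ::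
  "nat \<Rightarrow> real \<Rightarrow> (coords \<Rightarrow> coords) set \<Rightarrow> real set \<Rightarrow> ennreal" where
  "vol_rho n c \<Gamma> R =
     quotient_volume (riemannian_volume n c) (orbit_of \<Gamma>)
       (orbit_of \<Gamma> ` {p \<in> Nbar n. coord_rho p \<in> R})"

end

theory Submission
  imports Defs
begin

text \<open>
  The volume density of the metric is \<open>f(\<rho>) (1 - \<bar>X\<bar>\<^sup>2)\<^sup>-\<^sup>n\<close> with
  \<open>f(\<rho>) = (\<rho> + c)\<^sup>n\<^sup>-\<^sup>1 (\<rho> + 2c) / (4 \<rho>\<^sup>2\<^sup>n\<^sup>+\<^sup>2)\<close>, which is integrable at \<open>\<infinity>\<close> but not at \<open>0\<close>. So it suffices
  that the slices \<open>\<rho> = const\<close> of a set \<open>U\<close> on which the orbit projection is injective have bounded measure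
  with respect to \<open>\<nu> = (1 - \<bar>X\<bar>\<^sup>2)\<^sup>-\<^sup>n dX dw d\<phi>\<close>, and that some neighbourhood of the origin is such a set.

  The flows of the Killing fields integrate to an explicit action, in which \<open>\<phi>\<close> is shifted by \<open>- 2c\<close> times an
  argument of \<open>(g Z)\<^sup>0\<close>. A measurable choice of the argument gives an action up to shifts of \<open>\<phi>\<close> by
  \<open>4 \<pi> c \<int>\<close>, which is exactly \<open>\<C>\<close>.

  For the upper bound, integrate over all \<open>d\<close> in the group and all \<open>z\<close> in a bounded set \<open>F\<close> the condition
  \<open>d z \<in> U\<close>. For fixed \<open>z\<close> the set of these \<open>d\<close> meets each coset of the lattice at most once, because the
  action is free, so its Haar measure is at most the covolume. For fixed \<open>d\<close> substitute \<open>d z\<close> for \<open>z\<close>: by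
  transitivity and left invariance, each point of \<open>U\<close> is met for a set of \<open>d\<close> of measure at
  least \<open>m > 0\<close>. The substitution only needs the invariance of Lebesgue measure under \<open>SU(1,n-1)\<close>, since
  \<open>(1 - \<bar>X\<bar>\<^sup>2)\<^sup>-\<^sup>n dX\<close> is, up to a factor, the image of Lebesgue measure on the slab
  \<open>1 \<le> \<bar>Z\<^sup>0\<bar>\<^sup>2 - \<Sum>\<bar>Z\<^sup>a\<bar>\<^sup>2 \<le> 2\<close>.

  For the lower bound, suppose elements \<open>d\<^sub>N\<close> of the discrete group identify distinct points tending to the origin. They are
  bounded, so along a subsequence \<open>d\<^sub>N\<^sup>-\<^sup>1 d\<^sub>N\<^sub>+\<^sub>1 \<rightarrow> 1\<close>; hence \<open>d\<^sub>N\<close> is eventually constant and fixes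
  the origin, contradicting freeness.
\<close>


section \<open>Pseudo-unitary matrices\<close>

text \<open>\<open>quotient_volume\<close> is a supremum over measurable sets on which the
  projection is injective. So finiteness means one bound that is uniform over all such sets, while
  divergence is shown by a single family of boxes. The obstacle before any measure theory is that
  \<open>beta_graph\<close> is given by generators, whereas the counting needs the orbits of
  \<open>Gamma_group\<close> as an explicit set (\<open>orb\<close>). One inclusion rests on
  uniqueness of the flows, which limits what a generator can do; the other on the fact that
  exponentials generate SU(1,n-1), so that every group element has a lift. The elimination behind
  the second fact is used again for transitivity, and its factors, being products of shears, give
  the invariance of Lebesgue measure. The double count fits a left invariant measure: for z = s o,
  the substitution d = s d0 turns the preimage of z under d into the preimage of o under d0, and the
  fibres of d -> D d are swept out by left translations. The action preserves rho and does not
  depend on it, so one bound serves all slices.\<close>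

definition sg :: "nat \<Rightarrow> complex" where
  "sg k = (if k = 0 then - 1 else 1)"

definition homog :: "(nat \<Rightarrow> complex) \<Rightarrow> nat \<Rightarrow> complex" where
  "homog X j = (if j = 0 then 1 else X j)"

text \<open>Acts on functions, since the coordinates of points are functions;
  \<open>mult_vec_index\<close> relates it to the product with a \<open>vec\<close>.\<close>

definition mv :: "nat \<Rightarrow> complex mat \<Rightarrow> (nat \<Rightarrow> complex) \<Rightarrow> nat \<Rightarrow> complex" where
  "mv n g x i = (\<Sum>j<n. g $$ (i, j) * x j)"

text \<open>The minus sign sits at index 0, so X lies in the ball exactly if Z = (1, X) is a
  negative vector.\<close>

definition herm :: "nat \<Rightarrow> (nat \<Rightarrow> complex) \<Rightarrow> (nat \<Rightarrow> complex) \<Rightarrow> complex" where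
  "herm n x y = (\<Sum>k<n. sg k * cnj (x k) * y k)"

text \<open>The adjoint for the indefinite form, I times the conjugate transpose times I; on
  U(1,n-1) it is the inverse.\<close>

definition adj :: "nat \<Rightarrow> complex mat \<Rightarrow> complex mat" where
  "adj n g = mat n n (\<lambda>(i, j). sg i * sg j * cnj (g $$ (j, i)))"

text \<open>On U(1,n-1) this is the transposed inverse: the representation that integrates v -> -
  A^T v and through which g acts on w and on the Heisenberg group.\<close>

definition co :: "nat \<Rightarrow> complex mat \<Rightarrow> complex mat" where
  "co n g = mat n n (\<lambda>(i, j). sg i * sg j * cnj (g $$ (i, j)))"

lemma sg_simps [simp]: "sg 0 = - 1" "sg (Suc k) = 1" "sg k * sg k = 1" "cnj (sg k) = sg k"
    "sg k * (sg k * z) = z" "sg k \<noteq> 0"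
  by (auto simp: sg_def)

lemma sg_mult_eq_iff: "sg i * x = y \<longleftrightarrow> x = sg i * y"
proof
  assume "sg i * x = y"
  then have "sg i * y = sg i * (sg i * x)"
    by simp
  then show "x = sg i * y"
    by simp
qed simp

lemma mult_mat_entry:
  "M \<in> carrier_mat n m \<Longrightarrow> N \<in> carrier_mat m k \<Longrightarrow> i < n \<Longrightarrow> j < k \<Longrightarrow>
    (M * N) $$ (i, j) = (\<Sum>l<m. M $$ (i, l) * N $$ (l, j))"
  by (simp add: scalar_prod_def atLeast0LessThan)

lemma mat_Z_mv: "mat_Z n g X = mv n g (homog X)"
  by (auto simp: mat_Z_def mv_def homog_def fun_eq_iff)

lemma mv_mult:
  assumes "g \<in> carrier_mat n n" "h \<in> carrier_mat n n" "i < n"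
  shows "mv n (g * h) x i = mv n g (mv n h x) i"
proof -
  have "mv n (g * h) x i = (\<Sum>j<n. \<Sum>l<n. g $$ (i, l) * (h $$ (l, j) * x j))"
    unfolding mv_def using assms
    by (intro sum.cong) (auto simp: mult_mat_entry[of _ n n _ n] sum_distrib_right mult.assoc simp del: index_mult_mat)
  also have "\<dots> = mv n g (mv n h x) i"
    by (subst sum.swap) (simp add: mv_def sum_distrib_left)
  finally show ?thesis .
qed

lemma mv_one: "i < n \<Longrightarrow> mv n (1\<^sub>m n) x i = x i"
proof -
  assume i: "i < n"
  have "mv n (1\<^sub>m n) x i = (\<Sum>j<n. if j = i then x i else 0)"
    unfolding mv_def using i by (intro sum.cong) auto
  then show ?thesis
    using i by simp
qed

lemma mv_cong: "(\<And>j. j < n \<Longrightarrow> x j = y j) \<Longrightarrow> mv n g x i = mv n g y i"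
  by (simp add: mv_def)

lemma mv_divide: "mv n g (\<lambda>j. x j / z) i = mv n g x i / z"
  by (simp add: mv_def sum_divide_distrib)

lemma mv_add: "mv n g (\<lambda>j. x j + y j) i = mv n g x i + mv n g y i"
  by (simp add: mv_def sum.distrib algebra_simps)

lemma herm_cong:
  "(\<And>j. j < n \<Longrightarrow> x j = x' j) \<Longrightarrow> (\<And>j. j < n \<Longrightarrow> y j = y' j) \<Longrightarrow> herm n x y = herm n x' y'"
  by (simp add: herm_def)

lemma herm_add_left: "herm n (\<lambda>j. x j + x' j) y = herm n x y + herm n x' y"
  by (simp add: herm_def sum.distrib algebra_simps)

lemma herm_add_right: "herm n x (\<lambda>j. y j + y' j) = herm n x y + herm n x y'"
  by (simp add: herm_def sum.distrib algebra_simps)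

lemma herm_divide_right: "herm n x (\<lambda>j. y j / z) = herm n x y / z"
  by (simp add: herm_def sum_divide_distrib)

lemma herm_self:
  assumes "1 \<le> n"
  shows "herm n x x = complex_of_real ((\<Sum>a\<in>{1..<n}. (cmod (x a))\<^sup>2) - (cmod (x 0))\<^sup>2)"
proof -
  have s: "{..<n} = insert 0 {1..<n}"
    using assms by auto
  have "cnj z * z = complex_of_real ((cmod z)\<^sup>2)" for z
    using complex_norm_square[of z] by (simp add: mult.commute)
  then have "(\<Sum>k\<in>{1..<n}. sg k * cnj (x k) * x k) = (\<Sum>k\<in>{1..<n}. complex_of_real ((cmod (x k))\<^sup>2))"
    by (intro sum.cong) (auto simp: sg_def)
  moreover have "sg 0 * cnj (x 0) * x 0 = - complex_of_real ((cmod (x 0))\<^sup>2)"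
    using complex_norm_square[of "x 0"] by (simp add: mult.commute)
  ultimately show ?thesis
    unfolding herm_def s by simp
qed

lemma adj_carrier [simp]: "adj n g \<in> carrier_mat n n" and co_carrier [simp]: "co n g \<in> carrier_mat n n"
  by (auto simp: adj_def co_def)

lemma dim_co [simp]: "dim_row (co n g) = n" "dim_col (co n g) = n"
  by (auto simp: co_def)

lemma adj_adj: "g \<in> carrier_mat n n \<Longrightarrow> adj n (adj n g) = g"
  by (rule eq_matI) (auto simp: adj_def algebra_simps)

lemma adj_mult:
  assumes "g \<in> carrier_mat n n" "h \<in> carrier_mat n n"
  shows "adj n (g * h) = adj n h * adj n g"
proof (rule eq_matI)
  fix i j assume "i < dim_row (adj n h * adj n g)" "j < dim_col (adj n h * adj n g)"
  then have ij: "i < n" "j < n"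
    by (auto simp: adj_def)
  have "(adj n h * adj n g) $$ (i, j) = (\<Sum>l<n. adj n h $$ (i, l) * adj n g $$ (l, j))"
    using ij by (intro mult_mat_entry) auto
  also have "\<dots> = (\<Sum>l<n. sg i * sg j * cnj (g $$ (j, l) * h $$ (l, i)))"
    using ij by (intro sum.cong) (auto simp: adj_def algebra_simps)
  also have "\<dots> = adj n (g * h) $$ (i, j)"
    using ij assms by (simp add: adj_def mult_mat_entry[OF assms] sum_distrib_left del: index_mult_mat)
  finally show "adj n (g * h) $$ (i, j) = (adj n h * adj n g) $$ (i, j)"
    by simp
qed (auto simp: adj_def)

lemma co_transpose: "co n g = transpose_mat (adj n g)"
  by (rule eq_matI) (auto simp: adj_def co_def)

lemma adj_one: "adj n (1\<^sub>m n) = 1\<^sub>m n"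
  by (rule eq_matI) (auto simp: adj_def)

lemma U_iff_entries:
  "g \<in> carrier (U_group n) \<longleftrightarrow> g \<in> carrier_mat n n \<and>
    (\<forall>i<n. \<forall>j<n. (\<Sum>k<n. sg k * cnj (g $$ (k, i)) * g $$ (k, j)) = (if i = j then sg i else 0))"
proof (cases "g \<in> carrier_mat n n")
  case g: True
  have c: "conj_transpose g \<in> carrier_mat n n" "I_form n \<in> carrier_mat n n"
    using g by (auto simp: conj_transpose_def I_form_def)
  have 1: "(conj_transpose g * I_form n) $$ (i, k) = sg k * cnj (g $$ (k, i))" if "i < n" "k < n" for i k
  proof -
    have "(conj_transpose g * I_form n) $$ (i, k) = (\<Sum>l<n. if l = k then sg k * cnj (g $$ (k, i)) else 0)"
      unfolding mult_mat_entry[OF c that] using that g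
      by (intro sum.cong) (auto simp: conj_transpose_def I_form_def sg_def)
    then show ?thesis
      using that by simp
  qed
  have e: "(conj_transpose g * I_form n * g) $$ (i, j) = (\<Sum>k<n. sg k * cnj (g $$ (k, i)) * g $$ (k, j))"
    if "i < n" "j < n" for i j
  proof -
    have "(conj_transpose g * I_form n * g) $$ (i, j) = (\<Sum>k<n. (conj_transpose g * I_form n) $$ (i, k) * g $$ (k, j))"
      using that g c by (intro mult_mat_entry) auto
    also have "\<dots> = (\<Sum>k<n. sg k * cnj (g $$ (k, i)) * g $$ (k, j))"
      using that by (intro sum.cong refl) (simp only: 1 lessThan_iff)
    finally show ?thesis .
  qed
  have I: "I_form n $$ (i, j) = (if i = j then sg i else 0)" if "i < n" "j < n" for i j
    using that by (simp add: I_form_def sg_def)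
  have dims: "dim_row (conj_transpose g * I_form n * g) = n" "dim_col (conj_transpose g * I_form n * g) = n"
    using g c by auto
  have "conj_transpose g * I_form n * g = I_form n \<longleftrightarrow>
      (\<forall>i<n. \<forall>j<n. (conj_transpose g * I_form n * g) $$ (i, j) = I_form n $$ (i, j))"
    using dims c by (subst mat_eq_iff) auto
  also have "\<dots> \<longleftrightarrow> (\<forall>i<n. \<forall>j<n. (\<Sum>k<n. sg k * cnj (g $$ (k, i)) * g $$ (k, j)) = (if i = j then sg i else 0))"
    using e I by (simp del: index_mult_mat)
  finally show ?thesis
    using g by (simp add: U_group_def)
qed (simp add: U_group_def)

lemma U_iff_adj:
  "g \<in> carrier (U_group n) \<longleftrightarrow> g \<in> carrier_mat n n \<and> adj n g * g = 1\<^sub>m n"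
proof (cases "g \<in> carrier_mat n n")
  case g: True
  have e: "(adj n g * g) $$ (i, j) = sg i * (\<Sum>k<n. sg k * cnj (g $$ (k, i)) * g $$ (k, j))"
    if "i < n" "j < n" for i j
    using that g by (subst mult_mat_entry[of _ n n _ n])
      (auto simp: adj_def sum_distrib_left mult_ac intro!: sum.cong)
  have eqv: "adj n g * g = 1\<^sub>m n \<longleftrightarrow> (\<forall>i<n. \<forall>j<n. (adj n g * g) $$ (i, j) = (if i = j then 1 else 0))"
    using g by (subst mat_eq_iff) (auto simp: adj_def)
  have z: "sg i * x = (if i = j then 1 else 0) \<longleftrightarrow> x = (if i = j then sg i else 0)" for i j x
    by (simp add: sg_mult_eq_iff)
  show ?thesis
    unfolding U_iff_entries eqv using g e z by (simp del: index_mult_mat)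
qed (simp add: U_group_def)

lemma U_carrier_mat: "g \<in> carrier (U_group n) \<Longrightarrow> g \<in> carrier_mat n n"
  by (simp add: U_group_def)

lemma U_adj:
  assumes "g \<in> carrier (U_group n)"
  shows "adj n g * g = 1\<^sub>m n" "g * adj n g = 1\<^sub>m n" "adj n g \<in> carrier (U_group n)"
proof -
  show 1: "adj n g * g = 1\<^sub>m n"
    using assms by (simp add: U_iff_adj)
  show 2: "g * adj n g = 1\<^sub>m n"
    using mat_mult_left_right_inverse[OF _ _ 1] U_carrier_mat[OF assms] by simp
  show "adj n g \<in> carrier (U_group n)"
    using 2 U_carrier_mat[OF assms] by (simp add: U_iff_adj adj_adj)
qed

lemma U_mult:
  assumes "g \<in> carrier (U_group n)" "h \<in> carrier (U_group n)"
  shows "g * h \<in> carrier (U_group n)"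
proof -
  have c: "g \<in> carrier_mat n n" "h \<in> carrier_mat n n"
    using assms by (auto intro: U_carrier_mat)
  have "adj n (g * h) * (g * h) = adj n h * (adj n g * (g * h))"
    using c by (simp add: adj_mult assoc_mult_mat[of _ n n _ n _ n])
  also have "adj n g * (g * h) = h"
    using c U_adj(1)[OF assms(1)] by (simp flip: assoc_mult_mat[of _ n n _ n _ n])
  finally show ?thesis
    using c U_adj(1)[OF assms(2)] by (simp add: U_iff_adj)
qed

lemma U_group_simps [simp]: "mult (U_group n) = (*)" "one (U_group n) = 1\<^sub>m n"
  by (auto simp: U_group_def)

lemma SU_group_simps [simp]: "mult (SU_group n) = (*)" "one (SU_group n) = 1\<^sub>m n"
  by (auto simp: SU_group_def)

lemma SU_iff: "g \<in> carrier (SU_group n) \<longleftrightarrow> g \<in> carrier (U_group n) \<and> det g = 1"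
  by (auto simp: SU_group_def)

lemma SU_U: "g \<in> carrier (SU_group n) \<Longrightarrow> g \<in> carrier (U_group n)"
  by (simp add: SU_iff)

lemma one_U [simp]: "1\<^sub>m n \<in> carrier (U_group n)"
  by (simp add: U_iff_adj adj_one)

lemma one_SU [simp]: "1\<^sub>m n \<in> carrier (SU_group n)"
  by (simp add: SU_iff)

lemma SU_mult: "g \<in> carrier (SU_group n) \<Longrightarrow> h \<in> carrier (SU_group n) \<Longrightarrow> g * h \<in> carrier (SU_group n)"
  by (auto simp: SU_iff U_mult det_mult[OF U_carrier_mat U_carrier_mat])

lemma SU_adj:
  assumes "g \<in> carrier (SU_group n)"
  shows "adj n g \<in> carrier (SU_group n)"
proof -
  have "det (adj n g) * det g = 1"
    using det_mult[of "adj n g" n g] U_adj(1)[of g n] assms by (auto simp: SU_iff U_carrier_mat)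
  then show ?thesis
    using assms U_adj(3) by (simp add: SU_iff)
qed

lemma group_U: "group (U_group n)"
proof (rule groupI)
  show "\<exists>y\<in>carrier (U_group n). y \<otimes>\<^bsub>U_group n\<^esub> x = \<one>\<^bsub>U_group n\<^esub>" if "x \<in> carrier (U_group n)" for x
    using U_adj[OF that] by auto
qed (auto simp: U_mult U_carrier_mat left_mult_one_mat[OF U_carrier_mat] assoc_mult_mat[of _ n n _ n _ n])

lemma group_SU: "group (SU_group n)"
proof (rule groupI)
  show "\<exists>y\<in>carrier (SU_group n). y \<otimes>\<^bsub>SU_group n\<^esub> x = \<one>\<^bsub>SU_group n\<^esub>" if "x \<in> carrier (SU_group n)" for x
    using SU_adj[OF that] U_adj[OF SU_U[OF that]] by auto
qed (auto simp: SU_mult U_carrier_mat[OF SU_U] left_mult_one_mat[OF U_carrier_mat[OF SU_U]] assoc_mult_mat[of _ n n _ n _ n])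

lemma inv_U: "g \<in> carrier (U_group n) \<Longrightarrow> inv\<^bsub>U_group n\<^esub> g = adj n g"
  by (rule group.inv_equality[OF group_U]) (auto simp: U_adj)

text \<open>The definition speaks about columns. Rows follow because a left inverse of a square
  matrix is a right inverse.\<close>

lemma U_entries_rows:
  assumes "g \<in> carrier (U_group n)" "i < n" "j < n"
  shows "(\<Sum>k<n. sg k * (g $$ (i, k) * cnj (g $$ (j, k)))) = (if i = j then sg i else 0)"
proof -
  have "(g * adj n g) $$ (i, j) = (\<Sum>k<n. g $$ (i, k) * adj n g $$ (k, j))"
    using assms by (intro mult_mat_entry) (auto intro: U_carrier_mat)
  also have "\<dots> = sg j * (\<Sum>k<n. sg k * (g $$ (i, k) * cnj (g $$ (j, k))))"
    using assms by (auto simp: adj_def sum_distrib_left mult_ac intro!: sum.cong)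
  finally have "sg j * (\<Sum>k<n. sg k * (g $$ (i, k) * cnj (g $$ (j, k)))) = (if i = j then 1 else 0)"
    using assms U_adj(2)[OF assms(1)] by simp
  then show ?thesis
    by (auto simp: sg_mult_eq_iff)
qed

lemma herm_mv:
  assumes "g \<in> carrier (U_group n)"
  shows "herm n (mv n g x) (mv n g y) = herm n x y"
proof -
  have "herm n (mv n g x) (mv n g y) =
      (\<Sum>k<n. \<Sum>i<n. \<Sum>j<n. (sg k * cnj (g $$ (k, i)) * g $$ (k, j)) * (cnj (x i) * y j))"
    unfolding herm_def mv_def by (simp add: sum_product sum_distrib_left sum_distrib_right mult_ac)
  also have "\<dots> = (\<Sum>i<n. \<Sum>j<n. (\<Sum>k<n. sg k * cnj (g $$ (k, i)) * g $$ (k, j)) * (cnj (x i) * y j))"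
    by (subst sum.swap, rule sum.cong[OF refl], subst sum.swap) (simp add: sum_distrib_right)
  also have "\<dots> = (\<Sum>i<n. \<Sum>j<n. if j = i then sg i * (cnj (x i) * y i) else 0)"
    using assms by (intro sum.cong refl) (auto simp: U_iff_entries)
  also have "\<dots> = herm n x y"
    by (simp add: herm_def mult_ac)
  finally show ?thesis .
qed

lemma co_U: "g \<in> carrier (U_group n) \<Longrightarrow> co n g \<in> carrier (U_group n)"
proof -
  assume g: "g \<in> carrier (U_group n)"
  have "(\<Sum>k<n. sg k * cnj (co n g $$ (k, i)) * co n g $$ (k, j)) = (if i = j then sg i else 0)"
    if ij: "i < n" "j < n" for i j
  proof -
    have "(\<Sum>k<n. sg k * cnj (co n g $$ (k, i)) * co n g $$ (k, j)) =
        sg i * sg j * cnj (\<Sum>k<n. sg k * cnj (g $$ (k, i)) * g $$ (k, j))"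
      using ij by (auto simp: co_def sum_distrib_left mult_ac intro!: sum.cong)
    then show ?thesis
      using g ij unfolding U_iff_entries by (simp only: complex_cnj_zero complex_cnj_cnj) (auto simp del: cnj_sum)
  qed
  then show ?thesis
    by (simp add: U_iff_entries)
qed

lemma co_SU: "g \<in> carrier (SU_group n) \<Longrightarrow> co n g \<in> carrier (SU_group n)"
  using SU_adj[of g n] det_transpose[OF adj_carrier, of n g] by (simp add: SU_iff co_U flip: co_transpose)

lemma co_mult:
  assumes "g \<in> carrier_mat n n" "h \<in> carrier_mat n n"
  shows "co n (g * h) = co n g * co n h"
  using assms by (simp add: co_transpose adj_mult transpose_mult[OF adj_carrier adj_carrier])

lemma co_one: "co n (1\<^sub>m n) = 1\<^sub>m n"
  by (simp add: co_transpose adj_one)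

lemma mult_vec_index:
  "M \<in> carrier_mat n n \<Longrightarrow> v \<in> carrier_vec n \<Longrightarrow> k < n \<Longrightarrow> (M *\<^sub>v v) $ k = mv n M (($) v) k"
  by (simp add: mv_def scalar_prod_def atLeast0LessThan)

lemma Heis_act_U: "g \<in> carrier (U_group n) \<Longrightarrow> Heis_act n g (v, t) = (co n g *\<^sub>v v, t)"
  by (simp add: Heis_act_def inv_U co_transpose)

text \<open>Reduces the Heisenberg bracket to the Hermitian form, from which it inherits bilinearity
  over the reals and invariance under U(1,n-1).\<close>

lemma omega_herm: "1 \<le> n \<Longrightarrow> omega n v w = - Im (herm n (($) v) (($) w))"
proof -
  assume "1 \<le> n"
  then have s: "{..<n} = insert 0 {1..<n}"
    by auto
  have "(\<Sum>k\<in>{1..<n}. sg k * cnj (v $ k) * w $ k) = (\<Sum>k\<in>{1..<n}. cnj (v $ k) * w $ k)"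
    by (intro sum.cong) (auto simp: sg_def)
  then show ?thesis
    unfolding omega_def herm_def s by (simp add: Im_sum)
qed

lemma herm_anti: "Im (herm n x y) = - Im (herm n y x)"
proof -
  have "herm n x y = cnj (herm n y x)"
    by (simp add: herm_def cnj_sum mult_ac)
  then show ?thesis
    by simp
qed

lemma Im_herm_self: "Im (herm n x x) = 0"
  using herm_anti[of n x x] by simp

lemma omega_mult:
  assumes "1 \<le> n" "g \<in> carrier (U_group n)" "v \<in> carrier_vec n" "w \<in> carrier_vec n"
  shows "omega n (g *\<^sub>v v) (g *\<^sub>v w) = omega n v w"
proof -
  have "herm n (($) (g *\<^sub>v v)) (($) (g *\<^sub>v w)) = herm n (mv n g (($) v)) (mv n g (($) w))"
    using assms by (intro herm_cong mult_vec_index) (auto intro: U_carrier_mat)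
  then show ?thesis
    using assms by (simp add: omega_herm herm_mv)
qed

lemma omega_add_left:
  assumes "v \<in> carrier_vec n" "v' \<in> carrier_vec n" "1 \<le> n"
  shows "omega n (v + v') w = omega n v w + omega n v' w"
proof -
  have "herm n (($) (v + v')) (($) w) = herm n (\<lambda>j. v $ j + v' $ j) (($) w)"
    using assms by (intro herm_cong) auto
  then show ?thesis
    using assms by (simp add: omega_herm herm_add_left)
qed

lemma omega_anti: "1 \<le> n \<Longrightarrow> omega n v w = - omega n w v"
  using herm_anti[of n "($) v" "($) w"] by (simp add: omega_herm)

lemma omega_add_right:
  assumes "v \<in> carrier_vec n" "v' \<in> carrier_vec n" "1 \<le> n"
  shows "omega n w (v + v') = omega n w v + omega n w v'"
  using omega_add_left[OF assms, of w] assms(3) by (simp add: omega_anti[of _ w])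

lemma omega_uminus_left:
  assumes "v \<in> carrier_vec n" "1 \<le> n"
  shows "omega n (- v) w = - omega n v w"
  using omega_add_left[of "- v" n v w] assms
  by (simp add: omega_zero)

lemma omega_self: "1 \<le> n \<Longrightarrow> omega n v v = 0"
  using omega_anti[of n v v] by simp

section \<open>The groups\<close>

lemma Heis_group_simps [simp]:
  "carrier (Heis_group n) = carrier_vec n \<times> UNIV"
  "(v, t) \<otimes>\<^bsub>Heis_group n\<^esub> (v', t') = (v + v', t + t' + omega n v v' / 2)"
  "one (Heis_group n) = (0\<^sub>v n, 0)"
  by (auto simp: Heis_group_def)

lemma group_Heis:
  assumes "1 \<le> n"
  shows "group (Heis_group n)"
proof (rule groupI)
  fix x assume "x \<in> carrier (Heis_group n)"
  then obtain v t where x: "x = (v, t)" "v \<in> carrier_vec n"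
    by auto
  show "\<exists>y\<in>carrier (Heis_group n). y \<otimes>\<^bsub>Heis_group n\<^esub> x = \<one>\<^bsub>Heis_group n\<^esub>"
    by (rule bexI[of _ "(- v, - t)"]) (use x assms in \<open>auto simp: omega_uminus_left omega_self\<close>)
next
  fix x y z assume "x \<in> carrier (Heis_group n)" "y \<in> carrier (Heis_group n)" "z \<in> carrier (Heis_group n)"
  then show "x \<otimes>\<^bsub>Heis_group n\<^esub> y \<otimes>\<^bsub>Heis_group n\<^esub> z = x \<otimes>\<^bsub>Heis_group n\<^esub> (y \<otimes>\<^bsub>Heis_group n\<^esub> z)"
    using assms by (cases x, cases y, cases z)
      (auto simp: omega_add_left omega_add_right assoc_add_vec[of _ n] add_divide_distrib)
next
  fix x assume "x \<in> carrier (Heis_group n)"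
  then show "\<one>\<^bsub>Heis_group n\<^esub> \<otimes>\<^bsub>Heis_group n\<^esub> x = x"
    using assms by (cases x) (auto simp: omega_zero)
qed auto

lemma group_semidirect:
  assumes "group K" "group H"
    and hom: "\<And>k. k \<in> carrier K \<Longrightarrow> \<theta> k \<in> hom H H"
    and mult: "\<And>k k' h. k \<in> carrier K \<Longrightarrow> k' \<in> carrier K \<Longrightarrow> h \<in> carrier H \<Longrightarrow>
      \<theta> (k \<otimes>\<^bsub>K\<^esub> k') h = \<theta> k (\<theta> k' h)"
    and one: "\<And>h. h \<in> carrier H \<Longrightarrow> \<theta> \<one>\<^bsub>K\<^esub> h = h"
  shows "group (semidirect K \<theta> H)"
proof -
  interpret K: group K by fact
  interpret H: group H by fact
  have cl: "\<theta> k h \<in> carrier H" if "k \<in> carrier K" "h \<in> carrier H" for k h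
    using hom[OF that(1)] that(2) by (auto simp: hom_def)
  have hm: "\<theta> k (h \<otimes>\<^bsub>H\<^esub> h') = \<theta> k h \<otimes>\<^bsub>H\<^esub> \<theta> k h'"
    if "k \<in> carrier K" "h \<in> carrier H" "h' \<in> carrier H" for k h h'
    using hom[OF that(1)] that by (auto simp: hom_def)
  show ?thesis
  proof (rule groupI)
    fix x assume "x \<in> carrier (semidirect K \<theta> H)"
    then obtain k h where x: "x = (k, h)" "k \<in> carrier K" "h \<in> carrier H"
      by (auto simp: semidirect_def)
    have "\<theta> (inv\<^bsub>K\<^esub> k) (inv\<^bsub>H\<^esub> h) \<otimes>\<^bsub>H\<^esub> \<theta> (inv\<^bsub>K\<^esub> k) h = \<theta> (inv\<^bsub>K\<^esub> k) \<one>\<^bsub>H\<^esub>"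
      using x by (simp flip: hm)
    also have "\<dots> = \<one>\<^bsub>H\<^esub>"
      using group_hom.hom_one[of H H "\<theta> (inv\<^bsub>K\<^esub> k)"] hom[of "inv\<^bsub>K\<^esub> k"] x
      by (simp add: group_hom_def group_hom_axioms_def assms)
    finally show "\<exists>y\<in>carrier (semidirect K \<theta> H). y \<otimes>\<^bsub>semidirect K \<theta> H\<^esub> x = \<one>\<^bsub>semidirect K \<theta> H\<^esub>"
      by (intro bexI[of _ "(inv\<^bsub>K\<^esub> k, \<theta> (inv\<^bsub>K\<^esub> k) (inv\<^bsub>H\<^esub> h))"])
         (use x in \<open>auto simp: semidirect_def cl\<close>)
  qed (auto simp: semidirect_def cl hm mult one H.m_assoc K.m_assoc)
qed

lemma Heis_act_hom:
  assumes "1 \<le> n" "g \<in> carrier (U_group n)"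
  shows "Heis_act n g \<in> hom (Heis_group n) (Heis_group n)"
proof -
  have c: "co n g *\<^sub>v v \<in> carrier_vec n" if "v \<in> carrier_vec n" for v
    using that by (intro mult_mat_vec_carrier) auto
  show ?thesis
    using assms c by (auto simp: hom_def Heis_act_U mult_add_distrib_mat_vec[OF co_carrier] omega_mult co_U)
qed

lemma Heis_act_mult:
  assumes "g \<in> carrier (U_group n)" "g' \<in> carrier (U_group n)" "h \<in> carrier (Heis_group n)"
  shows "Heis_act n (g * g') h = Heis_act n g (Heis_act n g' h)"
  using assms by (auto simp: Heis_act_U U_mult co_mult U_carrier_mat assoc_mult_mat_vec[of _ n n _ n])

lemma Heis_act_one: "h \<in> carrier (Heis_group n) \<Longrightarrow> Heis_act n (1\<^sub>m n) h = h"
  by (auto simp: Heis_act_U co_one)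

lemma group_UHeis: "1 \<le> n \<Longrightarrow> group (UHeis n)"
  unfolding UHeis_def
  by (rule group_semidirect[OF group_U group_Heis])
     (auto simp: Heis_act_hom Heis_act_mult Heis_act_one)

lemma group_SUHeis: "1 \<le> n \<Longrightarrow> group (SUHeis n)"
  unfolding SUHeis_def
  by (rule group_semidirect[OF group_SU group_Heis])
     (auto simp: Heis_act_hom Heis_act_mult Heis_act_one SU_U)

lemma UHeis_simps:
  "carrier (UHeis n) = carrier (U_group n) \<times> carrier_vec n \<times> UNIV"
  "g \<in> carrier (U_group n) \<Longrightarrow> (g, (v, t)) \<otimes>\<^bsub>UHeis n\<^esub> (g', (v', t')) =
    (g * g', (v + co n g *\<^sub>v v', t + t' + omega n v (co n g *\<^sub>v v') / 2))"
  "one (UHeis n) = (1\<^sub>m n, (0\<^sub>v n, 0))"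
  by (auto simp: UHeis_def semidirect_def Heis_act_U)

lemma SUHeis_simps:
  "carrier (SUHeis n) = carrier (SU_group n) \<times> carrier_vec n \<times> UNIV"
  "g \<in> carrier (SU_group n) \<Longrightarrow> (g, (v, t)) \<otimes>\<^bsub>SUHeis n\<^esub> (g', (v', t')) =
    (g * g', (v + co n g *\<^sub>v v', t + t' + omega n v (co n g *\<^sub>v v') / 2))"
  "one (SUHeis n) = (1\<^sub>m n, (0\<^sub>v n, 0))"
  by (auto simp: SUHeis_def semidirect_def Heis_act_U SU_U)

lemma SUHeis_UHeis: "d \<in> carrier (SUHeis n) \<Longrightarrow> d \<in> carrier (UHeis n)"
  by (auto simp: SUHeis_simps UHeis_simps SU_U)

lemma SUHeis_mult_eq: "d \<in> carrier (SUHeis n) \<Longrightarrow> d \<otimes>\<^bsub>SUHeis n\<^esub> d' = d \<otimes>\<^bsub>UHeis n\<^esub> d'"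
  by (cases d, cases d') (auto simp: SUHeis_simps UHeis_simps SU_U)

text \<open>The inverse in coordinates, so that measurability and limits can be read off entrywise.
  The central entry is simply the negative because \<open>omega\<close> vanishes on a pair of
  parallel real multiples.\<close>

definition iinv :: "nat \<Rightarrow> complex mat \<times> heis \<Rightarrow> complex mat \<times> heis" where
  "iinv n = (\<lambda>(g, (v, t)). (adj n g, (- (co n (adj n g) *\<^sub>v v), - t)))"

lemma iinv_UHeis:
  assumes n: "1 \<le> n" and d: "d \<in> carrier (UHeis n)"
  shows "iinv n d \<in> carrier (UHeis n)" "iinv n d \<otimes>\<^bsub>UHeis n\<^esub> d = \<one>\<^bsub>UHeis n\<^esub>"
    "d \<otimes>\<^bsub>UHeis n\<^esub> iinv n d = \<one>\<^bsub>UHeis n\<^esub>" "inv\<^bsub>UHeis n\<^esub> d = iinv n d"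
proof -
  obtain g v t where d': "d = (g, (v, t))" and g: "g \<in> carrier (U_group n)" and v: "v \<in> carrier_vec n"
    using d by (auto simp: UHeis_simps)
  have c: "co n (adj n g) *\<^sub>v v \<in> carrier_vec n"
    using v by (intro mult_mat_vec_carrier) auto
  show 1: "iinv n d \<in> carrier (UHeis n)"
    using c U_adj(3)[OF g] by (auto simp: iinv_def d' UHeis_simps)
  show 2: "iinv n d \<otimes>\<^bsub>UHeis n\<^esub> d = \<one>\<^bsub>UHeis n\<^esub>"
    using c U_adj[OF g] n by (auto simp: iinv_def d' UHeis_simps omega_uminus_left omega_self)
  show 3: "inv\<^bsub>UHeis n\<^esub> d = iinv n d"
    by (rule group.inv_equality[OF group_UHeis[OF n] 2 d 1])
  show "d \<otimes>\<^bsub>UHeis n\<^esub> iinv n d = \<one>\<^bsub>UHeis n\<^esub>"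
    using group.r_inv[OF group_UHeis[OF n] d] 3 by simp
qed

lemma iinv_SUHeis:
  assumes n: "1 \<le> n" and d: "d \<in> carrier (SUHeis n)"
  shows "iinv n d \<in> carrier (SUHeis n)" "inv\<^bsub>SUHeis n\<^esub> d = iinv n d"
proof -
  obtain g v t where d': "d = (g, (v, t))" and g: "g \<in> carrier (SU_group n)" and v: "v \<in> carrier_vec n"
    using d by (auto simp: SUHeis_simps)
  have c: "co n (adj n g) *\<^sub>v v \<in> carrier_vec n"
    using v by (intro mult_mat_vec_carrier) auto
  show 1: "iinv n d \<in> carrier (SUHeis n)"
    using c SU_adj[OF g] by (auto simp: iinv_def d' SUHeis_simps)
  show "inv\<^bsub>SUHeis n\<^esub> d = iinv n d"
    by (rule group.inv_equality[OF group_SUHeis[OF n] _ d 1])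
       (use iinv_UHeis(2)[OF n SUHeis_UHeis[OF d]] SUHeis_mult_eq[OF 1] in
        \<open>simp add: SUHeis_simps UHeis_simps\<close>)
qed

section \<open>The action\<close>

text \<open>The angle is a free parameter and not a chosen argument of (g Z)^0. Composition is then
  exact, with angles adding (\<open>act_act\<close>), and the choice of a branch is postponed to
  \<open>Theta\<close>. The shift of w is v / 2 because this is the velocity in
  \<open>alpha\<close>.\<close>

fun act :: "nat \<Rightarrow> real \<Rightarrow> complex mat \<times> heis \<Rightarrow> real \<Rightarrow> coords \<Rightarrow> coords" where
  "act n c (g, (v, t)) \<theta> (X, w, \<phi>, \<rho>) =
     (\<lambda>b\<in>{1..<n}. mat_Z n g X b / mat_Z n g X 0,
      \<lambda>k\<in>{..<n}. mv n (co n g) w k + v $ k / 2,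
      \<phi> - 2 * c * \<theta> + omega n v (vec n (mv n (co n g) w)) + t, \<rho>)"

definition CH_ball :: "nat \<Rightarrow> (nat \<Rightarrow> complex) set" where
  "CH_ball n = {X. (\<Sum>a\<in>{1..<n}. (cmod (X a))\<^sup>2) < 1}"

lemma Nbar_iff: "(X, w, \<phi>, \<rho>) \<in> Nbar n \<longleftrightarrow>
    X \<in> extensional {1..<n} \<and> w \<in> extensional {..<n} \<and> X \<in> CH_ball n \<and> 0 < \<rho>"
  by (simp add: Nbar_def CH_ball_def)

text \<open>Invariance of \<open>herm\<close> at Z = (1, X). It makes (g Z)^0 nonzero on the ball
  and shows how 1 - |X|^2 scales under g.\<close>

lemma norm_mat_Z:
  assumes "1 \<le> n" "g \<in> carrier (U_group n)"
  shows "(cmod (mat_Z n g X 0))\<^sup>2 - (\<Sum>a\<in>{1..<n}. (cmod (mat_Z n g X a))\<^sup>2) = one_minus_normX2 n X"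
proof -
  have "herm n (mv n g (homog X)) (mv n g (homog X)) = herm n (homog X) (homog X)"
    by (rule herm_mv[OF assms(2)])
  then have "(\<Sum>a\<in>{1..<n}. (cmod (mat_Z n g X a))\<^sup>2) - (cmod (mat_Z n g X 0))\<^sup>2 =
      (\<Sum>a\<in>{1..<n}. (cmod (homog X a))\<^sup>2) - (cmod (homog X 0))\<^sup>2"
    using assms(1) by (simp only: herm_self mat_Z_mv of_real_eq_iff)
  moreover have "(\<Sum>a\<in>{1..<n}. (cmod (homog X a))\<^sup>2) = (\<Sum>a\<in>{1..<n}. (cmod (X a))\<^sup>2)"
    by (intro sum.cong) (auto simp: homog_def)
  ultimately show ?thesis
    by (simp add: one_minus_normX2_def homog_def)
qed

lemma mat_Z0_nonzero:
  assumes "1 \<le> n" "g \<in> carrier (U_group n)" "X \<in> CH_ball n"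
  shows "mat_Z n g X 0 \<noteq> 0"
proof
  assume "mat_Z n g X 0 = 0"
  moreover have "0 \<le> (\<Sum>a\<in>{1..<n}. (cmod (mat_Z n g X a))\<^sup>2)"
    by (intro sum_nonneg) auto
  ultimately show False
    using norm_mat_Z[OF assms(1,2), of X] assms(3) by (simp add: CH_ball_def one_minus_normX2_def)
qed

lemma CH_ball_act:
  assumes "1 \<le> n" "g \<in> carrier (U_group n)" "X \<in> CH_ball n"
  shows "(\<lambda>b\<in>{1..<n}. mat_Z n g X b / mat_Z n g X 0) \<in> CH_ball n"
    and "one_minus_normX2 n (\<lambda>b\<in>{1..<n}. mat_Z n g X b / mat_Z n g X 0) =
      one_minus_normX2 n X / (cmod (mat_Z n g X 0))\<^sup>2"
proof -
  let ?J = "mat_Z n g X 0"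
  have J: "(cmod ?J)\<^sup>2 > 0"
    using mat_Z0_nonzero[OF assms] by simp
  have "(\<Sum>b\<in>{1..<n}. (cmod ((\<lambda>b\<in>{1..<n}. mat_Z n g X b / ?J) b))\<^sup>2) =
      (\<Sum>b\<in>{1..<n}. (cmod (mat_Z n g X b))\<^sup>2) / (cmod ?J)\<^sup>2"
    unfolding sum_divide_distrib by (intro sum.cong) (auto simp: norm_divide power_divide)
  then have eq: "one_minus_normX2 n (\<lambda>b\<in>{1..<n}. mat_Z n g X b / ?J) =
      one_minus_normX2 n X / (cmod ?J)\<^sup>2"
    using J norm_mat_Z[OF assms(1,2), of X] by (simp add: one_minus_normX2_def field_simps)
  then show "one_minus_normX2 n (\<lambda>b\<in>{1..<n}. mat_Z n g X b / ?J) = one_minus_normX2 n X / (cmod ?J)\<^sup>2" .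
  have "one_minus_normX2 n X / (cmod ?J)\<^sup>2 > 0"
    using J assms(3) by (simp add: one_minus_normX2_def CH_ball_def)
  then show "(\<lambda>b\<in>{1..<n}. mat_Z n g X b / ?J) \<in> CH_ball n"
    using eq by (simp add: one_minus_normX2_def CH_ball_def)
qed

lemma act_Nbar:
  assumes "1 \<le> n" "d \<in> carrier (UHeis n)" "p \<in> Nbar n"
  shows "act n c d \<theta> p \<in> Nbar n"
  using assms CH_ball_act(1)[OF assms(1)]
  by (cases d, cases p) (auto simp: Nbar_iff UHeis_simps)

text \<open>In homogeneous coordinates the image point is g Z divided by the scalar (g Z)^0, and
  linear maps commute with this division.\<close>

lemma mat_Z_act:
  assumes "1 \<le> n" "g \<in> carrier (U_group n)" "h \<in> carrier_mat n n" "X \<in> CH_ball n" "b < n"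
  shows "mat_Z n h (\<lambda>b\<in>{1..<n}. mat_Z n g X b / mat_Z n g X 0) b =
    mat_Z n (h * g) X b / mat_Z n g X 0"
proof -
  have J: "mat_Z n g X 0 \<noteq> 0"
    by (rule mat_Z0_nonzero[OF assms(1,2,4)])
  have "mv n h (homog (\<lambda>b\<in>{1..<n}. mat_Z n g X b / mat_Z n g X 0)) b =
      mv n h (\<lambda>j. mv n g (homog X) j / mat_Z n g X 0) b"
    using J by (intro mv_cong) (auto simp: homog_def[of "restrict _ _"] mat_Z_mv)
  then show ?thesis
    using assms by (simp add: mat_Z_mv mv_divide mv_mult[OF _ U_carrier_mat])
qed

text \<open>The scalars (g Z)^0 cancel in the quotients for X. In the phi-coordinate v' is paired
  with the already shifted w; its shift is half of the transformed v, which produces exactly the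
  term \<open>omega / 2\<close> of the group law.\<close>

lemma act_act:
  assumes n: "1 \<le> n" and d: "d \<in> carrier (UHeis n)" "d' \<in> carrier (UHeis n)" and p: "p \<in> Nbar n"
  shows "act n c d' \<theta>' (act n c d \<theta> p) = act n c (d' \<otimes>\<^bsub>UHeis n\<^esub> d) (\<theta>' + \<theta>) p"
proof -
  obtain g v t where d1: "d = (g, (v, t))" and g: "g \<in> carrier (U_group n)" and v: "v \<in> carrier_vec n"
    using d by (auto simp: UHeis_simps)
  obtain g' v' t' where d2: "d' = (g', (v', t'))" and g': "g' \<in> carrier (U_group n)" and v': "v' \<in> carrier_vec n"
    using d by (auto simp: UHeis_simps)
  obtain X w \<phi> \<rho> where p1: "p = (X, w, \<phi>, \<rho>)" and X: "X \<in> CH_ball n"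
    using p by (cases p) (auto simp: Nbar_iff)
  have gc: "g \<in> carrier_mat n n" "g' \<in> carrier_mat n n"
    using g g' by (auto intro: U_carrier_mat)
  let ?w = "\<lambda>k\<in>{..<n}. mv n (co n g) w k + v $ k / 2"
  have w: "mv n (co n g') ?w k = mv n (co n (g' * g)) w k + mv n (co n g') (($) v) k / 2" if "k < n" for k
  proof -
    have "mv n (co n g') ?w k = mv n (co n g') (\<lambda>k. mv n (co n g) w k + v $ k / 2) k"
      by (intro mv_cong) auto
    then show ?thesis
      using that gc by (simp add: mv_add mv_divide co_mult mv_mult)
  qed
  have vw: "vec n (mv n (co n g') ?w) = vec n (mv n (co n (g' * g)) w) + (1/2) \<cdot>\<^sub>v (co n g' *\<^sub>v v)"
    using v w by (intro eq_vecI) (auto simp: mult_vec_index[of _ n] simp del: index_mult_mat_vec)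
  have vec2: "vec n (mv n (co n (g' * g)) w) = co n g' *\<^sub>v vec n (mv n (co n g) w)"
  proof (intro eq_vecI)
    fix i assume "i < dim_vec (co n g' *\<^sub>v vec n (mv n (co n g) w))"
    then have i: "i < n"
      by (simp add: co_def)
    have "mv n (co n g') (($) (vec n (mv n (co n g) w))) i = mv n (co n g') (mv n (co n g) w) i"
      by (intro mv_cong) auto
    then show "vec n (mv n (co n (g' * g)) w) $ i = (co n g' *\<^sub>v vec n (mv n (co n g) w)) $ i"
      using i gc by (simp add: mult_vec_index[of _ n] co_mult mv_mult del: index_mult_mat_vec)
  qed (simp add: co_def)
  have half: "omega n x ((1/2) \<cdot>\<^sub>v y) = omega n x y / 2" if "y \<in> carrier_vec n" for x y
  proof -
    have eq: "herm n (($) x) (($) ((1/2) \<cdot>\<^sub>v y)) = herm n (($) x) (\<lambda>j. y $ j / 2)"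
      using that by (intro herm_cong) auto
    show ?thesis
      unfolding omega_herm[OF n] eq herm_divide_right by simp
  qed
  have cv: "co n g' *\<^sub>v v \<in> carrier_vec n"
    using v by (intro mult_mat_vec_carrier) auto
  have om: "omega n v' (vec n (mv n (co n g') ?w)) = omega n v' (vec n (mv n (co n (g' * g)) w)) + omega n v' (co n g' *\<^sub>v v) / 2"
    using cv n by (simp add: vw omega_add_right half)
  have om2: "omega n (v' + co n g' *\<^sub>v v) (vec n (mv n (co n (g' * g)) w)) =
      omega n v' (vec n (mv n (co n (g' * g)) w)) + omega n v (vec n (mv n (co n g) w))"
    using cv v' n v by (simp add: omega_add_left) (simp add: vec2 omega_mult[OF n co_U[OF g']])
  have J: "mat_Z n g X 0 \<noteq> 0"
    by (rule mat_Z0_nonzero[OF n g X])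
  have n0: "0 < n"
    using n by simp
  have X1: "mat_Z n g' (\<lambda>b\<in>{1..<n}. mat_Z n g X b / mat_Z n g X 0) b / mat_Z n g' (\<lambda>b\<in>{1..<n}. mat_Z n g X b / mat_Z n g X 0) 0
      = mat_Z n (g' * g) X b / mat_Z n (g' * g) X 0" if "b < n" for b
    unfolding mat_Z_act[OF n g gc(2) X that] mat_Z_act[OF n g gc(2) X n0]
    using J by simp
  have wv: "mv n (co n (g' * g)) w k + mv n (co n g') (($) v) k / 2 + v' $ k / 2 =
      mv n (co n (g' * g)) w k + (v' + co n g' *\<^sub>v v) $ k / 2" if "k < n" for k
    using that v v' by (simp add: mult_vec_index[of _ n] add_divide_distrib del: index_mult_mat_vec)
  show ?thesis
    unfolding d1 d2 p1 UHeis_simps(2)[OF g'] act.simps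
  proof (intro arg_cong2[where f = Pair] refl)
    show "(\<lambda>b\<in>{1..<n}. mat_Z n g' (\<lambda>b\<in>{1..<n}. mat_Z n g X b / mat_Z n g X 0) b /
         mat_Z n g' (\<lambda>b\<in>{1..<n}. mat_Z n g X b / mat_Z n g X 0) 0) =
      (\<lambda>b\<in>{1..<n}. mat_Z n (g' * g) X b / mat_Z n (g' * g) X 0)"
      using X1 by (intro restrict_ext) auto
    show "(\<lambda>k\<in>{..<n}. mv n (co n g') ?w k + v' $ k / 2) =
      (\<lambda>k\<in>{..<n}. mv n (co n (g' * g)) w k + (v' + co n g' *\<^sub>v v) $ k / 2)"
      using w wv by (intro restrict_ext) (simp del: index_add_vec)
  qed (unfold om om2, simp add: algebra_simps)
qed

lemma act_one:
  assumes "1 \<le> n" "p \<in> Nbar n"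
  shows "act n c (1\<^sub>m n, (0\<^sub>v n, t)) \<theta> p =
    (coord_X p, coord_w p, coord_phi p - 2 * c * \<theta> + t, coord_rho p)"
proof -
  obtain X w \<phi> \<rho> where p1: "p = (X, w, \<phi>, \<rho>)" "X \<in> extensional {1..<n}" "w \<in> extensional {..<n}"
    using assms by (cases p) (auto simp: Nbar_iff)
  have "(\<lambda>b\<in>{1..<n}. mv n (1\<^sub>m n) (homog X) b / mv n (1\<^sub>m n) (homog X) 0) = X"
    using p1 assms by (auto simp: mv_one homog_def fun_eq_iff extensional_def)
  moreover have "(\<lambda>k\<in>{..<n}. mv n (1\<^sub>m n) w k + 0\<^sub>v n $ k / 2) = w"
    using p1 assms by (auto simp: mv_one fun_eq_iff extensional_def)
  ultimately show ?thesis
    using assms by (simp add: p1 co_one mat_Z_mv omega_zero)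
qed

section \<open>Matrix exponentials\<close>

text \<open>An entry of exp(z A) as a power series in a complex variable, so that termwise
  differentiation applies; real curves are restrictions.\<close>

definition mexp :: "complex mat \<Rightarrow> complex \<Rightarrow> nat \<Rightarrow> nat \<Rightarrow> complex" where
  "mexp A z i j = (\<Sum>k. (A ^\<^sub>m k) $$ (i, j) / fact k * z ^ k)"

lemma mat_exp_entry: "i < n \<Longrightarrow> j < n \<Longrightarrow> mat_exp n A $$ (i, j) = mexp A 1 i j"
  by (simp add: mat_exp_def mexp_def)

lemma mat_exp_carrier [simp]: "mat_exp n A \<in> carrier_mat n n"
  by (simp add: mat_exp_def)

lemma pow_mat_entry_Suc:
  assumes "A \<in> carrier_mat n n" "i < n" "j < n"
  shows "(A ^\<^sub>m Suc k) $$ (i, j) = (\<Sum>l<n. (A ^\<^sub>m k) $$ (i, l) * A $$ (l, j))"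
    and "(A ^\<^sub>m Suc k) $$ (i, j) = (\<Sum>l<n. A $$ (i, l) * (A ^\<^sub>m k) $$ (l, j))"
proof -
  have c: "A ^\<^sub>m m \<in> carrier_mat n n" for m
    using assms by simp
  show "(A ^\<^sub>m Suc k) $$ (i, j) = (\<Sum>l<n. (A ^\<^sub>m k) $$ (i, l) * A $$ (l, j))"
    using mult_mat_entry[OF c assms] by simp
  have "A ^\<^sub>m Suc m = A * A ^\<^sub>m m" for m
  proof (induction m)
    case (Suc m)
    then show ?case
      using assms(1) c[of m] by (simp add: assoc_mult_mat[of A n n "A ^\<^sub>m m" n A n])
  qed (use assms in simp)
  then show "(A ^\<^sub>m Suc k) $$ (i, j) = (\<Sum>l<n. A $$ (i, l) * (A ^\<^sub>m k) $$ (l, j))"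
    using mult_mat_entry[OF assms(1) c assms(2,3)] by (simp del: pow_mat.simps)
qed

text \<open>With M the sum of the moduli of all entries, the entries of the k-th power are at most
  (n M)^k, so the exponential series of n M |z| dominates.\<close>

lemma mexp_summable:
  fixes A :: "complex mat"
  assumes A: "A \<in> carrier_mat n n" and ij: "i < n" "j < n"
  shows "summable (\<lambda>k. (A ^\<^sub>m k) $$ (i, j) / fact k * z ^ k)"
proof -
  define M where "M = (\<Sum>i<n. \<Sum>j<n. cmod (A $$ (i, j)))"
  have M0: "0 \<le> M"
    by (auto simp: M_def intro!: sum_nonneg)
  have M: "cmod (A $$ (i, j)) \<le> M" if "i < n" "j < n" for i j
  proof -
    have "cmod (A $$ (i, j)) \<le> (\<Sum>j<n. cmod (A $$ (i, j)))"
      using that by (intro member_le_sum) auto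
    also have "\<dots> \<le> M"
      unfolding M_def using that by (intro member_le_sum[where f = "\<lambda>i. \<Sum>j<n. cmod (A $$ (i, j))"]) (auto intro: sum_nonneg)
    finally show ?thesis .
  qed
  have b: "cmod ((A ^\<^sub>m k) $$ (i, j)) \<le> (n * M) ^ k" if "i < n" "j < n" for i j k
    using that
  proof (induction k arbitrary: i j)
    case 0
    then show ?case
      using A by auto
  next
    case (Suc k)
    have "cmod ((A ^\<^sub>m Suc k) $$ (i, j)) \<le> (\<Sum>l<n. cmod ((A ^\<^sub>m k) $$ (i, l)) * cmod (A $$ (l, j)))"
      unfolding pow_mat_entry_Suc(1)[OF A Suc.prems] by (rule order_trans[OF norm_sum]) (simp add: norm_mult)
    also have "\<dots> \<le> (\<Sum>l<n. (n * M) ^ k * M)"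
      using Suc M M0 by (intro sum_mono mult_mono) auto
    finally show ?case
      by (simp add: mult_ac)
  qed
  have "norm ((A ^\<^sub>m k) $$ (i, j) / fact k * z ^ k) \<le> inverse (fact k) * (n * M * cmod z) ^ k" for k
    using mult_right_mono[OF b[OF ij, of k], of "inverse (fact k) * cmod z ^ k"]
    by (simp add: norm_mult norm_divide norm_power norm_inverse norm_fact power_mult_distrib divide_inverse mult_ac)
  then show ?thesis
    by (rule summable_comparison_test'[OF summable_exp[of "n * M * cmod z"]])
qed

text \<open>Both orders of the factors are recorded: with A on the right the product with a solution
  telescopes in \<open>mexp_minus_mult\<close>, and with A on the left the exponential is itself a
  solution.\<close>

lemma mexp_deriv:
  assumes A: "A \<in> carrier_mat n n" and ij: "i < n" "j < n"
  shows "((\<lambda>z. mexp A z i j) has_field_derivative (\<Sum>l<n. mexp A z i l * A $$ (l, j))) (at z)"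
    and "((\<lambda>z. mexp A z i j) has_field_derivative (\<Sum>l<n. A $$ (i, l) * mexp A z l j)) (at z)"
proof -
  let ?c = "\<lambda>i j k. (A ^\<^sub>m k) $$ (i, j) / fact k"
  have D: "((\<lambda>z. mexp A z i j) has_field_derivative (\<Sum>k. diffs (?c i j) k * z ^ k)) (at z)"
    unfolding mexp_def by (rule termdiffs_strong_converges_everywhere[OF mexp_summable[OF A ij]])
  have d: "diffs (?c i j) k = (A ^\<^sub>m Suc k) $$ (i, j) / fact k" for k
    by (simp add: diffs_def del: pow_mat.simps of_nat_Suc)
  have "(\<Sum>k. diffs (?c i j) k * z ^ k) = (\<Sum>k. \<Sum>l<n. ?c i l k * z ^ k * A $$ (l, j))"
    by (simp add: d pow_mat_entry_Suc(1)[OF A ij] sum_distrib_left sum_distrib_right sum_divide_distrib mult_ac del: pow_mat.simps)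
  also have "\<dots> = (\<Sum>l<n. \<Sum>k. ?c i l k * z ^ k * A $$ (l, j))"
    using ij by (intro suminf_sum summable_mult2 mexp_summable[OF A]) auto
  also have "\<dots> = (\<Sum>l<n. mexp A z i l * A $$ (l, j))"
    unfolding mexp_def using ij by (intro sum.cong refl suminf_mult2[symmetric] mexp_summable[OF A]) auto
  finally show "((\<lambda>z. mexp A z i j) has_field_derivative (\<Sum>l<n. mexp A z i l * A $$ (l, j))) (at z)"
    using D by simp
  have "(\<Sum>k. diffs (?c i j) k * z ^ k) = (\<Sum>k. \<Sum>l<n. A $$ (i, l) * (?c l j k * z ^ k))"
    by (simp add: d pow_mat_entry_Suc(2)[OF A ij] sum_distrib_left sum_distrib_right sum_divide_distrib mult_ac del: pow_mat.simps)
  also have "\<dots> = (\<Sum>l<n. \<Sum>k. A $$ (i, l) * (?c l j k * z ^ k))"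
    using ij by (intro suminf_sum summable_mult mexp_summable[OF A]) auto
  also have "\<dots> = (\<Sum>l<n. A $$ (i, l) * mexp A z l j)"
    unfolding mexp_def using ij by (intro sum.cong refl suminf_mult mexp_summable[OF A]) auto
  finally show "((\<lambda>z. mexp A z i j) has_field_derivative (\<Sum>l<n. A $$ (i, l) * mexp A z l j)) (at z)"
    using D by simp
qed

lemma mexp_zero: "A \<in> carrier_mat n n \<Longrightarrow> i < n \<Longrightarrow> j < n \<Longrightarrow> mexp A 0 i j = (if i = j then 1 else 0)"
  unfolding mexp_def powser_zero by simp

lemma mexp_vderiv:
  assumes "A \<in> carrier_mat n n" "i < n" "j < n"
  shows "((\<lambda>s. mexp A (complex_of_real s) i j) has_vector_derivative (\<Sum>l<n. mexp A s i l * A $$ (l, j))) (at s within T)"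
    and "((\<lambda>s. mexp A (complex_of_real s) i j) has_vector_derivative (\<Sum>l<n. A $$ (i, l) * mexp A s l j)) (at s within T)"
  by (rule has_vector_derivative_real_field mexp_deriv[OF assms])+

lemma constant_on_interval:
  fixes f :: "real \<Rightarrow> 'a :: real_normed_vector"
  assumes "\<And>s. s \<in> {0..S} \<Longrightarrow> (f has_vector_derivative 0) (at s within {0..S})" "0 \<le> S"
  shows "f S = f 0"
proof (rule has_derivative_zero_unique[of "{0..S}" f S 0])
  show "(f has_derivative (\<lambda>h. 0)) (at x within {0..S})" if "x \<in> {0..S}" for x
    using assms(1)[OF that] by (simp add: has_vector_derivative_def)
qed (use assms in auto)

lemma mexp_minus_mult:
  assumes A: "A \<in> carrier_mat n n" and ode: "\<And>s i. s \<in> {0..S} \<Longrightarrow> i < n \<Longrightarrow>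
      ((\<lambda>r. y r i) has_vector_derivative (\<Sum>l<n. A $$ (i, l) * y s l)) (at s within {0..S})"
    and S: "0 \<le> S" and i: "i < n"
  shows "(\<Sum>l<n. mexp A (complex_of_real (- S)) i l * y S l) = y 0 i"
proof -
  define f where "f s = (\<Sum>l<n. mexp A (complex_of_real (- s)) i l * y s l)" for s
  have "(f has_vector_derivative 0) (at s within {0..S})" if s: "s \<in> {0..S}" for s
  proof -
    have m: "((\<lambda>r. mexp A (complex_of_real (- r)) i l) has_vector_derivative
        - (\<Sum>m<n. mexp A (complex_of_real (- s)) i m * A $$ (m, l))) (at s within {0..S})" if "l < n" for l
    proof -
      have "((\<lambda>z. mexp A (- z) i l) has_field_derivative
          (\<Sum>m<n. mexp A (- complex_of_real s) i m * A $$ (m, l)) * (- 1)) (at (complex_of_real s))"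
        by (rule DERIV_chain2[OF mexp_deriv(1)[OF A i that]]) (auto intro!: derivative_eq_intros)
      from has_vector_derivative_real_field[OF this] show ?thesis
        by simp
    qed
    have "(f has_vector_derivative (\<Sum>l<n. mexp A (complex_of_real (- s)) i l * (\<Sum>m<n. A $$ (l, m) * y s m)
        + - (\<Sum>m<n. mexp A (complex_of_real (- s)) i m * A $$ (m, l)) * y s l)) (at s within {0..S})"
      unfolding f_def
      by (intro has_vector_derivative_sum has_vector_derivative_mult) (use m ode s in auto)
    moreover have "(\<Sum>l<n. \<Sum>m<n. mexp A (complex_of_real (- s)) i l * (A $$ (l, m) * y s m)) =
        (\<Sum>l<n. \<Sum>m<n. mexp A (complex_of_real (- s)) i m * A $$ (m, l) * y s l)"
      by (subst sum.swap) (simp add: mult.assoc)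
    ultimately show ?thesis
      by (simp add: sum.distrib sum_negf sum_subtractf sum_distrib_left sum_distrib_right)
  qed
  from constant_on_interval[OF this S] have "f S = f 0" by simp
  also have "f 0 = (\<Sum>l<n. if l = i then y 0 i else 0)"
    unfolding f_def using i by (intro sum.cong) (auto simp: mexp_zero[OF A])
  finally show ?thesis
    using i by (simp add: f_def)
qed

lemma mexp_minus:
  assumes A: "A \<in> carrier_mat n n" and S: "0 \<le> S" and ij: "i < n" "j < n"
  shows "(\<Sum>l<n. mexp A (complex_of_real (- S)) i l * mexp A (complex_of_real S) l j) = (if i = j then 1 else 0)"
  using mexp_minus_mult[OF A _ S ij(1), of "\<lambda>s l. mexp A (complex_of_real s) l j"] ij
  by (simp add: mexp_vderiv[OF A] mexp_zero[OF A])

text \<open>The order of the factors in \<open>mexp_minus\<close> is exchanged by matrix algebra: a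
  left inverse of a square matrix is a right inverse.\<close>

lemma mexp_plus_minus:
  assumes A: "A \<in> carrier_mat n n" and S: "0 \<le> S" and ij: "i < n" "j < n"
  shows "(\<Sum>l<n. mexp A (complex_of_real S) i l * mexp A (complex_of_real (- S)) l j) = (if i = j then 1 else 0)"
proof -
  define P where "P s = mat n n (\<lambda>(i, j). mexp A (complex_of_real s) i j)" for s
  have c: "P s \<in> carrier_mat n n" for s
    by (simp add: P_def)
  have "P (- S) * P S = 1\<^sub>m n"
  proof (rule eq_matI)
    fix i j assume "i < dim_row (1\<^sub>m n :: complex mat)" "j < dim_col (1\<^sub>m n :: complex mat)"
    then have ij: "i < n" "j < n"
      by auto
    show "(P (- S) * P S) $$ (i, j) = 1\<^sub>m n $$ (i, j)"
      unfolding mult_mat_entry[OF c c ij] using mexp_minus[OF A S ij] ij by (simp add: P_def)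
  qed (simp_all add: P_def)
  then have "P S * P (- S) = 1\<^sub>m n"
    using mat_mult_left_right_inverse[OF c c] by blast
  then have "(P S * P (- S)) $$ (i, j) = (if i = j then 1 else 0)"
    using ij by simp
  then show ?thesis
    unfolding mult_mat_entry[OF c c ij] using ij by (simp add: P_def)
qed

text \<open>\<open>exp(- s A) y(s)\<close> is constant along a solution.\<close>

lemma linear_ode_unique:
  assumes A: "A \<in> carrier_mat n n" and ode: "\<And>s i. s \<in> {0..S} \<Longrightarrow> i < n \<Longrightarrow>
      ((\<lambda>r. y r i) has_vector_derivative (\<Sum>l<n. A $$ (i, l) * y s l)) (at s within {0..S})"
    and S: "0 \<le> S" and i: "i < n"
  shows "y S i = (\<Sum>l<n. mexp A (complex_of_real S) i l * y 0 l)"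
proof -
  have "(\<Sum>l<n. mexp A (complex_of_real S) i l * y 0 l) =
      (\<Sum>l<n. mexp A (complex_of_real S) i l * (\<Sum>m<n. mexp A (complex_of_real (- S)) l m * y S m))"
    using mexp_minus_mult[OF A ode S] by (intro sum.cong) auto
  also have "\<dots> = (\<Sum>m<n. (\<Sum>l<n. mexp A (complex_of_real S) i l * mexp A (complex_of_real (- S)) l m) * y S m)"
    unfolding sum_distrib_left sum_distrib_right by (subst sum.swap) (simp add: mult.assoc)
  also have "\<dots> = (\<Sum>m<n. if m = i then y S i else 0)"
    using i by (intro sum.cong) (auto simp: mexp_plus_minus[OF A S] simp del: of_real_minus)
  finally show ?thesis
    using i by simp
qed

text \<open>Characterises the exponential by its differential equation. The explicit exponentials
  below are verified through it instead of by summing series.\<close>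

lemma mat_exp_unique:
  assumes A: "A \<in> carrier_mat n n" and M: "M 1 \<in> carrier_mat n n"
    and ode: "\<And>s i j. s \<in> {0..1} \<Longrightarrow> i < n \<Longrightarrow> j < n \<Longrightarrow>
      ((\<lambda>r. M r $$ (i, j)) has_vector_derivative (\<Sum>l<n. A $$ (i, l) * M s $$ (l, j))) (at s within {0..1})"
    and init: "\<And>i j. i < n \<Longrightarrow> j < n \<Longrightarrow> M 0 $$ (i, j) = (if i = j then 1 else 0)"
  shows "mat_exp n A = M (1 :: real)"
proof (rule eq_matI)
  fix i j assume "i < dim_row (M 1)" "j < dim_col (M 1)"
  then have ij: "i < n" "j < n"
    using M by auto
  have "M 1 $$ (i, j) = (\<Sum>l<n. mexp A (complex_of_real 1) i l * M 0 $$ (l, j))"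
    using linear_ode_unique[OF A, of 1 "\<lambda>s l. M s $$ (l, j)" i] ode ij by simp
  also have "\<dots> = (\<Sum>l<n. if l = j then mexp A 1 i j else 0)"
    using ij by (intro sum.cong) (auto simp: init)
  finally show "mat_exp n A $$ (i, j) = M 1 $$ (i, j)"
    using ij by (simp add: mat_exp_entry)
qed (use M in \<open>auto simp: mat_exp_def\<close>)

lemma lie_u_entry: "A \<in> lie_u n \<Longrightarrow> i < n \<Longrightarrow> j < n \<Longrightarrow> A $$ (i, j) = - sg i * cnj (A $$ (j, i)) * sg j"
  unfolding lie_u_iff sg_def by blast

lemma lie_u_carrier: "A \<in> lie_u n \<Longrightarrow> A \<in> carrier_mat n n"
  by (simp add: lie_u_iff)

lemma mexp_cnj_vderiv:
  assumes "A \<in> lie_u n" "i < n" "j < n"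
  shows "((\<lambda>s. cnj (mexp A (complex_of_real s) i j)) has_vector_derivative
    - (\<Sum>l<n. sg i * sg l * A $$ (l, i) * cnj (mexp A s l j))) (at s within T)"
proof -
  have "((\<lambda>s. cnj (mexp A (complex_of_real s) i j)) has_vector_derivative
      cnj (\<Sum>l<n. A $$ (i, l) * mexp A s l j)) (at s within T)"
    by (rule has_vector_derivative_cnj[OF mexp_vderiv(2)]) (use assms lie_u_carrier in auto)
  moreover have "cnj (\<Sum>l<n. A $$ (i, l) * mexp A s l j) = - (\<Sum>l<n. sg i * sg l * A $$ (l, i) * cnj (mexp A s l j))"
    unfolding cnj_sum sum_negf[symmetric]
    by (intro sum.cong refl, subst lie_u_entry[OF assms(1,2)]) (auto simp: mult_ac)
  ultimately show ?thesis
    by simp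
qed

text \<open>The Hermitian products of the columns of exp(s A) have derivative 0, since
  \<open>mexp_cnj_vderiv\<close> has built in that A is skew, and at s = 0 they are those of the
  identity matrix.\<close>

lemma mexp_U:
  assumes A: "A \<in> lie_u n" and S: "0 \<le> S"
  shows "mat n n (\<lambda>(i, j). mexp A (complex_of_real S) i j) \<in> carrier (U_group n)"
proof -
  have "(\<Sum>k<n. sg k * cnj (mexp A (complex_of_real S) k i) * mexp A (complex_of_real S) k j) = (if i = j then sg i else 0)"
    if ij: "i < n" "j < n" for i j
  proof -
    let ?e = "\<lambda>s k j. mexp A (complex_of_real s) k j"
    define f where "f s = (\<Sum>k<n. sg k * cnj (?e s k i) * ?e s k j)" for s
    have "(f has_vector_derivative 0) (at s within {0..S})" for s
    proof -
      have "(f has_vector_derivative (\<Sum>k<n. (sg k * cnj (?e s k i)) * (\<Sum>l<n. A $$ (k, l) * ?e s l j) +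
          sg k * (- (\<Sum>l<n. sg k * sg l * A $$ (l, k) * cnj (?e s l i))) * ?e s k j)) (at s within {0..S})"
        unfolding f_def using ij A lie_u_carrier[OF A]
        by (intro has_vector_derivative_sum has_vector_derivative_mult has_vector_derivative_mult_right
            mexp_vderiv mexp_cnj_vderiv) auto
      moreover have "(\<Sum>k<n. \<Sum>l<n. sg k * cnj (?e s k i) * (A $$ (k, l) * ?e s l j)) =
          (\<Sum>k<n. \<Sum>l<n. sg l * A $$ (l, k) * cnj (?e s l i) * ?e s k j)"
        by (subst sum.swap) (simp add: mult_ac)
      ultimately show ?thesis
        by (simp add: sum.distrib sum_negf sum_subtractf sum_distrib_left sum_distrib_right mult.assoc)
    qed
    then have "f S = f 0"
      using S by (intro constant_on_interval) auto
    also have "\<dots> = (\<Sum>k<n. if k = j then (if i = j then sg i else 0) else 0)"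
      unfolding f_def using ij lie_u_carrier[OF A] by (intro sum.cong) (auto simp: mexp_zero)
    finally show ?thesis
      using ij by (simp add: f_def)
  qed
  then show ?thesis
    by (simp add: U_iff_entries)
qed

lemma mat_exp_U: "A \<in> lie_u n \<Longrightarrow> mat_exp n A \<in> carrier (U_group n)"
proof -
  assume A: "A \<in> lie_u n"
  have "mat_exp n A = mat n n (\<lambda>(i, j). mexp A (complex_of_real 1) i j)"
    by (rule eq_matI) (auto simp: mat_exp_entry, auto simp: mat_exp_def)
  then show ?thesis
    using mexp_U[OF A, of 1] by simp
qed

section \<open>Flows of the Killing fields\<close>

text \<open>For z = 0 every angle qualifies; the relation is applied to z = (g Z)^0, which does not
  vanish on the ball.\<close>

definition isarg :: "real \<Rightarrow> complex \<Rightarrow> bool" where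
  "isarg \<theta> z \<longleftrightarrow> z = complex_of_real (cmod z) * cis \<theta>"

lemma isarg_exp: "isarg (Im z) (exp z)"
  unfolding isarg_def norm_exp_eq_Re by (rule exp_eq_polar)

lemma vector_derivative_quotient:
  fixes f g :: "real \<Rightarrow> complex"
  assumes f: "(f has_vector_derivative f') (at x within S)" and g: "(g has_vector_derivative g') (at x within S)"
    and nz: "g x \<noteq> 0"
  shows "((\<lambda>x. f x / g x) has_vector_derivative (f' * g x - f x * g') / (g x)\<^sup>2) (at x within S)"
proof -
  have "(inverse has_field_derivative - (inverse (g x) ^ 2)) (at (g x) within g ` S)"
    using DERIV_inverse[OF nz, of "g ` S"] by (simp add: power2_eq_square)
  from has_vector_derivative_mult[OF f field_vector_diff_chain_within[OF g this]]
  have "((\<lambda>x. f x * inverse (g x)) has_vector_derivative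
      (f x * (g' * - (inverse (g x) ^ 2)) + f' * inverse (g x))) (at x within S)"
    by (simp add: o_def)
  moreover have "f x * (g' * - (inverse (g x) ^ 2)) + f' * inverse (g x) = (f' * g x - f x * g') / (g x)\<^sup>2"
    using nz by (simp add: field_simps power2_eq_square)
  ultimately show ?thesis
    by (simp add: divide_inverse)
qed

definition emat :: "nat \<Rightarrow> complex mat \<Rightarrow> real \<Rightarrow> complex mat" where
  "emat n A s = mat n n (\<lambda>(i, j). mexp A (complex_of_real s) i j)"

lemma emat_carrier [simp]: "emat n A s \<in> carrier_mat n n"
  by (simp add: emat_def)

lemma emat_one: "emat n A 1 = mat_exp n A"
  by (rule eq_matI) (auto simp: emat_def mat_exp_def mexp_def)

lemma emat_zero: "A \<in> carrier_mat n n \<Longrightarrow> emat n A 0 = 1\<^sub>m n"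
  by (rule eq_matI) (auto simp: emat_def mexp_zero)

lemma emat_U: "A \<in> lie_u n \<Longrightarrow> 0 \<le> s \<Longrightarrow> emat n A s \<in> carrier (U_group n)"
  unfolding emat_def by (rule mexp_U)

lemma emat_mv_vderiv:
  assumes A: "A \<in> carrier_mat n n" and i: "i < n"
  shows "((\<lambda>s. mv n (emat n A s) x i) has_vector_derivative mv n A (mv n (emat n A s) x) i) (at s within T)"
proof -
  have "((\<lambda>s. mv n (emat n A s) x i) has_vector_derivative
      (\<Sum>j<n. (\<Sum>l<n. A $$ (i, l) * mexp A s l j) * x j)) (at s within T)"
    unfolding mv_def using i
    by (auto simp: emat_def intro!: has_vector_derivative_sum has_vector_derivative_mult_left mexp_vderiv(2)[OF A])
  also have "(\<Sum>j<n. (\<Sum>l<n. A $$ (i, l) * mexp A s l j) * x j) = mv n A (mv n (emat n A s) x) i"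
    unfolding mv_def sum_distrib_left sum_distrib_right
    by (subst sum.swap) (simp add: emat_def mult.assoc)
  finally show ?thesis .
qed

text \<open>Since A is skew for the form, \<open>co\<close> of exp(s A) solves the system with
  matrix - A^T, which is the w-part of \<open>alpha\<close>.\<close>

lemma emat_co_vderiv:
  assumes A: "A \<in> lie_u n" and k: "k < n"
  shows "((\<lambda>s. mv n (co n (emat n A s)) w k) has_vector_derivative
    - (\<Sum>l<n. A $$ (l, k) * mv n (co n (emat n A s)) w l)) (at s within T)"
proof -
  let ?d = "\<lambda>j. sg k * sg j * (- (\<Sum>l<n. sg k * sg l * A $$ (l, k) * cnj (mexp A s l j))) * w j"
  have "((\<lambda>s. co n (emat n A s) $$ (k, j) * w j) has_vector_derivative ?d j) (at s within T)" if "j < n" for j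
  proof -
    have "((\<lambda>s. sg k * sg j * cnj (mexp A (complex_of_real s) k j) * w j) has_vector_derivative ?d j) (at s within T)"
      by (intro has_vector_derivative_mult_left has_vector_derivative_mult_right mexp_cnj_vderiv[OF A k that])
    then show ?thesis
      using k that by (simp add: co_def emat_def)
  qed
  then have "((\<lambda>s. mv n (co n (emat n A s)) w k) has_vector_derivative (\<Sum>j<n. ?d j)) (at s within T)"
    unfolding mv_def by (intro has_vector_derivative_sum) auto
  also have "(\<Sum>j<n. sg k * sg j * (- (\<Sum>l<n. sg k * sg l * A $$ (l, k) * cnj (mexp A s l j))) * w j) =
      - (\<Sum>l<n. A $$ (l, k) * mv n (co n (emat n A s)) w l)"
    unfolding mv_def sum_distrib_left sum_distrib_right sum_negf[symmetric]
    by (subst sum.swap) (auto simp: emat_def co_def mult_ac intro!: sum.cong)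
  finally show ?thesis .
qed

definition flowX :: "nat \<Rightarrow> complex mat \<Rightarrow> (nat \<Rightarrow> complex) \<Rightarrow> real \<Rightarrow> nat \<Rightarrow> complex" where
  "flowX n A X s = (\<lambda>b\<in>{1..<n}. mat_Z n (emat n A s) X b / mat_Z n (emat n A s) X 0)"

text \<open>The angle is the imaginary part of a logarithm of (exp(s A) Z)^0 that is followed
  continuously from 0 (see \<open>curve_X\<close>). It therefore counts windings, which an argument
  taken in a fixed interval would lose.\<close>

definition flow :: "nat \<Rightarrow> real \<Rightarrow> complex mat \<Rightarrow> coords \<Rightarrow> real \<Rightarrow> coords" where
  "flow n c A p s = act n c (emat n A s, (0\<^sub>v n, 0))
     (Im (integral {0..s} (\<lambda>r. mat_Z n A (flowX n A (coord_X p) r) 0))) p"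

locale su_flow =
  fixes n :: nat and A :: "complex mat"
  assumes n: "1 \<le> n" and A: "A \<in> lie_u n"
begin

lemma A_carrier: "A \<in> carrier_mat n n"
  using A by (rule lie_u_carrier)

lemma n0: "0 < n"
  using n by simp

lemma denom: "X \<in> CH_ball n \<Longrightarrow> 0 \<le> s \<Longrightarrow> mat_Z n (emat n A s) X 0 \<noteq> 0"
  by (rule mat_Z0_nonzero[OF n emat_U[OF A]])

lemma mat_Z_flowX:
  assumes "X \<in> CH_ball n" "0 \<le> s" "b < n"
  shows "mat_Z n A (flowX n A X s) b = mv n A (mv n (emat n A s) (homog X)) b / mat_Z n (emat n A s) X 0"
  unfolding flowX_def mat_Z_act[OF n emat_U[OF A assms(2)] A_carrier assms(1,3)]
  using assms(3) A_carrier by (simp add: mat_Z_mv mv_mult)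

lemma continuous_integrand:
  assumes "X \<in> CH_ball n"
  shows "continuous_on {0..1} (\<lambda>r. mat_Z n A (flowX n A X r) 0)"
proof -
  have c: "continuous_on {0..1} (\<lambda>r. mv n (emat n A r) (homog X) i)" if "i < n" for i
    by (rule continuous_on_vector_derivative[OF emat_mv_vderiv[OF A_carrier that]])
  have "continuous_on {0..1} (\<lambda>s. mv n A (mv n (emat n A s) (homog X)) 0 / mat_Z n (emat n A s) X 0)"
    unfolding mat_Z_mv mv_def[of n A]
    using c n0 denom[OF assms] by (intro continuous_intros) (auto simp: mat_Z_mv)
  then show ?thesis
    by (rule continuous_on_eq) (use n0 assms in \<open>auto simp: mat_Z_flowX\<close>)
qed

lemma flow_zero: "p \<in> Nbar n \<Longrightarrow> flow n c A p 0 = p"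
  unfolding flow_def emat_zero[OF A_carrier]
  using act_one[OF n, of p c 0] by (cases p) auto

lemma flow_Nbar: "p \<in> Nbar n \<Longrightarrow> 0 \<le> s \<Longrightarrow> flow n c A p s \<in> Nbar n"
  unfolding flow_def by (intro act_Nbar[OF n]) (auto simp: UHeis_simps emat_U[OF A])

lemma coord_X_flow: "coord_X (flow n c A p s) = flowX n A (coord_X p) s"
  by (cases p) (simp add: flow_def flowX_def)

lemma alpha_simps:
  "coord_X (alpha n c (A, (0\<^sub>v n, 0)) q) b = mat_Z n A (coord_X q) b - coord_X q b * mat_Z n A (coord_X q) 0"
  "k < n \<Longrightarrow> coord_w (alpha n c (A, (0\<^sub>v n, 0)) q) k = - (\<Sum>l<n. A $$ (l, k) * coord_w q l)"
  "coord_phi (alpha n c (A, (0\<^sub>v n, 0)) q) = - 2 * c * Im (mat_Z n A (coord_X q) 0)"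
  "coord_rho (alpha n c (A, (0\<^sub>v n, 0)) q) = 0"
  by (cases q; use n in \<open>auto simp: omega_zero\<close>)+

lemma flow_velocity:
  assumes p: "p \<in> Nbar n" and s: "s \<in> {0..1}"
  shows "has_velocity n (flow n c A p) (alpha n c (A, (0\<^sub>v n, 0)) (flow n c A p s)) s {0..1}"
proof -
  obtain X w \<phi> \<rho> where p1: "p = (X, w, \<phi>, \<rho>)" and X: "X \<in> CH_ball n"
    using p by (cases p) (auto simp: Nbar_iff)
  have s0: "0 \<le> s"
    using s by simp
  have XX: "coord_X p = X"
    by (simp add: p1)
  show ?thesis
    unfolding has_velocity_def alpha_simps coord_X_flow XX
  proof (intro conjI ballI allI impI)
    fix a assume a: "a \<in> {1..<n}"
    have D: "((\<lambda>r. mat_Z n (emat n A r) X i) has_vector_derivative mv n A (mv n (emat n A s) (homog X)) i) (at s within {0..1})"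
      if "i < n" for i
      unfolding mat_Z_mv by (rule emat_mv_vderiv[OF A_carrier that])
    have "((\<lambda>r. flowX n A X r a) has_vector_derivative
        (mv n A (mv n (emat n A s) (homog X)) a * mat_Z n (emat n A s) X 0 -
          mat_Z n (emat n A s) X a * mv n A (mv n (emat n A s) (homog X)) 0) / (mat_Z n (emat n A s) X 0)\<^sup>2) (at s within {0..1})"
      using vector_derivative_quotient[OF D[of a] D[OF n0] denom[OF X s0]] a by (simp add: flowX_def)
    also have "(mv n A (mv n (emat n A s) (homog X)) a * mat_Z n (emat n A s) X 0 -
          mat_Z n (emat n A s) X a * mv n A (mv n (emat n A s) (homog X)) 0) / (mat_Z n (emat n A s) X 0)\<^sup>2 =
        mat_Z n A (flowX n A X s) a - flowX n A X s a * mat_Z n A (flowX n A X s) 0"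
    proof -
      have 1: "mat_Z n A (flowX n A X s) a = mv n A (mv n (emat n A s) (homog X)) a / mat_Z n (emat n A s) X 0"
        using a by (intro mat_Z_flowX X s0) auto
      have 2: "flowX n A X s a = mat_Z n (emat n A s) X a / mat_Z n (emat n A s) X 0"
        using a by (simp add: flowX_def)
      show ?thesis
        unfolding 1 2 mat_Z_flowX[OF X s0 n0] using denom[OF X s0] by (simp add: field_simps power2_eq_square)
    qed
    finally show "((\<lambda>r. flowX n A X r a) has_vector_derivative
        mat_Z n A (flowX n A X s) a - flowX n A X s a * mat_Z n A (flowX n A X s) 0) (at s within {0..1})" .
  next
    fix k assume k: "k < n"
    have fw: "coord_w (flow n c A p r) l = mv n (co n (emat n A r)) w l" if "l < n" for l r
      using that by (simp add: flow_def p1)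
    show "((\<lambda>r. coord_w (flow n c A p r) k) has_vector_derivative
        coord_w (alpha n c (A, 0\<^sub>v n, 0) (flow n c A p s)) k) (at s within {0..1})"
      unfolding alpha_simps(2)[OF k] using emat_co_vderiv[OF A k, of w s "{0..1}"] k
      by (simp add: fw)
  next
    have fp: "coord_phi (flow n c A p r) = \<phi> - 2 * c * Im (integral {0..r} (\<lambda>r. mat_Z n A (flowX n A X r) 0))" for r
      using n by (simp add: flow_def p1 omega_zero)
    have "((\<lambda>r. integral {0..r} (\<lambda>r. mat_Z n A (flowX n A X r) 0)) has_vector_derivative
        mat_Z n A (flowX n A X s) 0) (at s within {0..1})"
      by (rule integral_has_vector_derivative[OF continuous_integrand[OF X] s])
    then have "((\<lambda>r. Im (integral {0..r} (\<lambda>r. mat_Z n A (flowX n A X r) 0))) has_vector_derivative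
        Im (mat_Z n A (flowX n A X s) 0)) (at s within {0..1})"
      by (rule bounded_linear.has_vector_derivative[OF bounded_linear_Im])
    then have "((\<lambda>r. Im (integral {0..r} (\<lambda>r. mat_Z n A (flowX n A X r) 0))) has_real_derivative
        Im (mat_Z n A (flowX n A X s) 0)) (at s within {0..1})"
      by (simp only: has_real_derivative_iff_has_vector_derivative)
    from DERIV_diff[OF DERIV_const DERIV_cmult[OF this, of "2 * c"], of \<phi>]
    show "((\<lambda>r. coord_phi (flow n c A p r)) has_real_derivative
        - 2 * c * Im (mat_Z n A (flowX n A X s) 0)) (at s within {0..1})"
      unfolding fp by simp
  next
    have "coord_rho (flow n c A p r) = \<rho>" for r
      by (simp add: flow_def p1)
    then show "((\<lambda>r. coord_rho (flow n c A p r)) has_real_derivative 0) (at s within {0..1})"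
      by simp
  qed
qed

lemma velocity_alpha:
  assumes "has_velocity n \<gamma> (alpha n c (A, (0\<^sub>v n, 0)) (\<gamma> s)) s T"
  shows "a \<in> {1..<n} \<Longrightarrow> ((\<lambda>r. coord_X (\<gamma> r) a) has_vector_derivative
      mat_Z n A (coord_X (\<gamma> s)) a - coord_X (\<gamma> s) a * mat_Z n A (coord_X (\<gamma> s)) 0) (at s within T)"
    and "k < n \<Longrightarrow> ((\<lambda>r. coord_w (\<gamma> r) k) has_vector_derivative - (\<Sum>l<n. A $$ (l, k) * coord_w (\<gamma> s) l)) (at s within T)"
    and "((\<lambda>r. coord_phi (\<gamma> r)) has_real_derivative - 2 * c * Im (mat_Z n A (coord_X (\<gamma> s)) 0)) (at s within T)"
    and "((\<lambda>r. coord_rho (\<gamma> r)) has_real_derivative 0) (at s within T)"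
  using assms unfolding has_velocity_def by (auto simp: alpha_simps)

text \<open>The Riccati equation for \<open>X\<close> is linearised by \<open>\<lambda> (1, X)\<close> with \<open>\<lambda>(s) = exp \<integral> (A Z)\<^sup>0\<close>.\<close>

lemma curve_X:
  assumes curve: "\<And>s. s \<in> {0..1} \<Longrightarrow> \<gamma> s \<in> Nbar n \<and> has_velocity n \<gamma> (alpha n c (A, (0\<^sub>v n, 0)) (\<gamma> s)) s {0..1}"
    and S: "S \<in> {0..1}"
  shows "coord_X (\<gamma> S) = flowX n A (coord_X (\<gamma> 0)) S"
    and "exp (integral {0..S} (\<lambda>r. mat_Z n A (coord_X (\<gamma> r)) 0)) = mat_Z n (emat n A S) (coord_X (\<gamma> 0)) 0"
proof -
  let ?X = "\<lambda>s. coord_X (\<gamma> s)"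
  have S0: "0 \<le> S"
    using S by simp
  have X0: "?X 0 \<in> CH_ball n"
    using curve[of 0] by (cases "\<gamma> 0") (auto simp: Nbar_iff)
  have DX: "((\<lambda>r. ?X r a) has_vector_derivative mat_Z n A (?X s) a - ?X s a * mat_Z n A (?X s) 0) (at s within {0..1})"
    if "a \<in> {1..<n}" "s \<in> {0..1}" for a s
    using velocity_alpha(1)[OF conjunct2[OF curve[OF that(2)]] that(1)] .
  have cX: "continuous_on {0..1} (\<lambda>r. homog (?X r) j)" if "j < n" for j
  proof (cases "j = 0")
    case False
    then have "continuous_on {0..1} (\<lambda>r. ?X r j)"
      using that by (intro continuous_on_vector_derivative[OF DX]) auto
    then show ?thesis
      using False by (simp add: homog_def)
  qed (simp add: homog_def)
  have cf: "continuous_on {0..1} (\<lambda>r. mat_Z n A (?X r) 0)"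
    unfolding mat_Z_mv mv_def by (intro continuous_intros cX) auto
  define F where "F s = integral {0..s} (\<lambda>r. mat_Z n A (?X r) 0)" for s
  have F: "(F has_vector_derivative mat_Z n A (?X s) 0) (at s within {0..1})" if "s \<in> {0..1}" for s
    unfolding F_def by (rule integral_has_vector_derivative[OF cf that])
  have eF: "((\<lambda>s. exp (F s)) has_vector_derivative mat_Z n A (?X s) 0 * exp (F s)) (at s within {0..1})"
    if "s \<in> {0..1}" for s
    using field_vector_diff_chain_within[OF F[OF that] has_field_derivative_at_within[OF DERIV_exp]]
    by (simp add: o_def)
  define y where "y s j = exp (F s) * homog (?X s) j" for s j
  have ode: "((\<lambda>r. y r i) has_vector_derivative (\<Sum>l<n. A $$ (i, l) * y s l)) (at s within {0..1})"
    if s: "s \<in> {0..1}" and i: "i < n" for s i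
  proof -
    have e: "(\<Sum>l<n. A $$ (i, l) * y s l) = exp (F s) * mat_Z n A (?X s) i"
      by (simp add: y_def mat_Z_mv mv_def sum_distrib_left mult_ac)
    show ?thesis
    proof (cases "i = 0")
      case True
      then show ?thesis
        unfolding e using eF[OF s] by (simp add: y_def homog_def mult_ac)
    next
      case False
      then have "((\<lambda>r. exp (F r) * ?X r i) has_vector_derivative
          exp (F s) * (mat_Z n A (?X s) i - ?X s i * mat_Z n A (?X s) 0) + mat_Z n A (?X s) 0 * exp (F s) * ?X s i) (at s within {0..1})"
        using i by (intro has_vector_derivative_mult eF s DX) auto
      then show ?thesis
        unfolding e using False by (simp add: y_def homog_def algebra_simps)
    qed
  qed
  have "y S i = (\<Sum>l<n. mexp A (complex_of_real S) i l * y 0 l)" if "i < n" for i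
  proof (rule linear_ode_unique[OF A_carrier _ S0 that])
    show "((\<lambda>r. y r i) has_vector_derivative (\<Sum>l<n. A $$ (i, l) * y s l)) (at s within {0..S})"
      if "s \<in> {0..S}" "i < n" for s i
      using that S by (intro has_vector_derivative_within_subset[OF ode]) auto
  qed
  then have y: "y S i = mat_Z n (emat n A S) (?X 0) i" if "i < n" for i
    using that by (simp add: y_def F_def mat_Z_mv mv_def emat_def)
  show e: "exp (integral {0..S} (\<lambda>r. mat_Z n A (?X r) 0)) = mat_Z n (emat n A S) (?X 0) 0"
    using y[OF n0] by (simp add: y_def F_def homog_def)
  have "?X S \<in> extensional {1..<n}"
    using curve[OF S] by (cases "\<gamma> S") (auto simp: Nbar_iff)
  moreover have "?X S a = flowX n A (?X 0) S a" if "a \<in> {1..<n}" for a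
    using y[of a] that e denom[OF X0 S0] unfolding F_def[symmetric]
    by (simp add: y_def homog_def flowX_def field_simps)
  ultimately show "?X S = flowX n A (?X 0) S"
    by (intro ext) (auto simp: flowX_def extensional_def)
qed

text \<open>Once X is known from \<open>curve_X\<close>, w solves a linear system with matrix - A^T,
  and the velocities of phi and rho depend on X at most, so two solutions differ by constants
  there.\<close>

lemma flow_unique:
  assumes curve: "\<And>s. s \<in> {0..1} \<Longrightarrow> \<gamma> s \<in> Nbar n \<and> has_velocity n \<gamma> (alpha n c (A, (0\<^sub>v n, 0)) (\<gamma> s)) s {0..1}"
  shows "\<gamma> 1 = flow n c A (\<gamma> 0) 1"
proof -
  have g0: "\<gamma> 0 \<in> Nbar n" and g1: "\<gamma> 1 \<in> Nbar n"
    using curve[of 0] curve[of 1] by auto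
  let ?\<eta> = "flow n c A (\<gamma> 0)"
  have v1: "has_velocity n \<gamma> (alpha n c (A, (0\<^sub>v n, 0)) (\<gamma> s)) s {0..1}" if "s \<in> {0..1}" for s
    using curve that by blast
  have v2: "has_velocity n ?\<eta> (alpha n c (A, (0\<^sub>v n, 0)) (?\<eta> s)) s {0..1}" if "s \<in> {0..1}" for s
    by (rule flow_velocity[OF g0 that])
  have X: "coord_X (\<gamma> s) = coord_X (?\<eta> s)" if "s \<in> {0..1}" for s
    using curve_X(1)[OF curve that] by (simp add: coord_X_flow)
  let ?B = "- transpose_mat A"
  have B: "?B \<in> carrier_mat n n"
    using A_carrier by simp
  have Bs: "(\<Sum>l<n. ?B $$ (k, l) * x l) = - (\<Sum>l<n. A $$ (l, k) * x l)" if "k < n" for k x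
    using that A_carrier by (simp add: sum_negf)
  have "coord_w (\<gamma> 1) k = coord_w (?\<eta> 1) k" if k: "k < n" for k
  proof -
    have "coord_w (\<gamma> 1) k = (\<Sum>l<n. mexp ?B (complex_of_real 1) k l * coord_w (\<gamma> 0) l)"
      by (rule linear_ode_unique[OF B _ _ k]) (use velocity_alpha(2)[OF v1] Bs in auto)
    also have "\<dots> = (\<Sum>l<n. mexp ?B (complex_of_real 1) k l * coord_w (?\<eta> 0) l)"
      by (simp add: flow_zero[OF g0])
    also have "\<dots> = coord_w (?\<eta> 1) k"
      by (rule linear_ode_unique[OF B _ _ k, symmetric]) (use velocity_alpha(2)[OF v2] Bs in auto)
    finally show ?thesis .
  qed
  moreover have "coord_w q \<in> extensional {..<n}" if "q \<in> Nbar n" for q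
    using that by (cases q) (auto simp: Nbar_iff)
  ultimately have w: "coord_w (\<gamma> 1) = coord_w (?\<eta> 1)"
    using g1 flow_Nbar[OF g0, of 1 c] by (intro extensionalityI[of _ "{..<n}"]) auto
  have const: "f 1 - h 1 = f 0 - h 0" if "\<And>s. s \<in> {0..1} \<Longrightarrow> (f has_real_derivative d s) (at s within {0..1})"
    "\<And>s. s \<in> {0..1} \<Longrightarrow> (h has_real_derivative d s) (at s within {0..1})" for f h d :: "real \<Rightarrow> real"
    using constant_on_interval[of 1 "\<lambda>s. f s - h s"]
      has_vector_derivative_diff[OF that[unfolded has_real_derivative_iff_has_vector_derivative]] by simp
  have "coord_phi (\<gamma> 1) - coord_phi (?\<eta> 1) = coord_phi (\<gamma> 0) - coord_phi (?\<eta> 0)"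
  proof (rule const)
    fix s :: real assume s: "s \<in> {0..1}"
    show "((\<lambda>s. coord_phi (\<gamma> s)) has_real_derivative - 2 * c * Im (mat_Z n A (coord_X (\<gamma> s)) 0)) (at s within {0..1})"
      by (rule velocity_alpha(3)[OF v1[OF s]])
    show "((\<lambda>s. coord_phi (?\<eta> s)) has_real_derivative - 2 * c * Im (mat_Z n A (coord_X (\<gamma> s)) 0)) (at s within {0..1})"
      unfolding X[OF s] by (rule velocity_alpha(3)[OF v2[OF s]])
  qed
  moreover have "coord_rho (\<gamma> 1) - coord_rho (?\<eta> 1) = coord_rho (\<gamma> 0) - coord_rho (?\<eta> 0)"
    by (rule const) (auto intro: velocity_alpha(4)[OF v1] velocity_alpha(4)[OF v2])
  ultimately show ?thesis
    using X[of 1] w by (cases "\<gamma> 1"; cases "?\<eta> 1") (auto simp: flow_zero[OF g0])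
qed

lemma time_one_map_flow:
  assumes "time_one_map n (alpha n c (A, (0\<^sub>v n, 0))) \<psi>" "p \<in> Nbar n"
  shows "\<psi> p = flow n c A p 1"
proof -
  obtain \<gamma> where \<gamma>: "\<gamma> 0 = p" "\<gamma> 1 = \<psi> p"
      "\<forall>s\<in>{0..1}. \<gamma> s \<in> Nbar n \<and> has_velocity n \<gamma> (alpha n c (A, (0\<^sub>v n, 0)) (\<gamma> s)) s {0..1}"
    using assms unfolding time_one_map_def by blast
  show ?thesis
    using flow_unique[of \<gamma> c] \<gamma> by simp
qed

text \<open>Forgets how the angle was obtained and keeps that it is some argument of (exp(A) Z)^0:
  this property is stable under composing generators.\<close>

lemma flow_act:
  assumes p: "p \<in> Nbar n"
  obtains \<theta> where "flow n c A p 1 = act n c (mat_exp n A, (0\<^sub>v n, 0)) \<theta> p"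
    and "isarg \<theta> (mat_Z n (mat_exp n A) (coord_X p) 0)"
proof
  let ?\<theta> = "integral {0..1} (\<lambda>r. mat_Z n A (flowX n A (coord_X p) r) 0)"
  show "flow n c A p 1 = act n c (mat_exp n A, (0\<^sub>v n, 0)) (Im ?\<theta>) p"
    by (simp add: flow_def emat_one)
  have "exp ?\<theta> = mat_Z n (mat_exp n A) (coord_X p) 0"
    using curve_X(2)[of "flow n c A p" c 1] flow_Nbar[OF p] flow_velocity[OF p]
    by (simp add: coord_X_flow flow_zero[OF p] emat_one)
  then show "isarg (Im ?\<theta>) (mat_Z n (mat_exp n A) (coord_X p) 0)"
    using isarg_exp[of ?\<theta>] by simp
qed

end

lemma lie_u_minus: "A \<in> lie_u n \<Longrightarrow> - A \<in> lie_u n"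
proof -
  assume A: "A \<in> lie_u n"
  have c: "A \<in> carrier_mat n n"
    using A by (simp add: lie_u_iff)
  have e: "(- A) $$ (i, j) = - (if i = 0 then - 1 else 1) * cnj ((- A) $$ (j, i)) * (if j = 0 then - 1 else 1)"
    if ij: "i < n" "j < n" for i j
  proof -
    have "A $$ (i, j) = - (if i = 0 then - 1 else 1) * cnj (A $$ (j, i)) * (if j = 0 then - 1 else 1)"
      using A ij unfolding lie_u_iff by blast
    from arg_cong[OF this, of uminus] show ?thesis
      using c ij by simp
  qed
  show ?thesis
    unfolding lie_u_iff by (intro conjI allI impI) (use c in simp, rule e)
qed

lemma lie_su_minus: "A \<in> lie_su n \<Longrightarrow> - A \<in> lie_su n"
  using lie_u_minus[of A n] lie_u_carrier[of A n] by (auto simp: lie_su_def sum_negf)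

text \<open>The curve run backwards is an integral curve for - A, and uniqueness identifies it with
  the flow. This supplies the bijectivity that \<open>time_one_map\<close> demands.\<close>

lemma flow_minus:
  assumes n: "1 \<le> n" and A: "A \<in> lie_u n" and p: "p \<in> Nbar n"
  shows "flow n c (- A) (flow n c A p 1) 1 = p"
proof -
  interpret su_flow n A
    using n A by unfold_locales
  interpret m: su_flow n "- A"
    using n lie_u_minus[OF A] by unfold_locales
  define \<gamma> where "\<gamma> s = flow n c A p (1 - s)" for s
  have "\<gamma> s \<in> Nbar n \<and> has_velocity n \<gamma> (alpha n c (- A, (0\<^sub>v n, 0)) (\<gamma> s)) s {0..1}" if s: "s \<in> {0..1}" for s
  proof
    show "\<gamma> s \<in> Nbar n"
      unfolding \<gamma>_def using s by (intro flow_Nbar p) auto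
    have s': "1 - s \<in> {0..1}"
      using s by auto
    have im: "(\<lambda>r. 1 - r) ` {0..1 :: real} = {0..1}"
      by (auto simp: image_iff intro!: bexI[of _ "1 - _"])
    have rev: "((\<lambda>r. f (1 - r)) has_vector_derivative - f') (at s within {0..1})"
      if "(f has_vector_derivative f') (at (1 - s) within {0..1})" for f :: "real \<Rightarrow> 'b :: real_normed_vector" and f'
    proof -
      have "((\<lambda>r. 1 - r) has_vector_derivative - 1) (at s within {0..1})"
        by (auto intro!: derivative_eq_intros)
      from vector_diff_chain_within[OF this, of f f'] that show ?thesis
        by (simp add: im o_def)
    qed
    have neg: "mat_Z n (- A) X i = - mat_Z n A X i" if "i < n" for X i
      using that A_carrier by (simp add: mat_Z_mv mv_def sum_negf)
    note v = flow_velocity[OF p s', of c]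
    show "has_velocity n \<gamma> (alpha n c (- A, (0\<^sub>v n, 0)) (\<gamma> s)) s {0..1}"
      unfolding has_velocity_def m.alpha_simps has_real_derivative_iff_has_vector_derivative
    proof (intro conjI ballI allI impI)
      fix a assume a: "a \<in> {1..<n}"
      show "((\<lambda>r. coord_X (\<gamma> r) a) has_vector_derivative
          mat_Z n (- A) (coord_X (\<gamma> s)) a - coord_X (\<gamma> s) a * mat_Z n (- A) (coord_X (\<gamma> s)) 0) (at s within {0..1})"
        using rev[OF velocity_alpha(1)[OF v a]] a n0 by (simp add: \<gamma>_def neg)
    next
      fix k assume k: "k < n"
      show "((\<lambda>r. coord_w (\<gamma> r) k) has_vector_derivative coord_w (alpha n c (- A, 0\<^sub>v n, 0) (\<gamma> s)) k) (at s within {0..1})"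
        unfolding m.alpha_simps(2)[OF k]
        using rev[OF velocity_alpha(2)[OF v k]] k A_carrier by (simp add: \<gamma>_def sum_negf)
    next
      show "((\<lambda>r. coord_phi (\<gamma> r)) has_vector_derivative - 2 * c * Im (mat_Z n (- A) (coord_X (\<gamma> s)) 0)) (at s within {0..1})"
        using rev[OF velocity_alpha(3)[OF v, unfolded has_real_derivative_iff_has_vector_derivative]] n0
        by (simp add: \<gamma>_def neg)
      show "((\<lambda>r. coord_rho (\<gamma> r)) has_vector_derivative 0) (at s within {0..1})"
        using rev[OF velocity_alpha(4)[OF v, unfolded has_real_derivative_iff_has_vector_derivative]]
        by (simp add: \<gamma>_def)
    qed
  qed
  from m.flow_unique[OF this] show ?thesis
    by (simp add: \<gamma>_def flow_zero[OF p])
qed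

lemma time_one_map_exists:
  assumes n: "1 \<le> n" and A: "A \<in> lie_u n"
  shows "\<exists>\<psi>. time_one_map n (alpha n c (A, (0\<^sub>v n, 0))) \<psi>"
proof -
  interpret su_flow n A
    using n A by unfold_locales
  interpret m: su_flow n "- A"
    using n lie_u_minus[OF A] by unfold_locales
  define \<psi> where "\<psi> = (\<lambda>p\<in>Nbar n. flow n c A p 1)"
  have "bij_betw \<psi> (Nbar n) (Nbar n)"
  proof (rule bij_betwI[where g = "\<lambda>p. flow n c (- A) p 1"])
    fix q assume q: "q \<in> Nbar n"
    have "flow n c (- (- A)) (flow n c (- A) q 1) 1 = q"
      by (rule flow_minus[OF n lie_u_minus[OF A] q])
    then show "\<psi> (flow n c (- A) q 1) = q"
      using m.flow_Nbar[OF q, of 1 c] A_carrier by (simp add: \<psi>_def)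
  qed (auto simp: \<psi>_def flow_Nbar m.flow_Nbar flow_minus[OF n A])
  then have "\<psi> \<in> Bij (Nbar n)"
    by (auto simp: Bij_def \<psi>_def)
  moreover have "\<exists>\<gamma>. \<gamma> 0 = p \<and> \<gamma> 1 = \<psi> p \<and> (\<forall>s\<in>{0..1}. \<gamma> s \<in> Nbar n \<and>
      has_velocity n \<gamma> (alpha n c (A, (0\<^sub>v n, 0)) (\<gamma> s)) s {0..1})" if "p \<in> Nbar n" for p
    using that flow_zero flow_Nbar flow_velocity by (intro exI[of _ "flow n c A p"]) (auto simp: \<psi>_def)
  ultimately show ?thesis
    unfolding time_one_map_def by blast
qed

section \<open>Flows of the Heisenberg algebra\<close>

lemma act_heis:
  assumes "1 \<le> n" "(X, w, \<phi>, \<rho>) \<in> Nbar n"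
  shows "act n c (1\<^sub>m n, (v, t)) 0 (X, w, \<phi>, \<rho>) =
    (X, \<lambda>k\<in>{..<n}. w k + v $ k / 2, \<phi> + omega n v (vec n w) + t, \<rho>)"
proof -
  have "(\<lambda>b\<in>{1..<n}. mv n (1\<^sub>m n) (homog X) b / mv n (1\<^sub>m n) (homog X) 0) = X"
    using assms by (auto simp: Nbar_iff mv_one homog_def fun_eq_iff extensional_def)
  moreover have "vec n (mv n (1\<^sub>m n) w) = vec n w"
    by (intro eq_vecI) (auto simp: mv_one)
  ultimately show ?thesis
    by (auto simp: co_one mat_Z_mv mv_one fun_eq_iff)
qed

lemma alpha_heis:
  assumes "1 \<le> n"
  shows "b < n \<Longrightarrow> coord_X (alpha n c (0\<^sub>m n n, (v, t)) q) b = 0"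
    "k < n \<Longrightarrow> coord_w (alpha n c (0\<^sub>m n n, (v, t)) q) k = v $ k / 2"
    "coord_phi (alpha n c (0\<^sub>m n n, (v, t)) q) = omega n v (vec n (coord_w q)) + t"
    "coord_rho (alpha n c (0\<^sub>m n n, (v, t)) q) = 0"
  using assms by (cases q; auto simp: mat_Z_zero)+

text \<open>Because \<open>omega n v v = 0\<close>, the phi-velocity is constant while w moves in
  the direction of v; the flow lines of the Heisenberg fields are straight.\<close>

lemma omega_line:
  assumes "1 \<le> n" "v \<in> carrier_vec n"
  shows "omega n v (vec n (\<lambda>k. w k + complex_of_real s * v $ k)) = omega n v (vec n w)"
proof -
  have "herm n (($) v) (($) (vec n (\<lambda>k. w k + complex_of_real s * v $ k))) =
      herm n (($) v) (\<lambda>k. vec n w $ k + complex_of_real s * v $ k)"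
    using assms by (intro herm_cong) auto
  also have "\<dots> = herm n (($) v) (($) (vec n w)) + of_real s * herm n (($) v) (($) v)"
    by (simp add: herm_add_right) (simp add: herm_def sum_distrib_left mult_ac)
  finally show ?thesis
    using assms by (simp add: omega_herm Im_herm_self del: vec_carrier)
qed

text \<open>All velocities are constant along a solution, so integration determines its end point,
  and conversely the straight line is a solution. An equivalence is stated because
  \<open>beta_heis\<close> uses uniqueness and \<open>beta_heis_exists\<close> existence.\<close>

lemma time_one_map_heis:
  assumes n: "1 \<le> n" and v: "v \<in> carrier_vec n"
  shows "time_one_map n (alpha n c (0\<^sub>m n n, (v, t))) \<psi> \<longleftrightarrow>
    \<psi> = (\<lambda>p\<in>Nbar n. act n c (1\<^sub>m n, (v, t)) 0 p)"
proof
  assume \<psi>: "time_one_map n (alpha n c (0\<^sub>m n n, (v, t))) \<psi>"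
  have "\<psi> p = act n c (1\<^sub>m n, (v, t)) 0 p" if p: "p \<in> Nbar n" for p
  proof -
    obtain \<gamma> where \<gamma>: "\<gamma> 0 = p" "\<gamma> 1 = \<psi> p"
      "\<And>s. s \<in> {0..1} \<Longrightarrow> \<gamma> s \<in> Nbar n \<and> has_velocity n \<gamma> (alpha n c (0\<^sub>m n n, (v, t)) (\<gamma> s)) s {0..1}"
      using \<psi> p unfolding time_one_map_def by blast
    obtain X w \<phi> \<rho> where p1: "p = (X, w, \<phi>, \<rho>)"
      by (cases p)
    have X: "coord_X (\<gamma> 1) a = X a" if a: "a \<in> {1..<n}" for a
    proof -
      have "coord_X (\<gamma> 1) a = coord_X (\<gamma> 0) a"
        using \<gamma>(3) a unfolding has_velocity_def alpha_heis[OF n]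
        by (intro constant_on_interval[where f = "\<lambda>s. coord_X (\<gamma> s) a"]) (auto simp: alpha_heis[OF n])
      then show ?thesis
        by (simp add: \<gamma> p1)
    qed
    have w: "coord_w (\<gamma> S) k = w k + complex_of_real (S / 2) * v $ k" if k: "k < n" and S: "S \<in> {0..1}" for k S
    proof -
      have "((\<lambda>s. coord_w (\<gamma> s) k - s *\<^sub>R (v $ k / 2)) has_vector_derivative 0) (at s within {0..S})"
        if s: "s \<in> {0..S}" for s
      proof -
        have "s \<in> {0..1}"
          using s S by auto
        then have "((\<lambda>s. coord_w (\<gamma> s) k) has_vector_derivative v $ k / 2) (at s within {0..1})"
          using \<gamma>(3)[of s] k unfolding has_velocity_def by (auto simp: alpha_heis[OF n])
        then have "((\<lambda>s. coord_w (\<gamma> s) k) has_vector_derivative v $ k / 2) (at s within {0..S})"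
          by (rule has_vector_derivative_within_subset) (use S in auto)
        then show ?thesis
          by (auto intro!: derivative_eq_intros)
      qed
      from constant_on_interval[OF this] S have "coord_w (\<gamma> S) k - S *\<^sub>R (v $ k / 2) = coord_w (\<gamma> 0) k"
        by auto
      then show ?thesis
        by (simp add: \<gamma> p1 scaleR_conv_of_real algebra_simps)
    qed
    have "coord_phi (\<gamma> 1) - 1 * (omega n v (vec n w) + t) = coord_phi (\<gamma> 0) - 0 * (omega n v (vec n w) + t)"
    proof (rule constant_on_interval)
      fix s :: real assume s: "s \<in> {0..1}"
      have "vec n (coord_w (\<gamma> s)) = vec n (\<lambda>k. w k + complex_of_real (s / 2) * v $ k)"
        using w[OF _ s] by (intro eq_vecI) auto
      then have "((\<lambda>s. coord_phi (\<gamma> s)) has_real_derivative omega n v (vec n w) + t) (at s within {0..1})"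
        using \<gamma>(3)[OF s] omega_line[OF n v, of w "s / 2"] unfolding has_velocity_def by (simp add: alpha_heis[OF n])
      then show "((\<lambda>s. coord_phi (\<gamma> s) - s * (omega n v (vec n w) + t)) has_vector_derivative 0) (at s within {0..1})"
        unfolding has_real_derivative_iff_has_vector_derivative[symmetric] by (auto intro!: derivative_eq_intros)
    qed auto
    then have phi: "coord_phi (\<gamma> 1) = \<phi> + omega n v (vec n w) + t"
      by (simp add: \<gamma> p1)
    have "coord_rho (\<gamma> 1) = coord_rho (\<gamma> 0)"
      using \<gamma>(3) unfolding has_velocity_def alpha_heis[OF n] has_real_derivative_iff_has_vector_derivative
      by (intro constant_on_interval[where f = "\<lambda>s. coord_rho (\<gamma> s)"]) auto
    then have rho: "coord_rho (\<gamma> 1) = \<rho>"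
      by (simp add: \<gamma> p1)
    have "\<gamma> 1 \<in> Nbar n"
      using \<gamma>(3)[of 1] by simp
    moreover obtain X' w' where g1: "\<gamma> 1 = (X', w', \<phi> + omega n v (vec n w) + t, \<rho>)"
      using phi rho by (cases "\<gamma> 1") auto
    ultimately have "X' = X" "w' = (\<lambda>k\<in>{..<n}. w k + v $ k / 2)"
      using X w[of _ 1] p
      by (auto simp: Nbar_iff p1 intro!: extensionalityI[of X' "{1..<n}"] extensionalityI[of w' "{..<n}"])
    then show ?thesis
      using act_heis[OF n, of X w \<phi> \<rho> c v t] p g1 \<gamma>(2) by (simp add: p1)
  qed
  moreover have "\<psi> \<in> extensional (Nbar n)"
    using \<psi> by (auto simp: time_one_map_def Bij_def)
  ultimately show "\<psi> = (\<lambda>p\<in>Nbar n. act n c (1\<^sub>m n, (v, t)) 0 p)"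
    by (auto simp: fun_eq_iff extensional_def)
next
  assume \<psi>: "\<psi> = (\<lambda>p\<in>Nbar n. act n c (1\<^sub>m n, (v, t)) 0 p)"
  let ?d = "(1\<^sub>m n, (v, t))"
  have d: "?d \<in> carrier (UHeis n)"
    using v by (simp add: UHeis_simps)
  have one: "act n c \<one>\<^bsub>UHeis n\<^esub> 0 p = p" if "p \<in> Nbar n" for p
    using act_one[OF n that, of c 0 0] by (cases p) (simp add: UHeis_simps)
  have "bij_betw \<psi> (Nbar n) (Nbar n)"
    unfolding \<psi> using iinv_UHeis[OF n d]
    by (intro bij_betwI[where g = "act n c (iinv n ?d) 0"])
       (auto simp: act_Nbar[OF n] act_act[OF n] d one)
  then have "\<psi> \<in> Bij (Nbar n)"
    by (auto simp: Bij_def \<psi>)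
  moreover have "\<exists>\<gamma>. \<gamma> 0 = p \<and> \<gamma> 1 = \<psi> p \<and> (\<forall>s\<in>{0..1}. \<gamma> s \<in> Nbar n \<and>
      has_velocity n \<gamma> (alpha n c (0\<^sub>m n n, (v, t)) (\<gamma> s)) s {0..1})" if p: "p \<in> Nbar n" for p
  proof -
    obtain X w \<phi> \<rho> where p1: "p = (X, w, \<phi>, \<rho>)"
      by (cases p)
    define \<gamma> where "\<gamma> s = (X, \<lambda>k\<in>{..<n}. w k + complex_of_real (s / 2) * v $ k,
        \<phi> + s * (omega n v (vec n w) + t), \<rho>)" for s :: real
    have "\<gamma> 0 = p"
      using p by (auto simp: \<gamma>_def p1 Nbar_iff fun_eq_iff extensional_def)
    moreover have "\<gamma> 1 = \<psi> p"
      using p act_heis[OF n, of X w \<phi> \<rho> c v t] by (simp add: \<gamma>_def \<psi> p1)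
    moreover have "\<gamma> s \<in> Nbar n" for s
      using p by (simp add: \<gamma>_def p1 Nbar_iff)
    moreover have "has_velocity n \<gamma> (alpha n c (0\<^sub>m n n, (v, t)) (\<gamma> s)) s {0..1}" for s
    proof -
      have e: "vec n (\<lambda>k\<in>{..<n}. w k + complex_of_real (s / 2) * v $ k) = vec n (\<lambda>k. w k + complex_of_real (s / 2) * v $ k)"
        by (intro eq_vecI) auto
      have "((\<lambda>s. w k + complex_of_real (s / 2) * v $ k) has_vector_derivative v $ k / 2) (at s within {0..1})" for k
        using has_vector_derivative_real_field[of "\<lambda>z. w k + z / 2 * v $ k" "v $ k / 2" s "{0..1}"]
        by (auto intro!: derivative_eq_intros)
      then show ?thesis
        unfolding has_velocity_def alpha_heis[OF n]
        using omega_line[OF n v, of w "s / 2"] n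
        by (auto simp: \<gamma>_def e alpha_heis mat_Z_zero simp del: of_real_divide intro!: derivative_eq_intros)
    qed
    ultimately show ?thesis
      by blast
  qed
  ultimately show "time_one_map n (alpha n c (0\<^sub>m n n, (v, t))) \<psi>"
    unfolding time_one_map_def by blast
qed

section \<open>Generation and transitivity of SU(1,n-1)\<close>

text \<open>A 2 x 2 block in the coordinate plane (i, j): \<open>blk\<close> is completed by zeros,
  for the Lie algebra, and \<open>pl\<close> below by the identity, for the group.\<close>

definition blk :: "nat \<Rightarrow> nat \<Rightarrow> nat \<Rightarrow> complex \<Rightarrow> complex \<Rightarrow> complex \<Rightarrow> complex \<Rightarrow> complex mat" where
  "blk n i j \<alpha> \<beta> \<gamma> \<delta> = mat n n (\<lambda>(k, l).
     if k = i then (if l = i then \<alpha> else if l = j then \<beta> else 0)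
     else if k = j then (if l = i then \<gamma> else if l = j then \<delta> else 0) else 0)"

definition pl :: "nat \<Rightarrow> nat \<Rightarrow> nat \<Rightarrow> complex \<Rightarrow> complex \<Rightarrow> complex \<Rightarrow> complex \<Rightarrow> complex mat" where
  "pl n i j \<alpha> \<beta> \<gamma> \<delta> = mat n n (\<lambda>(k, l).
     if k = i then (if l = i then \<alpha> else if l = j then \<beta> else 0)
     else if k = j then (if l = i then \<gamma> else if l = j then \<delta> else 0) else if k = l then 1 else 0)"

lemma blk_carrier [simp]: "blk n i j \<alpha> \<beta> \<gamma> \<delta> \<in> carrier_mat n n"
  and pl_carrier [simp]: "pl n i j \<alpha> \<beta> \<gamma> \<delta> \<in> carrier_mat n n"
  by (auto simp: blk_def pl_def)

lemma sum_two:
  fixes x :: "nat \<Rightarrow> complex"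
  assumes "i < n" "j < n" "i \<noteq> j"
  shows "(\<Sum>l<n. (if l = i then a else if l = j then b else 0) * x l) = a * x i + b * x j"
proof -
  have "(\<Sum>l<n. (if l = i then a else if l = j then b else 0) * x l) =
      (\<Sum>l<n. (if l = i then a * x i else 0) + (if l = j then b * x j else 0))"
    using assms by (intro sum.cong) auto
  then show ?thesis
    using assms by (simp add: sum.distrib)
qed

lemma sum_one:
  fixes x :: "nat \<Rightarrow> complex"
  assumes "k < n"
  shows "(\<Sum>l<n. (if k = l then 1 else 0) * x l) = x k"
proof -
  have "(\<Sum>l<n. (if k = l then 1 else 0) * x l) = (\<Sum>l<n. if l = k then x k else 0)"
    by (intro sum.cong) auto
  then show ?thesis
    using assms by simp
qed

lemma mv_blk:
  assumes "i < n" "j < n" "i \<noteq> j" "k < n"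
  shows "mv n (blk n i j \<alpha> \<beta> \<gamma> \<delta>) x k =
    (if k = i then \<alpha> * x i + \<beta> * x j else if k = j then \<gamma> * x i + \<delta> * x j else 0)"
  using assms sum_two[OF assms(1-3)] unfolding mv_def by (simp add: blk_def)

lemma mv_pl:
  assumes "i < n" "j < n" "i \<noteq> j" "k < n"
  shows "mv n (pl n i j \<alpha> \<beta> \<gamma> \<delta>) x k =
    (if k = i then \<alpha> * x i + \<beta> * x j else if k = j then \<gamma> * x i + \<delta> * x j else x k)"
  using assms sum_two[OF assms(1-3)] sum_one[OF assms(4)] unfolding mv_def by (simp add: pl_def)

lemma pl_mult_entry:
  assumes "i < n" "j < n" "i \<noteq> j" "k < n" "l < n" "g \<in> carrier_mat n n"
  shows "(pl n i j \<alpha> \<beta> \<gamma> \<delta> * g) $$ (k, l) =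
    (if k = i then \<alpha> * g $$ (i, l) + \<beta> * g $$ (j, l)
     else if k = j then \<gamma> * g $$ (i, l) + \<delta> * g $$ (j, l) else g $$ (k, l))"
  using mv_pl[OF assms(1-4), of \<alpha> \<beta> \<gamma> \<delta> "\<lambda>k. g $$ (k, l)"] mult_mat_entry[OF pl_carrier assms(6,4,5)]
  unfolding mv_def by simp

lemma pl_mult:
  assumes "i < n" "j < n" "i \<noteq> j"
  shows "pl n i j \<alpha> \<beta> \<gamma> \<delta> * pl n i j \<alpha>' \<beta>' \<gamma>' \<delta>' =
    pl n i j (\<alpha> * \<alpha>' + \<beta> * \<gamma>') (\<alpha> * \<beta>' + \<beta> * \<delta>') (\<gamma> * \<alpha>' + \<delta> * \<gamma>') (\<gamma> * \<beta>' + \<delta> * \<delta>')"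
proof (rule eq_matI)
  fix k l assume "k < dim_row (pl n i j (\<alpha> * \<alpha>' + \<beta> * \<gamma>') (\<alpha> * \<beta>' + \<beta> * \<delta>') (\<gamma> * \<alpha>' + \<delta> * \<gamma>') (\<gamma> * \<beta>' + \<delta> * \<delta>'))"
    "l < dim_col (pl n i j (\<alpha> * \<alpha>' + \<beta> * \<gamma>') (\<alpha> * \<beta>' + \<beta> * \<delta>') (\<gamma> * \<alpha>' + \<delta> * \<gamma>') (\<gamma> * \<beta>' + \<delta> * \<delta>'))"
  then have "k < n" "l < n"
    by (auto simp: pl_def)
  then show "(pl n i j \<alpha> \<beta> \<gamma> \<delta> * pl n i j \<alpha>' \<beta>' \<gamma>' \<delta>') $$ (k, l) =
      pl n i j (\<alpha> * \<alpha>' + \<beta> * \<gamma>') (\<alpha> * \<beta>' + \<beta> * \<delta>') (\<gamma> * \<alpha>' + \<delta> * \<gamma>') (\<gamma> * \<beta>' + \<delta> * \<delta>') $$ (k, l)"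
    unfolding pl_mult_entry[OF assms \<open>k < n\<close> \<open>l < n\<close> pl_carrier] using assms by (auto simp: pl_def)
qed (auto simp: pl_def)

lemma pl_one: "pl n i j 1 0 0 1 = 1\<^sub>m n"
  by (rule eq_matI) (auto simp: pl_def)

lemma pl_swap: "i \<noteq> j \<Longrightarrow> pl n i j \<alpha> \<beta> \<gamma> \<delta> = pl n j i \<delta> \<gamma> \<beta> \<alpha>"
  by (rule eq_matI) (auto simp: pl_def)

lemma pl_eqI:
  "\<alpha> = \<alpha>' \<Longrightarrow> \<beta> = \<beta>' \<Longrightarrow> \<gamma> = \<gamma>' \<Longrightarrow> \<delta> = \<delta>' \<Longrightarrow> pl n i j \<alpha> \<beta> \<gamma> \<delta> = pl n i j \<alpha>' \<beta>' \<gamma>' \<delta>'"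
  by simp

text \<open>\<open>SL\<^sub>2\<close> is generated by shears.\<close>

lemma pl_shear_induct:
  assumes ij: "i < n" "j < n" "i \<noteq> j" and det: "\<alpha> * \<delta> - \<beta> * \<gamma> = 1"
    and shear: "\<And>i j a. i < n \<Longrightarrow> j < n \<Longrightarrow> i \<noteq> j \<Longrightarrow> P (pl n i j 1 a 0 1)"
    and mult: "\<And>M N. M \<in> carrier_mat n n \<Longrightarrow> N \<in> carrier_mat n n \<Longrightarrow> P M \<Longrightarrow> P N \<Longrightarrow> P (M * N)"
  shows "P (pl n i j \<alpha> \<beta> \<gamma> \<delta>)"
proof -
  have up: "P (pl n i j 1 a 0 1)" and low: "P (pl n i j 1 0 a 1)" for a
    using shear[of i j a] shear[of j i a] ij pl_swap[of i j n 1 0 a 1] by auto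
  have nz: "P (pl n i j \<alpha> \<beta> \<gamma> \<delta>)" if \<beta>: "\<beta> \<noteq> 0" and det: "\<alpha> * \<delta> - \<beta> * \<gamma> = 1" for \<alpha> \<beta> \<gamma> \<delta>
  proof -
    \<comment> \<open>Three shears reproduce the first row and one more entry; the last entry is
      then forced by the determinant.\<close>
    have "pl n i j 1 0 ((\<delta> - 1) / \<beta>) 1 * (pl n i j 1 \<beta> 0 1 * pl n i j 1 0 ((\<alpha> - 1) / \<beta>) 1) = pl n i j \<alpha> \<beta> \<gamma> \<delta>"
      unfolding pl_mult[OF ij] by (rule pl_eqI) (use det \<beta> in \<open>simp_all add: field_simps\<close>)
    then show ?thesis
      using mult[OF pl_carrier _ low mult[OF pl_carrier pl_carrier up low]] by (metis mult_carrier_mat pl_carrier)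
  qed
  show ?thesis
  proof (cases "\<beta> = 0")
    case True
    then have "\<alpha> \<noteq> 0"
      using det by auto
    \<comment> \<open>If the upper right entry is 0, a shear on the right copies the nonzero entry
      \<open>\<alpha>\<close> into it; the shear by -1 undoes this afterwards.\<close>
    then have "P (pl n i j \<alpha> \<alpha> \<gamma> (\<gamma> + \<delta>))"
      using det True by (intro nz) (auto simp: algebra_simps)
    from mult[OF pl_carrier pl_carrier this up[of "- 1"]] show ?thesis
      unfolding pl_mult[OF ij] by (simp add: True)
  qed (use nz det in blast)
qed

lemma det_pl:
  assumes ij: "i < n" "j < n" "i \<noteq> j" and det: "\<alpha> * \<delta> - \<beta> * \<gamma> = 1"
  shows "det (pl n i j \<alpha> \<beta> \<gamma> \<delta>) = 1"
proof (rule pl_shear_induct[OF assms])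
  fix i j a assume "i < n" "j < n" "i \<noteq> (j :: nat)"
  moreover have "pl n i j 1 a 0 1 = addrow_mat n a i j"
    using \<open>i \<noteq> j\<close> by (intro eq_matI) (auto simp: pl_def)
  ultimately show "det (pl n i j 1 a 0 1) = 1"
    by (simp add: det_addrow_mat)
qed (simp add: det_mult)

lemma blk_lie_su:
  assumes ij: "i < n" "j < n" "i \<noteq> j" and "\<alpha> = - cnj \<alpha>" "\<beta> = - sg i * sg j * cnj \<gamma>"
  shows "blk n i j \<alpha> \<beta> \<gamma> (- \<alpha>) \<in> lie_su n"
proof -
  have g: "\<gamma> = - sg i * sg j * cnj \<beta>"
    by (subst assms(5)) (auto simp: sg_def)
  have a: "- cnj \<alpha> = \<alpha>"
    using assms(4) by simp
  have e1: "blk n i j \<alpha> \<beta> \<gamma> (- \<alpha>) $$ (k, l) = - sg k * cnj (blk n i j \<alpha> \<beta> \<gamma> (- \<alpha>) $$ (l, k)) * sg l"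
    if kl: "k < n" "l < n" for k l
  proof (cases "k \<in> {i, j} \<and> l \<in> {i, j}")
    case False
    then show ?thesis
      using kl ij by (auto simp: blk_def)
  next
    case True
    then consider "k = i" "l = i" | "k = i" "l = j" | "k = j" "l = i" | "k = j" "l = j"
      by auto
    then show ?thesis
    proof cases
      case 2
      then show ?thesis
        using kl ij assms(5) by (simp add: blk_def)
    next
      case 3
      then show ?thesis
        using kl ij g by (simp add: blk_def mult_ac)
    qed (use kl ij a in \<open>auto simp: blk_def mult_ac\<close>)
  qed
  have e2: "(\<Sum>k<n. blk n i j \<alpha> \<beta> \<gamma> (- \<alpha>) $$ (k, k)) = 0"
  proof -
    have "(\<Sum>k<n. blk n i j \<alpha> \<beta> \<gamma> (- \<alpha>) $$ (k, k)) = (\<Sum>k<n. (if k = i then \<alpha> else if k = j then - \<alpha> else 0) * 1)"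
      using ij by (intro sum.cong) (auto simp: blk_def)
    then show ?thesis
      unfolding sum_two[OF ij] by simp
  qed
  show ?thesis
    unfolding lie_su_def lie_u_iff sg_def[symmetric] by (intro CollectI conjI allI impI blk_carrier e1 e2)
qed

text \<open>The square of the traceless block B with entries p, q, r, -p is epsilon times the
  identity of the plane, so exp(s R B) = C(s) + S(s) B with C' = R epsilon S and S' = R C. Below,
  epsilon = -1 gives rotations and epsilon = 1 gives boosts.\<close>

lemma mat_exp_blk:
  fixes C S :: "real \<Rightarrow> real" and p q r :: complex
  assumes ij: "i < n" "j < n" "i \<noteq> j" and sq: "p\<^sup>2 + q * r = complex_of_real \<epsilon>"
    and C: "\<And>s. (C has_real_derivative R * \<epsilon> * S s) (at s)"
    and S: "\<And>s. (S has_real_derivative R * C s) (at s)"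
    and init: "C 0 = 1" "S 0 = 0"
  shows "mat_exp n (blk n i j (R * p) (R * q) (R * r) (- (R * p))) = pl n i j (C 1 + S 1 * p) (S 1 * q) (S 1 * r) (C 1 - S 1 * p)"
proof (rule mat_exp_unique[where M = "\<lambda>s. pl n i j (C s + S s * p) (S s * q) (S s * r) (C s - S s * p)"])
  fix s :: real and k l assume kl: "k < n" "l < n"
  let ?M = "\<lambda>s. pl n i j (C s + S s * p) (S s * q) (S s * r) (C s - S s * p)"
  let ?A = "blk n i j (R * p) (R * q) (R * r) (- (R * p))"
  have pq: "p * p + q * r = \<epsilon>"
    using sq by (simp add: power2_eq_square)
  have Cd: "((\<lambda>s. complex_of_real (C s)) has_vector_derivative complex_of_real (R * \<epsilon> * S s)) (at s within {0..1})"
    using has_field_derivative_at_within[OF C] unfolding has_real_derivative_iff_has_vector_derivative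
    by (rule bounded_linear.has_vector_derivative[OF bounded_linear_of_real])
  have Sd: "((\<lambda>s. complex_of_real (S s)) has_vector_derivative complex_of_real (R * C s)) (at s within {0..1})"
    using has_field_derivative_at_within[OF S] unfolding has_real_derivative_iff_has_vector_derivative
    by (rule bounded_linear.has_vector_derivative[OF bounded_linear_of_real])
  have Sm: "((\<lambda>s. complex_of_real (S s) * z) has_vector_derivative complex_of_real (R * C s) * z) (at s within {0..1})" for z
    by (rule has_vector_derivative_mult_left[OF Sd])
  have e: "(\<Sum>m<n. ?A $$ (k, m) * ?M s $$ (m, l)) =
      (if k = i then R * p * ?M s $$ (i, l) + R * q * ?M s $$ (j, l)
       else if k = j then R * r * ?M s $$ (i, l) + - (R * p) * ?M s $$ (j, l) else 0)"
    using mv_blk[OF ij kl(1), of "R * p" "R * q" "R * r" "- (R * p)" "\<lambda>m. ?M s $$ (m, l)"] by (simp add: mv_def)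
  have ed: "complex_of_real (R * \<epsilon> * S s) = R * S s * (p * p + q * r)"
    by (simp add: pq)
  consider "k \<notin> {i, j}" | "k = i" "l = i" | "k = i" "l = j" | "k = j" "l = i" | "k = j" "l = j" | "k \<in> {i, j}" "l \<notin> {i, j}"
    by blast
  then show "((\<lambda>s. ?M s $$ (k, l)) has_vector_derivative (\<Sum>m<n. ?A $$ (k, m) * ?M s $$ (m, l))) (at s within {0..1})"
  proof cases
    case 2
    have "complex_of_real (R * \<epsilon> * S s) + complex_of_real (R * C s) * p = (\<Sum>m<n. ?A $$ (k, m) * ?M s $$ (m, l))"
      unfolding e ed using 2 ij by (simp add: pl_def algebra_simps)
    then show ?thesis
      using has_vector_derivative_add[OF Cd Sm[of p]] 2 ij by (simp add: pl_def)
  next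
    case 3
    have "complex_of_real (R * C s) * q = (\<Sum>m<n. ?A $$ (k, m) * ?M s $$ (m, l))"
      unfolding e using 3 ij by (simp add: pl_def algebra_simps)
    then show ?thesis
      using Sm[of q] 3 ij by (simp add: pl_def)
  next
    case 4
    have "complex_of_real (R * C s) * r = (\<Sum>m<n. ?A $$ (k, m) * ?M s $$ (m, l))"
      unfolding e using 4 ij by (simp add: pl_def algebra_simps)
    then show ?thesis
      using Sm[of r] 4 ij by (simp add: pl_def)
  next
    case 5
    have "complex_of_real (R * \<epsilon> * S s) - complex_of_real (R * C s) * p = (\<Sum>m<n. ?A $$ (k, m) * ?M s $$ (m, l))"
      unfolding e ed using 5 ij by (simp add: pl_def algebra_simps)
    then show ?thesis
      using has_vector_derivative_diff[OF Cd Sm[of p]] 5 ij by (simp add: pl_def)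
  next
    case 1
    then show ?thesis
      unfolding e using kl by (auto simp: pl_def)
  next
    case 6
    then show ?thesis
      unfolding e using kl ij by (auto simp: pl_def)
  qed
qed (auto simp: pl_def init ij)

text \<open>Two descriptions of one matrix are kept together: as the exponential of an element of
  \<open>lie_su\<close> it lifts through \<open>beta_graph\<close>, and as a plane block of
  determinant 1 it is a product of shears and preserves Lebesgue measure.\<close>

definition plane_exp :: "nat \<Rightarrow> complex mat \<Rightarrow> bool" where
  "plane_exp n M \<longleftrightarrow> (\<exists>A\<in>lie_su n. \<exists>i j \<alpha> \<beta> \<gamma> \<delta>. i < n \<and> j < n \<and> i \<noteq> j \<and> \<alpha> * \<delta> - \<beta> * \<gamma> = 1 \<and>
     M = mat_exp n A \<and> M = pl n i j \<alpha> \<beta> \<gamma> \<delta>)"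

lemma plane_expI:
  assumes ij: "i < n" "j < n" "i \<noteq> j" and sq: "p\<^sup>2 + q * r = complex_of_real \<epsilon>"
    and p: "p = - cnj p" "q = - sg i * sg j * cnj r"
    and C: "\<And>s. (C has_real_derivative R * \<epsilon> * S s) (at s)"
    and S: "\<And>s. (S has_real_derivative R * C s) (at s)"
    and init: "C 0 = 1" "S 0 = 0" and one: "(C 1)\<^sup>2 - \<epsilon> * (S 1)\<^sup>2 = (1 :: real)"
  shows "plane_exp n (pl n i j (C 1 + S 1 * p) (S 1 * q) (S 1 * r) (C 1 - S 1 * p))"
proof -
  have "(C 1 + S 1 * p) * (C 1 - S 1 * p) - S 1 * q * (S 1 * r) = (C 1)\<^sup>2 - (p\<^sup>2 + q * r) * (S 1)\<^sup>2"
    by (simp add: algebra_simps power2_eq_square)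
  also have "\<dots> = complex_of_real ((C 1)\<^sup>2 - \<epsilon> * (S 1)\<^sup>2)"
    by (simp add: sq)
  finally have "(C 1 + S 1 * p) * (C 1 - S 1 * p) - S 1 * q * (S 1 * r) = 1"
    by (simp add: one)
  moreover have "blk n i j (R * p) (R * q) (R * r) (- (R * p)) \<in> lie_su n"
    using p by (intro blk_lie_su[OF ij]) (auto, metis mult_minus_right)
  ultimately show ?thesis
    unfolding plane_exp_def using mat_exp_blk[OF ij sq C S init] ij by metis
qed

lemma rotation_exp:
  fixes R :: real and p q r :: complex
  assumes "i < n" "j < n" "i \<noteq> j" "p\<^sup>2 + q * r = - 1" "p = - cnj p" "q = - sg i * sg j * cnj r"
  shows "plane_exp n (pl n i j (cos R + sin R * p) (sin R * q) (sin R * r) (cos R - sin R * p))"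
proof -
  have "((\<lambda>s. cos (R * s)) has_real_derivative R * (- 1) * sin (R * s)) (at s)"
    "((\<lambda>s. sin (R * s)) has_real_derivative R * cos (R * s)) (at s)" for s
    by (auto intro!: derivative_eq_intros)
  from plane_expI[OF assms(1-3) _ assms(5,6) this] show ?thesis
    using assms(4) by simp
qed

lemma boost_exp:
  fixes R :: real and q r :: complex
  assumes "i < n" "j < n" "i \<noteq> j" "q * r = 1" "q = - sg i * sg j * cnj r"
  shows "plane_exp n (pl n i j (cosh R) (sinh R * q) (sinh R * r) (cosh R))"
proof -
  have "((\<lambda>s. cosh (R * s)) has_real_derivative R * 1 * sinh (R * s)) (at s)"
    "((\<lambda>s. sinh (R * s)) has_real_derivative R * cosh (R * s)) (at s)" for s
    by (auto intro!: derivative_eq_intros)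
  from plane_expI[OF assms(1-3) _ _ assms(5) this, of 0] show ?thesis
    using assms(4) by (simp add: cosh_square_eq)
qed

text \<open>Aligns phases first, so that the rotation or boost that follows has to match moduli
  only. The form without quotients covers x = 0 and y = 0.\<close>

lemma phase_quotient:
  fixes x y :: complex
  obtains \<zeta> where "cmod \<zeta> = 1" "cnj \<zeta> * x * cmod y = y * cmod x"
proof (cases "x = 0 \<or> y = 0")
  case True
  then show ?thesis
    using that[of 1] by auto
next
  case False
  define \<zeta> where "\<zeta> = cnj ((y / cmod y) / (x / cmod x))"
  show ?thesis
    by (rule that[of \<zeta>]) (use False in \<open>auto simp: \<zeta>_def norm_divide norm_mult\<close>)
qed

text \<open>For i > 0 this is a Givens rotation. In a plane that contains the negative direction 0
  it is a boost with tanh R = |y| / |x|, whence the condition |y| < |x|.\<close>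

lemma plane_exp_zero:
  assumes ij: "i < n" "j < n" "i \<noteq> j" "j \<noteq> 0" and xy: "i = 0 \<Longrightarrow> cmod y < cmod x"
  obtains \<alpha> \<beta> \<gamma> \<delta> where "plane_exp n (pl n i j \<alpha> \<beta> \<gamma> \<delta>)" "\<gamma> * x + \<delta> * y = 0"
proof (cases "i = 0")
  case False
  obtain \<zeta> where \<zeta>: "cmod \<zeta> = 1" "cnj \<zeta> * x * cmod y = y * cmod x"
    by (rule phase_quotient)
  have zz: "\<zeta> * cnj \<zeta> = 1"
    using \<zeta>(1) complex_norm_square[of \<zeta>] by simp
  have sij: "sg i = 1" "sg j = 1"
    using False ij by (auto simp: sg_def)
  have rot: "plane_exp n (pl n i j (cos R) (sin R * \<zeta>) (sin R * - cnj \<zeta>) (cos R))" for R :: real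
    using rotation_exp[OF ij(1-3), of 0 \<zeta> "- cnj \<zeta>" R] zz sij by simp
  define r where "r = sqrt ((cmod x)\<^sup>2 + (cmod y)\<^sup>2)"
  show ?thesis
  proof (cases "r = 0")
    case True
    then have "x = 0" "y = 0"
      by (auto simp: r_def sum_power2_eq_zero_iff)
    then show ?thesis
      using that[OF rot[of 0]] by simp
  next
    case False
    have r2: "r\<^sup>2 = (cmod x)\<^sup>2 + (cmod y)\<^sup>2"
      by (simp add: r_def)
    have "(cmod x / r)\<^sup>2 + (cmod y / r)\<^sup>2 = 1"
      using False by (simp add: power_divide flip: r2 add_divide_distrib)
    then obtain R where R: "cmod x / r = cos R" "cmod y / r = sin R"
      using sincos_total_2pi by metis
    have "sin R * - cnj \<zeta> * x + cos R * y = (- (cnj \<zeta> * x * cmod y) + y * cmod x) / r"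
      unfolding R[symmetric] using False by (simp add: field_simps)
    then show ?thesis
      using that[OF rot[of R]] \<zeta>(2) by simp
  qed
next
  case True
  obtain \<zeta> where \<zeta>: "cmod \<zeta> = 1" "cnj \<zeta> * x * cmod (- y) = - y * cmod x"
    by (rule phase_quotient)
  have zz: "\<zeta> * cnj \<zeta> = 1"
    using \<zeta>(1) complex_norm_square[of \<zeta>] by simp
  have sij: "sg i = - 1" "sg j = 1"
    using True ij by (auto simp: sg_def)
  define r where "r = sqrt ((cmod x)\<^sup>2 - (cmod y)\<^sup>2)"
  have pos: "(cmod x)\<^sup>2 - (cmod y)\<^sup>2 > 0"
    using xy[OF True] by (simp add: power_strict_mono)
  have r: "r > 0" "r\<^sup>2 = (cmod x)\<^sup>2 - (cmod y)\<^sup>2"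
    unfolding r_def using real_sqrt_gt_zero[OF pos] real_sqrt_pow2[OF less_imp_le[OF pos]] by blast+
  define R where "R = arsinh (cmod y / r)"
  have S: "sinh R = cmod y / r"
    by (simp add: R_def)
  have "(cosh R)\<^sup>2 = (cmod x / r)\<^sup>2"
    unfolding cosh_square_eq S using r by (simp add: field_simps)
  then have C: "cosh R = cmod x / r"
    by (rule power2_eq_imp_eq) (use r in auto)
  have "sinh R * cnj \<zeta> * x + cosh R * y = (cnj \<zeta> * x * cmod (- y) + y * cmod x) / r"
    unfolding S C using r by (simp add: field_simps)
  then show ?thesis
    using that[OF boost_exp[OF ij(1-3), of \<zeta> "cnj \<zeta>" R]] \<zeta>(2) zz sij by simp
qed

section \<open>Elimination: SU(1,n-1) consists of products of plane exponentials\<close>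

inductive_set SUgen :: "nat \<Rightarrow> complex mat set" for n where
  one: "1\<^sub>m n \<in> SUgen n"
| step: "plane_exp n M \<Longrightarrow> g \<in> SUgen n \<Longrightarrow> M * g \<in> SUgen n"

lemma plane_exp_SU: "plane_exp n M \<Longrightarrow> M \<in> carrier (SU_group n)"
proof -
  assume "plane_exp n M"
  then obtain A i j \<alpha> \<beta> \<gamma> \<delta> where A: "A \<in> lie_su n" and ij: "i < n" "j < n" "i \<noteq> j" and det: "\<alpha> * \<delta> - \<beta> * \<gamma> = 1"
    and M: "M = mat_exp n A" "M = pl n i j \<alpha> \<beta> \<gamma> \<delta>"
    unfolding plane_exp_def by blast
  have "M \<in> carrier (U_group n)"
    unfolding M(1) using A by (intro mat_exp_U) (simp add: lie_su_def)
  then show ?thesis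
    using det_pl[OF ij det] by (simp add: SU_iff flip: M(2))
qed

lemma SUgen_SU: "g \<in> SUgen n \<Longrightarrow> g \<in> carrier (SU_group n)"
  by (induction rule: SUgen.induct) (auto intro: SU_mult plane_exp_SU)

lemma SUgen_carrier: "g \<in> SUgen n \<Longrightarrow> g \<in> carrier_mat n n"
  using SUgen_SU SU_U U_carrier_mat by blast

lemma SUgen_mult: "g \<in> SUgen n \<Longrightarrow> h \<in> SUgen n \<Longrightarrow> g * h \<in> SUgen n"
proof (induction rule: SUgen.induct)
  case one
  then show ?case
    using SUgen_carrier[of h n] by simp
next
  case (step M g)
  then show ?case
    using SUgen.step[of n M "g * h"] assoc_mult_mat[of M n n g n h n] SUgen_carrier
      U_carrier_mat[OF SU_U[OF plane_exp_SU]] by metis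
qed

lemma plane_exp_SUgen: "plane_exp n M \<Longrightarrow> M \<in> SUgen n"
  using SUgen.step[OF _ SUgen.one, of n M] U_carrier_mat[OF SU_U[OF plane_exp_SU[of n M]]] by simp

text \<open>exp(- A) is a left inverse of M and the adjugate block is a right inverse, so they
  coincide; hence exp(- A) is a plane block too.\<close>

lemma plane_exp_inverse:
  assumes "plane_exp n M"
  shows "\<exists>N. plane_exp n N \<and> N * M = 1\<^sub>m n"
proof -
  obtain A i j \<alpha> \<beta> \<gamma> \<delta> where A: "A \<in> lie_su n" and ij: "i < n" "j < n" "i \<noteq> j" and det: "\<alpha> * \<delta> - \<beta> * \<gamma> = 1"
    and M: "M = mat_exp n A" "M = pl n i j \<alpha> \<beta> \<gamma> \<delta>"
    using assms unfolding plane_exp_def by blast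
  have Ac: "A \<in> carrier_mat n n"
    using A by (simp add: lie_su_def lie_u_iff)
  have pw: "((- A) ^\<^sub>m k) $$ (i, j) = (- 1) ^ k * (A ^\<^sub>m k) $$ (i, j)" if "i < n" "j < n" for i j k
    using that
  proof (induction k arbitrary: i j)
    case 0
    then show ?case
      using Ac by simp
  next
    case (Suc k)
    have mA: "- A \<in> carrier_mat n n"
      using Ac by simp
    show ?case
      unfolding pow_mat_entry_Suc(1)[OF mA Suc.prems] pow_mat_entry_Suc(1)[OF Ac Suc.prems] sum_distrib_left
      using Suc Ac by (intro sum.cong) auto
  qed
  have me: "mexp (- A) 1 i j = mexp A (- 1) i j" if "i < n" "j < n" for i j
    using pw[OF that] by (simp add: mexp_def mult.commute)
  have "mat_exp n (- A) * mat_exp n A = 1\<^sub>m n"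
  proof (rule eq_matI)
    fix i j assume "i < dim_row (1\<^sub>m n :: complex mat)" "j < dim_col (1\<^sub>m n :: complex mat)"
    then have ij: "i < n" "j < n"
      by auto
    have "(mat_exp n (- A) * mat_exp n A) $$ (i, j) = (\<Sum>l<n. mexp A (- 1) i l * mexp A 1 l j)"
      unfolding mult_mat_entry[OF mat_exp_carrier mat_exp_carrier ij] using ij
      by (intro sum.cong) (auto simp: mat_exp_entry me)
    then show "(mat_exp n (- A) * mat_exp n A) $$ (i, j) = 1\<^sub>m n $$ (i, j)"
      using mexp_minus[OF Ac _ ij, of 1] ij by simp
  qed (auto simp: mat_exp_def)
  moreover have "pl n i j \<delta> (- \<beta>) (- \<gamma>) \<alpha> * M = 1\<^sub>m n"
    unfolding M(2) pl_mult[OF ij] pl_one[of n i j, symmetric]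
    by (rule pl_eqI) (use det in \<open>simp_all add: algebra_simps\<close>)
  moreover have Mc: "M \<in> carrier_mat n n"
    by (simp add: M(2))
  ultimately have MN: "M * pl n i j \<delta> (- \<beta>) (- \<gamma>) \<alpha> = 1\<^sub>m n" and EM: "mat_exp n (- A) * M = 1\<^sub>m n"
    using mat_mult_left_right_inverse[OF pl_carrier Mc] M(1) by auto
  have "mat_exp n (- A) = mat_exp n (- A) * (M * pl n i j \<delta> (- \<beta>) (- \<gamma>) \<alpha>)"
    unfolding MN by (simp add: right_mult_one_mat[OF mat_exp_carrier])
  also have "\<dots> = pl n i j \<delta> (- \<beta>) (- \<gamma>) \<alpha>"
    unfolding assoc_mult_mat[OF mat_exp_carrier Mc pl_carrier, symmetric] EM
    by (rule left_mult_one_mat[OF pl_carrier])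
  finally have "mat_exp n (- A) = pl n i j \<delta> (- \<beta>) (- \<gamma>) \<alpha>" .
  then have "plane_exp n (mat_exp n (- A))"
    unfolding plane_exp_def using lie_su_minus[OF A] ij det
    by (intro bexI[of _ "- A"] exI[of _ i] exI[of _ j] exI[of _ \<delta>] exI[of _ "- \<beta>"] exI[of _ "- \<gamma>"] exI[of _ \<alpha>])
       (auto simp: mult.commute)
  then show ?thesis
    using \<open>mat_exp n (- A) * mat_exp n A = 1\<^sub>m n\<close> M(1) by blast
qed

lemma SUgen_inverse: "g \<in> SUgen n \<Longrightarrow> \<exists>h\<in>SUgen n. h * g = 1\<^sub>m n"
proof (induction rule: SUgen.induct)
  case one
  then show ?case
    using SUgen.one by force
next
  case (step M g)
  obtain h where h: "h \<in> SUgen n" "h * g = 1\<^sub>m n"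
    using step by blast
  obtain N where N: "plane_exp n N" "N * M = 1\<^sub>m n"
    using plane_exp_inverse step by blast
  have c: "h \<in> carrier_mat n n" "N \<in> carrier_mat n n" "M \<in> carrier_mat n n" "g \<in> carrier_mat n n"
    using h N step SUgen_carrier U_carrier_mat[OF SU_U[OF plane_exp_SU]] by auto
  have "(h * N) * (M * g) = h * ((N * M) * g)"
    using c by (simp add: assoc_mult_mat[of _ n n _ n _ n])
  also have "\<dots> = 1\<^sub>m n"
    using h N c by simp
  finally show ?case
    using SUgen_mult[OF h(1) plane_exp_SUgen[OF N(1)]] by blast
qed

lemma SUgen_cancel:
  assumes "p \<in> SUgen n" "p * g \<in> SUgen n" "g \<in> carrier_mat n n"
  shows "g \<in> SUgen n"
proof -
  obtain h where h: "h \<in> SUgen n" "h * p = 1\<^sub>m n"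
    using SUgen_inverse assms by blast
  have "h * (p * g) = g"
    using assoc_mult_mat[of h n n p n g n] h assms SUgen_carrier by simp
  then show ?thesis
    using SUgen_mult[OF h(1) assms(2)] by simp
qed

text \<open>Elimination of the entries after b, one index m at a time, leaving the rows and columns
  before b alone. For b = 0 the matrices used so far preserve the form, so |y_m| < |y_0| stays true
  and a boost is available at every stage.\<close>

lemma zero_below:
  fixes x :: "nat \<Rightarrow> complex"
  assumes b: "b < n" and x: "b = 0 \<Longrightarrow> (\<Sum>a\<in>{1..<n}. (cmod (x a))\<^sup>2) < (cmod (x 0))\<^sup>2"
  shows "\<exists>p\<in>SUgen n. (\<forall>k<n. \<forall>l<n. k < b \<or> l < b \<longrightarrow> p $$ (k, l) = (if k = l then 1 else 0)) \<and>
    (\<forall>l\<in>{b<..<n}. mv n p x l = 0)"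
proof -
  have "\<exists>p\<in>SUgen n. (\<forall>k<n. \<forall>l<n. k < b \<or> l < b \<longrightarrow> p $$ (k, l) = (if k = l then 1 else 0)) \<and>
      (\<forall>l\<in>{b<..<m}. mv n p x l = 0)" if "b < m" "m \<le> n" for m
    using that
  proof (induction m)
    case (Suc m)
    show ?case
    proof (cases "b < m")
      case False
      then have "{b<..<Suc m} = {}"
        using Suc.prems by auto
      then show ?thesis
        by (intro bexI[OF _ SUgen.one]) auto
    next
      case True
      obtain p where p: "p \<in> SUgen n"
        and bl': "\<forall>k<n. \<forall>l<n. k < b \<or> l < b \<longrightarrow> p $$ (k, l) = (if k = l then 1 else 0)"
        and z': "\<forall>l\<in>{b<..<m}. mv n p x l = 0"
        using Suc.IH[OF True Suc_leD[OF Suc.prems(2)]] by blast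
      note bl = bl'[rule_format] and z = z'[rule_format]
      define y where "y = mv n p x"
      have pU: "p \<in> carrier (U_group n)"
        by (rule SU_U[OF SUgen_SU[OF p]])
      have m: "m < n" "b \<noteq> m" "m \<noteq> 0"
        using Suc.prems True by auto
      have "cmod (y m) < cmod (y b)" if "b = 0"
      proof -
        have n: "1 \<le> n"
          using m by simp
        have "herm n y y = herm n x x"
          unfolding y_def by (rule herm_mv[OF pU])
        then have "(\<Sum>a\<in>{1..<n}. (cmod (y a))\<^sup>2) < (cmod (y 0))\<^sup>2"
          using x[OF that] unfolding herm_self[OF n] of_real_eq_iff by simp
        moreover have "(cmod (y m))\<^sup>2 \<le> (\<Sum>a\<in>{1..<n}. (cmod (y a))\<^sup>2)"
          using m by (intro member_le_sum[where f = "\<lambda>a. (cmod (y a))\<^sup>2"]) auto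
        ultimately have "(cmod (y m))\<^sup>2 < (cmod (y b))\<^sup>2"
          using that by simp
        then show ?thesis
          by (rule power2_less_imp_less) simp
      qed
      then obtain \<alpha> \<beta> \<gamma> \<delta> where M: "plane_exp n (pl n b m \<alpha> \<beta> \<gamma> \<delta>)" "\<gamma> * y b + \<delta> * y m = 0"
        using plane_exp_zero[OF b m(1,2,3)] by metis
      let ?M = "pl n b m \<alpha> \<beta> \<gamma> \<delta>"
      have "mv n (?M * p) x l = 0" if "l \<in> {b<..<Suc m}" for l
      proof -
        have "mv n (?M * p) x l = mv n ?M y l"
          unfolding y_def using that m by (intro mv_mult SUgen_carrier[OF p]) auto
        also have "\<dots> = (if l = m then \<gamma> * y b + \<delta> * y m else y l)"
          using that m by (subst mv_pl[OF b m(1,2)]) auto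
        finally show ?thesis
          using M(2) z[of l] that by (auto simp: y_def)
      qed
      moreover have "(?M * p) $$ (k, l) = (if k = l then 1 else 0)" if "k < n" "l < n" "k < b \<or> l < b" for k l
        unfolding pl_mult_entry[OF b m(1,2) that(1,2) SUgen_carrier[OF p]]
        using bl[of k l] bl[of b l] bl[of m l] that b m True by auto
      ultimately show ?thesis
        using SUgen.step[OF M(1) p] by blast
    qed
  qed simp
  from this[OF b order.refl] show ?thesis .
qed

text \<open>Columns are reduced to unit vectors one after the other. Once column b is a multiple of
  the unit vector, its orthogonality to the other columns for the form clears row b as well. At the
  end a single diagonal entry is left, and it equals the determinant 1.\<close>

theorem SU_SUgen:
  assumes n: "1 \<le> n" and g: "g \<in> carrier (SU_group n)"
  shows "g \<in> SUgen n"
proof -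
  have "g \<in> SUgen n" if "b \<le> n - 1" "g \<in> carrier (SU_group n)"
    "\<And>k l. k < n \<Longrightarrow> l < n \<Longrightarrow> k < b \<or> l < b \<Longrightarrow> g $$ (k, l) = (if k = l then 1 else 0)" for b g
    using that
  proof (induction b arbitrary: g rule: inc_induct)
    case base
    have gc: "g \<in> carrier_mat n n"
      using base U_carrier_mat SU_U by blast
    have "prod_list (diag_mat g) = (\<Prod>i<n. g $$ (i, i))"
      using gc by (simp add: diag_mat_def prod.distinct_set_conv_list[symmetric] atLeast0LessThan)
    also have "\<dots> = (\<Prod>i<n. if i = n - 1 then g $$ (n - 1, n - 1) else 1)"
      using base(2) by (intro prod.cong) auto
    also have "\<dots> = g $$ (n - 1, n - 1)"
      using n by simp
    finally have "prod_list (diag_mat g) = g $$ (n - 1, n - 1)" .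
    moreover have b2: "g $$ (k, l) = (if k = l then 1 else 0)" if "k < n" "l < n" "k \<noteq> l \<or> k \<noteq> n - 1" for k l
      using base(2)[of k l] that by (cases "k < n - 1") auto
    ultimately have "g $$ (n - 1, n - 1) = det g"
      using gc by (subst det_upper_triangular[OF _ gc]) (auto simp: upper_triangular_def)
    then have g1: "g $$ (n - 1, n - 1) = 1"
      using base(1) by (simp add: SU_iff)
    have "g = 1\<^sub>m n"
    proof (rule eq_matI)
      fix k l assume "k < dim_row (1\<^sub>m n :: complex mat)" "l < dim_col (1\<^sub>m n :: complex mat)"
      then show "g $$ (k, l) = 1\<^sub>m n $$ (k, l)"
        using b2[of k l] g1 by (cases "k = l \<and> k = n - 1") auto
    qed (use gc in auto)
    then show ?case
      using SUgen.one by simp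
  next
    case (step b)
    have b: "b < n" "b + 1 < n"
      using step.hyps by auto
    have gc: "g \<in> carrier_mat n n" and gU: "g \<in> carrier (U_group n)"
      using step.prems U_carrier_mat SU_U by blast+
    define x where "x = (\<lambda>k. g $$ (k, b))"
    have "herm n x x = sg b"
      using gU b unfolding U_iff_entries herm_def x_def by simp
    then have "(\<Sum>a\<in>{1..<n}. (cmod (x a))\<^sup>2) < (cmod (x 0))\<^sup>2" if "b = 0"
      using that unfolding herm_self[OF n] sg_def by (simp add: complex_eq_iff)
    from zero_below[OF b(1) this] obtain p where p: "p \<in> SUgen n"
      and bl': "\<forall>k<n. \<forall>l<n. k < b \<or> l < b \<longrightarrow> p $$ (k, l) = (if k = l then 1 else 0)"
      and z': "\<forall>l\<in>{b<..<n}. mv n p x l = 0"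
      by blast
    note bl = bl'[rule_format] and z = z'[rule_format]
    have pc: "p \<in> carrier_mat n n"
      by (rule SUgen_carrier[OF p])
    define h where "h = p * g"
    have hSU: "h \<in> carrier (SU_group n)"
      unfolding h_def by (intro SU_mult SUgen_SU p step.prems)
    then have hU: "h \<in> carrier (U_group n)" and hc: "h \<in> carrier_mat n n"
      using U_carrier_mat SU_U by blast+
    have he: "h $$ (k, l) = (\<Sum>m<n. p $$ (k, m) * g $$ (m, l))" if "k < n" "l < n" for k l
      unfolding h_def by (rule mult_mat_entry[OF pc gc that])
    have hb: "h $$ (k, l) = (if k = l then 1 else 0)" if kl: "k < n" "l < n" "k < b \<or> l < b" for k l
    proof (cases "k < b")
      case True
      have "h $$ (k, l) = (\<Sum>m<n. (if k = m then 1 else 0) * g $$ (m, l))"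
        unfolding he[OF kl(1,2)] using bl kl True by (intro sum.cong) auto
      then show ?thesis
        using step.prems(2)[of k l] kl True by (simp add: sum_one)
    next
      case False
      have "h $$ (k, l) = (\<Sum>m<n. (if l = m then 1 else 0) * p $$ (k, m))"
        unfolding he[OF kl(1,2)] using step.prems(2) kl False by (intro sum.cong) auto
      then show ?thesis
        using bl[of k l] kl False by (simp add: sum_one)
    qed
    have hcol: "h $$ (k, b) = 0" if "k < n" "k \<noteq> b" for k
    proof (cases "k < b")
      case True
      then show ?thesis
        using hb[of k b] that b by simp
    next
      case False
      then show ?thesis
        using z[of k] that b he[of k b] by (simp add: mv_def x_def)
    qed
    have sumb: "(\<Sum>k<n. sg k * cnj (h $$ (k, b)) * h $$ (k, l)) = sg b * cnj (h $$ (b, b)) * h $$ (b, l)" if "l < n" for l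
    proof -
      have "(\<Sum>k<n. sg k * cnj (h $$ (k, b)) * h $$ (k, l)) =
          (\<Sum>k<n. if k = b then sg b * cnj (h $$ (b, b)) * h $$ (b, l) else 0)"
        using hcol by (intro sum.cong) auto
      then show ?thesis
        using b by simp
    qed
    have row: "sg b * cnj (h $$ (b, b)) * h $$ (b, l) = (if b = l then sg b else 0)" if "l < n" for l
      using hU b that unfolding U_iff_entries sumb[OF that, symmetric] by blast
    have unit: "cnj (h $$ (b, b)) * h $$ (b, b) = 1"
      using row[OF b(1)] by (simp add: mult.assoc)
    have hrow: "h $$ (b, l) = 0" if "l < n" "l \<noteq> b" for l
      using row[OF that(1)] that unit by auto
    have "cmod (h $$ (b, b)) = 1"
      using unit complex_norm_square[of "h $$ (b, b)"]
      by (metis mult.commute norm_ge_zero of_real_1 of_real_eq_iff power2_eq_1_iff not_one_le_zero neg_equal_0_iff_equal one_neq_neg_one le_minus_one_simps(3) abs_norm_cancel power2_abs real_sqrt_abs real_sqrt_one)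
    then obtain \<theta> where \<theta>: "h $$ (b, b) = cis \<theta>"
      by (metis complex_norm_eq_1_exp cis_conv_exp)
    \<comment> \<open>The phase of the diagonal entry b is pushed into the next diagonal position by
      a diagonal block of determinant 1; in the inductive step b + 1 < n, so there is such a
      position.\<close>
    let ?M = "pl n b (b + 1) (cis (- \<theta>)) 0 0 (cis \<theta>)"
    have bb: "b < n" "b + 1 < n" "b \<noteq> b + 1"
      using b by auto
    have M: "plane_exp n ?M"
    proof -
      have "cis (- \<theta>) = cos (- \<theta>) + sin (- \<theta>) * \<i>" "cis \<theta> = cos (- \<theta>) - sin (- \<theta>) * \<i>"
        by (auto simp: complex_eq_iff)
      then show ?thesis
        using rotation_exp[OF bb, of \<i> 0 0 "- \<theta>"] by simp
    qed
    have "?M * h \<in> SUgen n"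
    proof (rule step.IH)
      show "?M * h \<in> carrier (SU_group n)"
        by (intro SU_mult hSU plane_exp_SU M)
      show "(?M * h) $$ (k, l) = (if k = l then 1 else 0)" if kl: "k < n" "l < n" "k < Suc b \<or> l < Suc b" for k l
      proof -
        have c1: "cis (- \<theta>) * h $$ (b, b) = 1"
          by (simp add: \<theta> cis_mult)
        show ?thesis
          unfolding pl_mult_entry[OF bb kl(1,2) hc]
          using kl hb[of k l] hrow[of l] hcol[of k] c1 hb[of "Suc b" l] hcol[of "Suc b"] b
          by (auto simp: less_Suc_eq)
      qed
    qed
    then have "h \<in> SUgen n"
      using SUgen_cancel[OF plane_exp_SUgen[OF M]] hc by blast
    then show ?case
      unfolding h_def by (rule SUgen_cancel[OF p _ gc])
  qed
  from this[of 0, OF _ g] show ?thesis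
    by simp
qed

text \<open>Eliminating Z = (1, X) gives p Z = mu e_0, so the inverse of p sends e_0 to a multiple
  of Z, that is, the centre of the ball to X.\<close>

lemma SU_transitive:
  assumes n: "1 \<le> n" and X: "X \<in> CH_ball n"
  obtains s where "s \<in> carrier (SU_group n)"
    "\<And>b. b \<in> {1..<n} \<Longrightarrow> mat_Z n s (\<lambda>a\<in>{1..<n}. 0) b / mat_Z n s (\<lambda>a\<in>{1..<n}. 0) 0 = X b"
proof -
  have "(\<Sum>a\<in>{1..<n}. (cmod (homog X a))\<^sup>2) < (cmod (homog X 0))\<^sup>2"
  proof -
    have "(\<Sum>a\<in>{1..<n}. (cmod (homog X a))\<^sup>2) = (\<Sum>a\<in>{1..<n}. (cmod (X a))\<^sup>2)"
      by (intro sum.cong) (auto simp: homog_def)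
    then show ?thesis
      using X by (simp add: homog_def CH_ball_def)
  qed
  then obtain p where p: "p \<in> SUgen n" and z: "\<And>l. l \<in> {0<..<n} \<Longrightarrow> mv n p (homog X) l = 0"
    using zero_below[of 0 n "homog X"] n by auto
  have pSU: "p \<in> carrier (SU_group n)" and pU: "p \<in> carrier (U_group n)"
    using SUgen_SU[OF p] SU_U by blast+
  define \<mu> where "\<mu> = mv n p (homog X) 0"
  have \<mu>: "\<mu> \<noteq> 0"
    using mat_Z0_nonzero[OF n pU X] by (simp add: \<mu>_def mat_Z_mv)
  have "mat_Z n (adj n p) (\<lambda>a\<in>{1..<n}. 0) j = homog X j / \<mu>" if "j < n" for j
  proof -
    have "mat_Z n (adj n p) (\<lambda>a\<in>{1..<n}. 0) j = mv n (adj n p) (\<lambda>l. mv n p (homog X) l / \<mu>) j"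
      unfolding mat_Z_mv using z \<mu> by (intro mv_cong) (auto simp: homog_def[of "restrict _ _"] \<mu>_def)
    also have "\<dots> = mv n (adj n p * p) (homog X) j / \<mu>"
      using that pU by (simp add: mv_divide mv_mult U_carrier_mat)
    finally show ?thesis
      using that by (simp add: U_adj[OF pU] mv_one)
  qed
  then show ?thesis
    using n \<mu> by (intro that[OF SU_adj[OF pSU]]) (auto simp: homog_def)
qed

section \<open>Lifts of group elements to the covering\<close>

definition projX :: "nat \<Rightarrow> complex mat \<Rightarrow> (nat \<Rightarrow> complex) \<Rightarrow> nat \<Rightarrow> complex" where
  "projX n g X = (\<lambda>b\<in>{1..<n}. mat_Z n g X b / mat_Z n g X 0)"

lemma co_zero [simp]: "co n g *\<^sub>v 0\<^sub>v n = 0\<^sub>v n"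
  by (intro eq_vecI) auto

lemma coord_act:
  "coord_X (act n c d \<theta> p) = projX n (fst d) (coord_X p)"
  "coord_rho (act n c d \<theta> p) = coord_rho p"
  by (cases d; cases p; auto simp: projX_def)+

lemma Nbar_ball: "p \<in> Nbar n \<Longrightarrow> coord_X p \<in> CH_ball n"
  by (cases p) (auto simp: Nbar_iff)

text \<open>(g Z)^0 is the automorphy factor of the action on the ball; its cocycle rule is what
  makes the angles of lifts add.\<close>

lemma mat_Z0_mult:
  assumes "1 \<le> n" "g \<in> carrier (U_group n)" "h \<in> carrier_mat n n" "X \<in> CH_ball n"
  shows "mat_Z n (h * g) X 0 = mat_Z n h (projX n g X) 0 * mat_Z n g X 0"
  using mat_Z_act[OF assms, of 0] mat_Z0_nonzero[OF assms(1,2,4)] assms(1) by (simp add: projX_def)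

lemma mat_Z0_one: "1 \<le> n \<Longrightarrow> mat_Z n (1\<^sub>m n) X 0 = 1"
  by (simp add: mat_Z_mv mv_one homog_def)

lemma group_beta: "1 \<le> n \<Longrightarrow> group (UHeis n \<times>\<times> BijGroup (Nbar n))"
  by (intro DirProd_group group_UHeis group_BijGroup)

lemma BijGroup_simps:
  "carrier (BijGroup S) = Bij S"
  "f \<in> Bij S \<Longrightarrow> g \<in> Bij S \<Longrightarrow> f \<otimes>\<^bsub>BijGroup S\<^esub> g = compose S f g"
  "\<one>\<^bsub>BijGroup S\<^esub> = (\<lambda>x\<in>S. x)"
  by (auto simp: BijGroup_def)

text \<open>\<open>T g X\<close> is the set of admissible angles over g at X, and the three
  conditions are its cocycle rules for identity, product and inverse. It is applied to all arguments
  of (g Z)^0, and to T = {0} over the Heisenberg group.\<close>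

lemma lift_subgroup:
  fixes T :: "complex mat \<Rightarrow> (nat \<Rightarrow> complex) \<Rightarrow> real set"
  assumes n: "1 \<le> n" and D: "subgroup D (UHeis n)"
    and one: "\<And>X. X \<in> CH_ball n \<Longrightarrow> 0 \<in> T (1\<^sub>m n) X"
    and mult: "\<And>g h X \<theta> \<theta>'. g \<in> carrier (U_group n) \<Longrightarrow> h \<in> carrier (U_group n) \<Longrightarrow> X \<in> CH_ball n \<Longrightarrow>
      \<theta> \<in> T g X \<Longrightarrow> \<theta>' \<in> T h (projX n g X) \<Longrightarrow> \<theta>' + \<theta> \<in> T (h * g) X"
    and inv: "\<And>g X \<theta>. g \<in> carrier (U_group n) \<Longrightarrow> X \<in> CH_ball n \<Longrightarrow> \<theta> \<in> T g X \<Longrightarrow>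
      - \<theta> \<in> T (adj n g) (projX n g X)"
  shows "subgroup {(d, \<psi>). d \<in> D \<and> \<psi> \<in> Bij (Nbar n) \<and>
      (\<forall>p\<in>Nbar n. \<exists>\<theta>\<in>T (fst d) (coord_X p). \<psi> p = act n c d \<theta> p)} (UHeis n \<times>\<times> BijGroup (Nbar n))"
    (is "subgroup ?L ?G")
proof -
  interpret D: subgroup D "UHeis n" by fact
  interpret G: group ?G by (rule group_beta[OF n])
  have DU: "d \<in> carrier (UHeis n)" if "d \<in> D" for d
    using D.subset that by blast
  have fstU: "fst d \<in> carrier (U_group n)" if "d \<in> D" for d
    using DU[OF that] by (auto simp: UHeis_simps)
  have id: "act n c \<one>\<^bsub>UHeis n\<^esub> 0 p = p" if "p \<in> Nbar n" for p
    using act_one[OF n that, of c 0 0] by (cases p) (simp add: UHeis_simps)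
  show ?thesis
  proof (rule G.subgroupI)
    show "?L \<subseteq> carrier ?G"
      using DU by (auto simp: BijGroup_simps)
    have "(\<one>\<^bsub>UHeis n\<^esub>, \<lambda>p\<in>Nbar n. p) \<in> ?L"
      using one[OF Nbar_ball] id D.one_closed by (auto simp: id_Bij UHeis_simps intro!: bexI[of _ 0])
    then show "?L \<noteq> {}"
      by blast
  next
    fix x assume xL: "x \<in> ?L"
    obtain d \<psi> where x: "x = (d, \<psi>)"
      by (cases x)
    from xL have d: "d \<in> D" and \<psi>: "\<psi> \<in> Bij (Nbar n)"
      and act: "\<And>p. p \<in> Nbar n \<Longrightarrow> \<exists>\<theta>\<in>T (fst d) (coord_X p). \<psi> p = act n c d \<theta> p"
      unfolding x by simp_all
    let ?\<psi>' = "inv\<^bsub>BijGroup (Nbar n)\<^esub> \<psi>"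
    have \<psi>': "?\<psi>' \<in> Bij (Nbar n)"
      using group.inv_closed[OF group_BijGroup, of \<psi> "Nbar n"] \<psi> by (simp add: BijGroup_simps)
    have "\<exists>\<theta>\<in>T (fst (inv\<^bsub>UHeis n\<^esub> d)) (coord_X p). ?\<psi>' p = act n c (inv\<^bsub>UHeis n\<^esub> d) \<theta> p" if p: "p \<in> Nbar n" for p
    proof -
      have "compose (Nbar n) \<psi> ?\<psi>' = (\<lambda>p\<in>Nbar n. p)"
        using group.r_inv[OF group_BijGroup, of \<psi> "Nbar n"] \<psi> \<psi>' by (simp add: BijGroup_simps)
      from fun_cong[OF this, of p] have q: "\<psi> (?\<psi>' p) = p"
        using p by (simp add: compose_def)
      have qN: "?\<psi>' p \<in> Nbar n"
        using Bij_imp_funcset[OF \<psi>'] p by blast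
      from act[OF this] obtain \<theta> where \<theta>: "\<theta> \<in> T (fst d) (coord_X (?\<psi>' p))" "p = act n c d \<theta> (?\<psi>' p)"
        unfolding q by blast
      have "act n c (inv\<^bsub>UHeis n\<^esub> d) (- \<theta>) p = act n c (inv\<^bsub>UHeis n\<^esub> d) (- \<theta>) (act n c d \<theta> (?\<psi>' p))"
        using \<theta>(2) by simp
      also have "\<dots> = act n c (inv\<^bsub>UHeis n\<^esub> d \<otimes>\<^bsub>UHeis n\<^esub> d) (- \<theta> + \<theta>) (?\<psi>' p)"
        using DU[OF d] group.inv_closed[OF group_UHeis[OF n]] qN by (intro act_act[OF n]) auto
      also have "\<dots> = ?\<psi>' p"
        using DU[OF d] qN by (simp add: group.l_inv[OF group_UHeis[OF n]] id)
      finally have "?\<psi>' p = act n c (inv\<^bsub>UHeis n\<^esub> d) (- \<theta>) p" ..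
      moreover have "- \<theta> \<in> T (fst (inv\<^bsub>UHeis n\<^esub> d)) (coord_X p)"
      proof -
        have "fst (inv\<^bsub>UHeis n\<^esub> d) = adj n (fst d)"
          using iinv_UHeis(4)[OF n DU[OF d]] by (simp add: iinv_def split: prod.splits)
        moreover have "coord_X p = projX n (fst d) (coord_X (?\<psi>' p))"
          by (subst \<theta>(2)) (simp add: coord_act)
        ultimately show ?thesis
          using inv[OF fstU[OF d] Nbar_ball[OF qN] \<theta>(1)] by simp
      qed
      ultimately show ?thesis
        by blast
    qed
    then show "inv\<^bsub>?G\<^esub> x \<in> ?L"
      unfolding x using d \<psi> \<psi>' DU[OF d]
      by (subst inv_DirProd[OF group_UHeis[OF n] group_BijGroup]) (auto simp: BijGroup_simps D.m_inv_closed)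
  next
    fix x y assume xy: "x \<in> ?L" "y \<in> ?L"
    obtain d \<psi> where x: "x = (d, \<psi>)"
      by (cases x)
    obtain d' \<psi>' where y: "y = (d', \<psi>')"
      by (cases y)
    from xy have d: "d \<in> D" "d' \<in> D" and \<psi>: "\<psi> \<in> Bij (Nbar n)" "\<psi>' \<in> Bij (Nbar n)"
      and act: "\<And>p. p \<in> Nbar n \<Longrightarrow> \<exists>\<theta>\<in>T (fst d) (coord_X p). \<psi> p = act n c d \<theta> p"
        "\<And>p. p \<in> Nbar n \<Longrightarrow> \<exists>\<theta>\<in>T (fst d') (coord_X p). \<psi>' p = act n c d' \<theta> p"
      unfolding x y by simp_all
    have "\<exists>\<theta>\<in>T (fst (d \<otimes>\<^bsub>UHeis n\<^esub> d')) (coord_X p). \<psi> (\<psi>' p) = act n c (d \<otimes>\<^bsub>UHeis n\<^esub> d') \<theta> p" if p: "p \<in> Nbar n" for p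
    proof -
      obtain \<theta>' where \<theta>': "\<theta>' \<in> T (fst d') (coord_X p)" "\<psi>' p = act n c d' \<theta>' p"
        using act(2)[OF p] by blast
      have q: "act n c d' \<theta>' p \<in> Nbar n"
        by (rule act_Nbar[OF n DU[OF d(2)] p])
      obtain \<theta> where \<theta>: "\<theta> \<in> T (fst d) (projX n (fst d') (coord_X p))" "\<psi> (\<psi>' p) = act n c d \<theta> (act n c d' \<theta>' p)"
        using act(1)[OF q] by (auto simp: \<theta>'(2) coord_act)
      have "fst (d \<otimes>\<^bsub>UHeis n\<^esub> d') = fst d * fst d'"
        using fstU[OF d(1)] by (cases d; cases d') (auto simp: UHeis_simps)
      then show ?thesis
        using mult[OF fstU[OF d(2)] fstU[OF d(1)] Nbar_ball[OF p] \<theta>'(1) \<theta>(1)] \<theta>(2)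
        by (auto simp: act_act[OF n DU[OF d(2)] DU[OF d(1)] p])
    qed
    then show "x \<otimes>\<^bsub>?G\<^esub> y \<in> ?L"
      unfolding x y using d \<psi> compose_Bij[OF \<psi>] by (auto simp: BijGroup_simps compose_eq D.m_closed)
  qed
qed

lemma isarg_mult: "isarg \<theta> z \<Longrightarrow> isarg \<theta>' z' \<Longrightarrow> isarg (\<theta> + \<theta>') (z * z')"
  by (auto simp: isarg_def norm_mult cis_mult[symmetric]) (metis mult.assoc mult.left_commute)

lemma isarg_cis: "isarg \<theta> z \<longleftrightarrow> sgn z = cis \<theta> \<or> z = 0"
  by (cases "z = 0") (auto simp: isarg_def sgn_eq divide_eq_eq mult.commute)

lemma isarg_unique:
  assumes "isarg \<theta> z" "isarg \<theta>' z" "z \<noteq> 0"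
  obtains k :: int where "\<theta> = \<theta>' + 2 * pi * k"
proof -
  have "cis \<theta> = cis \<theta>'"
    using assms by (simp add: isarg_cis)
  then have "sin \<theta> = sin \<theta>' \<and> cos \<theta> = cos \<theta>'"
    by (simp add: complex_eq_iff)
  then obtain k :: int where "\<theta> = \<theta>' + 2 * pi * k"
    unfolding sin_cos_eq_iff by auto
  then show ?thesis
    by (rule that)
qed

lemma isarg_one_iff: "isarg \<theta> 1 \<longleftrightarrow> (\<exists>k::int. \<theta> = 2 * pi * k)"
proof
  assume "isarg \<theta> 1"
  moreover have "isarg 0 1"
    by (simp add: isarg_def)
  ultimately show "\<exists>k::int. \<theta> = 2 * pi * k"
    using isarg_unique[of \<theta> 1 0] by auto
next
  assume "\<exists>k::int. \<theta> = 2 * pi * k"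
  then show "isarg \<theta> 1"
    by (auto simp: isarg_def cis_multiple_2pi)
qed

lemma mat_Z0_adj:
  assumes "1 \<le> n" "g \<in> carrier (U_group n)" "X \<in> CH_ball n"
  shows "mat_Z n (adj n g) (projX n g X) 0 * mat_Z n g X 0 = 1"
  using mat_Z0_mult[OF assms(1,2) adj_carrier[of n g] assms(3)] U_adj(1)[OF assms(2)] mat_Z0_one[OF assms(1), of X] by simp

lemma isarg_inverse: "isarg \<theta> z \<Longrightarrow> w * z = 1 \<Longrightarrow> isarg (- \<theta>) w"
proof -
  assume a: "isarg \<theta> z" "w * z = 1"
  have n: "cmod w * cmod z = 1"
    using a(2) by (metis norm_mult norm_one)
  have "w * (complex_of_real (cmod z) * cis \<theta>) = 1"
    using a by (simp add: isarg_def)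
  then have "w * (complex_of_real (cmod z) * cis \<theta>) * (complex_of_real (cmod w) * cis (- \<theta>)) = complex_of_real (cmod w) * cis (- \<theta>)"
    by simp
  moreover have "w * (complex_of_real (cmod z) * cis \<theta>) * (complex_of_real (cmod w) * cis (- \<theta>)) =
      w * complex_of_real (cmod w * cmod z) * (cis \<theta> * cis (- \<theta>))"
    by (simp only: of_real_mult mult_ac)
  ultimately show ?thesis
    using n by (simp add: isarg_def cis_mult)
qed

definition lift_args :: "nat \<Rightarrow> complex mat \<Rightarrow> (nat \<Rightarrow> complex) \<Rightarrow> real set" where
  "lift_args n g X = {\<theta>. isarg \<theta> (mat_Z n g X 0)}"

lemma lift_args_subgroup:
  assumes n: "1 \<le> n" and D: "subgroup D (UHeis n)"
  shows "subgroup {(d, \<psi>). d \<in> D \<and> \<psi> \<in> Bij (Nbar n) \<and>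
      (\<forall>p\<in>Nbar n. \<exists>\<theta>\<in>lift_args n (fst d) (coord_X p). \<psi> p = act n c d \<theta> p)} (UHeis n \<times>\<times> BijGroup (Nbar n))"
proof (rule lift_subgroup[OF assms])
  show "0 \<in> lift_args n (1\<^sub>m n) X" for X
    using n by (simp add: lift_args_def mat_Z0_one isarg_def)
  show "\<theta>' + \<theta> \<in> lift_args n (h * g) X"
    if "g \<in> carrier (U_group n)" "h \<in> carrier (U_group n)" "X \<in> CH_ball n"
      "\<theta> \<in> lift_args n g X" "\<theta>' \<in> lift_args n h (projX n g X)" for g h X \<theta> \<theta>'
    using that isarg_mult by (auto simp: lift_args_def mat_Z0_mult[OF n _ U_carrier_mat])
  show "- \<theta> \<in> lift_args n (adj n g) (projX n g X)"
    if "g \<in> carrier (U_group n)" "X \<in> CH_ball n" "\<theta> \<in> lift_args n g X" for g X \<theta>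
    using isarg_inverse mat_Z0_adj[OF n that(1,2)] that(3) by (auto simp: lift_args_def)
qed

lemma beta_graph_subset:
  assumes n: "1 \<le> n" and A: "\<aa> \<subseteq> lie_u n" and H: "\<hh> \<subseteq> carrier (Heis_group n)"
    and D: "subgroup D (UHeis n)" and exp_D: "\<And>A. A \<in> \<aa> \<Longrightarrow> (mat_exp n A, (0\<^sub>v n, 0)) \<in> D"
    and heis_D: "\<And>h. h \<in> \<hh> \<Longrightarrow> (1\<^sub>m n, h) \<in> D"
  shows "beta_graph n c \<aa> \<hh> \<subseteq> {(d, \<psi>). d \<in> D \<and> \<psi> \<in> Bij (Nbar n) \<and>
      (\<forall>p\<in>Nbar n. \<exists>\<theta>\<in>lift_args n (fst d) (coord_X p). \<psi> p = act n c d \<theta> p)}"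
    (is "_ \<subseteq> ?L")
proof -
  have 1: "((mat_exp n A, (0\<^sub>v n, 0)), \<psi>) \<in> ?L"
    if a: "A \<in> \<aa>" and \<psi>: "time_one_map n (alpha n c (A, (0\<^sub>v n, 0))) \<psi>" for A \<psi>
  proof -
    interpret su_flow n A
      using n A a by unfold_locales auto
    have "\<exists>\<theta>\<in>lift_args n (mat_exp n A) (coord_X p). \<psi> p = act n c (mat_exp n A, (0\<^sub>v n, 0)) \<theta> p"
      if p: "p \<in> Nbar n" for p
    proof -
      obtain \<theta> where "flow n c A p 1 = act n c (mat_exp n A, (0\<^sub>v n, 0)) \<theta> p" "isarg \<theta> (mat_Z n (mat_exp n A) (coord_X p) 0)"
        by (rule flow_act[OF p])
      then show ?thesis
        using time_one_map_flow[OF \<psi> p] by (auto simp: lift_args_def)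
    qed
    then show ?thesis
      using exp_D[OF a] \<psi> by (auto simp: time_one_map_def)
  qed
  have 2: "((1\<^sub>m n, (v, t)), \<psi>) \<in> ?L"
    if h: "(v, t) \<in> \<hh>" and \<psi>: "time_one_map n (alpha n c (0\<^sub>m n n, (v, t))) \<psi>" for v t \<psi>
  proof -
    have v: "v \<in> carrier_vec n"
      using h H by auto
    have "0 \<in> lift_args n (1\<^sub>m n) X" for X
      using mat_Z0_one[OF n] by (auto simp: lift_args_def isarg_def)
    moreover have "\<psi> p = act n c (1\<^sub>m n, (v, t)) 0 p" if "p \<in> Nbar n" for p
      using \<psi> that unfolding time_one_map_heis[OF n v] by simp
    ultimately show ?thesis
      using heis_D[OF h] \<psi> by (auto simp: time_one_map_def)
  qed
  show ?thesis
    unfolding beta_graph_def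
  proof (rule group.generate_subgroup_incl[OF group_beta[OF n] _ lift_args_subgroup[OF n D]], rule Un_least)
    show "{((mat_exp n A, \<one>\<^bsub>Heis_group n\<^esub>), \<psi>) |A \<psi>. A \<in> \<aa> \<and> time_one_map n (alpha n c (A, 0\<^sub>v n, 0)) \<psi>} \<subseteq> ?L"
    proof
      fix x assume "x \<in> {((mat_exp n A, \<one>\<^bsub>Heis_group n\<^esub>), \<psi>) |A \<psi>. A \<in> \<aa> \<and> time_one_map n (alpha n c (A, 0\<^sub>v n, 0)) \<psi>}"
      then obtain A \<psi> where "x = ((mat_exp n A, \<one>\<^bsub>Heis_group n\<^esub>), \<psi>)" "A \<in> \<aa>" "time_one_map n (alpha n c (A, 0\<^sub>v n, 0)) \<psi>"
        by blast
      then show "x \<in> ?L"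
        using 1[of A \<psi>] by (simp only: Heis_group_simps)
    qed
    show "{((1\<^sub>m n, h), \<psi>) |h \<psi>. h \<in> \<hh> \<and> time_one_map n (alpha n c (0\<^sub>m n n, h)) \<psi>} \<subseteq> ?L"
    proof
      fix x assume "x \<in> {((1\<^sub>m n :: complex mat, h), \<psi>) |h \<psi>. h \<in> \<hh> \<and> time_one_map n (alpha n c (0\<^sub>m n n, h)) \<psi>}"
      then obtain v t \<psi> where "x = ((1\<^sub>m n, (v, t)), \<psi>)" "(v, t) \<in> \<hh>" "time_one_map n (alpha n c (0\<^sub>m n n, (v, t))) \<psi>"
        by auto
      then show "x \<in> ?L"
        using 2[of v t \<psi>] by (simp only:)
    qed
  qed
qed

lemma beta_lift:
  assumes n: "1 \<le> n" and "\<aa> \<subseteq> lie_u n" "\<hh> \<subseteq> carrier (Heis_group n)" "(d, \<psi>) \<in> beta_graph n c \<aa> \<hh>"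
  shows "d \<in> carrier (UHeis n)" "\<psi> \<in> Bij (Nbar n)"
    and "p \<in> Nbar n \<Longrightarrow> \<exists>\<theta>. isarg \<theta> (mat_Z n (fst d) (coord_X p) 0) \<and> \<psi> p = act n c d \<theta> p"
proof -
  have "beta_graph n c \<aa> \<hh> \<subseteq> {(d, \<psi>). d \<in> carrier (UHeis n) \<and> \<psi> \<in> Bij (Nbar n) \<and>
      (\<forall>p\<in>Nbar n. \<exists>\<theta>\<in>lift_args n (fst d) (coord_X p). \<psi> p = act n c d \<theta> p)}"
    using assms
    by (intro beta_graph_subset[OF n assms(2,3) group.subgroup_self[OF group_UHeis[OF n]]])
       (auto simp: UHeis_simps mat_exp_U)
  with assms(4) show "d \<in> carrier (UHeis n)" "\<psi> \<in> Bij (Nbar n)"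
    "p \<in> Nbar n \<Longrightarrow> \<exists>\<theta>. isarg \<theta> (mat_Z n (fst d) (coord_X p) 0) \<and> \<psi> p = act n c d \<theta> p"
    by (auto simp: lift_args_def)
qed

lemma beta_exp:
  assumes n: "1 \<le> n" and A: "\<aa> \<subseteq> lie_u n" and b: "(d, \<psi>) \<in> beta_graph n c \<aa> {}"
  shows "snd d = (0\<^sub>v n, 0)"
proof -
  let ?D = "carrier (U_group n) \<times> {(0\<^sub>v n, 0) :: heis}"
  have "subgroup ?D (UHeis n)"
  proof (rule group.subgroupI[OF group_UHeis[OF n]])
    fix x assume "x \<in> ?D"
    then obtain g where x: "x = (g, (0\<^sub>v n, 0))" and g: "g \<in> carrier (U_group n)"
      by auto
    have "x \<in> carrier (UHeis n)"
      using x g by (simp add: UHeis_simps)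
    then show "inv\<^bsub>UHeis n\<^esub> x \<in> ?D"
      using U_adj(3)[OF g] by (subst iinv_UHeis(4)[OF n]) (auto simp: x iinv_def mult_mat_vec_def)
  qed (use n one_U in \<open>auto simp: UHeis_simps U_mult omega_zero simp del: one_U\<close>)
  then have "beta_graph n c \<aa> {} \<subseteq> {(d, \<psi>). d \<in> ?D \<and> \<psi> \<in> Bij (Nbar n) \<and>
      (\<forall>p\<in>Nbar n. \<exists>\<theta>\<in>lift_args n (fst d) (coord_X p). \<psi> p = act n c d \<theta> p)}"
    using A mat_exp_U by (intro beta_graph_subset[OF n A]) auto
  then have "d \<in> ?D"
    using b by blast
  then show ?thesis
    by auto
qed

text \<open>Heisenberg flows involve no angle, so with T = {0} a lift is determined by the group
  element.\<close>

lemma beta_heis: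
  assumes n: "1 \<le> n" and b: "(d, \<psi>) \<in> beta_graph n c {} (carrier (Heis_group n))"
  shows "fst d = 1\<^sub>m n" "snd d \<in> carrier (Heis_group n)" "p \<in> Nbar n \<Longrightarrow> \<psi> p = act n c d 0 p"
proof -
  let ?D = "{1\<^sub>m n :: complex mat} \<times> carrier (Heis_group n)"
  let ?L = "{(d, \<psi>). d \<in> ?D \<and> \<psi> \<in> Bij (Nbar n) \<and>
      (\<forall>p\<in>Nbar n. \<exists>\<theta>\<in>{0}. \<psi> p = act n c d \<theta> p)}"
  have "subgroup ?D (UHeis n)"
  proof (rule group.subgroupI[OF group_UHeis[OF n]])
    fix x assume "x \<in> ?D"
    then obtain v t where x: "x = (1\<^sub>m n, (v, t))" and v: "v \<in> carrier_vec n"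
      by auto
    have "x \<in> carrier (UHeis n)"
      using x v by (simp add: UHeis_simps)
    then show "inv\<^bsub>UHeis n\<^esub> x \<in> ?D"
      using v by (subst iinv_UHeis(4)[OF n]) (auto simp: x iinv_def adj_one co_one)
  qed (use zero_carrier_vec[of n] in \<open>auto simp: UHeis_simps co_one simp del: zero_carrier_vec\<close>)
  then have "subgroup ?L (UHeis n \<times>\<times> BijGroup (Nbar n))"
    by (intro lift_subgroup[OF n, where T = "\<lambda>_ _. {0}"]) auto
  then have "beta_graph n c {} (carrier (Heis_group n)) \<subseteq> ?L"
    unfolding beta_graph_def
  proof (rule group.generate_subgroup_incl[OF group_beta[OF n], rotated], intro subsetI)
    fix x assume "x \<in> {((mat_exp n A, \<one>\<^bsub>Heis_group n\<^esub>), \<psi>) |A \<psi>. A \<in> {} \<and> time_one_map n (alpha n c (A, 0\<^sub>v n, 0)) \<psi>} \<union>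
      {((1\<^sub>m n, h), \<psi>) |h \<psi>. h \<in> carrier (Heis_group n) \<and> time_one_map n (alpha n c (0\<^sub>m n n, h)) \<psi>}"
    then obtain v t \<psi> where x: "x = ((1\<^sub>m n, (v, t)), \<psi>)" and v: "v \<in> carrier_vec n"
      and \<psi>: "time_one_map n (alpha n c (0\<^sub>m n n, (v, t))) \<psi>"
      by auto
    have "\<psi> p = act n c (1\<^sub>m n, (v, t)) 0 p" if "p \<in> Nbar n" for p
      using \<psi> that unfolding time_one_map_heis[OF n v] by simp
    then show "x \<in> ?L"
      using v \<psi> by (auto simp: x time_one_map_def)
  qed
  then show "fst d = 1\<^sub>m n" "snd d \<in> carrier (Heis_group n)" "p \<in> Nbar n \<Longrightarrow> \<psi> p = act n c d 0 p"
    using b by auto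
qed

lemma beta_heis_exists:
  assumes n: "1 \<le> n" and v: "v \<in> carrier_vec n" and H: "carrier (Heis_group n) \<subseteq> \<hh>"
  shows "((1\<^sub>m n, (v, t)), \<lambda>p\<in>Nbar n. act n c (1\<^sub>m n, (v, t)) 0 p) \<in> beta_graph n c \<aa> \<hh>"
  unfolding beta_graph_def
proof (rule generate.incl, rule UnI2)
  show "((1\<^sub>m n, v, t), \<lambda>p\<in>Nbar n. act n c (1\<^sub>m n, v, t) 0 p)
    \<in> {((1\<^sub>m n, h), \<psi>) |h \<psi>. h \<in> \<hh> \<and> time_one_map n (alpha n c (0\<^sub>m n n, h)) \<psi>}"
    using time_one_map_heis[OF n v, of c t] v H by auto
qed

lemma beta_exp_exists:
  assumes n: "1 \<le> n" and A: "A \<in> \<aa>" "A \<in> lie_u n"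
  obtains \<psi> where "((mat_exp n A, (0\<^sub>v n, 0)), \<psi>) \<in> beta_graph n c \<aa> \<hh>" "time_one_map n (alpha n c (A, (0\<^sub>v n, 0))) \<psi>"
proof -
  obtain \<psi> where \<psi>: "time_one_map n (alpha n c (A, (0\<^sub>v n, 0))) \<psi>"
    using time_one_map_exists[OF n A(2)] by blast
  have "((mat_exp n A, (0\<^sub>v n, 0)), \<psi>) \<in> beta_graph n c \<aa> \<hh>"
    unfolding beta_graph_def by (rule generate.incl, rule UnI1) (use A \<psi> in auto)
  then show ?thesis
    using that \<psi> by blast
qed

lemma beta_mult:
  "(d, \<psi>) \<in> beta_graph n c \<aa> \<hh> \<Longrightarrow> (d', \<psi>') \<in> beta_graph n c \<aa> \<hh> \<Longrightarrow>
    (d \<otimes>\<^bsub>UHeis n\<^esub> d', \<psi> \<otimes>\<^bsub>BijGroup (Nbar n)\<^esub> \<psi>') \<in> beta_graph n c \<aa> \<hh>"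
  unfolding beta_graph_def using generate.eng by fastforce

text \<open>Each plane exponential has a lift, lifts multiply, and by \<open>SU_SUgen\<close>
  products of plane exponentials exhaust SU(1,n-1); the Heisenberg factor is then put on the
  left.\<close>

lemma beta_SUHeis_exists:
  assumes n: "1 \<le> n" and d: "d \<in> carrier (SUHeis n)"
  shows "\<exists>\<psi>. (d, \<psi>) \<in> beta_SUHeis n c"
proof -
  obtain g v t where d': "d = (g, (v, t))" and g: "g \<in> carrier (SU_group n)" and v: "v \<in> carrier_vec n"
    using d by (auto simp: SUHeis_simps)
  have "\<exists>\<psi>. ((g, (0\<^sub>v n, 0)), \<psi>) \<in> beta_SUHeis n c"
    using SU_SUgen[OF n g]
  proof (induction rule: SUgen.induct)
    case one
    show ?case
      by (rule exI, rule beta_heis_exists[OF n zero_carrier_vec order.refl])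
  next
    case (step M g)
    obtain A where A: "A \<in> lie_su n" "M = mat_exp n A"
      using step.hyps by (auto simp: plane_exp_def)
    then have Au: "A \<in> lie_u n"
      by (simp add: lie_su_def)
    obtain \<psi> where \<psi>: "((M, (0\<^sub>v n, 0)), \<psi>) \<in> beta_SUHeis n c"
      unfolding A(2) by (rule beta_exp_exists[OF n A(1) Au])
    obtain \<psi>' where \<psi>': "((g, (0\<^sub>v n, 0)), \<psi>') \<in> beta_SUHeis n c"
      using step.IH by blast
    have "(M, (0\<^sub>v n, 0 :: real)) \<otimes>\<^bsub>UHeis n\<^esub> (g, (0\<^sub>v n, 0)) = (M * g, (0\<^sub>v n, 0))"
    proof -
      have "co n M *\<^sub>v 0\<^sub>v n = 0\<^sub>v n"
        by (intro eq_vecI) auto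
      then show ?thesis
        using mat_exp_U[OF Au] n by (simp add: A(2) UHeis_simps omega_zero)
    qed
    then show ?case
      using beta_mult[OF \<psi> \<psi>'] by auto
  qed
  then obtain \<psi> where \<psi>: "((g, (0\<^sub>v n, 0)), \<psi>) \<in> beta_SUHeis n c"
    by blast
  have "(1\<^sub>m n, (v, t)) \<otimes>\<^bsub>UHeis n\<^esub> (g, (0\<^sub>v n, 0)) = d"
    using v n SU_U[OF g] U_carrier_mat[OF SU_U[OF g]] omega_anti[OF n, of v "0\<^sub>v n"]
    by (auto simp: d' UHeis_simps co_one omega_zero)
  then show ?thesis
    using beta_mult[OF beta_heis_exists[OF n v order.refl, where t = t] \<psi>] by auto
qed

section \<open>The group \<open>\<C>\<close>\<close>

definition shift :: "real \<Rightarrow> coords \<Rightarrow> coords" where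
  "shift s p = (coord_X p, coord_w p, coord_phi p + s, coord_rho p)"

lemma shift_simps [simp]:
  "shift s (X, w, \<phi>, \<rho>) = (X, w, \<phi> + s, \<rho>)"
  "coord_X (shift s p) = coord_X p" "coord_w (shift s p) = coord_w p"
  "coord_phi (shift s p) = coord_phi p + s" "coord_rho (shift s p) = coord_rho p"
  "shift s (shift s' p) = shift (s + s') p"
  by (auto simp: shift_def)

lemma shift_zero [simp]: "shift 0 p = p"
  by (cases p) simp

lemma shift_Nbar [simp]: "shift s p \<in> Nbar n \<longleftrightarrow> p \<in> Nbar n"
  by (cases p) (simp add: Nbar_iff)

lemma shift_inject: "shift s p = shift s' p \<longleftrightarrow> s = s'"
  by (cases p) simp

lemma act_shift: "act n c d \<theta> (shift s p) = shift s (act n c d \<theta> p)"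
  by (cases d; cases p) auto

lemma act_arg: "act n c d \<theta> p = shift (- 2 * c * (\<theta> - \<theta>')) (act n c d \<theta>' p)"
  by (cases d; cases p) (auto simp: algebra_simps)

lemma act_central: "act n c (g, (v, t + s)) \<theta> p = shift s (act n c (g, (v, t)) \<theta> p)"
  by (cases p) (simp add: add.assoc)

lemma act_one_shift:
  "1 \<le> n \<Longrightarrow> p \<in> Nbar n \<Longrightarrow> act n c (1\<^sub>m n, (0\<^sub>v n, t)) \<theta> p = shift (t - 2 * c * \<theta>) p"
  by (simp add: act_one shift_def)

text \<open>The angle enters phi with the factor 2 c, so a change of branch by 2 pi k moves phi by a
  multiple of 4 pi c. For c = 0 all periods vanish.\<close>

definition period :: "real \<Rightarrow> int \<Rightarrow> real" where
  "period c k = 4 * pi * c * k"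

lemma period_simps: "period c k + period c l = period c (k + l)" "- period c k = period c (- k)"
    "period c k - period c l = period c (k - l)" "period c 0 = 0"
  by (auto simp: period_def algebra_simps)

text \<open>A closed one-parameter loop: exp(A) = 1, although the angle followed along it is - 2 pi
  k. For n >= 2 it is diagonal and traceless in the plane (0, 1); for n = 1 the algebra
  \<open>lie_su\<close> is zero and the loop lives in U(1), which is the case distinction in
  \<open>C_group\<close>.\<close>

lemma exp_one_matrix:
  fixes k :: int
  assumes n: "1 \<le> n"
  obtains A where "A \<in> (if n = 1 then lie_u n else lie_su n)" "mat_exp n A = 1\<^sub>m n"
    "\<forall>X. mat_Z n A X 0 = - 2 * pi * k * \<i>"
proof (cases "n = 1")
  case True
  define z where "z = complex_of_real (- 2 * pi * k) * \<i>"
  define A where "A = mat 1 1 (\<lambda>_. z)"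
  have "A \<in> lie_u 1"
    by (auto simp: lie_u_iff A_def z_def)
  moreover have "mat_exp 1 A = mat 1 1 (\<lambda>_. exp (complex_of_real 1 * z))"
  proof (rule mat_exp_unique[where M = "\<lambda>s. mat 1 1 (\<lambda>_. exp (complex_of_real s * z))"])
    fix s :: real
    have "((\<lambda>x. exp (x * z)) has_field_derivative z * exp (complex_of_real s * z)) (at (complex_of_real s))"
      by (auto intro!: derivative_eq_intros)
    from has_vector_derivative_real_field[OF this, of "{0..1}"]
    show "((\<lambda>r. mat 1 1 (\<lambda>_. exp (complex_of_real r * z)) $$ (i, j)) has_vector_derivative
        (\<Sum>l<1. A $$ (i, l) * mat 1 1 (\<lambda>_. exp (complex_of_real s * z)) $$ (l, j))) (at s within {0..1})"
      if "i < 1" "j < 1" for i j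
      using that by (simp add: A_def)
  qed (auto simp: A_def)
  moreover have "exp z = 1"
    using exp_integer_2pi[of "real_of_int (- k)"] by (simp add: z_def mult_ac)
  moreover have "mat 1 1 (\<lambda>_. 1) = (1\<^sub>m 1 :: complex mat)"
    by (rule eq_matI) auto
  ultimately show ?thesis
    using that[of A] True by (simp add: mat_Z_def A_def z_def)
next
  case False
  then have ij: "0 < n" "1 < n" "(0::nat) \<noteq> 1"
    using n by auto
  define R where "R = - 2 * pi * real_of_int k"
  let ?A = "blk n 0 1 (complex_of_real R * \<i>) (complex_of_real R * 0) (complex_of_real R * 0) (- (complex_of_real R * \<i>))"
  have "?A \<in> lie_su n"
    by (rule blk_lie_su[OF ij]) auto
  moreover have "mat_exp n ?A = 1\<^sub>m n"
  proof -
    have d: "((\<lambda>s. cos (R * s)) has_real_derivative R * (- 1) * sin (R * s)) (at s)"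
      "((\<lambda>s. sin (R * s)) has_real_derivative R * cos (R * s)) (at s)" for s
      by (auto intro!: derivative_eq_intros)
    have cs: "cos R = 1" "sin R = 0"
      using cos_int_2pin[of "- k"] sin_int_2pin[of "- k"] by (simp_all add: R_def mult_ac)
    show ?thesis
      using mat_exp_blk[OF ij _ d, of \<i> 0 0] by (simp add: cs pl_one[of n 0 1, simplified])
  qed
  moreover have "mat_Z n ?A X 0 = - 2 * pi * k * \<i>" for X
    unfolding mat_Z_mv mv_blk[OF ij ij(1)] by (simp add: homog_def R_def)
  ultimately show ?thesis
    using that[of ?A] False by simp
qed

text \<open>If a lift of g is also a Heisenberg translation, comparing the w-coordinates over X = 0
  for all w forces v = 0 and g = 1, so its angle there is an argument of 1 and its shift a period.
  Conversely the loops of \<open>exp_one_matrix\<close> realise every period.\<close>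

lemma C_group_eq:
  assumes n: "1 \<le> n"
  shows "C_group n c = {(\<lambda>p\<in>Nbar n. shift (period c k) p) | k. True}"
proof (intro equalityI subsetI)
  let ?\<aa> = "if n = 1 then lie_u n else lie_su n"
  have su: "?\<aa> \<subseteq> lie_u n"
    by (auto simp: lie_su_def)
  {
    fix \<psi> assume "\<psi> \<in> C_group n c"
    then obtain d e where d: "(d, \<psi>) \<in> beta_graph n c ?\<aa> {}"
      and e: "(e, \<psi>) \<in> beta_graph n c {} (carrier (Heis_group n))"
      unfolding C_group_def H_group_def by (auto split: if_splits)
    obtain g where d': "d = (g, (0\<^sub>v n, 0))" and g: "g \<in> carrier (U_group n)"
      using beta_exp[OF n su d] beta_lift(1)[OF n su _ d] by (cases d) (auto simp: UHeis_simps)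
    obtain v t where e': "e = (1\<^sub>m n, (v, t))" and v: "v \<in> carrier_vec n"
      using beta_heis[OF n e] by (cases e) auto
    have 1: "\<exists>\<theta>. isarg \<theta> (mat_Z n g (coord_X p) 0) \<and> \<psi> p = act n c d \<theta> p" if "p \<in> Nbar n" for p
      using beta_lift(3)[OF n su _ d that] d' by auto
    have 2: "\<psi> p = act n c e 0 p" if "p \<in> Nbar n" for p
      by (rule beta_heis(3)[OF n e that])
    define pt where "pt w = (\<lambda>a\<in>{1..<n}. 0 :: complex, \<lambda>k\<in>{..<n}. w k :: complex, 0 :: real, 1 :: real)" for w
    have pt: "pt w \<in> Nbar n" for w
    proof -
      have "(\<Sum>a\<in>{1..<n}. (cmod ((\<lambda>a\<in>{1..<n}. 0 :: complex) a))\<^sup>2) = (\<Sum>a\<in>{1..<n}. 0)"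
        by (intro sum.cong) auto
      then show ?thesis
        by (simp add: pt_def Nbar_iff CH_ball_def)
    qed
    have w: "mv n (co n g) w k = w k + v $ k / 2" if "k < n" for w k
    proof -
      obtain \<theta> where "act n c d \<theta> (pt w) = act n c e 0 (pt w)"
        using 1[OF pt, of w] 2[OF pt, of w] by auto
      then have "coord_w (act n c d \<theta> (pt w)) k = coord_w (act n c e 0 (pt w)) k"
        by simp
      then have "mv n (co n g) (\<lambda>k\<in>{..<n}. w k) k = w k + v $ k / 2"
        using that by (simp add: d' e' pt_def co_one mv_one)
      moreover have "mv n (co n g) (\<lambda>k\<in>{..<n}. w k) k = mv n (co n g) w k"
        by (intro mv_cong) auto
      ultimately show ?thesis
        by simp
    qed
    have v0: "v = 0\<^sub>v n"
      using w[of _ "\<lambda>_. 0"] v by (intro eq_vecI) (auto simp: mv_def)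
    have "g $$ (k, j) = (if k = j then 1 else 0)" if kj: "k < n" "j < n" for k j
    proof -
      have "mv n (co n g) (\<lambda>l. if j = l then 1 else 0) k = (\<Sum>l<n. (if j = l then 1 else 0) * co n g $$ (k, l))"
        unfolding mv_def by (intro sum.cong) auto
      also have "\<dots> = co n g $$ (k, j)"
        by (rule sum_one[OF kj(2)])
      finally have "sg k * (sg j * cnj (g $$ (k, j))) = (if j = k then 1 else 0)"
        using w[OF kj(1), of "\<lambda>l. if j = l then 1 else 0"] kj v0 by (simp add: co_def mult.assoc)
      then have "cnj (g $$ (k, j)) = sg j * (sg k * (if j = k then 1 else 0))"
        unfolding sg_mult_eq_iff .
      then have "cnj (cnj (g $$ (k, j))) = (if k = j then 1 else 0)"
        by simp
      then show ?thesis
        by simp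
    qed
    then have g1: "g = 1\<^sub>m n"
      using U_carrier_mat[OF g] by (intro eq_matI) auto
    obtain \<theta> where \<theta>: "isarg \<theta> 1" "act n c d \<theta> (pt (\<lambda>_. 0)) = act n c e 0 (pt (\<lambda>_. 0))"
      using 1[OF pt, of "\<lambda>_. 0"] 2[OF pt, of "\<lambda>_. 0"] mat_Z0_one[OF n] g1 by auto
    then have "shift (0 - 2 * c * \<theta>) (pt (\<lambda>_. 0)) = shift (t - 2 * c * 0) (pt (\<lambda>_. 0))"
      by (simp only: d' e' g1 v0 act_one_shift[OF n pt])
    then have t: "t = - 2 * c * \<theta>"
      by (simp add: shift_inject)
    obtain k :: int where "\<theta> = 2 * pi * k"
      using \<theta>(1) by (auto simp: isarg_one_iff)
    then have tk: "t = period c (- k)"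
      by (simp add: t period_def)
    have "\<psi> \<in> extensional (Nbar n)"
      using beta_lift(2)[OF n su _ d] by (auto simp: Bij_def)
    then have "\<psi> = (\<lambda>p\<in>Nbar n. shift (period c (- k)) p)"
      using 2 act_one_shift[OF n] by (auto simp: fun_eq_iff extensional_def e' v0 tk)
    then show "\<psi> \<in> {(\<lambda>p\<in>Nbar n. shift (period c k) p) | k. True}"
      by blast
  }
  {
    fix \<psi> assume "\<psi> \<in> {(\<lambda>p\<in>Nbar n. shift (period c k) p) | k. True}"
    then obtain k where \<psi>: "\<psi> = (\<lambda>p\<in>Nbar n. shift (period c k) p)"
      by blast
    have "\<psi> = (\<lambda>p\<in>Nbar n. act n c (1\<^sub>m n, (0\<^sub>v n, period c k)) 0 p)"
      unfolding \<psi> by (intro restrict_ext) (simp add: act_one_shift[OF n])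
    then have H: "\<psi> \<in> H_group n c"
      unfolding H_group_def using beta_heis_exists[OF n zero_carrier_vec order.refl, of "period c k" c "{}"]
      by (metis image_eqI snd_conv)
    obtain A where AA: "A \<in> ?\<aa>" "mat_exp n A = 1\<^sub>m n" "\<forall>X. mat_Z n A X 0 = - 2 * pi * k * \<i>"
      by (rule exp_one_matrix[OF n, of k])
    have Au: "A \<in> lie_u n"
      using AA(1) su by blast
    interpret su_flow n A
      using n Au by unfold_locales
    obtain \<psi>' where \<psi>': "((mat_exp n A, (0\<^sub>v n, 0)), \<psi>') \<in> beta_graph n c ?\<aa> {}"
        "time_one_map n (alpha n c (A, (0\<^sub>v n, 0))) \<psi>'"
      by (rule beta_exp_exists[OF n AA(1) Au])
    have "\<psi>' p = shift (period c k) p" if p: "p \<in> Nbar n" for p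
      unfolding time_one_map_flow[OF \<psi>'(2) p] flow_def emat_one AA(2) AA(3)[rule_format]
      using p by (simp add: act_one_shift[OF n] period_def mult_ac)
    moreover have "\<psi>' \<in> extensional (Nbar n)"
      using \<psi>'(2) by (auto simp: time_one_map_def Bij_def)
    ultimately have "\<psi>' = \<psi>"
      by (auto simp: \<psi> fun_eq_iff extensional_def)
    then have "\<psi> \<in> snd ` beta_graph n c ?\<aa> {}"
      using \<psi>'(1) by (metis image_eqI snd_conv)
    then show "\<psi> \<in> C_group n c"
      using H by (auto simp: C_group_def)
  }
qed

lemma C_heis_eq:
  assumes n: "1 \<le> n"
  shows "C_heis n c = {(0\<^sub>v n, period c k) | k. True}"
proof (intro equalityI subsetI)
  fix h :: heis assume "h \<in> C_heis n c"
  then obtain \<psi> where \<psi>: "\<psi> \<in> C_group n c" "((1\<^sub>m n, h), \<psi>) \<in> beta_graph n c {} (carrier (Heis_group n))"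
    by (auto simp: C_heis_def)
  obtain k where k: "\<psi> = (\<lambda>p\<in>Nbar n. shift (period c k) p)"
    using \<psi>(1) by (auto simp: C_group_eq[OF n])
  obtain v t where h: "h = (v, t)" and v: "v \<in> carrier_vec n"
    using beta_heis(2)[OF n \<psi>(2)] by auto
  define p where "p = (\<lambda>a\<in>{1..<n}. 0 :: complex, \<lambda>k\<in>{..<n}. 0 :: complex, 0 :: real, 1 :: real)"
  have pN: "p \<in> Nbar n"
    by (simp add: p_def Nbar_iff CH_ball_def)
  have eq: "act n c (1\<^sub>m n, (v, t)) 0 p = shift (period c k) p"
    using beta_heis(3)[OF n \<psi>(2) pN] pN by (simp add: k h)
  have A: "act n c (1\<^sub>m n, (v, t)) 0 p = (\<lambda>a\<in>{1..<n}. 0, \<lambda>k\<in>{..<n}. (\<lambda>k\<in>{..<n}. 0) k + v $ k / 2,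
      0 + omega n v (vec n (\<lambda>k\<in>{..<n}. 0)) + t, 1)"
    unfolding p_def by (rule act_heis[OF n pN[unfolded p_def]])
  have t: "omega n v (vec n (\<lambda>k\<in>{..<n}. 0)) + t = period c k"
    using arg_cong[OF eq, of coord_phi] unfolding A by (simp add: p_def)
  have "v $ j = 0" if "j < n" for j
    using arg_cong[OF eq, of "\<lambda>q. coord_w q j"] that unfolding A by (simp add: p_def)
  then have v0: "v = 0\<^sub>v n"
    using v by (intro eq_vecI) auto
  then show "h \<in> {(0\<^sub>v n, period c k) | k. True}"
    using t n by (auto simp: h omega_zero)
next
  fix h :: heis assume "h \<in> {(0\<^sub>v n, period c k) | k. True}"
  then obtain k where h: "h = (0\<^sub>v n, period c k)"
    by blast
  have "(\<lambda>p\<in>Nbar n. act n c (1\<^sub>m n, h) 0 p) = (\<lambda>p\<in>Nbar n. shift (period c k) p)"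
    unfolding h by (intro restrict_ext) (simp add: act_one_shift[OF n])
  then show "h \<in> C_heis n c"
    unfolding C_heis_def C_group_eq[OF n]
    using beta_heis_exists[OF n zero_carrier_vec order.refl, of "period c k" c "{}"] by (auto simp: h)
qed

lemma C_heis_coset:
  assumes n: "1 \<le> n" and v: "v \<in> carrier_vec n"
  shows "C_heis n c #>\<^bsub>Heis_group n\<^esub> (v, t) = {(v, t + period c k) | k. True}"
  using v n by (auto simp: r_coset_def C_heis_eq[OF n] omega_zero add.commute)

lemma orbit_C:
  assumes n: "1 \<le> n" and p: "p \<in> Nbar n"
  shows "orbit_of (C_group n c) p = {shift (period c k) p | k. True}"
  unfolding orbit_of_def C_group_eq[OF n] setcompr_eq_image image_image using p by simp

lemma orbit_C_shift:
  assumes n: "1 \<le> n" and p: "p \<in> Nbar n"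
  shows "orbit_of (C_group n c) (shift (period c k) p) = orbit_of (C_group n c) p"
proof -
  have pk: "shift (period c k) p \<in> Nbar n"
    using p by simp
  show ?thesis
  proof (intro equalityI subsetI)
    fix y assume "y \<in> orbit_of (C_group n c) (shift (period c k) p)"
    then obtain i where "y = shift (period c (i + k)) p"
      by (auto simp: orbit_C[OF n pk] period_simps)
    then show "y \<in> orbit_of (C_group n c) p"
      unfolding orbit_C[OF n p] by blast
  next
    fix y assume "y \<in> orbit_of (C_group n c) p"
    then obtain i where "y = shift (period c (i - k)) (shift (period c k) p)"
      by (auto simp: orbit_C[OF n p] period_simps)
    then show "y \<in> orbit_of (C_group n c) (shift (period c k) p)"
      unfolding orbit_C[OF n pk] by blast
  qed
qed

section \<open>The quasi-action and the orbits of \<open>\<Gamma>\<close>\<close>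

text \<open>An argument of (g Z)^0 from which that of g_00 is split off. The remaining ratio tends
  to 1 as X tends to 0, so for fixed g the choice is continuous at X = 0 whatever g_00 is;
  \<open>origin_fixed\<close> relies on this. The bound 2 pi enters the cells of the counting
  argument.\<close>

definition Theta :: "nat \<Rightarrow> complex mat \<Rightarrow> (nat \<Rightarrow> complex) \<Rightarrow> real" where
  "Theta n g X = Arg (g $$ (0, 0)) + Arg (mat_Z n g X 0 / g $$ (0, 0))"

definition qact :: "nat \<Rightarrow> real \<Rightarrow> complex mat \<times> heis \<Rightarrow> coords \<Rightarrow> coords" where
  "qact n c d p = act n c d (Theta n (fst d) (coord_X p)) p"

lemma U_entry00_nonzero:
  assumes "1 \<le> n" "g \<in> carrier (U_group n)"
  shows "g $$ (0, 0) \<noteq> 0"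
proof -
  have "mat_Z n g (\<lambda>_. 0) 0 = (\<Sum>j<n. if j = 0 then g $$ (0, 0) else 0)"
    unfolding mat_Z_def by (intro sum.cong) auto
  also have "\<dots> = g $$ (0, 0)"
    using assms(1) by simp
  finally show ?thesis
    using mat_Z0_nonzero[OF assms, of "\<lambda>_. 0"] by (simp add: CH_ball_def)
qed

lemma isarg_Arg: "isarg (Arg z) z"
  by (cases "z = 0") (auto simp: isarg_cis cis_Arg)

lemma isarg_Theta:
  assumes "1 \<le> n" "g \<in> carrier (U_group n)"
  shows "isarg (Theta n g X) (mat_Z n g X 0)"
  using isarg_mult[OF isarg_Arg isarg_Arg, of "g $$ (0, 0)" "mat_Z n g X 0 / g $$ (0, 0)"]
    U_entry00_nonzero[OF assms] by (simp add: Theta_def)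

lemma Theta_bound: "\<bar>Theta n g X\<bar> \<le> 2 * pi"
  using Arg_bounded[of "g $$ (0, 0)"] Arg_bounded[of "mat_Z n g X 0 / g $$ (0, 0)"]
  unfolding Theta_def by linarith

lemma act_eq_qact:
  assumes n: "1 \<le> n" and d: "d \<in> carrier (UHeis n)" and p: "p \<in> Nbar n"
    and \<theta>: "isarg \<theta> (mat_Z n (fst d) (coord_X p) 0)"
  obtains k where "act n c d \<theta> p = shift (period c k) (qact n c d p)"
proof -
  have g: "fst d \<in> carrier (U_group n)"
    using d by (auto simp: UHeis_simps)
  obtain k :: int where "\<theta> = Theta n (fst d) (coord_X p) + 2 * pi * k"
    by (rule isarg_unique[OF \<theta> isarg_Theta[OF n g] mat_Z0_nonzero[OF n g Nbar_ball[OF p]]])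
  then have "act n c d \<theta> p = shift (period c (- k)) (qact n c d p)"
    unfolding qact_def by (subst act_arg[of _ _ _ \<theta> _ "Theta n (fst d) (coord_X p)"]) (simp add: period_def mult_ac)
  then show ?thesis
    by (rule that)
qed

lemma qact_Nbar: "1 \<le> n \<Longrightarrow> d \<in> carrier (UHeis n) \<Longrightarrow> p \<in> Nbar n \<Longrightarrow> qact n c d p \<in> Nbar n"
  unfolding qact_def by (rule act_Nbar)

lemma qact_shift: "qact n c d (shift s p) = shift s (qact n c d p)"
  by (simp add: qact_def act_shift)

lemma qact_central: "qact n c (g, (v, t + s)) p = shift s (qact n c (g, (v, t)) p)"
  by (simp add: qact_def act_central)

text \<open>The sum of the two chosen angles is an argument of the automorphy factor of the product,
  but not necessarily the chosen one; the integer k depends on the point.\<close>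

lemma qact_qact:
  assumes n: "1 \<le> n" and d: "d \<in> carrier (UHeis n)" "d' \<in> carrier (UHeis n)" and p: "p \<in> Nbar n"
  obtains k where "qact n c d' (qact n c d p) = shift (period c k) (qact n c (d' \<otimes>\<^bsub>UHeis n\<^esub> d) p)"
proof -
  have g: "fst d \<in> carrier (U_group n)" "fst d' \<in> carrier (U_group n)"
    using d by (auto simp: UHeis_simps)
  have f: "fst (d' \<otimes>\<^bsub>UHeis n\<^esub> d) = fst d' * fst d"
    using g by (cases d; cases d') (auto simp: UHeis_simps)
  let ?\<theta> = "Theta n (fst d') (projX n (fst d) (coord_X p)) + Theta n (fst d) (coord_X p)"
  have "isarg ?\<theta> (mat_Z n (fst d') (projX n (fst d) (coord_X p)) 0 * mat_Z n (fst d) (coord_X p) 0)"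
    by (intro isarg_mult isarg_Theta n g)
  then have "isarg ?\<theta> (mat_Z n (fst (d' \<otimes>\<^bsub>UHeis n\<^esub> d)) (coord_X p) 0)"
    unfolding f using mat_Z0_mult[OF n g(1) U_carrier_mat[OF g(2)] Nbar_ball[OF p]] by simp
  moreover have "d' \<otimes>\<^bsub>UHeis n\<^esub> d \<in> carrier (UHeis n)"
    using group.is_monoid[OF group_UHeis[OF n]] d by (intro monoid.m_closed)
  ultimately obtain k where "act n c (d' \<otimes>\<^bsub>UHeis n\<^esub> d) ?\<theta> p = shift (period c k) (qact n c (d' \<otimes>\<^bsub>UHeis n\<^esub> d) p)"
    using act_eq_qact[OF n _ p] by metis
  moreover have "qact n c d' (qact n c d p) = act n c (d' \<otimes>\<^bsub>UHeis n\<^esub> d) ?\<theta> p"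
    unfolding qact_def coord_act by (rule act_act[OF n d p])
  ultimately show ?thesis
    using that by simp
qed

lemma qact_one:
  assumes n: "1 \<le> n" and p: "p \<in> Nbar n"
  shows "qact n c (1\<^sub>m n, (0\<^sub>v n, t)) p = shift t p"
  using n p mat_Z0_one[OF n] by (simp add: qact_def act_one_shift Theta_def)

lemma beta_SUHeis_qact:
  assumes n: "1 \<le> n" and b: "(d, \<psi>) \<in> beta_SUHeis n c" and p: "p \<in> Nbar n"
  obtains k where "\<psi> p = shift (period c k) (qact n c d p)"
proof -
  have su: "lie_su n \<subseteq> lie_u n"
    by (auto simp: lie_su_def)
  obtain \<theta> where "isarg \<theta> (mat_Z n (fst d) (coord_X p) 0)" "\<psi> p = act n c d \<theta> p"
    using beta_lift(3)[OF n su _ b p] by auto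
  then show ?thesis
    using act_eq_qact[OF n beta_lift(1)[OF n su order.refl b] p] that by metis
qed

text \<open>The coset of h and the orbit of p are both closed under periods, which absorbs every
  choice of branch. For the second inclusion an arbitrary lift is corrected by the central
  translation through the period k - j.\<close>

lemma hat_action_orbit:
  assumes n: "1 \<le> n" and d: "(g, h) \<in> carrier (SUHeis n)" and p: "p \<in> Nbar n"
  shows "hat_action n c (g, C_heis n c #>\<^bsub>Heis_group n\<^esub> h) (orbit_of (C_group n c) p) =
    orbit_of (C_group n c) (qact n c (g, h) p)"
proof -
  obtain v t where h: "h = (v, t)" and v: "v \<in> carrier_vec n" and g: "g \<in> carrier (SU_group n)"
    using d by (auto simp: SUHeis_simps)
  have dU: "(g, h) \<in> carrier (UHeis n)"
    by (rule SUHeis_UHeis[OF d])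
  have q: "qact n c (g, h) p \<in> Nbar n"
    by (rule qact_Nbar[OF n dU p])
  show ?thesis
  proof (intro equalityI subsetI)
    fix y assume "y \<in> hat_action n c (g, C_heis n c #>\<^bsub>Heis_group n\<^esub> h) (orbit_of (C_group n c) p)"
    then obtain \<psi> j m where y: "y = \<psi> (shift (period c j) p)"
      and b: "((g, (v, t + period c m)), \<psi>) \<in> beta_SUHeis n c"
      by (auto simp: hat_action_def orbit_C[OF n p] h C_heis_coset[OF n v])
    obtain k where "\<psi> (shift (period c j) p) = shift (period c k) (qact n c (g, (v, t + period c m)) (shift (period c j) p))"
      by (rule beta_SUHeis_qact[OF n b, of "shift (period c j) p"]) (simp_all add: p)
    then have "y = shift (period c (k + (m + j))) (qact n c (g, h) p)"
      by (simp add: y h qact_shift qact_central period_simps add_ac)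
    then show "y \<in> orbit_of (C_group n c) (qact n c (g, h) p)"
      by (auto simp: orbit_C[OF n q])
  next
    fix y assume "y \<in> orbit_of (C_group n c) (qact n c (g, h) p)"
    then obtain k where y: "y = shift (period c k) (qact n c (g, h) p)"
      by (auto simp: orbit_C[OF n q])
    obtain \<psi> where b: "((g, h), \<psi>) \<in> beta_SUHeis n c"
      using beta_SUHeis_exists[OF n d] by blast
    have bij: "\<psi> \<in> Bij (Nbar n)"
      using beta_lift(2)[OF n _ _ b] by (auto simp: lie_su_def)
    obtain j where j: "\<psi> p = shift (period c j) (qact n c (g, h) p)"
      by (rule beta_SUHeis_qact[OF n b p])
    have su: "lie_su n \<subseteq> lie_u n"
      by (auto simp: lie_su_def)
    have hh: "(v, t + period c (k - j)) \<in> C_heis n c #>\<^bsub>Heis_group n\<^esub> h"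
      by (auto simp: h C_heis_coset[OF n v])
    have \<tau>: "((1\<^sub>m n, (0\<^sub>v n, period c (k - j))), \<lambda>p\<in>Nbar n. act n c (1\<^sub>m n, (0\<^sub>v n, period c (k - j))) 0 p) \<in> beta_SUHeis n c"
      by (rule beta_heis_exists[OF n zero_carrier_vec order.refl])
    from beta_mult[OF \<tau> b]
    have "((1\<^sub>m n, (0\<^sub>v n, period c (k - j))) \<otimes>\<^bsub>UHeis n\<^esub> (g, h),
        compose (Nbar n) (\<lambda>p\<in>Nbar n. act n c (1\<^sub>m n, (0\<^sub>v n, period c (k - j))) 0 p) \<psi>) \<in> beta_SUHeis n c"
      using bij beta_lift(2)[OF n su order.refl \<tau>] by (simp add: BijGroup_simps)
    moreover have "(1\<^sub>m n, (0\<^sub>v n, period c (k - j))) \<otimes>\<^bsub>UHeis n\<^esub> (g, h) = (g, (v, t + period c (k - j)))"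
      using v n U_carrier_mat[OF SU_U[OF g]] by (simp add: h UHeis_simps co_one omega_zero)
    moreover have "compose (Nbar n) (\<lambda>p\<in>Nbar n. act n c (1\<^sub>m n, (0\<^sub>v n, period c (k - j))) 0 p) \<psi> p = y"
    proof -
      have "\<psi> p \<in> Nbar n"
        using Bij_imp_funcset[OF bij] p by blast
      then show ?thesis
        using p by (simp add: compose_def act_one_shift[OF n]) (simp add: j y period_simps)
    qed
    moreover have "p \<in> orbit_of (C_group n c) p"
      unfolding orbit_C[OF n p] using period_simps(4) by (metis (mono_tags, lifting) mem_Collect_eq shift_zero)
    ultimately show "y \<in> hat_action n c (g, C_heis n c #>\<^bsub>Heis_group n\<^esub> h) (orbit_of (C_group n c) p)"
      unfolding hat_action_def mem_Collect_eq using hh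
      by (intro exI[of _ "compose (Nbar n) (\<lambda>p\<in>Nbar n. act n c (1\<^sub>m n, (0\<^sub>v n, period c (k - j))) 0 p) \<psi>"]
          exI[of _ p] exI[of _ "(v, t + period c (k - j))"]) simp
  qed
qed

lemma orbit_C_refl: "1 \<le> n \<Longrightarrow> p \<in> Nbar n \<Longrightarrow> p \<in> orbit_of (C_group n c) p"
  by (subst orbit_C) (auto intro!: exI[of _ 0] simp: period_simps)

text \<open>Freeness on \<open>Nhat\<close> translated to the covering space: an element of the
  lattice that fixes a point up to a period is itself a period.\<close>

lemma free_action:
  assumes n: "1 \<le> n" and \<Gamma>: "\<Gamma>\<^sub>t \<subseteq> carrier (SUHeis n)"
    and free: "acts_freely_on_Nhat n c (Gamma_hat n c \<Gamma>\<^sub>t)"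
    and d: "d \<in> \<Gamma>\<^sub>t" and p: "p \<in> Nbar n" and stab: "qact n c d p = shift (period c k) p"
  obtains j where "d = (1\<^sub>m n, (0\<^sub>v n, period c j))"
proof -
  obtain g v t where d': "d = (g, (v, t))" and v: "v \<in> carrier_vec n"
    using d \<Gamma> by (cases d) (auto simp: SUHeis_simps)
  let ?\<gamma> = "(g, C_heis n c #>\<^bsub>Heis_group n\<^esub> (v, t))"
  have "hat_action n c ?\<gamma> (orbit_of (C_group n c) p) = orbit_of (C_group n c) p"
    using hat_action_orbit[OF n _ p, of g "(v, t)" c] d \<Gamma> stab orbit_C_shift[OF n p, of c k] by (auto simp: d')
  moreover have "?\<gamma> \<in> Gamma_hat n c \<Gamma>\<^sub>t"
    using d by (auto simp: Gamma_hat_def d' intro!: image_eqI[of _ _ d])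
  moreover have "orbit_of (C_group n c) p \<in> Nhat n c"
    using p by (simp add: Nhat_def)
  ultimately have "?\<gamma> = \<one>\<^bsub>SUHeis_mod_C n c\<^esub>"
    using free unfolding acts_freely_on_Nhat_def by blast
  then have g: "g = 1\<^sub>m n" and C: "C_heis n c #>\<^bsub>Heis_group n\<^esub> (v, t) = C_heis n c"
    by (auto simp: SUHeis_mod_C_def semidirect_def FactGroup_def)
  have "(v, t) \<in> C_heis n c #>\<^bsub>Heis_group n\<^esub> (v, t)"
    unfolding C_heis_coset[OF n v] using period_simps(4)[of c] by (auto intro!: exI[of _ 0])
  then obtain j where "v = 0\<^sub>v n" "t = period c j"
    unfolding C by (auto simp: C_heis_eq[OF n])
  then show ?thesis
    using that g d' by blast
qed

text \<open>The orbit of p under the lifted group, written without lifts; see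
  \<open>Gamma_orbit\<close>.\<close>

definition orb :: "nat \<Rightarrow> real \<Rightarrow> (complex mat \<times> heis) set \<Rightarrow> coords \<Rightarrow> coords set" where
  "orb n c D p = {shift (period c k) (qact n c d p) | k d. d \<in> D}"

text \<open>In one direction the defining property of \<open>Gamma_group\<close> compares orbits of
  \<open>C_group\<close>, which consist of period shifts. In the other a lift of d is composed with
  a period translation so that it hits the prescribed point exactly.\<close>

lemma Gamma_orbit:
  assumes n: "1 \<le> n" and \<Gamma>: "\<Gamma>\<^sub>t \<subseteq> carrier (SUHeis n)" and p: "p \<in> Nbar n"
  shows "orbit_of (Gamma_group n c \<Gamma>\<^sub>t) p = orb n c \<Gamma>\<^sub>t p"
proof (intro equalityI subsetI)
  have su: "lie_su n \<subseteq> lie_u n"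
    by (auto simp: lie_su_def)
  have CB: "(\<lambda>p\<in>Nbar n. shift (period c k) p) \<in> Bij (Nbar n)" for k
  proof -
    have "((1\<^sub>m n, (0\<^sub>v n, period c k)), \<lambda>p\<in>Nbar n. act n c (1\<^sub>m n, (0\<^sub>v n, period c k)) 0 p) \<in> beta_SUHeis n c"
      by (rule beta_heis_exists[OF n zero_carrier_vec order.refl])
    from beta_lift(2)[OF n su order.refl this]
    have "(\<lambda>p\<in>Nbar n. act n c (1\<^sub>m n, (0\<^sub>v n, period c k)) 0 p) \<in> Bij (Nbar n)" .
    also have "(\<lambda>p\<in>Nbar n. act n c (1\<^sub>m n, (0\<^sub>v n, period c k)) 0 p) = (\<lambda>p\<in>Nbar n. shift (period c k) p)"
      by (intro restrict_ext) (simp add: act_one_shift[OF n])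
    finally show ?thesis .
  qed
  {
    fix y assume "y \<in> orbit_of (Gamma_group n c \<Gamma>\<^sub>t) p"
    then obtain \<psi> where \<psi>: "\<psi> \<in> Gamma_group n c \<Gamma>\<^sub>t" and y: "y = \<psi> p"
      by (auto simp: orbit_of_def)
    obtain \<gamma> where \<gamma>: "\<gamma> \<in> Gamma_hat n c \<Gamma>\<^sub>t"
      "\<And>p. p \<in> Nbar n \<Longrightarrow> orbit_of (C_group n c) (\<psi> p) = hat_action n c \<gamma> (orbit_of (C_group n c) p)"
      using \<psi> unfolding Gamma_group_def by blast
    obtain g h where d: "(g, h) \<in> \<Gamma>\<^sub>t" "\<gamma> = (g, C_heis n c #>\<^bsub>Heis_group n\<^esub> h)"
      using \<gamma>(1) by (auto simp: Gamma_hat_def)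
    have dS: "(g, h) \<in> carrier (SUHeis n)"
      using d \<Gamma> by blast
    obtain e \<psi>1 k where e: "(e, \<psi>1) \<in> beta_SUHeis n c" "\<psi> = \<psi>1 \<otimes>\<^bsub>BijGroup (Nbar n)\<^esub> (\<lambda>p\<in>Nbar n. shift (period c k) p)"
      using \<psi> by (auto simp: Gamma_group_def set_mult_def C_group_eq[OF n])
    have b1: "\<psi>1 \<in> Bij (Nbar n)"
      by (rule beta_lift(2)[OF n su order.refl e(1)])
    have "\<psi> \<in> Bij (Nbar n)"
      unfolding e(2) using b1 CB by (simp add: BijGroup_simps compose_Bij)
    then have yN: "y \<in> Nbar n"
      using Bij_imp_funcset p y by blast
    have "y \<in> orbit_of (C_group n c) y"
      by (rule orbit_C_refl[OF n yN])
    also have "\<dots> = orbit_of (C_group n c) (qact n c (g, h) p)"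
      unfolding y \<gamma>(2)[OF p] d(2) by (rule hat_action_orbit[OF n dS p])
    finally obtain k where "y = shift (period c k) (qact n c (g, h) p)"
      by (auto simp: orbit_C[OF n qact_Nbar[OF n SUHeis_UHeis[OF dS] p]])
    then show "y \<in> orb n c \<Gamma>\<^sub>t p"
      using d(1) unfolding orb_def by blast
  }
  {
    fix y assume "y \<in> orb n c \<Gamma>\<^sub>t p"
    then obtain k d where y: "y = shift (period c k) (qact n c d p)" and d: "d \<in> \<Gamma>\<^sub>t"
      by (auto simp: orb_def)
    obtain g h where d': "d = (g, h)"
      by (cases d)
    have dS: "d \<in> carrier (SUHeis n)"
      using d \<Gamma> by blast
    note dU = SUHeis_UHeis[OF dS]
    obtain \<psi> where b: "(d, \<psi>) \<in> beta_SUHeis n c"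
      using beta_SUHeis_exists[OF n dS] by blast
    have bij: "\<psi> \<in> Bij (Nbar n)"
      by (rule beta_lift(2)[OF n su order.refl b])
    obtain \<theta> where \<theta>: "isarg \<theta> (mat_Z n (fst d) (coord_X p) 0)" "\<psi> p = act n c d \<theta> p"
      using beta_lift(3)[OF n su order.refl b p] by auto
    obtain j where j: "\<psi> p = shift (period c j) (qact n c d p)"
      using act_eq_qact[OF n dU p \<theta>(1)] \<theta>(2) by metis
    let ?e = "(1\<^sub>m n, (0\<^sub>v n, period c (k - j)))"
    let ?\<tau> = "\<lambda>p\<in>Nbar n. act n c ?e 0 p"
    have \<tau>: "(?e, ?\<tau>) \<in> beta_SUHeis n c"
      by (rule beta_heis_exists[OF n zero_carrier_vec order.refl])
    have \<tau>B: "?\<tau> \<in> Bij (Nbar n)"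
      by (rule beta_lift(2)[OF n su order.refl \<tau>])
    let ?\<psi>' = "compose (Nbar n) ?\<tau> \<psi>"
    have "(?e \<otimes>\<^bsub>UHeis n\<^esub> d, ?\<psi>') \<in> beta_SUHeis n c"
      using beta_mult[OF \<tau> b] \<tau>B bij by (simp add: BijGroup_simps)
    then have b': "?\<psi>' \<in> snd ` beta_SUHeis n c"
      by (metis image_eqI snd_conv)
    have \<psi>'B: "?\<psi>' \<in> Bij (Nbar n)"
      by (rule compose_Bij[OF \<tau>B bij])
    have "?\<psi>' = ?\<psi>' \<otimes>\<^bsub>BijGroup (Nbar n)\<^esub> (\<lambda>p\<in>Nbar n. p)"
      using monoid.r_one[OF group.is_monoid[OF group_BijGroup], of ?\<psi>' "Nbar n"] \<psi>'B
      unfolding BijGroup_simps by simp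
    moreover have "(\<lambda>p\<in>Nbar n. p) \<in> C_group n c"
      unfolding C_group_eq[OF n] by (rule CollectI, rule exI[of _ 0]) (auto simp: period_simps)
    ultimately have mem: "?\<psi>' \<in> snd ` beta_SUHeis n c <#>\<^bsub>BijGroup (Nbar n)\<^esub> C_group n c"
      using b' unfolding set_mult_def by blast
    have qN: "\<psi> q \<in> Nbar n" if "q \<in> Nbar n" for q
      using Bij_imp_funcset[OF bij] that by blast
    have val: "?\<psi>' q = shift (period c (k - j)) (\<psi> q)" if q: "q \<in> Nbar n" for q
      using q qN[OF q] by (simp add: compose_def act_one_shift[OF n])
    have "orbit_of (C_group n c) (?\<psi>' q) =
        hat_action n c (g, C_heis n c #>\<^bsub>Heis_group n\<^esub> h) (orbit_of (C_group n c) q)" if q: "q \<in> Nbar n" for q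
    proof -
      obtain m where m: "\<psi> q = shift (period c m) (qact n c d q)"
        by (rule beta_SUHeis_qact[OF n b q])
      have "orbit_of (C_group n c) (?\<psi>' q) = orbit_of (C_group n c) (\<psi> q)"
        unfolding val[OF q] by (rule orbit_C_shift[OF n qN[OF q]])
      also have "\<dots> = orbit_of (C_group n c) (qact n c d q)"
        unfolding m by (rule orbit_C_shift[OF n qact_Nbar[OF n dU q]])
      finally show ?thesis
        using hat_action_orbit[OF n _ q, of g h c] dS by (simp add: d')
    qed
    moreover have "(g, C_heis n c #>\<^bsub>Heis_group n\<^esub> h) \<in> Gamma_hat n c \<Gamma>\<^sub>t"
      using d by (auto simp: Gamma_hat_def d' intro!: image_eqI[of _ _ d])
    ultimately have "?\<psi>' \<in> Gamma_group n c \<Gamma>\<^sub>t"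
      using mem unfolding Gamma_group_def by blast
    moreover have "?\<psi>' p = y"
      unfolding val[OF p] j y by (simp add: period_simps)
    ultimately show "y \<in> orbit_of (Gamma_group n c \<Gamma>\<^sub>t) p"
      unfolding orbit_of_def by blast
  }
qed

lemma orb_subset:
  assumes n: "1 \<le> n" and D: "subgroup D (SUHeis n)" and p: "p \<in> Nbar n" and q: "q \<in> orb n c D p"
  shows "orb n c D q \<subseteq> orb n c D p"
proof
  have DS: "d \<in> carrier (SUHeis n)" if "d \<in> D" for d
    using subgroup.subset[OF D] that by blast
  fix y assume "y \<in> orb n c D q"
  then obtain k d where y: "y = shift (period c k) (qact n c d q)" and d: "d \<in> D"
    by (auto simp: orb_def)
  obtain l e where q': "q = shift (period c l) (qact n c e p)" and e: "e \<in> D"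
    using q by (auto simp: orb_def)
  obtain j where "qact n c d (qact n c e p) = shift (period c j) (qact n c (d \<otimes>\<^bsub>UHeis n\<^esub> e) p)"
    by (rule qact_qact[OF n SUHeis_UHeis[OF DS[OF e]] SUHeis_UHeis[OF DS[OF d]] p])
  then have "y = shift (period c (k + (l + j))) (qact n c (d \<otimes>\<^bsub>SUHeis n\<^esub> e) p)"
    by (simp add: y q' qact_shift period_simps SUHeis_mult_eq[OF DS[OF d]])
  then show "y \<in> orb n c D p"
    using subgroup.m_closed[OF D d e] unfolding orb_def by blast
qed

lemma orb_refl:
  assumes n: "1 \<le> n" and D: "subgroup D (SUHeis n)" and p: "p \<in> Nbar n"
  shows "p \<in> orb n c D p"
proof -
  have "p = shift (period c 0) (qact n c (1\<^sub>m n, (0\<^sub>v n, 0)) p)"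
    by (simp add: qact_one[OF n p] period_simps)
  moreover have "(1\<^sub>m n, (0\<^sub>v n, 0)) \<in> D"
    using subgroup.one_closed[OF D] by (simp add: SUHeis_simps)
  ultimately show ?thesis
    unfolding orb_def by blast
qed

lemma orb_eq:
  assumes n: "1 \<le> n" and D: "subgroup D (SUHeis n)" and p: "p \<in> Nbar n" and q: "q \<in> orb n c D p"
  shows "orb n c D q = orb n c D p"
proof
  have DS: "d \<in> carrier (SUHeis n)" if "d \<in> D" for d
    using subgroup.subset[OF D] that by blast
  show "orb n c D q \<subseteq> orb n c D p"
    by (rule orb_subset[OF assms])
  obtain l e where q': "q = shift (period c l) (qact n c e p)" and e: "e \<in> D"
    using q by (auto simp: orb_def)
  have eU: "e \<in> carrier (UHeis n)"
    by (rule SUHeis_UHeis[OF DS[OF e]])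
  have qN: "q \<in> Nbar n"
    by (simp add: q' qact_Nbar[OF n eU p])
  have i: "iinv n e \<in> D"
    using subgroup.m_inv_closed[OF D e] iinv_SUHeis(2)[OF n DS[OF e]] by simp
  obtain j where "qact n c (iinv n e) (qact n c e p) = shift (period c j) (qact n c (iinv n e \<otimes>\<^bsub>UHeis n\<^esub> e) p)"
    by (rule qact_qact[OF n eU iinv_UHeis(1)[OF n eU] p])
  then have "qact n c (iinv n e) q = shift (period c (l + j)) p"
    using qact_one[OF n p, of c 0] by (simp add: q' qact_shift iinv_UHeis(2)[OF n eU] UHeis_simps period_simps)
  then have "p = shift (period c (- (l + j))) (qact n c (iinv n e) q)"
    by (simp add: period_simps)
  then have "p \<in> orb n c D q"
    unfolding orb_def using i by blast
  then show "orb n c D p \<subseteq> orb n c D q"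
    by (rule orb_subset[OF n D qN])
qed

section \<open>The volume density\<close>

definition rank1 :: "nat \<Rightarrow> (nat \<Rightarrow> real) \<Rightarrow> (nat \<Rightarrow> real) \<Rightarrow> real mat" where
  "rank1 N u v = mat N N (\<lambda>(i, j). (if i = j then 1 else 0) + u i * v j)"

lemma rank1_carrier [simp]: "rank1 N u v \<in> carrier_mat N N"
  by (simp add: rank1_def)

lemma real_mult_mat_entry:
  fixes M :: "real mat"
  shows "M \<in> carrier_mat n m \<Longrightarrow> N \<in> carrier_mat m k \<Longrightarrow> i < n \<Longrightarrow> j < k \<Longrightarrow>
    (M * N) $$ (i, j) = (\<Sum>l<m. M $$ (i, l) * N $$ (l, j))"
  by (simp add: scalar_prod_def atLeast0LessThan)

text \<open>Sylvester's identity \<open>det (1 + U V) = det (1 + V U)\<close> for a column \<open>U\<close> and a row \<open>V\<close>, read off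
  from two triangular factorisations of a bordered matrix.\<close>

lemma det_rank1: "det (rank1 N u v) = 1 + (\<Sum>i<N. v i * u i)"
proof -
  let ?U = "mat N 1 (\<lambda>(i, j). u i)" and ?V = "mat 1 N (\<lambda>(i, j). v j)"
  let ?M = "four_block_mat (1\<^sub>m N) (- ?U) ?V (1\<^sub>m 1) :: real mat"
  let ?P = "four_block_mat (1\<^sub>m N) ?U (0\<^sub>m 1 N) (1\<^sub>m 1) :: real mat"
  let ?Q = "four_block_mat (1\<^sub>m N) (0\<^sub>m N 1) (- ?V) (1\<^sub>m 1) :: real mat"
  have c: "?M \<in> carrier_mat (N + 1) (N + 1)" "?P \<in> carrier_mat (N + 1) (N + 1)" "?Q \<in> carrier_mat (N + 1) (N + 1)"
    by auto
  have "?M * ?P = four_block_mat (1\<^sub>m N * 1\<^sub>m N + - ?U * 0\<^sub>m 1 N) (1\<^sub>m N * ?U + - ?U * 1\<^sub>m 1)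
      (?V * 1\<^sub>m N + 1\<^sub>m 1 * 0\<^sub>m 1 N) (?V * ?U + 1\<^sub>m 1 * 1\<^sub>m 1)"
    by (rule mult_four_block_mat) auto
  also have "\<dots> = four_block_mat (1\<^sub>m N) (0\<^sub>m N 1) ?V (?V * ?U + 1\<^sub>m 1)"
    by (intro arg_cong2[where f = "\<lambda>a b. four_block_mat (1\<^sub>m N) a b (?V * ?U + 1\<^sub>m 1)"] eq_matI
        cong_four_block_mat) (auto simp: uminus_mult_left_mat)
  finally have MP: "?M * ?P = four_block_mat (1\<^sub>m N) (0\<^sub>m N 1) ?V (?V * ?U + 1\<^sub>m 1)" .
  have "?M * ?Q = four_block_mat (1\<^sub>m N * 1\<^sub>m N + - ?U * - ?V) (1\<^sub>m N * 0\<^sub>m N 1 + - ?U * 1\<^sub>m 1)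
      (?V * 1\<^sub>m N + 1\<^sub>m 1 * - ?V) (?V * 0\<^sub>m N 1 + 1\<^sub>m 1 * 1\<^sub>m 1)"
    by (rule mult_four_block_mat) auto
  also have "\<dots> = four_block_mat (rank1 N u v) (- ?U) (0\<^sub>m 1 N) (1\<^sub>m 1)"
    by (intro cong_four_block_mat eq_matI) (auto simp: rank1_def scalar_prod_def)
  finally have MQ: "?M * ?Q = four_block_mat (rank1 N u v) (- ?U) (0\<^sub>m 1 N) (1\<^sub>m 1)" .
  have "det ?P = 1" "det ?Q = 1"
    by (subst det_four_block_mat_lower_left_zero[where n = N and m = 1], auto)
       (subst det_four_block_mat_upper_right_zero[where n = N and m = 1], auto)
  then have "det (four_block_mat (1\<^sub>m N) (0\<^sub>m N 1) ?V (?V * ?U + 1\<^sub>m 1)) =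
      det (four_block_mat (rank1 N u v) (- ?U) (0\<^sub>m 1 N) (1\<^sub>m 1))"
    using det_mult[OF c(1,2)] det_mult[OF c(1,3)] by (simp only: MP MQ)
  moreover have "det (four_block_mat (1\<^sub>m N) (0\<^sub>m N 1) ?V (?V * ?U + 1\<^sub>m 1)) = det (?V * ?U + 1\<^sub>m 1)"
    by (subst det_four_block_mat_upper_right_zero[where n = N and m = 1]) auto
  moreover have "det (four_block_mat (rank1 N u v) (- ?U) (0\<^sub>m 1 N) (1\<^sub>m 1)) = det (rank1 N u v)"
    by (subst det_four_block_mat_lower_left_zero[where n = N and m = 1]) auto
  moreover have "det (?V * ?U + 1\<^sub>m 1) = 1 + (\<Sum>i<N. v i * u i)"
    by (subst det_single) (auto simp: scalar_prod_def atLeast0LessThan)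
  ultimately show ?thesis
    by simp
qed

lemma rank1_mult_left:
  assumes "M \<in> carrier_mat N N" "i < N" "j < N"
  shows "(rank1 N u v * M) $$ (i, j) = M $$ (i, j) + u i * (\<Sum>l<N. v l * M $$ (l, j))"
proof -
  have "(rank1 N u v * M) $$ (i, j) = (\<Sum>l<N. (if l = i then M $$ (i, j) else 0) + u i * (v l * M $$ (l, j)))"
    unfolding real_mult_mat_entry[OF rank1_carrier assms]
    using assms by (intro sum.cong) (auto simp: rank1_def algebra_simps)
  then show ?thesis
    using assms by (simp add: sum.distrib sum_distrib_left)
qed

lemma rank1_mult_right:
  assumes "M \<in> carrier_mat N N" "i < N" "j < N"
  shows "(M * rank1 N u v) $$ (i, j) = M $$ (i, j) + (\<Sum>l<N. M $$ (i, l) * u l) * v j"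
proof -
  have "(M * rank1 N u v) $$ (i, j) = (\<Sum>l<N. (if l = j then M $$ (i, j) else 0) + M $$ (i, l) * u l * v j)"
    unfolding real_mult_mat_entry[OF assms(1) rank1_carrier assms(2,3)]
    using assms by (intro sum.cong) (auto simp: rank1_def algebra_simps)
  then show ?thesis
    using assms by (simp add: sum.distrib sum_distrib_right)
qed

text \<open>If the pairings of v_m with u_l vanish for m different from l, the product of the
  matrices 1 + u_m v_m^T has no mixed terms and equals 1 plus the sum, so \<open>det_rank1\<close>
  applies factor by factor.\<close>

lemma det_orthogonal_rank1_sum:
  fixes u v :: "'m \<Rightarrow> nat \<Rightarrow> real"
  assumes "finite F" and "\<And>m l. m \<in> F \<Longrightarrow> l \<in> F \<Longrightarrow> m \<noteq> l \<Longrightarrow> (\<Sum>i<N. v m i * u l i) = 0"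
  shows "det (mat N N (\<lambda>(i, j). (if i = j then 1 else 0) + (\<Sum>m\<in>F. u m i * v m j))) =
    (\<Prod>m\<in>F. 1 + (\<Sum>i<N. v m i * u m i))"
  using assms
proof (induction F)
  case empty
  have "mat N N (\<lambda>(i, j). (if i = j then 1 else 0) + (\<Sum>m\<in>{}. u m i * v m j)) = (1\<^sub>m N :: real mat)"
    by (rule eq_matI) auto
  then show ?case
    by simp
next
  case (insert a F)
  let ?S = "mat N N (\<lambda>(i, j). (if i = j then 1 else 0) + (\<Sum>m\<in>F. u m i * v m j))"
  have S: "?S \<in> carrier_mat N N"
    by simp
  have Su: "(\<Sum>l<N. ?S $$ (i, l) * u a l) = u a i" if i: "i < N" for i
  proof -
    have "(\<Sum>l<N. ?S $$ (i, l) * u a l) = (\<Sum>l<N. (if l = i then u a i else 0) + (\<Sum>m\<in>F. u m i * (v m l * u a l)))"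
      using i by (intro sum.cong) (auto simp: algebra_simps sum_distrib_left)
    also have "\<dots> = u a i + (\<Sum>m\<in>F. u m i * (\<Sum>l<N. v m l * u a l))"
      using i by (simp add: sum.distrib sum_distrib_left) (rule sum.swap)
    also have "(\<Sum>m\<in>F. u m i * (\<Sum>l<N. v m l * u a l)) = 0"
      using insert.prems[of _ a] insert.hyps by (intro sum.neutral) auto
    finally show ?thesis
      by simp
  qed
  have "mat N N (\<lambda>(i, j). (if i = j then 1 else 0) + (\<Sum>m\<in>insert a F. u m i * v m j)) = ?S * rank1 N (u a) (v a)"
  proof (rule eq_matI)
    fix i j assume "i < dim_row (?S * rank1 N (u a) (v a))" "j < dim_col (?S * rank1 N (u a) (v a))"
    then have ij: "i < N" "j < N"
      by (auto simp: rank1_def)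
    show "mat N N (\<lambda>(i, j). (if i = j then 1 else 0) + (\<Sum>m\<in>insert a F. u m i * v m j)) $$ (i, j) =
        (?S * rank1 N (u a) (v a)) $$ (i, j)"
      unfolding rank1_mult_right[OF S ij] Su[OF ij(1)] using ij insert.hyps by simp
  qed (auto simp: rank1_def)
  moreover have "det ?S = (\<Prod>m\<in>F. 1 + (\<Sum>i<N. v m i * u m i))"
    using insert by auto
  ultimately show ?case
    using insert.hyps by (simp add: det_mult[OF S rank1_carrier] det_rank1)
qed

section \<open>The coordinate frame and the determinant of its Gram matrix\<close>

abbreviation "Xe \<equiv> \<lambda>(a :: nat) (z :: complex). (((\<lambda>_. 0)(a := z), \<lambda>_. 0, 0, 0) :: coords)"
abbreviation "We \<equiv> \<lambda>(k :: nat) (z :: complex). ((\<lambda>_. 0, (\<lambda>_. 0)(k := z), 0, 0) :: coords)"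
abbreviation "Pe \<equiv> ((\<lambda>_. 0, \<lambda>_. 0, 1, 0) :: coords)"
abbreviation "Re' \<equiv> ((\<lambda>_. 0, \<lambda>_. 0, 0, 1) :: coords)"

lemma coord_frame_eq:
  "coord_frame n = concat (map (\<lambda>a. [Xe a 1, Xe a \<i>]) [1..<n]) @ concat (map (\<lambda>k. [We k 1, We k \<i>]) [0..<n]) @ [Pe, Re']"
  by (simp add: coord_frame_def)

lemma sum_frame:
  fixes F :: "coords \<Rightarrow> real"
  shows "(\<Sum>i<length (coord_frame n). F (coord_frame n ! i)) =
    (\<Sum>a\<in>{1..<n}. F (Xe a 1) + F (Xe a \<i>)) + (\<Sum>k<n. F (We k 1) + F (We k \<i>)) + F Pe + F Re'"
proof -
  have p: "sum_list (concat xss) = sum_list (map sum_list xss)" for xss :: "real list list"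
    by (induction xss) auto
  have "(\<Sum>i<length (coord_frame n). F (coord_frame n ! i)) = sum_list (map F (coord_frame n))"
    by (simp add: sum_list_sum_nth atLeast0LessThan)
  also have "\<dots> = (\<Sum>a\<leftarrow>[1..<n]. F (Xe a 1) + F (Xe a \<i>)) + (\<Sum>k\<leftarrow>[0..<n]. F (We k 1) + F (We k \<i>)) + F Pe + F Re'"
    unfolding coord_frame_eq by (simp add: map_concat p comp_def add.assoc)
  finally show ?thesis
    by (simp add: interv_sum_list_conv_sum_set_nat atLeast0LessThan)
qed

lemma prod_frame:
  fixes F :: "coords \<Rightarrow> real"
  shows "(\<Prod>i<length (coord_frame n). F (coord_frame n ! i)) =
    (\<Prod>a\<in>{1..<n}. F (Xe a 1) * F (Xe a \<i>)) * (\<Prod>k<n. F (We k 1) * F (We k \<i>)) * F Pe * F Re'"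
proof -
  have p: "prod_list (concat xss) = prod_list (map prod_list xss)" for xss :: "real list list"
    by (induction xss) auto
  have "(\<Prod>i<length (coord_frame n). F (coord_frame n ! i)) = prod_list (map F (coord_frame n))"
    by (simp add: prod.list_conv_set_nth atLeast0LessThan)
  also have "\<dots> = prod_list (map (\<lambda>a. F (Xe a 1) * F (Xe a \<i>)) [1..<n]) *
      prod_list (map (\<lambda>k. F (We k 1) * F (We k \<i>)) [0..<n]) * F Pe * F Re'"
    unfolding coord_frame_eq by (simp add: map_concat p comp_def mult.assoc)
  finally show ?thesis
    by (simp add: prod.distinct_set_conv_list[symmetric] atLeast0LessThan)
qed

lemma single_eq_iff: "z \<noteq> 0 \<Longrightarrow> (\<lambda>_. 0 :: complex)(a := z) = (\<lambda>_. 0)(b := z') \<longleftrightarrow> a = b \<and> z = z'"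
  by (metis fun_upd_apply)

lemma single_nz: "z \<noteq> 0 \<Longrightarrow> (\<lambda>_. 0 :: complex)(a := z) \<noteq> (\<lambda>_. 0)"
  by (metis fun_upd_apply)

text \<open>Equality of frame vectors becomes equality of indices, so a form that is diagonal on the
  frame has a diagonal matrix.\<close>

lemma distinct_frame: "distinct (coord_frame n)"
proof -
  have 1: "distinct (concat (map (\<lambda>a. [f a 1, f a \<i>]) xs))"
    if "distinct xs" "\<And>a b z z'. z \<in> {1, \<i>} \<Longrightarrow> z' \<in> {1, \<i>} \<Longrightarrow> f a z = f b z' \<longleftrightarrow> a = b \<and> z = z'"
    for f :: "nat \<Rightarrow> complex \<Rightarrow> coords" and xs
    using that(1)
  proof (induction xs)
    case (Cons x xs)
    moreover have "f x z \<notin> set (concat (map (\<lambda>a. [f a 1, f a \<i>]) xs))" if z: "z \<in> {1, \<i>}" for z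
    proof
      assume "f x z \<in> set (concat (map (\<lambda>a. [f a 1, f a \<i>]) xs))"
      then obtain a z' where "a \<in> set xs" "z' \<in> {1, \<i>}" "f x z = f a z'"
        by auto
      then show False
        using Cons.prems \<open>\<And>a b z z'. z \<in> {1, \<i>} \<Longrightarrow> z' \<in> {1, \<i>} \<Longrightarrow> f a z = f b z' \<longleftrightarrow> a = b \<and> z = z'\<close>[OF z] by auto
    qed
    moreover have "f x 1 \<noteq> f x \<i>"
      using that(2)[of 1 \<i> x x] by (simp add: complex_eq_iff)
    ultimately show ?case
      by simp
  qed simp
  have "distinct (concat (map (\<lambda>a. [Xe a 1, Xe a \<i>]) [1..<n]))"
    by (rule 1[where f = Xe]) (auto simp: single_eq_iff simp del: fun_upd_apply)
  moreover have "distinct (concat (map (\<lambda>a. [We a 1, We a \<i>]) [0..<n]))"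
    by (rule 1[where f = We]) (auto simp: single_eq_iff simp del: fun_upd_apply)
  ultimately show ?thesis
    unfolding coord_frame_eq by (auto simp: single_nz)
qed

lemma set_frame:
  "e \<in> set (coord_frame n) \<longleftrightarrow> (\<exists>a\<in>{1..<n}. \<exists>z\<in>{1, \<i>}. e = Xe a z) \<or>
    (\<exists>k<n. \<exists>z\<in>{1, \<i>}. e = We k z) \<or> e = Pe \<or> e = Re'"
  unfolding coord_frame_eq by (auto simp: Bex_def)

lemma rdot_simps [simp]: "rdot 0 z = 0" "rdot z 0 = 0" "rdot 1 1 = 1" "rdot \<i> \<i> = 1" "rdot 1 \<i> = 0" "rdot \<i> 1 = 0"
  by (auto simp: rdot_def)

lemma rdot_Re_Im: "rdot z z' = Re z * Re z' + Im z * Im z'"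
  by (simp add: rdot_def)

lemma sum_rdot_single:
  assumes "finite S"
  shows "(\<Sum>x\<in>S. rdot (((\<lambda>_. 0)(a := z)) x) (((\<lambda>_. 0)(b := z')) x)) = (if a = b \<and> a \<in> S then rdot z z' else 0)"
proof -
  have "(\<Sum>x\<in>S. rdot (((\<lambda>_. 0)(a := z)) x) (((\<lambda>_. 0)(b := z')) x)) =
      (\<Sum>x\<in>S. if x = a then (if a = b then rdot z z' else 0) else 0)"
    by (intro sum.cong) auto
  then show ?thesis
    using assms by simp
qed

lemma sum_mult_single:
  assumes "finite S"
  shows "(\<Sum>x\<in>S. f x * ((\<lambda>_. 0 :: complex)(a := z)) x) = (if a \<in> S then f a * z else 0)"
proof -
  have "(\<Sum>x\<in>S. f x * ((\<lambda>_. 0 :: complex)(a := z)) x) = (\<Sum>x\<in>S. if x = a then f a * z else 0)"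
    by (intro sum.cong) auto
  then show ?thesis
    using assms by simp
qed

definition rho_density :: "nat \<Rightarrow> real \<Rightarrow> real \<Rightarrow> real" where
  "rho_density n c \<rho> = (\<rho> + c) ^ (n - 1) * (\<rho> + 2 * c) / (4 * \<rho> ^ (2 * n + 2))"

text \<open>The metric is a form \<open>bs\<close> diagonal on the frame, plus four rank-one terms
  \<open>v m\<close>, the real and imaginary parts of the two complex one-forms, plus kappa times
  the square of \<open>phi_form\<close>. Accordingly the Gram matrix is L (D B) L^T, where the shear
  L completes d phi to \<open>phi_form\<close>, D is diagonal and B is 1 plus four mutually
  orthogonal rank-one matrices.\<close>

lemma det_gram_matrix:
  assumes n: "1 \<le> n" and c: "0 \<le> c" and p: "(X, w, \<phi>, \<rho>) \<in> Nbar n"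
  shows "sqrt (det (gram_matrix n c (X, w, \<phi>, \<rho>))) = rho_density n c \<rho> / one_minus_normX2 n X ^ n"
proof -
  define q where "q = one_minus_normX2 n X"
  have q: "q > 0" and \<rho>: "\<rho> > 0"
    using p by (auto simp: q_def one_minus_normX2_def Nbar_iff CH_ball_def)
  have \<rho>c: "\<rho> + c > 0" "\<rho> + 2 * c > 0"
    using \<rho> c by auto
  define A where "A = (\<rho> + c) / \<rho> * (1 / q)"
  define \<kappa> where "\<kappa> = 1 / (4 * \<rho>\<^sup>2) * ((\<rho> + c) / (\<rho> + 2 * c))"
  define R where "R = 1 / (4 * \<rho>\<^sup>2) * ((\<rho> + 2 * c) / (\<rho> + c))"
  define S where "S = (\<rho> + c) / \<rho>\<^sup>2 * (2 / q)"
  have pos: "A > 0" "\<kappa> > 0" "R > 0"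
    using q \<rho> \<rho>c by (auto simp: A_def \<kappa>_def R_def)
  define bs :: "coords \<Rightarrow> coords \<Rightarrow> real" where "bs e e' =
    A * (\<Sum>a\<in>{1..<n}. rdot (coord_X e a) (coord_X e' a)) + R * (coord_rho e * coord_rho e')
    - 1 / \<rho> * (rdot (coord_w e 0) (coord_w e' 0) - (\<Sum>a\<in>{1..<n}. rdot (coord_w e a) (coord_w e' a)))" for e e'
  define v :: "nat \<Rightarrow> coords \<Rightarrow> real" where "v m e =
    (if m = 0 then Re (Xbar_dX n X (coord_X e)) else if m = 1 then Im (Xbar_dX n X (coord_X e))
     else if m = 2 then Re (dw0_plus_Xdw n X (coord_w e)) else Im (dw0_plus_Xdw n X (coord_w e)))" for m e
  define cf where "cf m = (if m < 2 then A / q else S)" for m :: nat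
  define pf where "pf e = phi_form n c (X, w, \<phi>, \<rho>) e" for e
  define \<beta> where "\<beta> e = pf e - coord_phi e" for e
  have metric: "qk_metric n c (X, w, \<phi>, \<rho>) e e' = bs e e' + (\<Sum>m<4. cf m * (v m e * v m e')) + \<kappa> * (pf e * pf e')" for e e'
    by (cases e; cases e') (simp add: bs_def v_def cf_def pf_def A_def \<kappa>_def R_def S_def g_CH_def q_def[symmetric]
        numeral_eq_Suc rdot_Re_Im[of "Xbar_dX _ _ _"] rdot_Re_Im[of "dw0_plus_Xdw _ _ _"] algebra_simps)
  let ?fr = "coord_frame n"
  define N where "N = length ?fr"
  define P where "P = N - 2"
  have "?fr = (concat (map (\<lambda>a. [Xe a 1, Xe a \<i>]) [1..<n]) @ concat (map (\<lambda>k. [We k 1, We k \<i>]) [0..<n])) @ [Pe, Re']"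
    by (simp add: coord_frame_eq)
  then have P: "P < N" "?fr ! P = Pe"
    unfolding P_def N_def by (auto simp: nth_append)
  have fr_inj: "?fr ! i = ?fr ! j \<longleftrightarrow> i = j" if "i < N" "j < N" for i j
    using nth_eq_iff_index_eq[OF distinct_frame] that by (simp add: N_def)
  have fr_mem: "?fr ! i \<in> set ?fr" if "i < N" for i
    using that by (simp add: N_def)
  have frP: "?fr ! i = Pe \<longleftrightarrow> i = P" if "i < N" for i
    using fr_inj[OF that P(1)] P(2) by simp
  have diag: "bs e e' = 0" if "e \<in> set ?fr" "e' \<in> set ?fr" "e \<noteq> e'" for e e'
  proof -
    have z: "rdot z z' = 0" if "z \<in> {1, \<i>}" "z' \<in> {1, \<i>}" "z \<noteq> z'" for z z'
      using that by auto
    consider a z where "a \<in> {1..<n}" "z \<in> {1, \<i>}" "e = Xe a z" | k z where "z \<in> {1, \<i>}" "e = We k z" | "e = Pe" | "e = Re'"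
      using \<open>e \<in> set ?fr\<close> unfolding set_frame by blast
    note ce = this
    consider a z where "a \<in> {1..<n}" "z \<in> {1, \<i>}" "e' = Xe a z" | k z where "z \<in> {1, \<i>}" "e' = We k z" | "e' = Pe" | "e' = Re'"
      using \<open>e' \<in> set ?fr\<close> unfolding set_frame by blast
    note ce' = this
    show ?thesis
    proof (cases rule: ce)
      case (1 a z)
      note e = this
      show ?thesis
      proof (cases rule: ce')
        case (1 b z')
        then have "\<not> (a = b \<and> z = z')"
          using e \<open>e \<noteq> e'\<close> by auto
        then show ?thesis
          unfolding bs_def e(3) 1(3) coord_X.simps coord_w.simps coord_rho.simps sum_rdot_single[OF finite_atLeastLessThan]
          using z[OF e(2) 1(2)] by (cases "a = b") auto
      next
        case (2 l z')
        show ?thesis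
          unfolding e(3) 2(2) bs_def by simp
      next
        case 3
        show ?thesis
          unfolding e(3) 3 bs_def by simp
      next
        case 4
        show ?thesis
          unfolding e(3) 4 bs_def by simp
      qed
    next
      case (2 k z)
      note e = this
      show ?thesis
      proof (cases rule: ce')
        case (2 l z')
        then have "\<not> (k = l \<and> z = z')"
          using e \<open>e \<noteq> e'\<close> by auto
        then show ?thesis
          unfolding bs_def e(2) 2(2) coord_X.simps coord_w.simps coord_rho.simps sum_rdot_single[OF finite_atLeastLessThan]
          using z[OF e(1) 2(1)] by (cases "k = l") auto
      next
        case (1 b z')
        show ?thesis
          unfolding e(2) 1(3) bs_def by simp
      next
        case 3
        show ?thesis
          unfolding e(2) 3 bs_def by simp
      next
        case 4
        show ?thesis
          unfolding e(2) 4 bs_def by simp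
      qed
    next
      case 3
      then show ?thesis
        using that(3) by (simp add: bs_def)
    next
      case 4
      note e = this
      show ?thesis
      proof (cases rule: ce')
        case (1 b z')
        show ?thesis
          unfolding e 1(3) bs_def by simp
      next
        case (2 l z')
        show ?thesis
          unfolding e 2(2) bs_def by simp
      next
        case 3
        show ?thesis
          unfolding e 3 bs_def by simp
      next
        case 4
        then show ?thesis
          using e \<open>e \<noteq> e'\<close> by simp
      qed
    qed
  qed
  \<comment> \<open>\<open>bs\<close> vanishes in the phi-direction. Entering kappa there makes D
    invertible; the equation \<open>base\<close> below checks that this amounts to the d phi d phi
    part of the last summand.\<close>
  define lam where "lam e = (if e = Pe then \<kappa> else bs e e)" for e
  have lamX: "lam (Xe a z) = A" if "a \<in> {1..<n}" "z \<in> {1, \<i>}" for a z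
  proof -
    have "Xe a z \<noteq> Pe"
      by simp
    moreover have "rdot z z = 1"
      using that by auto
    ultimately show ?thesis
      using that unfolding lam_def bs_def
      by (simp only: coord_X.simps coord_w.simps coord_rho.simps sum_rdot_single[OF finite_atLeastLessThan]) auto
  qed
  have lamW: "lam (We k z) = (if k = 0 then - (1 / \<rho>) else 1 / \<rho>)" if "k < n" "z \<in> {1, \<i>}" for k z
  proof -
    have "We k z \<noteq> Pe"
      by simp
    moreover have "rdot z z = 1"
      using that by auto
    ultimately show ?thesis
      using that unfolding lam_def bs_def
      by (simp only: coord_X.simps coord_w.simps coord_rho.simps sum_rdot_single[OF finite_atLeastLessThan]) auto
  qed
  have lamR: "lam Re' = R"
    by (simp add: lam_def bs_def)
  have lam_nz: "lam (?fr ! i) \<noteq> 0" if iN: "i < N" for i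
  proof -
    have P0: "lam Pe \<noteq> 0" and R0: "lam Re' \<noteq> 0"
      using pos by (simp_all add: lam_def[of Pe] lamR)
    have X0: "lam (Xe a z) \<noteq> 0" if "a \<in> {1..<n}" "z \<in> {1, \<i>}" for a z
      unfolding lamX[OF that] using pos by simp
    have W0: "lam (We k z) \<noteq> 0" if "k < n" "z \<in> {1, \<i>}" for k z
      unfolding lamW[OF that] using \<rho> by simp
    consider a z where "a \<in> {1..<n}" "z \<in> {1, \<i>}" "?fr ! i = Xe a z"
      | k z where "k < n" "z \<in> {1, \<i>}" "?fr ! i = We k z" | "?fr ! i = Pe" | "?fr ! i = Re'"
      using fr_mem[OF iN] unfolding set_frame by blast
    then show ?thesis
    proof cases
      case (1 a z)
      show ?thesis
        unfolding 1(3) by (rule X0[OF 1(1,2)])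
    next
      case (2 k z)
      show ?thesis
        unfolding 2(3) by (rule W0[OF 2(1,2)])
    next
      case 3
      show ?thesis
        unfolding 3 by (rule P0)
    next
      case 4
      show ?thesis
        unfolding 4 by (rule R0)
    qed
  qed
  have vX: "v m (Xe a z) = (if m = 0 then Re (cnj (X a) * z) else if m = 1 then Im (cnj (X a) * z) else 0)"
    if "a \<in> {1..<n}" for m a z
    using that n sum_mult_single[of "{1..<n}" "\<lambda>a. cnj (X a)" a z]
    by (simp add: v_def Xbar_dX_def dw0_plus_Xdw_def)
  have vW: "v m (We k z) = (if m = 0 \<or> m = 1 then 0 else if m = 2 then Re ((if k = 0 then 1 else X k) * z)
      else Im ((if k = 0 then 1 else X k) * z))" if "k < n" for m k z
    using that sum_mult_single[of "{1..<n}" X k z]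
    by (auto simp: v_def Xbar_dX_def dw0_plus_Xdw_def)
  have vP: "v m Pe = 0" "v m Re' = 0" for m
    by (auto simp: v_def Xbar_dX_def dw0_plus_Xdw_def)
  have r2: "(\<Sum>a\<in>{1..<n}. (Re (X a))\<^sup>2 + (Im (X a))\<^sup>2) = 1 - q"
    by (simp add: q_def one_minus_normX2_def cmod_power2)
  \<comment> \<open>Pairings of the rank-one terms relative to D. The X-forms contribute the sum of
    |X^a|^2 = 1 - q; for the w-form the indices a >= 1 give rho (1 - q) and the negative direction 0
    gives - rho, together - rho q.\<close>
  have vv: "(\<Sum>i<N. v m (?fr ! i) * (cf l * v l (?fr ! i) / lam (?fr ! i))) =
      (if m \<noteq> l then 0 else if m < 2 then (1 - q) / q else - S * \<rho> * q)" if ml: "m < 4" "l < 4" for m l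
  proof -
    have E0: "(\<Sum>i<N. v m (?fr ! i) * (cf l * v l (?fr ! i) / lam (?fr ! i))) =
        cf l * ((\<Sum>a\<in>{1..<n}. v m (Xe a 1) * v l (Xe a 1) + v m (Xe a \<i>) * v l (Xe a \<i>)) / A +
          ((\<Sum>a\<in>{1..<n}. v m (We a 1) * v l (We a 1) + v m (We a \<i>) * v l (We a \<i>)) * \<rho>
           - (v m (We 0 1) * v l (We 0 1) + v m (We 0 \<i>) * v l (We 0 \<i>)) * \<rho>))"
    proof -
      have sp: "{..<n} = insert 0 {1..<n}"
        using n by auto
      have 1: "(\<Sum>a\<in>{1..<n}. v m (Xe a 1) * (cf l * v l (Xe a 1) / lam (Xe a 1)) + v m (Xe a \<i>) * (cf l * v l (Xe a \<i>) / lam (Xe a \<i>)))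
          = cf l * ((\<Sum>a\<in>{1..<n}. v m (Xe a 1) * v l (Xe a 1) + v m (Xe a \<i>) * v l (Xe a \<i>)) / A)"
        unfolding sum_divide_distrib sum_distrib_left
        by (intro sum.cong refl) (simp add: lamX add_divide_distrib algebra_simps)
      have 2: "(\<Sum>a\<in>{1..<n}. v m (We a 1) * (cf l * v l (We a 1) / lam (We a 1)) + v m (We a \<i>) * (cf l * v l (We a \<i>) / lam (We a \<i>)))
          = cf l * ((\<Sum>a\<in>{1..<n}. v m (We a 1) * v l (We a 1) + v m (We a \<i>) * v l (We a \<i>)) * \<rho>)"
        unfolding sum_distrib_right sum_distrib_left
        by (intro sum.cong refl) (simp add: lamW algebra_simps)
      have 3: "v m (We 0 1) * (cf l * v l (We 0 1) / lam (We 0 1)) + v m (We 0 \<i>) * (cf l * v l (We 0 \<i>) / lam (We 0 \<i>))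
          = - cf l * ((v m (We 0 1) * v l (We 0 1) + v m (We 0 \<i>) * v l (We 0 \<i>)) * \<rho>)"
        using n by (simp add: lamW algebra_simps)
      have "(\<Sum>i<N. v m (?fr ! i) * (cf l * v l (?fr ! i) / lam (?fr ! i))) =
          (\<Sum>a\<in>{1..<n}. v m (Xe a 1) * (cf l * v l (Xe a 1) / lam (Xe a 1)) + v m (Xe a \<i>) * (cf l * v l (Xe a \<i>) / lam (Xe a \<i>)))
          + (\<Sum>a<n. v m (We a 1) * (cf l * v l (We a 1) / lam (We a 1)) + v m (We a \<i>) * (cf l * v l (We a \<i>) / lam (We a \<i>)))"
        unfolding N_def sum_frame[where F = "\<lambda>e. v m e * (cf l * v l e / lam e)"] by (simp add: vP)
      also have "(\<Sum>a<n. v m (We a 1) * (cf l * v l (We a 1) / lam (We a 1)) + v m (We a \<i>) * (cf l * v l (We a \<i>) / lam (We a \<i>))) =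
          (v m (We 0 1) * (cf l * v l (We 0 1) / lam (We 0 1)) + v m (We 0 \<i>) * (cf l * v l (We 0 \<i>) / lam (We 0 \<i>))) +
          (\<Sum>a\<in>{1..<n}. v m (We a 1) * (cf l * v l (We a 1) / lam (We a 1)) + v m (We a \<i>) * (cf l * v l (We a \<i>) / lam (We a \<i>)))"
        unfolding sp by (rule sum.insert) auto
      finally show ?thesis
        unfolding 1 2 3 by (simp add: algebra_simps)
    qed
    have SX: "(\<Sum>a\<in>{1..<n}. v m (Xe a 1) * v l (Xe a 1) + v m (Xe a \<i>) * v l (Xe a \<i>)) = (if m = l \<and> m < 2 then 1 - q else 0)"
    proof -
      have "(\<Sum>a\<in>{1..<n}. v m (Xe a 1) * v l (Xe a 1) + v m (Xe a \<i>) * v l (Xe a \<i>)) =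
          (\<Sum>a\<in>{1..<n}. if m = l \<and> m < 2 then (Re (X a))\<^sup>2 + (Im (X a))\<^sup>2 else 0)"
        by (intro sum.cong refl) (auto simp: vX power2_eq_square)
      then show ?thesis
        using r2 by (cases "m = l \<and> m < 2") auto
    qed
    have SW: "(\<Sum>a\<in>{1..<n}. v m (We a 1) * v l (We a 1) + v m (We a \<i>) * v l (We a \<i>)) = (if m = l \<and> 2 \<le> m then 1 - q else 0)"
    proof -
      have "(\<Sum>a\<in>{1..<n}. v m (We a 1) * v l (We a 1) + v m (We a \<i>) * v l (We a \<i>)) =
          (\<Sum>a\<in>{1..<n}. if m = l \<and> 2 \<le> m then (Re (X a))\<^sup>2 + (Im (X a))\<^sup>2 else 0)"
        using ml by (intro sum.cong refl) (auto simp: vW power2_eq_square)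
      then show ?thesis
        using r2 by (cases "m = l \<and> 2 \<le> m") auto
    qed
    have S0: "v m (We 0 1) * v l (We 0 1) + v m (We 0 \<i>) * v l (We 0 \<i>) = (if m = l \<and> 2 \<le> m then 1 else 0)"
      using n ml by (auto simp: vW)
    show ?thesis
      unfolding E0 SX SW S0 using pos q by (auto simp: cf_def field_simps)
  qed
  define B where "B = mat N N (\<lambda>(i, j). (if i = j then 1 else 0) + (\<Sum>m<4. (cf m * v m (?fr ! i) / lam (?fr ! i)) * v m (?fr ! j)))"
  have detB: "det B = (1 / q)\<^sup>2 * (1 - S * \<rho> * q)\<^sup>2"
  proof -
    have "det B = (\<Prod>m<4. 1 + (\<Sum>i<N. v m (?fr ! i) * (cf m * v m (?fr ! i) / lam (?fr ! i))))"
      unfolding B_def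
    proof (rule det_orthogonal_rank1_sum)
      fix m l :: nat assume ml: "m \<in> {..<4}" "l \<in> {..<4}" "m \<noteq> l"
      then have m: "m < 4" and l: "l < 4"
        by auto
      show "(\<Sum>i<N. v m (?fr ! i) * (cf l * v l (?fr ! i) / lam (?fr ! i))) = 0"
        unfolding vv[OF m l] using ml by simp
    qed simp
    also have "\<dots> = (\<Prod>m<(4 :: nat). if m < 2 then 1 / q else 1 - S * \<rho> * q)"
    proof (rule prod.cong[OF refl])
      fix m :: nat assume "m \<in> {..<4}"
      then have m: "m < 4"
        by simp
      show "1 + (\<Sum>i<N. v m (?fr ! i) * (cf m * v m (?fr ! i) / lam (?fr ! i))) = (if m < 2 then 1 / q else 1 - S * \<rho> * q)"
        unfolding vv[OF m m] using q by (simp add: field_simps)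
    qed
    also have "\<dots> = (1 / q)\<^sup>2 * (1 - S * \<rho> * q)\<^sup>2"
      by (simp add: numeral_eq_Suc lessThan_Suc)
    finally show ?thesis .
  qed
  define D where "D = mat N N (\<lambda>(i, j). if i = j then lam (?fr ! i) else 0)"
  have detD: "det D = (A\<^sup>2) ^ (n - 1) * ((1 / \<rho>)\<^sup>2) ^ n * \<kappa> * R"
  proof -
    have "det D = prod_list (diag_mat D)"
      by (rule det_upper_triangular[of _ N]) (auto simp: D_def upper_triangular_def)
    also have "\<dots> = (\<Prod>i<N. lam (?fr ! i))"
      by (simp add: diag_mat_def D_def prod.distinct_set_conv_list[symmetric] atLeast0LessThan cong: map_cong)
    also have "\<dots> = (\<Prod>a\<in>{1..<n}. lam (Xe a 1) * lam (Xe a \<i>)) * (\<Prod>k<n. lam (We k 1) * lam (We k \<i>)) * lam Pe * lam Re'"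
      unfolding N_def by (rule prod_frame)
    also have "(\<Prod>a\<in>{1..<n}. lam (Xe a 1) * lam (Xe a \<i>)) = (\<Prod>a\<in>{1..<n}. A\<^sup>2)"
      by (intro prod.cong refl) (simp add: lamX power2_eq_square)
    also have "(\<Prod>k<n. lam (We k 1) * lam (We k \<i>)) = (\<Prod>k<n. (1 / \<rho>)\<^sup>2)"
      by (intro prod.cong refl) (simp add: lamW power2_eq_square)
    finally show ?thesis
      by (simp add: lamR lam_def[of Pe])
  qed
  have DB: "(D * B) $$ (i, j) = (if i = j then lam (?fr ! i) else 0) + (\<Sum>m<4. cf m * (v m (?fr ! i) * v m (?fr ! j)))"
    if ij: "i < N" "j < N" for i j
  proof -
    have Dc: "D \<in> carrier_mat N N" and Bc: "B \<in> carrier_mat N N"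
      by (simp_all add: D_def B_def)
    have "(D * B) $$ (i, j) = (\<Sum>l<N. D $$ (i, l) * B $$ (l, j))"
      by (rule real_mult_mat_entry[OF Dc Bc ij])
    also have "\<dots> = (\<Sum>l<N. if l = i then lam (?fr ! i) * B $$ (i, j) else 0)"
      by (intro sum.cong refl) (use ij in \<open>auto simp: D_def\<close>)
    also have "\<dots> = lam (?fr ! i) * B $$ (i, j)"
      using ij by simp
    also have "\<dots> = (if i = j then lam (?fr ! i) else 0) + (\<Sum>m<4. cf m * (v m (?fr ! i) * v m (?fr ! j)))"
      using ij lam_nz[OF ij(1)] by (simp add: B_def distrib_left sum_distrib_left mult.assoc)
    finally show ?thesis .
  qed
  define b where "b i = \<beta> (?fr ! i)" for i
  define \<epsilon> where "\<epsilon> i = (if i = P then 1 else 0 :: real)" for i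
  have Dc: "D \<in> carrier_mat N N" and Bc: "B \<in> carrier_mat N N"
    by (simp_all add: D_def B_def)
  then have DBc: "D * B \<in> carrier_mat N N"
    by (rule mult_carrier_mat)
  have sel: "(\<Sum>l<N. \<epsilon> l * f l) = f P" "(\<Sum>l<N. f l * \<epsilon> l) = f P" for f
  proof -
    have "(\<Sum>l<N. \<epsilon> l * f l) = (\<Sum>l<N. if l = P then f P else 0)"
      by (intro sum.cong) (auto simp: \<epsilon>_def)
    then show "(\<Sum>l<N. \<epsilon> l * f l) = f P"
      using P by simp
    then show "(\<Sum>l<N. f l * \<epsilon> l) = f P"
      by (simp add: mult.commute)
  qed
  have bP: "b P = 0"
    using P by (simp add: b_def \<beta>_def pf_def Xbar_dX_def)
  \<comment> \<open>Both outer factors are unipotent: \<open>b\<close> vanishes at the index P of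
    the phi-direction, so they have determinant 1.\<close>
  have "gram_matrix n c (X, w, \<phi>, \<rho>) = rank1 N b \<epsilon> * (D * B) * rank1 N \<epsilon> b"
  proof (rule eq_matI)
    fix i j assume "i < dim_row (rank1 N b \<epsilon> * (D * B) * rank1 N \<epsilon> b)" "j < dim_col (rank1 N b \<epsilon> * (D * B) * rank1 N \<epsilon> b)"
    then have ij: "i < N" "j < N"
      by (auto simp: rank1_def)
    have c1: "rank1 N b \<epsilon> * (D * B) \<in> carrier_mat N N"
      by (rule mult_carrier_mat[OF rank1_carrier DBc])
    have L: "(rank1 N b \<epsilon> * (D * B)) $$ (k, l) = (D * B) $$ (k, l) + b k * (D * B) $$ (P, l)" if "k < N" "l < N" for k l
      unfolding rank1_mult_left[OF DBc that] sel(1) ..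
    have pfe: "pf (?fr ! k) = b k + \<epsilon> k" if "k < N" for k
    proof -
      have "coord_phi (?fr ! k) = \<epsilon> k"
        using fr_mem[OF that] frP[OF that] unfolding set_frame by (auto simp: \<epsilon>_def)
      then show ?thesis
        by (simp add: b_def \<beta>_def)
    qed
    have DBP: "(D * B) $$ (P, l) = \<kappa> * \<epsilon> l" "(D * B) $$ (l, P) = \<kappa> * \<epsilon> l" if "l < N" for l
      using that P by (auto simp: DB vP lam_def \<epsilon>_def)
    have base: "bs (?fr ! i) (?fr ! j) + \<kappa> * (\<epsilon> i * \<epsilon> j) = (if i = j then lam (?fr ! i) else 0)"
    proof (cases "i = j")
      case True
      show ?thesis
      proof (cases "i = P")
        case True
        then show ?thesis
          using \<open>i = j\<close> P by (simp add: lam_def bs_def \<epsilon>_def)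
      next
        case False
        then show ?thesis
          using \<open>i = j\<close> frP[OF ij(1)] by (simp add: lam_def \<epsilon>_def)
      qed
    next
      case False
      then show ?thesis
        using diag[OF fr_mem[OF ij(1)] fr_mem[OF ij(2)]] fr_inj[OF ij] by (auto simp: \<epsilon>_def)
    qed
    have "(rank1 N b \<epsilon> * (D * B) * rank1 N \<epsilon> b) $$ (i, j) =
        (D * B) $$ (i, j) + b i * (D * B) $$ (P, j) + ((D * B) $$ (i, P) + b i * (D * B) $$ (P, P)) * b j"
      unfolding rank1_mult_right[OF c1 ij] sel(2) L[OF ij] L[OF ij(1) P(1)] ..
    also have "\<dots> = (D * B) $$ (i, j) + \<kappa> * (b i * \<epsilon> j + \<epsilon> i * b j + b i * b j)"
      using DBP(1)[OF ij(2)] DBP(2)[OF ij(1)] DBP(1)[OF P(1)] by (simp add: \<epsilon>_def[of P] algebra_simps)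
    also have "\<dots> = bs (?fr ! i) (?fr ! j) + (\<Sum>m<4. cf m * (v m (?fr ! i) * v m (?fr ! j))) + \<kappa> * (pf (?fr ! i) * pf (?fr ! j))"
      unfolding DB[OF ij] base[symmetric] pfe[OF ij(1)] pfe[OF ij(2)] by (simp add: algebra_simps)
    also have "\<dots> = gram_matrix n c (X, w, \<phi>, \<rho>) $$ (i, j)"
      using ij by (simp add: gram_matrix_def N_def[symmetric] metric)
    finally show "gram_matrix n c (X, w, \<phi>, \<rho>) $$ (i, j) = (rank1 N b \<epsilon> * (D * B) * rank1 N \<epsilon> b) $$ (i, j)" ..
  qed (auto simp: gram_matrix_def N_def rank1_def)
  then have "det (gram_matrix n c (X, w, \<phi>, \<rho>)) = det (rank1 N b \<epsilon>) * (det D * det B) * det (rank1 N \<epsilon> b)"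
    using DBc by (simp only: det_mult[OF mult_carrier_mat[OF rank1_carrier DBc] rank1_carrier]
        det_mult[OF rank1_carrier DBc] det_mult[OF Dc Bc])
  also have "det (rank1 N b \<epsilon>) = 1"
    unfolding det_rank1 sel(1) by (simp add: bP)
  also have "det (rank1 N \<epsilon> b) = 1"
    unfolding det_rank1 sel(2) by (simp add: bP)
  finally have det: "det (gram_matrix n c (X, w, \<phi>, \<rho>)) = (A\<^sup>2) ^ (n - 1) * ((1 / \<rho>)\<^sup>2) ^ n * \<kappa> * R * ((1 / q)\<^sup>2 * (1 - S * \<rho> * q)\<^sup>2)"
    by (simp add: detD detB)
  have KR: "\<kappa> * R = (1 / (4 * \<rho>\<^sup>2))\<^sup>2"
    using \<rho>c by (simp add: \<kappa>_def R_def power2_eq_square)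
  \<comment> \<open>Negative, but it occurs once for the real and once for the imaginary part, so
    the determinant contains its square.\<close>
  have S1: "1 - S * \<rho> * q = - ((\<rho> + 2 * c) / \<rho>)"
    using q \<rho> by (simp add: S_def field_simps power2_eq_square)
  have pw: "(x\<^sup>2) ^ k = (x ^ k)\<^sup>2" for x :: real and k
    by (simp add: mult.commute flip: power_mult)
  have "det (gram_matrix n c (X, w, \<phi>, \<rho>)) =
      (A\<^sup>2) ^ (n - 1) * ((1 / \<rho>)\<^sup>2) ^ n * (\<kappa> * R) * ((1 / q)\<^sup>2 * (1 - S * \<rho> * q)\<^sup>2)"
    unfolding det by (simp only: mult.assoc)
  also have "\<dots> = (A ^ (n - 1) * (1 / \<rho>) ^ n * (1 / (4 * \<rho>\<^sup>2)) * (1 / q) * ((\<rho> + 2 * c) / \<rho>))\<^sup>2"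
    unfolding KR S1 pw power2_minus by (simp only: power_mult_distrib mult.assoc)
  finally have "det (gram_matrix n c (X, w, \<phi>, \<rho>)) =
      (A ^ (n - 1) * (1 / \<rho>) ^ n * (1 / (4 * \<rho>\<^sup>2)) * (1 / q) * ((\<rho> + 2 * c) / \<rho>))\<^sup>2" .
  then have "sqrt (det (gram_matrix n c (X, w, \<phi>, \<rho>))) =
      A ^ (n - 1) * (1 / \<rho>) ^ n * (1 / (4 * \<rho>\<^sup>2)) * (1 / q) * ((\<rho> + 2 * c) / \<rho>)"
    using pos \<rho> q \<rho>c by simp
  also have "\<dots> = rho_density n c \<rho> / q ^ n"
  proof -
    obtain k where k: "n = Suc k"
      using n by (cases n) auto
    have e: "\<rho> ^ (2 * n + 2) = \<rho> ^ k * \<rho> ^ n * \<rho>\<^sup>2 * \<rho>"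
      by (simp add: k power_add[symmetric] power2_eq_square) (simp add: power_add mult_2 power2_eq_square)
    show ?thesis
      unfolding rho_density_def e using q \<rho>
      by (simp add: A_def power_mult_distrib power_divide k field_simps)
  qed
  finally show ?thesis
    by (simp add: q_def)
qed

section \<open>Invariance of Lebesgue measure\<close>

abbreviation LC :: "nat set \<Rightarrow> (nat \<Rightarrow> complex) measure" where
  "LC I \<equiv> Pi\<^sub>M I (\<lambda>_. lborel)"

interpretation LC: product_sigma_finite "\<lambda>_ :: nat. lborel :: complex measure"
  by standard

lemma sigma_finite_LC: "finite I \<Longrightarrow> sigma_finite_measure (LC I)"
  by (rule LC.sigma_finite)

definition matvec :: "nat \<Rightarrow> complex mat \<Rightarrow> (nat \<Rightarrow> complex) \<Rightarrow> nat \<Rightarrow> complex" where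
  "matvec n g x = (\<lambda>i\<in>{..<n}. mv n g x i)"

lemma measurable_LC_component [measurable]: "i \<in> I \<Longrightarrow> (\<lambda>x. x i) \<in> borel_measurable (LC I)"
  using measurable_component_singleton[of i I "\<lambda>_. lborel :: complex measure"] by simp

lemma measurable_LC_restrict:
  "(\<And>i. i \<in> I \<Longrightarrow> (\<lambda>x. f x i) \<in> borel_measurable M) \<Longrightarrow> (\<lambda>x. \<lambda>i\<in>I. f x i) \<in> measurable M (LC I)"
  by (rule measurable_restrict) simp

lemma measurable_mv:
  assumes "x \<in> measurable M (LC {..<n})"
  shows "(\<lambda>y. mv n g (x y) i) \<in> borel_measurable M"
proof -
  have "(\<lambda>y. x y j) \<in> borel_measurable M" if "j < n" for j
    using measurable_compose[OF assms measurable_LC_component[of j]] that by simp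
  then show ?thesis
    unfolding mv_def by (intro borel_measurable_sum borel_measurable_times) auto
qed

lemma measurable_matvec [measurable]: "matvec n g \<in> measurable (LC {..<n}) (LC {..<n})"
  unfolding matvec_def by (intro measurable_LC_restrict measurable_mv measurable_ident_sets[OF refl])

lemma matvec_mult:
  assumes "g \<in> carrier_mat n n" "h \<in> carrier_mat n n"
  shows "matvec n (g * h) x = matvec n g (matvec n h x)"
  unfolding matvec_def using assms
  by (intro restrict_ext) (auto simp: mv_mult intro!: mv_cong)

lemma nn_integral_translate:
  fixes f :: "'a :: euclidean_space \<Rightarrow> ennreal"
  assumes "f \<in> borel_measurable borel"
  shows "(\<integral>\<^sup>+ y. f (y + b) \<partial>lborel) = (\<integral>\<^sup>+ y. f y \<partial>lborel)"
proof -
  have "(\<integral>\<^sup>+ y. f y \<partial>lborel) = (\<integral>\<^sup>+ y. f y \<partial>distr lborel borel ((+) b))"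
    by (simp add: lborel_distr_plus)
  also have "\<dots> = (\<integral>\<^sup>+ y. f (b + y) \<partial>lborel)"
    using assms by (intro nn_integral_distr) auto
  finally show ?thesis
    by (simp add: add.commute)
qed

lemma measurable_LC_update:
  assumes "f \<in> borel_measurable (LC (insert k J))" "x \<in> space (LC J)" "k \<notin> J"
  shows "(\<lambda>y. f (x(k := y))) \<in> borel_measurable borel"
  using measurable_compose[OF measurable_component_update[OF assms(2,3)] assms(1)] by simp

definition pres :: "nat \<Rightarrow> complex mat \<Rightarrow> bool" where
  "pres n g \<longleftrightarrow> (\<forall>f\<in>borel_measurable (LC {..<n}).
     (\<integral>\<^sup>+ x. f (matvec n g x) \<partial>LC {..<n}) = (\<integral>\<^sup>+ x. f x \<partial>LC {..<n}))"

text \<open>Integrating over the coordinate i first, with the others fixed, the shear is a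
  translation of that coordinate by a x_j.\<close>

lemma pres_shear:
  assumes ij: "i < n" "j < n" "i \<noteq> j"
  shows "pres n (pl n i j 1 a 0 1)"
  unfolding pres_def
proof
  fix f :: "(nat \<Rightarrow> complex) \<Rightarrow> ennreal" assume f: "f \<in> borel_measurable (LC {..<n})"
  define J where "J = {..<n} - {i}"
  have I: "{..<n} = insert i J" and J: "finite J" "i \<notin> J" "j \<in> J"
    using ij by (auto simp: J_def)
  let ?g = "\<lambda>x. f (matvec n (pl n i j 1 a 0 1) x)"
  have g: "?g \<in> borel_measurable (LC {..<n})"
    using f by measurable
  have mvx: "matvec n (pl n i j 1 a 0 1) (x(i := y)) = x(i := y + a * x j)" if x: "x \<in> space (LC J)" for x y
  proof
    fix k
    show "matvec n (pl n i j 1 a 0 1) (x(i := y)) k = (x(i := y + a * x j)) k"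
    proof (cases "k < n")
      case True
      then show ?thesis
        using mv_pl[OF ij True] ij by (simp add: matvec_def)
    next
      case False
      then show ?thesis
        using x I ij by (auto simp: matvec_def space_PiM PiE_def extensional_def)
    qed
  qed
  have "(\<integral>\<^sup>+ x. ?g x \<partial>LC {..<n}) = (\<integral>\<^sup>+ x. (\<integral>\<^sup>+ y. ?g (x(i := y)) \<partial>lborel) \<partial>LC J)"
    unfolding I by (rule LC.product_nn_integral_insert[OF J(1,2) g[unfolded I]])
  also have "\<dots> = (\<integral>\<^sup>+ x. (\<integral>\<^sup>+ y. f (x(i := y)) \<partial>lborel) \<partial>LC J)"
  proof (rule nn_integral_cong)
    fix x assume x: "x \<in> space (LC J)"
    show "(\<integral>\<^sup>+ y. ?g (x(i := y)) \<partial>lborel) = (\<integral>\<^sup>+ y. f (x(i := y)) \<partial>lborel)"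
      unfolding mvx[OF x]
      by (rule nn_integral_translate[OF measurable_LC_update[OF f[unfolded I] x J(2)]])
  qed
  also have "\<dots> = (\<integral>\<^sup>+ x. f x \<partial>LC {..<n})"
    unfolding I by (rule LC.product_nn_integral_insert[OF J(1,2) f[unfolded I], symmetric])
  finally show "(\<integral>\<^sup>+ x. ?g x \<partial>LC {..<n}) = (\<integral>\<^sup>+ x. f x \<partial>LC {..<n})" .
qed

lemma pres_mult:
  assumes "g \<in> carrier_mat n n" "h \<in> carrier_mat n n" "pres n g" "pres n h"
  shows "pres n (g * h)"
  unfolding pres_def
proof
  fix f :: "(nat \<Rightarrow> complex) \<Rightarrow> ennreal" assume f: "f \<in> borel_measurable (LC {..<n})"
  have "(\<lambda>x. f (matvec n g x)) \<in> borel_measurable (LC {..<n})"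
    using f by measurable
  from bspec[OF assms(4)[unfolded pres_def] this]
  have "(\<integral>\<^sup>+ x. f (matvec n g (matvec n h x)) \<partial>LC {..<n}) = (\<integral>\<^sup>+ x. f (matvec n g x) \<partial>LC {..<n})" .
  also have "\<dots> = (\<integral>\<^sup>+ x. f x \<partial>LC {..<n})"
    using assms(3) f unfolding pres_def by blast
  finally show "(\<integral>\<^sup>+ x. f (matvec n (g * h) x) \<partial>LC {..<n}) = (\<integral>\<^sup>+ x. f x \<partial>LC {..<n})"
    by (simp add: matvec_mult[OF assms(1,2)])
qed

lemma pres_pl:
  assumes "i < n" "j < n" "i \<noteq> j" "\<alpha> * \<delta> - \<beta> * \<gamma> = 1"
  shows "pres n (pl n i j \<alpha> \<beta> \<gamma> \<delta>)"
  by (rule pl_shear_induct[OF assms pres_shear pres_mult])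

lemma pres_one: "pres n (1\<^sub>m n)"
  unfolding pres_def
proof
  fix f :: "(nat \<Rightarrow> complex) \<Rightarrow> ennreal"
  have "matvec n (1\<^sub>m n) x = x" if "x \<in> space (LC {..<n})" for x
    using that by (auto simp: matvec_def mv_one fun_eq_iff space_PiM PiE_def extensional_def)
  then show "(\<integral>\<^sup>+ x. f (matvec n (1\<^sub>m n) x) \<partial>LC {..<n}) = (\<integral>\<^sup>+ x. f x \<partial>LC {..<n})"
    by (intro nn_integral_cong) auto
qed

text \<open>Each factor from \<open>SU_SUgen\<close> is a plane block of determinant 1, hence a
  product of shears, although the shears themselves need not be pseudo-unitary.\<close>

lemma pres_SU:
  assumes n: "1 \<le> n" and g: "g \<in> carrier (SU_group n)"
  shows "pres n g"
  using SU_SUgen[OF n g]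
proof (induction rule: SUgen.induct)
  case one
  show ?case
    by (rule pres_one)
next
  case (step M g)
  obtain i j \<alpha> \<beta> \<gamma> \<delta> where "i < n" "j < n" "i \<noteq> j" "\<alpha> * \<delta> - \<beta> * \<gamma> = 1" and M: "M = pl n i j \<alpha> \<beta> \<gamma> \<delta>"
    using step.hyps by (auto simp: plane_exp_def)
  then have "pres n M"
    unfolding M by (intro pres_pl)
  then show ?case
    using step.IH SUgen_carrier[OF step.hyps(2)] by (intro pres_mult) (auto simp: M)
qed

text \<open>Apply the invariance under \<open>diag(z, 1/z)\<close> to a product with a disc.\<close>

lemma nn_integral_complex_scale:
  fixes h :: "complex \<Rightarrow> ennreal"
  assumes h: "h \<in> borel_measurable borel" and z: "z \<noteq> 0"
  shows "(\<integral>\<^sup>+ x. h x \<partial>lborel) = ennreal ((cmod z)\<^sup>2) * (\<integral>\<^sup>+ x. h (z * x) \<partial>lborel)"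
proof -
  define B :: "real \<Rightarrow> complex \<Rightarrow> ennreal" where "B r = indicator (cball 0 r)" for r
  have Bm: "B r \<in> borel_measurable borel" for r
    unfolding B_def by (rule borel_measurable_indicator) simp
  have IB: "(\<integral>\<^sup>+ x. B r x \<partial>lborel) = ennreal (pi * r\<^sup>2)" if "r \<ge> 0" for r
    using emeasure_cball[OF that, of "0 :: complex"] by (simp add: B_def unit_ball_vol_2)
  let ?f = "\<lambda>x. \<Prod>i<2. (if i = 0 then h else B 1) (x i)"
  have I2: "{..<2} = {0, 1 :: nat}"
    by auto
  have fm: "?f \<in> borel_measurable (LC {..<2})"
    using h Bm by (intro borel_measurable_prod_ennreal) (auto intro: measurable_compose[OF measurable_LC_component])
  have prod: "(\<integral>\<^sup>+ x. (\<Prod>i<2. (if i = 0 then f else g) (x i)) \<partial>LC {..<2}) = (\<integral>\<^sup>+ x. f x \<partial>lborel) * (\<integral>\<^sup>+ x. g x \<partial>lborel)"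
    if "f \<in> borel_measurable borel" "g \<in> borel_measurable borel" for f g :: "complex \<Rightarrow> ennreal"
    using LC.product_nn_integral_prod[of "{..<2}" "\<lambda>i. if i = 0 then f else g"] that
    by (auto simp: I2)
  have "pres 2 (pl 2 0 1 z 0 0 (1 / z))"
    using z by (intro pres_pl) auto
  from bspec[OF this[unfolded pres_def] fm]
  have "(\<integral>\<^sup>+ x. ?f (matvec 2 (pl 2 0 1 z 0 0 (1 / z)) x) \<partial>LC {..<2}) = (\<integral>\<^sup>+ x. ?f x \<partial>LC {..<2})" .
  also have "(\<lambda>x. ?f (matvec 2 (pl 2 0 1 z 0 0 (1 / z)) x)) =
      (\<lambda>x. \<Prod>i<2. (if i = 0 then (\<lambda>x. h (z * x)) else B (cmod z)) (x i))"
  proof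
    fix x :: "nat \<Rightarrow> complex"
    have "B 1 (x 1 / z) = B (cmod z) (x 1)"
      using z by (auto simp: B_def indicator_def norm_divide field_simps)
    then show "?f (matvec 2 (pl 2 0 1 z 0 0 (1 / z)) x) =
        (\<Prod>i<2. (if i = 0 then (\<lambda>x. h (z * x)) else B (cmod z)) (x i))"
      by (simp add: I2 matvec_def mv_pl)
  qed
  finally have "(\<integral>\<^sup>+ x. h (z * x) \<partial>lborel) * ennreal (pi * (cmod z)\<^sup>2) = (\<integral>\<^sup>+ x. h x \<partial>lborel) * ennreal pi"
    using h Bm IB[of 1] IB[of "cmod z"] by (simp add: prod)
  then have "ennreal pi * (ennreal ((cmod z)\<^sup>2) * (\<integral>\<^sup>+ x. h (z * x) \<partial>lborel)) = ennreal pi * (\<integral>\<^sup>+ x. h x \<partial>lborel)"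
    by (simp add: ennreal_mult mult_ac)
  then show ?thesis
    by (simp add: ennreal_mult_cancel_left)
qed

lemma nn_integral_LC_scale:
  assumes I: "finite I" and f: "f \<in> borel_measurable (LC I)" and z: "z \<noteq> 0"
  shows "(\<integral>\<^sup>+ x. f x \<partial>LC I) = ennreal ((cmod z)\<^sup>2) ^ card I * (\<integral>\<^sup>+ x. f (\<lambda>i\<in>I. z * x i) \<partial>LC I)"
  using I f
proof (induction I arbitrary: f)
  case empty
  show ?case
  proof -
    have e: "integral\<^sup>N (LC {}) g = g (\<lambda>_. undefined)" for g
      by (rule LC.nn_integral_empty) simp
    show ?thesis
      unfolding e by (simp add: restrict_def)
  qed
next
  case (insert k J)
  let ?s = "ennreal ((cmod z)\<^sup>2)"
  let ?F = "\<lambda>x. \<integral>\<^sup>+ y. f (x(k := y)) \<partial>lborel"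
  have Fm: "?F \<in> borel_measurable (LC J)"
  proof (rule sigma_finite_measure.borel_measurable_nn_integral[OF sigma_finite_lborel])
    show "(\<lambda>(x, y). f (x(k := y))) \<in> borel_measurable (LC J \<Otimes>\<^sub>M lborel)"
      using measurable_compose[OF measurable_add_dim[of k J "\<lambda>_. lborel"] insert.prems] by (simp add: case_prod_beta' del: fun_upd_apply)
  qed
  have gm: "(\<lambda>x. f (\<lambda>i\<in>insert k J. z * x i)) \<in> borel_measurable (LC (insert k J))"
    by (rule measurable_compose[OF measurable_LC_restrict insert.prems]) (auto intro: measurable_LC_component)
  have "(\<integral>\<^sup>+ x. f x \<partial>LC (insert k J)) = (\<integral>\<^sup>+ x. ?F x \<partial>LC J)"
    by (rule LC.product_nn_integral_insert[OF insert.hyps(1,2) insert.prems])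
  also have "\<dots> = ?s ^ card J * (\<integral>\<^sup>+ x. ?F (\<lambda>i\<in>J. z * x i) \<partial>LC J)"
    by (rule insert.IH[OF Fm])
  also have "(\<integral>\<^sup>+ x. ?F (\<lambda>i\<in>J. z * x i) \<partial>LC J) =
      (\<integral>\<^sup>+ x. ?s * (\<integral>\<^sup>+ y. f (\<lambda>i\<in>insert k J. z * (x(k := y)) i) \<partial>lborel) \<partial>LC J)"
  proof (rule nn_integral_cong)
    fix x assume "x \<in> space (LC J)"
    have sp: "(\<lambda>i\<in>J. z * x i) \<in> space (LC J)"
      by (auto simp: space_PiM)
    have e: "(\<lambda>i\<in>J. z * x i)(k := z * y) = (\<lambda>i\<in>insert k J. z * (x(k := y)) i)" for y
      using insert.hyps by (auto simp: fun_eq_iff)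
    show "?F (\<lambda>i\<in>J. z * x i) = ?s * (\<integral>\<^sup>+ y. f (\<lambda>i\<in>insert k J. z * (x(k := y)) i) \<partial>lborel)"
      using nn_integral_complex_scale[OF measurable_LC_update[OF insert.prems sp insert.hyps(2)] z] unfolding e .
  qed
  also have "\<dots> = ?s * (\<integral>\<^sup>+ x. (\<integral>\<^sup>+ y. f (\<lambda>i\<in>insert k J. z * (x(k := y)) i) \<partial>lborel) \<partial>LC J)"
  proof (rule nn_integral_cmult, rule sigma_finite_measure.borel_measurable_nn_integral[OF sigma_finite_lborel])
    show "(\<lambda>(x, y). f (\<lambda>i\<in>insert k J. z * (x(k := y)) i)) \<in> borel_measurable (LC J \<Otimes>\<^sub>M lborel)"
      using measurable_compose[OF measurable_add_dim[of k J "\<lambda>_. lborel"] gm] by (simp add: case_prod_beta' del: fun_upd_apply)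
  qed
  also have "(\<integral>\<^sup>+ x. (\<integral>\<^sup>+ y. f (\<lambda>i\<in>insert k J. z * (x(k := y)) i) \<partial>lborel) \<partial>LC J) =
      (\<integral>\<^sup>+ x. f (\<lambda>i\<in>insert k J. z * x i) \<partial>LC (insert k J))"
    by (rule LC.product_nn_integral_insert[OF insert.hyps(1,2) gm, symmetric])
  finally show ?case
    unfolding card_insert_disjoint[OF insert.hyps(1,2)] power_Suc by (simp only: mult.assoc mult.left_commute)
qed

text \<open>Invariant under U(1,n-1). Writing Z = y (1, X), it lies over the ball, and its fibre
  over each X is an annulus in y.\<close>

definition slab :: "nat \<Rightarrow> (nat \<Rightarrow> complex) set" where
  "slab n = {Z. 1 \<le> (cmod (Z 0))\<^sup>2 - (\<Sum>a\<in>{1..<n}. (cmod (Z a))\<^sup>2) \<and>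
     (cmod (Z 0))\<^sup>2 - (\<Sum>a\<in>{1..<n}. (cmod (Z a))\<^sup>2) \<le> 2}"

definition dehom :: "nat \<Rightarrow> (nat \<Rightarrow> complex) \<Rightarrow> nat \<Rightarrow> complex" where
  "dehom n Z = (\<lambda>a\<in>{1..<n}. Z a / Z 0)"

text \<open>The fibre integral over X = 0, with the weight |y|^(2(n-1)) that is the Jacobian of X ->
  y X.\<close>

definition kappa :: "nat \<Rightarrow> ennreal" where
  "kappa n = (\<integral>\<^sup>+ u. ennreal ((cmod u)\<^sup>2) ^ (n - 1) * indicator {u. 1 \<le> (cmod u)\<^sup>2 \<and> (cmod u)\<^sup>2 \<le> 2} u \<partial>(lborel :: complex measure))"

lemma measurable_dehom [measurable]: "1 \<le> n \<Longrightarrow> dehom n \<in> measurable (LC {..<n}) (LC {1..<n})"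
  unfolding dehom_def by (intro measurable_LC_restrict borel_measurable_divide measurable_LC_component) auto

lemma measurable_norms:
  "(\<lambda>X. (\<Sum>a\<in>{1..<n}. (cmod (X a))\<^sup>2)) \<in> borel_measurable (LC {1..<n})"
  "1 \<le> n \<Longrightarrow> (\<lambda>X. (cmod (X 0))\<^sup>2 - (\<Sum>a\<in>{1..<n}. (cmod (X a))\<^sup>2)) \<in> borel_measurable (LC {..<n})"
proof -
  have m: "(\<lambda>X. (cmod (X i))\<^sup>2) \<in> borel_measurable (LC I)" if "i \<in> I" for i I
    using measurable_LC_component[OF that] by measurable
  show "(\<lambda>X. (\<Sum>a\<in>{1..<n}. (cmod (X a))\<^sup>2)) \<in> borel_measurable (LC {1..<n})"
    by (intro borel_measurable_sum m)
  show "(\<lambda>X. (cmod (X 0))\<^sup>2 - (\<Sum>a\<in>{1..<n}. (cmod (X a))\<^sup>2)) \<in> borel_measurable (LC {..<n})" if "1 \<le> n"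
    using that by (intro borel_measurable_sum borel_measurable_diff m) auto
qed

lemma measurable_one_minus: "one_minus_normX2 n \<in> borel_measurable (LC {1..<n})"
  unfolding one_minus_normX2_def by (intro borel_measurable_diff measurable_norms) auto

lemma pred_slab: "1 \<le> n \<Longrightarrow> (indicator (slab n) :: _ \<Rightarrow> ennreal) \<in> borel_measurable (LC {..<n})"
proof -
  assume "1 \<le> n"
  note m = measurable_norms(2)[OF this]
  have "{Z \<in> space (LC {..<n}). Z \<in> slab n} \<in> sets (LC {..<n})"
    unfolding slab_def mem_Collect_eq using m by measurable
  then show ?thesis
    by (subst borel_measurable_indicator_iff) (simp add: Int_def conj_commute)
qed

lemma measurable_ball_weight:
  "(\<lambda>X. indicator (CH_ball n) X * ennreal (1 / one_minus_normX2 n X ^ n)) \<in> borel_measurable (LC {1..<n})"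
proof -
  have "{X \<in> space (LC {1..<n}). X \<in> CH_ball n} \<in> sets (LC {1..<n})"
    unfolding CH_ball_def mem_Collect_eq using measurable_norms(1)[of n] by measurable
  then have "(indicator (CH_ball n) :: _ \<Rightarrow> ennreal) \<in> borel_measurable (LC {1..<n})"
    by (subst borel_measurable_indicator_iff) (simp add: Int_def conj_commute)
  then show ?thesis
    using measurable_one_minus[of n] by measurable
qed

lemma kappa_pos: "kappa n > 0"
proof -
  \<comment> \<open>Moduli in this disc lie between 1.1 and 1.3, so their squares lie well inside
    [1, 2].\<close>
  have "ball (6 / 5) (1 / 10) \<subseteq> {u :: complex. 1 \<le> (cmod u)\<^sup>2 \<and> (cmod u)\<^sup>2 \<le> 2}"
  proof
    fix u :: complex assume "u \<in> ball (6 / 5) (1 / 10)"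
    then have d: "cmod (6 / 5 - u) < 1 / 10"
      by (simp add: dist_norm)
    have "cmod (6 / 5 :: complex) = 6 / 5"
      by simp
    then have l: "11 / 10 \<le> cmod u" "cmod u \<le> 13 / 10"
      using d norm_triangle_ineq2[of "6 / 5" u] norm_triangle_ineq3[of "6 / 5" u] by linarith+
    have "(11 / 10)\<^sup>2 \<le> (cmod u)\<^sup>2" "(cmod u)\<^sup>2 \<le> (13 / 10)\<^sup>2"
      using l by (auto intro: power_mono)
    then show "u \<in> {u. 1 \<le> (cmod u)\<^sup>2 \<and> (cmod u)\<^sup>2 \<le> 2}"
      by (simp add: power2_eq_square)
  qed
  note sub = this
  have "emeasure lborel (ball (6 / 5 :: complex) (1 / 10)) \<le>
      (\<integral>\<^sup>+ u. indicator {u :: complex. 1 \<le> (cmod u)\<^sup>2 \<and> (cmod u)\<^sup>2 \<le> 2} u \<partial>lborel)"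
  proof -
    have "{u :: complex. 1 \<le> (cmod u)\<^sup>2 \<and> (cmod u)\<^sup>2 \<le> 2} \<in> sets lborel"
      by measurable
    then show ?thesis
      using emeasure_mono[OF sub] by (simp add: nn_integral_indicator)
  qed
  also have "\<dots> \<le> kappa n"
    unfolding kappa_def
  proof (intro nn_integral_mono)
    fix u :: complex
    have "1 \<le> ennreal ((cmod u)\<^sup>2) ^ (n - 1)" if "1 \<le> (cmod u)\<^sup>2"
      using that by (intro one_le_power) (simp add: ennreal_ge_1)
    then show "indicator {u. 1 \<le> (cmod u)\<^sup>2 \<and> (cmod u)\<^sup>2 \<le> 2} u \<le>
        ennreal ((cmod u)\<^sup>2) ^ (n - 1) * indicator {u. 1 \<le> (cmod u)\<^sup>2 \<and> (cmod u)\<^sup>2 \<le> 2} u"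
      by (auto simp: indicator_def)
  qed
  finally show ?thesis
    using emeasure_ball[of "1 / 10" "6 / 5 :: complex"] by (simp add: unit_ball_vol_2 order.strict_trans2[rotated])
qed

text \<open>For fixed y = Z^0 the substitution Z = y (1, X) has Jacobian |y|^(2(n-1)). Then, for
  fixed X, rescaling y by the square root of 1 - |X|^2 turns the annulus into that of
  \<open>kappa\<close> and costs the power -n: -(n-1) from the weight and -1 from the area
  element.\<close>

lemma slab_to_ball:
  assumes n: "1 \<le> n" and q: "q \<in> borel_measurable (LC {1..<n})"
  shows "(\<integral>\<^sup>+ Z. indicator (slab n) Z * q (dehom n Z) \<partial>LC {..<n}) =
    kappa n * (\<integral>\<^sup>+ X. indicator (CH_ball n) X * ennreal (1 / one_minus_normX2 n X ^ n) * q X \<partial>LC {1..<n})"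
proof -
  let ?J = "{1..<n}"
  have I: "{..<n} = insert 0 ?J" and J: "finite ?J" "0 \<notin> ?J"
    using n by auto
  let ?Q = "one_minus_normX2 n"
  let ?A = "{t :: real. 1 \<le> t \<and> t \<le> 2}"
  let ?H = "\<lambda>y X. ennreal ((cmod y)\<^sup>2) ^ (n - 1) * indicator ?A ((cmod y)\<^sup>2 * ?Q X) :: ennreal"
  let ?f = "\<lambda>Z. indicator (slab n) Z * q (dehom n Z) :: ennreal"
  have fm: "?f \<in> borel_measurable (LC {..<n})"
    using pred_slab[OF n] measurable_compose[OF measurable_dehom[OF n] q] by (intro borel_measurable_times_ennreal)
  have Hm: "(\<lambda>(y, X). ?H y X * q X) \<in> borel_measurable (lborel \<Otimes>\<^sub>M LC ?J)"
  proof -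
    have "(\<lambda>p. ?Q (snd p)) \<in> borel_measurable (lborel \<Otimes>\<^sub>M LC ?J)" for T :: "complex measure"
      by (rule measurable_compose[OF measurable_snd measurable_one_minus])
    moreover have "(\<lambda>p. q (snd p)) \<in> borel_measurable (lborel \<Otimes>\<^sub>M LC ?J)" for T :: "complex measure"
      by (rule measurable_compose[OF measurable_snd q])
    ultimately show ?thesis
      unfolding case_prod_beta by measurable
  qed
  have "(\<integral>\<^sup>+ Z. ?f Z \<partial>LC {..<n}) = (\<integral>\<^sup>+ y. (\<integral>\<^sup>+ Y. ?f (Y(0 := y)) \<partial>LC ?J) \<partial>lborel)"
    unfolding I by (rule LC.product_nn_integral_insert_rev[OF J fm[unfolded I]])
  also have "\<dots> = (\<integral>\<^sup>+ y. (\<integral>\<^sup>+ X. ?H y X * q X \<partial>LC ?J) \<partial>lborel)"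
  proof (rule nn_integral_cong)
    fix y :: complex
    have sl: "Y(0 := y) \<in> slab n \<longleftrightarrow> (cmod y)\<^sup>2 - (\<Sum>a\<in>?J. (cmod (Y a))\<^sup>2) \<in> ?A" for Y
    proof -
      have "(\<Sum>a\<in>?J. (cmod ((Y(0 := y)) a))\<^sup>2) = (\<Sum>a\<in>?J. (cmod (Y a))\<^sup>2)"
        by (intro sum.cong) auto
      then show ?thesis
        by (simp add: slab_def)
    qed
    show "(\<integral>\<^sup>+ Y. ?f (Y(0 := y)) \<partial>LC ?J) = (\<integral>\<^sup>+ X. ?H y X * q X \<partial>LC ?J)"
    proof (cases "y = 0")
      case True
      have "(0 :: real) \<le> (\<Sum>a\<in>?J. (cmod (Y a))\<^sup>2)" for Y :: "nat \<Rightarrow> complex"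
        by (intro sum_nonneg) auto
      note nn = this
      have "\<not> 1 \<le> (cmod y)\<^sup>2 - (\<Sum>a\<in>?J. (cmod (Y a))\<^sup>2)" for Y :: "nat \<Rightarrow> complex"
        using nn[of Y] unfolding True by simp
      then have "Y(0 := y) \<notin> slab n" for Y
        unfolding sl mem_Collect_eq by blast
      then show ?thesis
        using True by (simp add: indicator_def)
    next
      case False
      let ?G = "\<lambda>Y. ?f (Y(0 := y))"
      have Gm: "?G \<in> borel_measurable (LC ?J)"
      proof -
        have "(\<lambda>Y. (Y, y)) \<in> measurable (LC ?J) (LC ?J \<Otimes>\<^sub>M lborel)"
          by simp
        from measurable_compose[OF measurable_compose[OF this measurable_add_dim[of 0 ?J "\<lambda>_. lborel"]] fm[unfolded I]]
        show ?thesis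
          by simp
      qed
      have "(\<integral>\<^sup>+ Y. ?G Y \<partial>LC ?J) = ennreal ((cmod y)\<^sup>2) ^ card ?J * (\<integral>\<^sup>+ X. ?G (\<lambda>i\<in>?J. y * X i) \<partial>LC ?J)"
        by (rule nn_integral_LC_scale[OF J(1) Gm False])
      also have "(\<integral>\<^sup>+ X. ?G (\<lambda>i\<in>?J. y * X i) \<partial>LC ?J) = (\<integral>\<^sup>+ X. indicator ?A ((cmod y)\<^sup>2 * ?Q X) * q X \<partial>LC ?J)"
      proof (rule nn_integral_cong)
        fix X assume X: "X \<in> space (LC ?J)"
        have "(\<Sum>a\<in>?J. (cmod ((\<lambda>i\<in>?J. y * X i) a))\<^sup>2) = (cmod y)\<^sup>2 * (\<Sum>a\<in>?J. (cmod (X a))\<^sup>2)"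
          unfolding sum_distrib_left by (intro sum.cong) (auto simp: norm_mult power_mult_distrib)
        then have "(\<lambda>i\<in>?J. y * X i)(0 := y) \<in> slab n \<longleftrightarrow> (cmod y)\<^sup>2 * ?Q X \<in> ?A"
          unfolding sl by (simp only:) (simp add: one_minus_normX2_def right_diff_distrib)
        moreover have "dehom n ((\<lambda>i\<in>?J. y * X i)(0 := y)) = X"
          using X False by (auto simp: dehom_def fun_eq_iff space_PiM PiE_def extensional_def)
        ultimately show "?G (\<lambda>i\<in>?J. y * X i) = indicator ?A ((cmod y)\<^sup>2 * ?Q X) * q X"
          by (simp add: indicator_def)
      qed
      also have "ennreal ((cmod y)\<^sup>2) ^ card ?J * \<dots> = (\<integral>\<^sup>+ X. ?H y X * q X \<partial>LC ?J)"
      proof -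
        have "(\<lambda>X. indicator ?A ((cmod y)\<^sup>2 * ?Q X) * q X) \<in> borel_measurable (LC ?J)"
          using measurable_one_minus[of n] q by measurable
        then show ?thesis
          by (subst nn_integral_cmult[symmetric]) (auto simp: mult.assoc)
      qed
      finally show ?thesis .
    qed
  qed
  also have "\<dots> = (\<integral>\<^sup>+ X. (\<integral>\<^sup>+ y. ?H y X * q X \<partial>lborel) \<partial>LC ?J)"
  proof -
    interpret pair_sigma_finite lborel "LC ?J"
      by (intro pair_sigma_finite.intro sigma_finite_lborel sigma_finite_LC) simp
    show ?thesis
      using Fubini'[OF Hm] by simp
  qed
  also have "\<dots> = (\<integral>\<^sup>+ X. kappa n * (indicator (CH_ball n) X * ennreal (1 / ?Q X ^ n) * q X) \<partial>LC ?J)"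
  proof (rule nn_integral_cong)
    fix X assume "X \<in> space (LC ?J)"
    have Hy: "(\<lambda>y. ?H y X) \<in> borel_measurable borel"
      by measurable
    have H0: "(\<lambda>u. ennreal ((cmod u)\<^sup>2) ^ (n - 1) * indicator {u. 1 \<le> (cmod u)\<^sup>2 \<and> (cmod u)\<^sup>2 \<le> 2} u :: ennreal) \<in> borel_measurable (borel :: complex measure)"
      by measurable
    have "(\<integral>\<^sup>+ y. ?H y X \<partial>lborel) = kappa n * (indicator (CH_ball n) X * ennreal (1 / ?Q X ^ n))"
    proof (cases "X \<in> CH_ball n")
      case False
      then have "?Q X \<le> 0"
        by (simp add: CH_ball_def one_minus_normX2_def)
      then have "(cmod y)\<^sup>2 * ?Q X \<le> 0" for y :: complex
        by (simp add: mult_nonneg_nonpos)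
      then have nA: "(cmod y)\<^sup>2 * ?Q X \<notin> ?A" for y :: complex
        by (metis (mono_tags, lifting) mem_Collect_eq not_one_le_zero order_trans)
      then have "?H y X = 0" for y :: complex
        unfolding indicator_simps(2)[OF nA] by simp
      then show ?thesis
        using False by (simp only:) simp
    next
      case True
      then have Q: "?Q X > 0"
        by (simp add: CH_ball_def one_minus_normX2_def)
      define s where "s = complex_of_real (sqrt (?Q X))"
      have s: "s \<noteq> 0" "(cmod s)\<^sup>2 = ?Q X"
        using Q by (auto simp: s_def)
      have e: "ennreal ((cmod (s * y))\<^sup>2) ^ (n - 1) * indicator {u. 1 \<le> (cmod u)\<^sup>2 \<and> (cmod u)\<^sup>2 \<le> 2} (s * y) =
          ennreal (?Q X ^ (n - 1)) * ?H y X" for y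
        using Q by (simp add: norm_mult power_mult_distrib s ennreal_mult ennreal_power indicator_def mult_ac)
      have "kappa n = ennreal (?Q X) * (\<integral>\<^sup>+ y. ennreal (?Q X ^ (n - 1)) * ?H y X \<partial>lborel)"
        unfolding kappa_def nn_integral_complex_scale[OF H0 s(1)] e s(2) ..
      also have "(\<integral>\<^sup>+ y. ennreal (?Q X ^ (n - 1)) * ?H y X \<partial>lborel) = ennreal (?Q X ^ (n - 1)) * (\<integral>\<^sup>+ y. ?H y X \<partial>lborel)"
        using Hy by (intro nn_integral_cmult) simp
      also have "ennreal (?Q X) * \<dots> = ennreal (?Q X ^ n) * (\<integral>\<^sup>+ y. ?H y X \<partial>lborel)"
        using Q n by (simp add: ennreal_mult[symmetric] mult.assoc[symmetric] power_eq_if[of _ n])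
      finally have k: "kappa n = ennreal (?Q X ^ n) * (\<integral>\<^sup>+ y. ?H y X \<partial>lborel)" .
      have "ennreal (1 / ?Q X ^ n) * kappa n = ennreal (1 / ?Q X ^ n * ?Q X ^ n) * (\<integral>\<^sup>+ y. ?H y X \<partial>lborel)"
        unfolding k using Q by (subst ennreal_mult) (auto simp: mult.assoc)
      also have "1 / ?Q X ^ n * ?Q X ^ n = 1"
        using Q by simp
      finally show ?thesis
        using True by (simp add: mult.commute)
    qed
    moreover have "(\<integral>\<^sup>+ y. ?H y X * q X \<partial>lborel) = (\<integral>\<^sup>+ y. ?H y X \<partial>lborel) * q X"
      using Hy by (intro nn_integral_multc) simp
    ultimately show "(\<integral>\<^sup>+ y. ?H y X * q X \<partial>lborel) = kappa n * (indicator (CH_ball n) X * ennreal (1 / ?Q X ^ n) * q X)"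
      by (simp add: mult_ac)
  qed
  also have "\<dots> = kappa n * (\<integral>\<^sup>+ X. indicator (CH_ball n) X * ennreal (1 / ?Q X ^ n) * q X \<partial>LC ?J)"
  proof (rule nn_integral_cmult)
    show "(\<lambda>X. indicator (CH_ball n) X * ennreal (1 / ?Q X ^ n) * q X) \<in> borel_measurable (LC ?J)"
      by (intro borel_measurable_times_ennreal measurable_ball_weight q)
  qed
  finally show ?thesis .
qed

section \<open>Haar measure\<close>

text \<open>Open sets of the pullback topology are traces of preimages, so a cover of K comes from a
  cover of its image and a finite subcover comes back.\<close>

lemma compactin_pullback:
  assumes K: "K \<subseteq> A" and c: "compactin T (f ` K)"
  shows "compactin (pullback_topology A f T) K"
  unfolding compactin_def
proof (intro conjI allI impI)
  show "K \<subseteq> topspace (pullback_topology A f T)"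
    using K compactin_subset_topspace[OF c] by (auto simp: topspace_pullback_topology)
  fix \<U> assume U: "(\<forall>U\<in>\<U>. openin (pullback_topology A f T) U) \<and> K \<subseteq> \<Union>\<U>"
  then have "\<forall>U\<in>\<U>. \<exists>V. openin T V \<and> U = f -` V \<inter> A"
    by (simp add: openin_pullback_topology)
  then obtain V where V: "\<And>U. U \<in> \<U> \<Longrightarrow> openin T (V U) \<and> U = f -` V U \<inter> A"
    by metis
  have "f ` K \<subseteq> \<Union>(V ` \<U>)"
    using U V by blast
  moreover have "\<forall>W\<in>V ` \<U>. openin T W"
    using V by blast
  ultimately obtain F where F: "finite F" "F \<subseteq> V ` \<U>" "f ` K \<subseteq> \<Union>F"
    using c unfolding compactin_def by meson
  obtain W where W: "W \<subseteq> \<U>" "finite W" "F = V ` W"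
    using finite_subset_image[OF F(1,2)] by blast
  have "K \<subseteq> \<Union>W"
  proof
    fix x assume x: "x \<in> K"
    then obtain U' where "U' \<in> W" "f x \<in> V U'"
      using F(3) W(3) by blast
    then show "x \<in> \<Union>W"
      using V W(1) K x by blast
  qed
  then show "\<exists>F. finite F \<and> F \<subseteq> \<U> \<and> K \<subseteq> \<Union>F"
    using W by blast
qed

lemma SU_top_continuous:
  assumes "i < n" "j < n"
  shows "continuous_map (SU_top n) euclidean (\<lambda>g. g $$ (i, j))"
proof -
  have "continuous_map euclidean euclidean (\<lambda>x :: nat \<times> nat \<Rightarrow> complex. x (i, j))"
    by (simp add: continuous_map_iff_continuous2 continuous_on_product_coordinates)
  from continuous_map_pullback[OF this, of "carrier (SU_group n)" "\<lambda>g. \<lambda>ij\<in>{..<n} \<times> {..<n}. g $$ ij"]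
  show ?thesis
    using assms unfolding SU_top_def by (simp add: comp_def)
qed

lemma Heis_top_continuous:
  "k < n \<Longrightarrow> continuous_map (Heis_top n) euclidean (\<lambda>h. fst h $ k)"
  "continuous_map (Heis_top n) euclidean (\<lambda>h. snd h)"
proof -
  let ?f = "\<lambda>(v, t). (\<lambda>k\<in>{..<n}. v $ k, t :: real)"
  have "continuous_map euclidean euclidean (\<lambda>x :: (nat \<Rightarrow> complex) \<times> real. fst x k)"
    by (simp add: continuous_map_iff_continuous2 continuous_on_compose2[OF continuous_on_product_coordinates continuous_on_fst[OF continuous_on_id]])
  from continuous_map_pullback[OF this, of "carrier (Heis_group n)" ?f]
  show "continuous_map (Heis_top n) euclidean (\<lambda>h. fst h $ k)" if "k < n"
    using that unfolding Heis_top_def by (simp add: comp_def case_prod_beta)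
  have "continuous_map euclidean euclidean (\<lambda>x :: (nat \<Rightarrow> complex) \<times> real. snd x)"
    by (simp add: continuous_map_iff_continuous2 continuous_on_snd continuous_on_id)
  from continuous_map_pullback[OF this, of "carrier (Heis_group n)" ?f]
  show "continuous_map (Heis_top n) euclidean (\<lambda>h. snd h)"
    unfolding Heis_top_def by (simp add: comp_def case_prod_beta)
qed

lemma topspace_groups [simp]:
  "topspace (SU_top n) = carrier (SU_group n)" "topspace (Heis_top n) = carrier (Heis_group n)"
  "topspace (SUHeis_top n) = carrier (SUHeis n)"
  by (auto simp: SU_top_def Heis_top_def SUHeis_top_def topspace_pullback_topology SUHeis_simps)

lemma SUHeis_top_continuous:
  "i < n \<Longrightarrow> j < n \<Longrightarrow> continuous_map (SUHeis_top n) euclidean (\<lambda>d. fst d $$ (i, j))"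
  "k < n \<Longrightarrow> continuous_map (SUHeis_top n) euclidean (\<lambda>d. fst (snd d) $ k)"
  "continuous_map (SUHeis_top n) euclidean (\<lambda>d. snd (snd d))"
  unfolding SUHeis_top_def
  using continuous_map_compose[OF continuous_map_fst SU_top_continuous]
    continuous_map_compose[OF continuous_map_snd Heis_top_continuous(1)]
    continuous_map_compose[OF continuous_map_snd Heis_top_continuous(2)]
  by (simp_all add: comp_def)

lemma haar_space: "haar_measure (SUHeis n) (SUHeis_top n) \<mu> \<Longrightarrow> space \<mu> = carrier (SUHeis n)"
  by (simp add: haar_measure_def)

lemma haar_measurable:
  fixes f :: "complex mat \<times> heis \<Rightarrow> 'a :: topological_space"
  assumes h: "haar_measure (SUHeis n) (SUHeis_top n) \<mu>" and f: "continuous_map (SUHeis_top n) euclidean f"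
  shows "f \<in> borel_measurable \<mu>"
proof (rule borel_measurableI)
  fix S :: "'a set" assume "open S"
  then have "openin (SUHeis_top n) {d \<in> topspace (SUHeis_top n). f d \<in> S}"
    by (intro openin_continuous_map_preimage[OF f]) simp
  also have "{d \<in> topspace (SUHeis_top n). f d \<in> S} = f -` S \<inter> space \<mu>"
    by (auto simp: haar_space[OF h])
  finally have "f -` S \<inter> space \<mu> \<in> sigma_sets (carrier (SUHeis n)) {U. openin (SUHeis_top n) U}"
    by (intro sigma_sets.Basic) simp
  then show "f -` S \<inter> space \<mu> \<in> sets \<mu>"
    using h by (simp add: haar_measure_def)
qed

text \<open>The group is a carrier set with a topology, so a map into it is called measurable if its
  coordinates are; this is the form in which the explicit formulas of the action use it.\<close>

definition measurable_in_SUHeis :: "nat \<Rightarrow> 'a measure \<Rightarrow> ('a \<Rightarrow> complex mat \<times> heis) \<Rightarrow> bool" where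
  "measurable_in_SUHeis n M d \<longleftrightarrow> (\<forall>m\<in>space M. d m \<in> carrier (SUHeis n)) \<and>
     (\<forall>i<n. \<forall>j<n. (\<lambda>m. fst (d m) $$ (i, j)) \<in> borel_measurable M) \<and>
     (\<forall>k<n. (\<lambda>m. fst (snd (d m)) $ k) \<in> borel_measurable M) \<and>
     (\<lambda>m. snd (snd (d m))) \<in> borel_measurable M"

lemma haar_measurable_id:
  "haar_measure (SUHeis n) (SUHeis_top n) \<mu> \<Longrightarrow> measurable_in_SUHeis n \<mu> (\<lambda>d. d)"
  unfolding measurable_in_SUHeis_def using haar_space[of n \<mu>]
  by (auto intro: haar_measurable SUHeis_top_continuous)

lemma measurable_in_SUHeis_compose:
  assumes "measurable_in_SUHeis n M d" "f \<in> measurable N M"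
  shows "measurable_in_SUHeis n N (\<lambda>x. d (f x))"
  unfolding measurable_in_SUHeis_def
proof (intro conjI allI impI ballI)
  show "d (f m) \<in> carrier (SUHeis n)" if "m \<in> space N" for m
    using assms measurable_space[OF assms(2) that] by (simp add: measurable_in_SUHeis_def)
  show "(\<lambda>m. fst (d (f m)) $$ (i, j)) \<in> borel_measurable N" if "i < n" "j < n" for i j
    using measurable_compose[OF assms(2), of "\<lambda>m. fst (d m) $$ (i, j)"] assms(1) that by (simp add: measurable_in_SUHeis_def)
  show "(\<lambda>m. fst (snd (d (f m))) $ k) \<in> borel_measurable N" if "k < n" for k
    using measurable_compose[OF assms(2), of "\<lambda>m. fst (snd (d m)) $ k"] assms(1) that by (simp add: measurable_in_SUHeis_def)
  show "(\<lambda>m. snd (snd (d (f m)))) \<in> borel_measurable N"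
    using measurable_compose[OF assms(2), of "\<lambda>m. snd (snd (d m))"] assms(1) by (simp add: measurable_in_SUHeis_def)
qed

section \<open>Joint measurability of the action in the group element and the point\<close>

lemma borel_measurable_cnj: "f \<in> borel_measurable M \<Longrightarrow> (\<lambda>x. cnj (f x)) \<in> borel_measurable M"
  by (erule measurable_compose) (intro borel_measurable_continuous_onI continuous_intros)

lemma measurable_mv_entries:
  assumes "\<And>j. j < n \<Longrightarrow> (\<lambda>m. g m $$ (i, j)) \<in> borel_measurable M" "\<And>j. j < n \<Longrightarrow> (\<lambda>m. x m j) \<in> borel_measurable M"
  shows "(\<lambda>m. mv n (g m) (x m) i) \<in> borel_measurable M"
  unfolding mv_def using assms by (intro borel_measurable_sum borel_measurable_times) auto

lemma measurable_adj_co: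
  assumes "\<And>i j. i < n \<Longrightarrow> j < n \<Longrightarrow> (\<lambda>m. g m $$ (i, j)) \<in> borel_measurable M" "i < n" "j < n"
  shows "(\<lambda>m. adj n (g m) $$ (i, j)) \<in> borel_measurable M"
    and "(\<lambda>m. co n (g m) $$ (i, j)) \<in> borel_measurable M"
  using assms by (auto simp: adj_def co_def intro!: borel_measurable_times borel_measurable_cnj)

lemma measurable_iinv:
  assumes n: "1 \<le> n" and d: "measurable_in_SUHeis n M d"
  shows "measurable_in_SUHeis n M (\<lambda>m. iinv n (d m))"
  unfolding measurable_in_SUHeis_def
proof (intro conjI allI impI ballI)
  have m: "(\<lambda>m. fst (d m) $$ (i, j)) \<in> borel_measurable M" if "i < n" "j < n" for i j
    using d that by (simp add: measurable_in_SUHeis_def)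
  show "iinv n (d m) \<in> carrier (SUHeis n)" if "m \<in> space M" for m
    using d that by (intro iinv_SUHeis[OF n]) (simp add: measurable_in_SUHeis_def)
  show "(\<lambda>m. fst (iinv n (d m)) $$ (i, j)) \<in> borel_measurable M" if "i < n" "j < n" for i j
    using measurable_adj_co(1)[OF m that] by (simp add: iinv_def case_prod_beta)
  show "(\<lambda>m. fst (snd (iinv n (d m))) $ k) \<in> borel_measurable M" if k: "k < n" for k
  proof -
    have "(\<lambda>m. - mv n (co n (adj n (fst (d m)))) (($) (fst (snd (d m)))) k) \<in> borel_measurable M"
      using d k by (intro borel_measurable_uminus measurable_mv_entries measurable_adj_co m) (auto simp: measurable_in_SUHeis_def)
    moreover have "fst (snd (iinv n (d m))) $ k = - mv n (co n (adj n (fst (d m)))) (($) (fst (snd (d m)))) k"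
      if "m \<in> space M" for m
    proof -
      have v: "fst (snd (d m)) \<in> carrier_vec n"
        using d that by (auto simp: measurable_in_SUHeis_def SUHeis_simps mem_Times_iff)
      have "(co n (adj n (fst (d m))) *\<^sub>v fst (snd (d m))) $ k = mv n (co n (adj n (fst (d m)))) (($) (fst (snd (d m)))) k"
        using v k by (intro mult_vec_index) auto
      then show ?thesis
        using k by (simp add: iinv_def case_prod_beta del: index_mult_mat_vec)
    qed
    ultimately show ?thesis
      by (subst measurable_cong[where g = "\<lambda>m. - mv n (co n (adj n (fst (d m)))) (($) (fst (snd (d m)))) k"])
  qed
  show "(\<lambda>m. snd (snd (iinv n (d m)))) \<in> borel_measurable M"
    using d by (simp add: iinv_def case_prod_beta measurable_in_SUHeis_def)
qed

text \<open>The discontinuities of \<open>Arg\<close> lie on the closed negative real axis, where it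
  is constantly pi, apart from the value 0 by convention at the origin.\<close>

lemma measurable_Arg: "Arg \<in> borel_measurable borel"
proof -
  have "(\<lambda>z. if z \<in> \<real>\<^sub>\<le>\<^sub>0 then pi else Arg z) \<in> borel_measurable borel"
    by (intro borel_measurable_continuous_on_if continuous_on_Arg continuous_intros borel_closed) auto
  then have m: "(\<lambda>z. if z = 0 then 0 else if z \<in> \<real>\<^sub>\<le>\<^sub>0 then pi else Arg z) \<in> borel_measurable borel"
    by measurable
  have "Arg z = (if z = 0 then 0 else if z \<in> \<real>\<^sub>\<le>\<^sub>0 then pi else Arg z)" for z
  proof (cases "z = 0 \<or> z \<notin> \<real>\<^sub>\<le>\<^sub>0")
    case True
    then show ?thesis
      by (auto simp: Arg_zero)
  next
    case False
    then have "Re z < 0 \<and> Im z = 0"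
      by (auto simp: complex_nonpos_Reals_iff complex_eq_iff less_le)
    then show ?thesis
      using False by (simp add: Arg_eq_pi)
  qed
  then show ?thesis
    using m by (subst measurable_cong) auto
qed

lemma coord_eq: "coord_X = fst" "coord_w = (\<lambda>p. fst (snd p))" "coord_phi = (\<lambda>p. fst (snd (snd p)))"
    "coord_rho = (\<lambda>p. snd (snd (snd p)))"
  by (auto simp: fun_eq_iff)

lemma measurable_coords:
  "coord_X \<in> measurable (coord_lebesgue n) (LC {1..<n})" "coord_w \<in> measurable (coord_lebesgue n) (LC {..<n})"
  "coord_phi \<in> borel_measurable (coord_lebesgue n)" "coord_rho \<in> borel_measurable (coord_lebesgue n)"
  unfolding coord_eq coord_lebesgue_def by measurable

lemma measurable_coord_entries:
  assumes p: "p \<in> measurable M (coord_lebesgue n)"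
  shows "a \<in> {1..<n} \<Longrightarrow> (\<lambda>m. coord_X (p m) a) \<in> borel_measurable M"
    "k < n \<Longrightarrow> (\<lambda>m. coord_w (p m) k) \<in> borel_measurable M"
    "(\<lambda>m. coord_phi (p m)) \<in> borel_measurable M" "(\<lambda>m. coord_rho (p m)) \<in> borel_measurable M"
  using measurable_compose[OF measurable_compose[OF p measurable_coords(1)] measurable_LC_component[of a]]
    measurable_compose[OF measurable_compose[OF p measurable_coords(2)] measurable_LC_component[of k]]
    measurable_compose[OF p measurable_coords(3)] measurable_compose[OF p measurable_coords(4)] by auto

lemma measurable_mat_Z:
  assumes "\<And>j. j < n \<Longrightarrow> (\<lambda>m. g m $$ (i, j)) \<in> borel_measurable M" "\<And>a. a \<in> {1..<n} \<Longrightarrow> (\<lambda>m. X m a) \<in> borel_measurable M"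
  shows "(\<lambda>m. mat_Z n (g m) (X m) i) \<in> borel_measurable M"
proof -
  have "(\<lambda>m. if j = 0 then 1 else X m j) \<in> borel_measurable M" if "j < n" for j
    using assms(2)[of j] that by (cases "j = 0") auto
  then show ?thesis
    unfolding mat_Z_def using assms(1) by (intro borel_measurable_sum borel_measurable_times) auto
qed

lemma act_eq:
  "act n c d \<theta> p =
     (\<lambda>b\<in>{1..<n}. mat_Z n (fst d) (coord_X p) b / mat_Z n (fst d) (coord_X p) 0,
      \<lambda>k\<in>{..<n}. mv n (co n (fst d)) (coord_w p) k + fst (snd d) $ k / 2,
      coord_phi p - 2 * c * \<theta> + omega n (fst (snd d)) (vec n (mv n (co n (fst d)) (coord_w p))) + snd (snd d),
      coord_rho p)"
  by (cases d, cases p) (auto split: prod.splits)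

lemma measurable_act:
  assumes n: "1 \<le> n" and d: "measurable_in_SUHeis n M d" and \<theta>: "\<theta> \<in> borel_measurable M"
    and p: "p \<in> measurable M (coord_lebesgue n)"
  shows "(\<lambda>m. act n c (d m) (\<theta> m) (p m)) \<in> measurable M (coord_lebesgue n)"
proof -
  have dm: "\<And>i j. i < n \<Longrightarrow> j < n \<Longrightarrow> (\<lambda>m. fst (d m) $$ (i, j)) \<in> borel_measurable M"
    "\<And>k. k < n \<Longrightarrow> (\<lambda>m. fst (snd (d m)) $ k) \<in> borel_measurable M"
    "(\<lambda>m. snd (snd (d m))) \<in> borel_measurable M"
    using d by (auto simp: measurable_in_SUHeis_def)
  note pm = measurable_coord_entries[OF p]
  have wm: "(\<lambda>m. mv n (co n (fst (d m))) (coord_w (p m)) k) \<in> borel_measurable M" if "k < n" for k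
    using that by (intro measurable_mv_entries measurable_adj_co dm pm) auto
  have "(\<lambda>m. \<lambda>b\<in>{1..<n}. mat_Z n (fst (d m)) (coord_X (p m)) b / mat_Z n (fst (d m)) (coord_X (p m)) 0) \<in> measurable M (LC {1..<n})"
    using n by (intro measurable_LC_restrict borel_measurable_divide measurable_mat_Z dm pm) auto
  moreover have "(\<lambda>m. \<lambda>k\<in>{..<n}. mv n (co n (fst (d m))) (coord_w (p m)) k + fst (snd (d m)) $ k / 2) \<in> measurable M (LC {..<n})"
    using n by (intro measurable_LC_restrict borel_measurable_divide borel_measurable_add borel_measurable_const wm dm) auto
  moreover have "(\<lambda>m. omega n (fst (snd (d m))) (vec n (mv n (co n (fst (d m))) (coord_w (p m))))) \<in> borel_measurable M"
  proof -
    have "(\<lambda>m. vec n (mv n (co n (fst (d m))) (coord_w (p m))) $ k) \<in> borel_measurable M" if "k < n" for k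
      using wm[OF that] that by simp
    then show ?thesis
      unfolding omega_def using n
      by (intro borel_measurable_diff borel_measurable_sum borel_measurable_times borel_measurable_cnj dm
          measurable_compose[OF _ borel_measurable_Im]) auto
  qed
  ultimately show ?thesis
    unfolding act_eq coord_lebesgue_def using dm(3) pm \<theta> n
    by (intro measurable_Pair) auto
qed

lemma measurable_Theta:
  assumes n: "1 \<le> n" and d: "measurable_in_SUHeis n M d" and X: "\<And>a. a \<in> {1..<n} \<Longrightarrow> (\<lambda>m. X m a) \<in> borel_measurable M"
  shows "(\<lambda>m. Theta n (fst (d m)) (X m)) \<in> borel_measurable M"
  unfolding Theta_def using assms
  by (intro borel_measurable_add measurable_compose[OF _ measurable_Arg] borel_measurable_divide measurable_mat_Z)
    (auto simp: measurable_in_SUHeis_def)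

lemma measurable_qact:
  assumes n: "1 \<le> n" and d: "measurable_in_SUHeis n M d" and p: "p \<in> measurable M (coord_lebesgue n)"
  shows "(\<lambda>m. qact n c (d m) (p m)) \<in> measurable M (coord_lebesgue n)"
  unfolding qact_def using measurable_coord_entries[OF p]
  by (intro measurable_act[OF n d _ p] measurable_Theta[OF n d]) auto

text \<open>A left inverse of \<open>qact\<close>; since \<open>Theta\<close> is only a cocycle up to periods, it is not \<open>qact\<close> of the inverse.\<close>

definition qinv :: "nat \<Rightarrow> real \<Rightarrow> complex mat \<times> heis \<Rightarrow> coords \<Rightarrow> coords" where
  "qinv n c d q = act n c (iinv n d) (- Theta n (fst d) (projX n (adj n (fst d)) (coord_X q))) q"

lemma measurable_qinv:
  assumes n: "1 \<le> n" and d: "measurable_in_SUHeis n M d" and p: "p \<in> measurable M (coord_lebesgue n)"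
  shows "(\<lambda>m. qinv n c (d m) (p m)) \<in> measurable M (coord_lebesgue n)"
proof -
  note i = measurable_iinv[OF n d]
  have dm: "(\<lambda>m. fst (d m) $$ (i, j)) \<in> borel_measurable M" if "i < n" "j < n" for i j
    using d that by (auto simp: measurable_in_SUHeis_def)
  have "(\<lambda>m. projX n (adj n (fst (d m))) (coord_X (p m)) a) \<in> borel_measurable M" if "a \<in> {1..<n}" for a
    unfolding projX_def using that measurable_coord_entries[OF p]
    by (simp, intro borel_measurable_divide measurable_mat_Z measurable_adj_co dm) auto
  then show ?thesis
    unfolding qinv_def by (intro measurable_act[OF n i _ p] borel_measurable_uminus measurable_Theta[OF n d])
qed

text \<open>The inverse of g recovers X from the image point, so the angle that is subtracted is the
  very value of \<open>Theta\<close> that was added, and no period is left over.\<close>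

lemma qinv_qact:
  assumes n: "1 \<le> n" and d: "d \<in> carrier (UHeis n)" and p: "p \<in> Nbar n"
  shows "qinv n c d (qact n c d p) = p"
proof -
  have a: "act n c (iinv n d) \<theta>' (act n c d \<theta> p) = shift (- 2 * c * (\<theta>' + \<theta>)) p" for \<theta> \<theta>'
    using act_act[OF n d iinv_UHeis(1)[OF n d] p] iinv_UHeis(2)[OF n d] act_one_shift[OF n p, of c 0]
    by (simp add: UHeis_simps)
  have "projX n (adj n (fst d)) (coord_X (qact n c d p)) = coord_X p"
    using arg_cong[OF a[of 0 "Theta n (fst d) (coord_X p)"], of coord_X] unfolding coord_act(1) qact_def
    by (simp add: iinv_def case_prod_beta)
  then show ?thesis
    unfolding qinv_def by (simp add: qact_def a)
qed

text \<open>Membership is a finite system of polynomial equations in the entries and their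
  conjugates; the determinant is expanded by the Leibniz formula to exhibit this.\<close>

lemma closed_SU: "closed {x :: nat \<times> nat \<Rightarrow> complex. mat n n x \<in> carrier (SU_group n)}"
proof -
  have c: "continuous_on UNIV (\<lambda>x :: nat \<times> nat \<Rightarrow> complex. x ij)" for ij
    by (rule continuous_on_product_coordinates)
  have "closed {x :: nat \<times> nat \<Rightarrow> complex. (\<forall>i. i < n \<longrightarrow> (\<forall>j. j < n \<longrightarrow>
      (\<Sum>k<n. sg k * cnj (x (k, i)) * x (k, j)) = (if i = j then sg i else 0))) \<and>
      (\<Sum>p\<in>{p. p permutes {0..<n}}. signof p * (\<Prod>i=0..<n. x (i, p i))) = 1}"
    by (intro closed_Collect_conj closed_Collect_all closed_Collect_imp open_Collect_const closed_Collect_eq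
        continuous_on_sum continuous_on_prod continuous_on_mult continuous_on_const continuous_on_cnj c)
  also have "{x :: nat \<times> nat \<Rightarrow> complex. (\<forall>i. i < n \<longrightarrow> (\<forall>j. j < n \<longrightarrow>
      (\<Sum>k<n. sg k * cnj (x (k, i)) * x (k, j)) = (if i = j then sg i else 0))) \<and>
      (\<Sum>p\<in>{p. p permutes {0..<n}}. signof p * (\<Prod>i=0..<n. x (i, p i))) = 1} =
      {x. mat n n x \<in> carrier (SU_group n)}"
  proof (rule Collect_cong)
    fix x :: "nat \<times> nat \<Rightarrow> complex"
    have "(\<Prod>i=0..<n. mat n n x $$ (i, p i)) = (\<Prod>i=0..<n. x (i, p i))" if "p permutes {0..<n}" for p
      using permutes_in_image[OF that] by (intro prod.cong) auto
    then have "det (mat n n x) = (\<Sum>p\<in>{p. p permutes {0..<n}}. signof p * (\<Prod>i=0..<n. x (i, p i)))"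
      unfolding det_def'[OF mat_carrier] by (intro sum.cong) auto
    then show "(\<forall>i. i < n \<longrightarrow> (\<forall>j. j < n \<longrightarrow>
        (\<Sum>k<n. sg k * cnj (x (k, i)) * x (k, j)) = (if i = j then sg i else 0))) \<and>
        (\<Sum>p\<in>{p. p permutes {0..<n}}. signof p * (\<Prod>i=0..<n. x (i, p i))) = 1 \<longleftrightarrow>
        mat n n x \<in> carrier (SU_group n)"
      unfolding SU_iff U_iff_entries by simp
  qed
  finally show ?thesis .
qed

section \<open>Compact boxes that exhaust the group\<close>

definition bounded_SU :: "nat \<Rightarrow> real \<Rightarrow> complex mat set" where
  "bounded_SU n r = {g \<in> carrier (SU_group n). \<forall>i<n. \<forall>j<n. cmod (g $$ (i, j)) \<le> r}"

definition bounded_Heis :: "nat \<Rightarrow> real \<Rightarrow> heis set" where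
  "bounded_Heis n r = {h \<in> carrier (Heis_group n). (\<forall>k<n. cmod (fst h $ k) \<le> r) \<and> \<bar>snd h\<bar> \<le> r}"

text \<open>Outside of I the functions are frozen at \<open>undefined\<close>, so the set is a
  product over all indices with singletons there, and Tychonoff applies.\<close>

lemma compact_PiE_cball:
  "compact (PiE I (\<lambda>_. cball 0 r) :: ('a \<Rightarrow> 'b :: {heine_borel, real_normed_vector}) set)"
proof -
  have eq: "PiE I (\<lambda>_. cball 0 r) = PiE UNIV (\<lambda>i. if i \<in> I then cball (0 :: 'b) r else {undefined})"
    by (auto simp: PiE_def Pi_def extensional_def split: if_splits)
  have "compactin (product_topology (\<lambda>i. euclidean) UNIV) (PiE UNIV (\<lambda>i. if i \<in> I then cball (0 :: 'b) r else {undefined}))"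
    by (subst compactin_PiE) auto
  then show ?thesis
    unfolding eq euclidean_product_topology by simp
qed

lemma compactin_bounded_SU: "compactin (SU_top n) (bounded_SU n r)"
  unfolding SU_top_def
proof (rule compactin_pullback)
  let ?f = "\<lambda>g. \<lambda>ij\<in>{..<n} \<times> {..<n}. g $$ ij"
  have "?f ` bounded_SU n r = PiE ({..<n} \<times> {..<n}) (\<lambda>_. cball 0 r) \<inter> {x. mat n n x \<in> carrier (SU_group n)}"
    (is "_ = ?R")
  proof (intro equalityI subsetI)
    fix x assume "x \<in> ?f ` bounded_SU n r"
    then obtain g where g: "g \<in> bounded_SU n r" and x: "x = ?f g"
      by blast
    have "g \<in> carrier_mat n n"
      using g U_carrier_mat[OF SU_U] by (auto simp: bounded_SU_def)
    then have "mat n n x = g"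
      unfolding x by (intro eq_matI) auto
    then show "x \<in> ?R"
      using g by (auto simp: bounded_SU_def x)
  next
    fix x assume x: "x \<in> ?R"
    then have "x = ?f (mat n n x)"
      by (auto simp: fun_eq_iff PiE_def extensional_def)
    moreover have "mat n n x \<in> bounded_SU n r"
      using x by (auto simp: bounded_SU_def PiE_def Pi_def)
    ultimately show "x \<in> ?f ` bounded_SU n r"
      by (rule image_eqI)
  qed
  then show "compactin euclidean (?f ` bounded_SU n r)"
    by (simp add: compact_Int_closed[OF compact_PiE_cball closed_SU])
qed (auto simp: bounded_SU_def)

lemma compactin_bounded_Heis: "compactin (Heis_top n) (bounded_Heis n r)"
  unfolding Heis_top_def
proof (rule compactin_pullback)
  let ?f = "\<lambda>(v, t). (\<lambda>k\<in>{..<n}. v $ k, t)"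
  have "?f ` bounded_Heis n r = PiE {..<n} (\<lambda>_. cball 0 r) \<times> cball 0 r" (is "_ = ?R")
  proof (intro equalityI subsetI)
    fix x assume "x \<in> ?f ` bounded_Heis n r"
    then obtain v t where "(v, t) \<in> bounded_Heis n r" "x = ((\<lambda>k\<in>{..<n}. v $ k), t)"
      by (auto simp del: restrict_apply)
    then show "x \<in> ?R"
      unfolding bounded_Heis_def by (simp add: restrict_PiE_iff)
  next
    fix x assume x: "x \<in> ?R"
    have "x = ?f (vec n (fst x), snd x)"
      using x by (auto simp: fun_eq_iff PiE_def extensional_def mem_Times_iff prod_eq_iff)
    moreover have "(vec n (fst x), snd x) \<in> bounded_Heis n r"
      using x by (auto simp: bounded_Heis_def PiE_def Pi_def)
    ultimately show "x \<in> ?f ` bounded_Heis n r"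
      by (rule image_eqI)
  qed
  then show "compactin euclidean (?f ` bounded_Heis n r)"
    by (simp add: compact_Times[OF compact_PiE_cball compact_cball])
qed (auto simp: bounded_Heis_def)

text \<open>The boxes of radius N are compact, hence of finite Haar measure, and exhaust the group.
  Sigma-finiteness is what Fubini asks for in \<open>slice_bound\<close>.\<close>

lemma haar_sigma_finite:
  assumes h: "haar_measure (SUHeis n) (SUHeis_top n) \<mu>"
  shows "sigma_finite_measure \<mu>"
proof
  let ?K = "\<lambda>N :: nat. bounded_SU n N \<times> bounded_Heis n N"
  have K: "compactin (SUHeis_top n) (?K N)" for N
    unfolding SUHeis_top_def compactin_Times using compactin_bounded_SU compactin_bounded_Heis by blast
  have eq: "?K N = {d \<in> space \<mu>. (\<forall>i\<in>{..<n}. \<forall>j\<in>{..<n}. cmod (fst d $$ (i, j)) \<le> N) \<and>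
      (\<forall>k\<in>{..<n}. cmod (fst (snd d) $ k) \<le> N) \<and> \<bar>snd (snd d)\<bar> \<le> N}" for N
    by (auto simp: haar_space[OF h] SUHeis_simps bounded_SU_def bounded_Heis_def)
  have Ks: "?K N \<in> sets \<mu>" for N
  proof -
    note m = haar_measurable_id[OF h, unfolded measurable_in_SUHeis_def]
    have 1: "{d \<in> space \<mu>. cmod (fst d $$ (i, j)) \<le> N} \<in> sets \<mu>" if "i < n" "j < n" for i j
    proof -
      have "(\<lambda>d. fst d $$ (i, j)) \<in> borel_measurable \<mu>"
        using m that by blast
      then show ?thesis by measurable
    qed
    have 2: "{d \<in> space \<mu>. cmod (fst (snd d) $ k) \<le> N} \<in> sets \<mu>" if "k < n" for k
    proof -
      have "(\<lambda>d. fst (snd d) $ k) \<in> borel_measurable \<mu>"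
        using m that by blast
      then show ?thesis by measurable
    qed
    have 3: "{d \<in> space \<mu>. \<bar>snd (snd d)\<bar> \<le> N} \<in> sets \<mu>"
    proof -
      have "(\<lambda>d. snd (snd d)) \<in> borel_measurable \<mu>"
        using m by blast
      then show ?thesis by measurable
    qed
    show ?thesis
      unfolding eq by (intro sets.sets_Collect_conj sets.sets_Collect_finite_All' sets.sets_Collect_finite_All 1 2 3) auto
  qed
  have un: "(\<Union>N. ?K N) = space \<mu>"
  proof (intro equalityI subsetI)
    fix d assume d: "d \<in> space \<mu>"
    let ?S = "(\<lambda>(i, j). cmod (fst d $$ (i, j))) ` ({..<n} \<times> {..<n}) \<union> (\<lambda>k. cmod (fst (snd d) $ k)) ` {..<n} \<union> {\<bar>snd (snd d)\<bar>}"
    obtain N where N: "Max ?S \<le> real N"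
      using real_arch_simple by blast
    have "x \<le> real N" if "x \<in> ?S" for x
      using Max_ge[of ?S x] that N by (intro order_trans[OF _ N]) auto
    then have "d \<in> ?K N"
      unfolding eq using d by (auto simp: image_def)
    then show "d \<in> (\<Union>N. ?K N)"
      by blast
  qed (auto simp: eq)
  show "\<exists>A. countable A \<and> A \<subseteq> sets \<mu> \<and> \<Union> A = space \<mu> \<and> (\<forall>a\<in>A. emeasure \<mu> a \<noteq> \<infinity>)"
  proof (intro exI conjI)
    show "countable (range ?K)"
      by simp
    show "range ?K \<subseteq> sets \<mu>" "\<Union> (range ?K) = space \<mu>"
      using Ks un by auto
    show "\<forall>a\<in>range ?K. emeasure \<mu> a \<noteq> \<infinity>"
      using K h unfolding haar_measure_def by (auto simp: less_top)
  qed
qed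

section \<open>Counting lattice points\<close>

lemma nn_integral_LC_translate:
  assumes I: "finite I" and f: "f \<in> borel_measurable (LC I)"
  shows "(\<integral>\<^sup>+ x. f (\<lambda>i\<in>I. x i + b i) \<partial>LC I) = (\<integral>\<^sup>+ x. f x \<partial>LC I)"
  using I f
proof (induction I arbitrary: f)
  case empty
  have e: "integral\<^sup>N (LC {}) g = g (\<lambda>_. undefined)" for g
    by (rule LC.nn_integral_empty) simp
  show ?case
    unfolding e by (simp add: restrict_def)
next
  case (insert k J)
  let ?F = "\<lambda>x. \<integral>\<^sup>+ y. f (x(k := y)) \<partial>lborel"
  have Fm: "?F \<in> borel_measurable (LC J)"
  proof (rule sigma_finite_measure.borel_measurable_nn_integral[OF sigma_finite_lborel])
    show "(\<lambda>(x, y). f (x(k := y))) \<in> borel_measurable (LC J \<Otimes>\<^sub>M lborel)"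
      using measurable_compose[OF measurable_add_dim[of k J "\<lambda>_. lborel"] insert.prems] by (simp add: case_prod_beta' del: fun_upd_apply)
  qed
  have gm: "(\<lambda>x. f (\<lambda>i\<in>insert k J. x i + b i)) \<in> borel_measurable (LC (insert k J))"
    by (rule measurable_compose[OF measurable_LC_restrict insert.prems]) (auto intro: measurable_LC_component)
  have "(\<integral>\<^sup>+ x. f (\<lambda>i\<in>insert k J. x i + b i) \<partial>LC (insert k J)) =
      (\<integral>\<^sup>+ x. (\<integral>\<^sup>+ y. f (\<lambda>i\<in>insert k J. (x(k := y)) i + b i) \<partial>lborel) \<partial>LC J)"
    by (rule LC.product_nn_integral_insert[OF insert.hyps(1,2) gm])
  also have "\<dots> = (\<integral>\<^sup>+ x. ?F (\<lambda>i\<in>J. x i + b i) \<partial>LC J)"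
  proof (rule nn_integral_cong)
    fix x assume "x \<in> space (LC J)"
    have sp: "(\<lambda>i\<in>J. x i + b i) \<in> space (LC J)"
      by (auto simp: space_PiM)
    have e: "(\<lambda>i\<in>insert k J. (x(k := y)) i + b i) = (\<lambda>i\<in>J. x i + b i)(k := y + b k)" for y
      using insert.hyps by (auto simp: fun_eq_iff)
    show "(\<integral>\<^sup>+ y. f (\<lambda>i\<in>insert k J. (x(k := y)) i + b i) \<partial>lborel) = ?F (\<lambda>i\<in>J. x i + b i)"
      unfolding e by (rule nn_integral_translate[OF measurable_LC_update[OF insert.prems sp insert.hyps(2)]])
  qed
  also have "\<dots> = (\<integral>\<^sup>+ x. ?F x \<partial>LC J)"
    by (rule insert.IH[OF Fm])
  also have "\<dots> = (\<integral>\<^sup>+ x. f x \<partial>LC (insert k J))"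
    by (rule LC.product_nn_integral_insert[OF insert.hyps(1,2) insert.prems, symmetric])
  finally show ?case .
qed

abbreviation Lw :: "nat \<Rightarrow> ((nat \<Rightarrow> complex) \<times> real) measure" where
  "Lw n \<equiv> LC {..<n} \<Otimes>\<^sub>M lborel"

abbreviation LZ :: "nat \<Rightarrow> ((nat \<Rightarrow> complex) \<times> (nat \<Rightarrow> complex) \<times> real) measure" where
  "LZ n \<equiv> LC {..<n} \<Otimes>\<^sub>M Lw n"

lemma sigma_finite_Lw: "sigma_finite_measure (Lw n)"
  by (intro sigma_finite_pair_measure sigma_finite_LC sigma_finite_lborel) simp

lemma sigma_finite_LZ: "sigma_finite_measure (LZ n)"
  by (intro sigma_finite_pair_measure sigma_finite_LC sigma_finite_Lw) simp

lemma LZ_iterated: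
  assumes H: "H \<in> borel_measurable (LZ n)"
  shows "(\<integral>\<^sup>+ z. H z \<partial>LZ n) = (\<integral>\<^sup>+ Z. (\<integral>\<^sup>+ w. (\<integral>\<^sup>+ \<phi>. H (Z, w, \<phi>) \<partial>lborel) \<partial>LC {..<n}) \<partial>LC {..<n})"
proof -
  have "(\<integral>\<^sup>+ z. H z \<partial>LZ n) = (\<integral>\<^sup>+ Z. (\<integral>\<^sup>+ y. H (Z, y) \<partial>Lw n) \<partial>LC {..<n})"
    by (rule sigma_finite_measure.nn_integral_fst[OF sigma_finite_Lw H, symmetric])
  also have "\<dots> = (\<integral>\<^sup>+ Z. (\<integral>\<^sup>+ w. (\<integral>\<^sup>+ \<phi>. H (Z, w, \<phi>) \<partial>lborel) \<partial>LC {..<n}) \<partial>LC {..<n})"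
  proof (rule nn_integral_cong)
    fix Z assume Z: "Z \<in> space (LC {..<n})"
    have "(\<lambda>y. H (Z, y)) \<in> borel_measurable (Lw n)"
      by (rule measurable_compose[OF measurable_Pair1'[OF Z] H])
    then show "(\<integral>\<^sup>+ y. H (Z, y) \<partial>Lw n) = (\<integral>\<^sup>+ w. (\<integral>\<^sup>+ \<phi>. H (Z, w, \<phi>) \<partial>lborel) \<partial>LC {..<n})"
      by (rule sigma_finite_measure.nn_integral_fst[OF sigma_finite_lborel, symmetric])
  qed
  finally show ?thesis .
qed

text \<open>The map is triangular: phi is translated by a function of Z and w, so it is integrated
  first; then w undergoes an affine map whose linear part \<open>co n g\<close> is again in
  SU(1,n-1), and finally Z the linear map g.\<close>

lemma LZ_change_of_variables:
  assumes n: "1 \<le> n" and g: "g \<in> carrier (SU_group n)" and H: "H \<in> borel_measurable (LZ n)"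
    and b: "(\<lambda>z. b (fst z) (fst (snd z))) \<in> borel_measurable (LZ n)"
  shows "(\<integral>\<^sup>+ z. H (matvec n g (fst z), (\<lambda>k\<in>{..<n}. mv n (co n g) (fst (snd z)) k + u k), snd (snd z) + b (fst z) (fst (snd z))) \<partial>LZ n) =
    (\<integral>\<^sup>+ z. H z \<partial>LZ n)"
proof -
  let ?L = "LC {..<n}"
  define K where "K Z w = (\<integral>\<^sup>+ \<phi>. H (Z, w, \<phi>) \<partial>lborel)" for Z w
  define L where "L Z = (\<integral>\<^sup>+ w. K Z w \<partial>?L)" for Z
  let ?a = "\<lambda>w. \<lambda>k\<in>{..<n}. mv n (co n g) w k + u k"
  have am: "?a \<in> measurable ?L ?L"
    by (intro measurable_LC_restrict borel_measurable_add measurable_mv measurable_ident_sets[OF refl] borel_measurable_const)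
  have T: "(\<lambda>z. (matvec n g (fst z), ?a (fst (snd z)), snd (snd z) + b (fst z) (fst (snd z)))) \<in> measurable (LZ n) (LZ n)"
    using b by (intro measurable_Pair measurable_compose[OF measurable_fst measurable_matvec]
        measurable_compose[OF measurable_compose[OF measurable_snd measurable_fst] am]) auto
  have Km: "(\<lambda>p. K (fst p) (snd p)) \<in> borel_measurable (?L \<Otimes>\<^sub>M ?L)"
    unfolding K_def
  proof (rule sigma_finite_measure.borel_measurable_nn_integral[OF sigma_finite_lborel])
    have "(\<lambda>p. (fst (fst p), snd (fst p), snd p)) \<in> measurable ((?L \<Otimes>\<^sub>M ?L) \<Otimes>\<^sub>M lborel) (LZ n)"
      by measurable
    from measurable_compose[OF this H]
    show "(\<lambda>(p, \<phi>). H (fst p, snd p, \<phi>)) \<in> borel_measurable ((?L \<Otimes>\<^sub>M ?L) \<Otimes>\<^sub>M lborel)"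
      by (simp add: case_prod_beta')
  qed
  have Km1: "K Z \<in> borel_measurable ?L" if "Z \<in> space ?L" for Z
    using measurable_compose[OF measurable_Pair1'[OF that] Km] by simp
  have Lm: "L \<in> borel_measurable ?L"
    unfolding L_def
    by (rule sigma_finite_measure.borel_measurable_nn_integral[OF sigma_finite_LC]) (use Km in \<open>simp_all add: case_prod_beta'\<close>)
  have "(\<integral>\<^sup>+ z. H (matvec n g (fst z), ?a (fst (snd z)), snd (snd z) + b (fst z) (fst (snd z))) \<partial>LZ n) =
      (\<integral>\<^sup>+ Z. (\<integral>\<^sup>+ w. (\<integral>\<^sup>+ \<phi>. H (matvec n g Z, ?a w, \<phi> + b Z w) \<partial>lborel) \<partial>?L) \<partial>?L)"
    by (subst LZ_iterated[OF measurable_compose[OF T H]]) simp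
  also have "\<dots> = (\<integral>\<^sup>+ Z. (\<integral>\<^sup>+ w. K (matvec n g Z) (?a w) \<partial>?L) \<partial>?L)"
  proof (intro nn_integral_cong)
    fix Z w assume "Z \<in> space ?L" "w \<in> space ?L"
    have gZ: "matvec n g Z \<in> space ?L" and aw: "?a w \<in> space ?L"
      by (auto simp: matvec_def space_PiM)
    have "(\<lambda>\<phi>. H (matvec n g Z, ?a w, \<phi>)) \<in> borel_measurable lborel"
      by (rule measurable_compose[OF measurable_Pair1'[OF aw] measurable_compose[OF measurable_Pair1'[OF gZ] H]])
    then show "(\<integral>\<^sup>+ \<phi>. H (matvec n g Z, ?a w, \<phi> + b Z w) \<partial>lborel) = K (matvec n g Z) (?a w)"
      unfolding K_def by (intro nn_integral_translate) simp
  qed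
  also have "\<dots> = (\<integral>\<^sup>+ Z. L (matvec n g Z) \<partial>?L)"
  proof (intro nn_integral_cong)
    fix Z assume "Z \<in> space ?L"
    have gZ: "matvec n g Z \<in> space ?L"
      by (auto simp: matvec_def space_PiM)
    have "(\<lambda>w. K (matvec n g Z) (\<lambda>k\<in>{..<n}. w k + u k)) \<in> borel_measurable ?L"
      by (rule measurable_compose[OF _ Km1[OF gZ]])
        (intro measurable_LC_restrict borel_measurable_add measurable_LC_component borel_measurable_const)
    from bspec[OF pres_SU[OF n co_SU[OF g], unfolded pres_def] this]
    have "(\<integral>\<^sup>+ w. K (matvec n g Z) (\<lambda>k\<in>{..<n}. matvec n (co n g) w k + u k) \<partial>?L) =
        (\<integral>\<^sup>+ w. K (matvec n g Z) (\<lambda>k\<in>{..<n}. w k + u k) \<partial>?L)" .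
    moreover have "(\<lambda>k\<in>{..<n}. matvec n (co n g) w k + u k) = ?a w" for w
      by (intro restrict_ext) (simp add: matvec_def)
    ultimately show "(\<integral>\<^sup>+ w. K (matvec n g Z) (?a w) \<partial>?L) = L (matvec n g Z)"
      unfolding L_def using nn_integral_LC_translate[OF _ Km1[OF gZ], of u] by simp
  qed
  also have "\<dots> = (\<integral>\<^sup>+ Z. L Z \<partial>?L)"
    using pres_SU[OF n g] Lm unfolding pres_def by blast
  also have "\<dots> = (\<integral>\<^sup>+ z. H z \<partial>LZ n)"
    unfolding L_def K_def by (rule LZ_iterated[OF H, symmetric])
  finally show ?thesis .
qed

definition pz :: "nat \<Rightarrow> real \<Rightarrow> (nat \<Rightarrow> complex) \<times> (nat \<Rightarrow> complex) \<times> real \<Rightarrow> coords" where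
  "pz n \<rho> z = (dehom n (fst z), fst (snd z), snd (snd z), \<rho>)"

lemma measurable_pz: "1 \<le> n \<Longrightarrow> pz n \<rho> \<in> measurable (LZ n) (coord_lebesgue n)"
  unfolding pz_def coord_lebesgue_def
  by (intro measurable_Pair measurable_compose[OF measurable_fst measurable_dehom]) auto

lemma slab_Z0: "Z \<in> slab n \<Longrightarrow> Z 0 \<noteq> 0"
proof
  assume "Z \<in> slab n" "Z 0 = 0"
  moreover have "0 \<le> (\<Sum>a\<in>{1..<n}. (cmod (Z a))\<^sup>2)"
    by (intro sum_nonneg) auto
  ultimately show False
    by (simp add: slab_def)
qed

lemma slab_dehom:
  assumes Z: "Z \<in> slab n"
  shows "one_minus_normX2 n (dehom n Z) = ((cmod (Z 0))\<^sup>2 - (\<Sum>a\<in>{1..<n}. (cmod (Z a))\<^sup>2)) / (cmod (Z 0))\<^sup>2"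
    and "dehom n Z \<in> CH_ball n"
proof -
  note Z0 = slab_Z0[OF Z]
  have "(\<Sum>a\<in>{1..<n}. (cmod (dehom n Z a))\<^sup>2) = (\<Sum>a\<in>{1..<n}. (cmod (Z a))\<^sup>2) / (cmod (Z 0))\<^sup>2"
    unfolding sum_divide_distrib by (intro sum.cong) (auto simp: dehom_def norm_divide power_divide)
  then show eq: "one_minus_normX2 n (dehom n Z) = ((cmod (Z 0))\<^sup>2 - (\<Sum>a\<in>{1..<n}. (cmod (Z a))\<^sup>2)) / (cmod (Z 0))\<^sup>2"
    using Z0 by (simp add: one_minus_normX2_def field_simps)
  have "0 < (cmod (Z 0))\<^sup>2 - (\<Sum>a\<in>{1..<n}. (cmod (Z a))\<^sup>2)"
    using Z by (auto simp: slab_def)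
  then have "one_minus_normX2 n (dehom n Z) > 0"
    unfolding eq using Z0 by simp
  then show "dehom n Z \<in> CH_ball n"
    by (simp add: CH_ball_def one_minus_normX2_def)
qed

lemma pz_Nbar: "fst z \<in> slab n \<Longrightarrow> z \<in> space (LZ n) \<Longrightarrow> 0 < \<rho> \<Longrightarrow> pz n \<rho> z \<in> Nbar n"
  using slab_dehom(2)[of "fst z" n] by (auto simp: pz_def Nbar_iff space_pair_measure space_PiM PiE_def dehom_def)

lemma slab_matvec:
  assumes n: "1 \<le> n" and g: "g \<in> carrier (U_group n)"
  shows "matvec n g Z \<in> slab n \<longleftrightarrow> Z \<in> slab n"
proof -
  have "herm n (mv n g Z) (mv n g Z) = herm n Z Z"
    by (rule herm_mv[OF g])
  then have "(\<Sum>a\<in>{1..<n}. (cmod (mv n g Z a))\<^sup>2) - (cmod (mv n g Z 0))\<^sup>2 = (\<Sum>a\<in>{1..<n}. (cmod (Z a))\<^sup>2) - (cmod (Z 0))\<^sup>2"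
    using n by (simp only: herm_self of_real_eq_iff)
  moreover have "(\<Sum>a\<in>{1..<n}. (cmod (matvec n g Z a))\<^sup>2) = (\<Sum>a\<in>{1..<n}. (cmod (mv n g Z a))\<^sup>2)"
    by (intro sum.cong) (auto simp: matvec_def)
  moreover have "matvec n g Z 0 = mv n g Z 0"
    using n by (simp add: matvec_def)
  ultimately have "(cmod (matvec n g Z 0))\<^sup>2 - (\<Sum>a\<in>{1..<n}. (cmod (matvec n g Z a))\<^sup>2) =
      (cmod (Z 0))\<^sup>2 - (\<Sum>a\<in>{1..<n}. (cmod (Z a))\<^sup>2)"
    by simp
  then show ?thesis
    unfolding slab_def mem_Collect_eq by (simp only:)
qed

text \<open>The homogeneous lift of \<open>qact\<close>: it is linear in Z, and division by Z^0
  gives the projective action, with rho as a parameter. With \<open>LZ_change_of_variables\<close>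
  it yields the invariance of the slice measure under each fixed d.\<close>

lemma pz_qact:
  assumes n: "1 \<le> n" and d: "d \<in> carrier (UHeis n)" and z: "fst z \<in> slab n"
  shows "pz n \<rho> (matvec n (fst d) (fst z), (\<lambda>k\<in>{..<n}. mv n (co n (fst d)) (fst (snd z)) k + fst (snd d) $ k / 2),
      snd (snd z) + (- 2 * c * Theta n (fst d) (dehom n (fst z)) + omega n (fst (snd d)) (vec n (mv n (co n (fst d)) (fst (snd z)))) + snd (snd d)))
    = qact n c d (pz n \<rho> z)"
proof -
  note Z0 = slab_Z0[OF z]
  have mz: "mat_Z n (fst d) (dehom n (fst z)) b = mv n (fst d) (fst z) b / fst z 0" for b
  proof -
    have "mv n (fst d) (homog (dehom n (fst z))) b = mv n (fst d) (\<lambda>j. fst z j / fst z 0) b"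
      using Z0 by (intro mv_cong) (auto simp: homog_def dehom_def)
    then show ?thesis
      by (simp add: mat_Z_mv mv_divide)
  qed
  have "dehom n (matvec n (fst d) (fst z)) = (\<lambda>b\<in>{1..<n}. mat_Z n (fst d) (dehom n (fst z)) b / mat_Z n (fst d) (dehom n (fst z)) 0)"
    unfolding dehom_def[of n "matvec n (fst d) (fst z)"] mz using n Z0 by (intro restrict_ext) (simp add: matvec_def)
  then show ?thesis
    unfolding qact_def act_eq pz_def by simp
qed

definition nu :: "nat \<Rightarrow> real \<Rightarrow> coords set \<Rightarrow> ennreal" where
  "nu n \<rho> U = (\<integral>\<^sup>+ X. indicator (CH_ball n) X * ennreal (1 / one_minus_normX2 n X ^ n) *
     (\<integral>\<^sup>+ y. indicator U (X, fst y, snd y, \<rho>) \<partial>Lw n) \<partial>LC {1..<n})"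

lemma measurable_slice:
  assumes U: "U \<in> sets (coord_lebesgue n)"
  shows "(\<lambda>p. indicator U (fst p, fst (snd p), snd (snd p), \<rho>) :: ennreal) \<in> borel_measurable (LC {1..<n} \<Otimes>\<^sub>M Lw n)"
    and "(\<lambda>X. \<integral>\<^sup>+ y. indicator U (X, fst y, snd y, \<rho>) \<partial>Lw n) \<in> borel_measurable (LC {1..<n})"
proof -
  have "(\<lambda>p. (fst p, fst (snd p), snd (snd p), \<rho>)) \<in> measurable (LC {1..<n} \<Otimes>\<^sub>M Lw n) (coord_lebesgue n)"
    unfolding coord_lebesgue_def by measurable
  from measurable_compose[OF this borel_measurable_indicator[OF U]]
  show m: "(\<lambda>p. indicator U (fst p, fst (snd p), snd (snd p), \<rho>) :: ennreal) \<in> borel_measurable (LC {1..<n} \<Otimes>\<^sub>M Lw n)" .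
  show "(\<lambda>X. \<integral>\<^sup>+ y. indicator U (X, fst y, snd y, \<rho>) \<partial>Lw n) \<in> borel_measurable (LC {1..<n})"
    by (rule sigma_finite_measure.borel_measurable_nn_integral[OF sigma_finite_Lw])
      (use m in \<open>simp add: case_prod_beta'\<close>)
qed

lemma slab_nu:
  assumes n: "1 \<le> n" and U: "U \<in> sets (coord_lebesgue n)"
  shows "(\<integral>\<^sup>+ z. indicator (slab n) (fst z) * indicator U (pz n \<rho> z) \<partial>LZ n) = kappa n * nu n \<rho> U"
proof -
  have sm: "(\<lambda>z. indicator (slab n) (fst z) :: ennreal) \<in> borel_measurable (LZ n)"
    by (rule measurable_compose[OF measurable_fst pred_slab[OF n]])
  have Um: "(\<lambda>z. indicator U (pz n \<rho> z) :: ennreal) \<in> borel_measurable (LZ n)"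
    by (rule measurable_compose[OF measurable_pz[OF n] borel_measurable_indicator[OF U]])
  have "(\<integral>\<^sup>+ z. indicator (slab n) (fst z) * indicator U (pz n \<rho> z) \<partial>LZ n) =
      (\<integral>\<^sup>+ Z. (\<integral>\<^sup>+ y. indicator (slab n) Z * indicator U (pz n \<rho> (Z, y)) \<partial>Lw n) \<partial>LC {..<n})"
    by (subst sigma_finite_measure.nn_integral_fst[OF sigma_finite_Lw borel_measurable_times_ennreal[OF sm Um], symmetric]) simp
  also have "\<dots> = (\<integral>\<^sup>+ Z. indicator (slab n) Z * (\<integral>\<^sup>+ y. indicator U (dehom n Z, fst y, snd y, \<rho>) \<partial>Lw n) \<partial>LC {..<n})"
  proof (rule nn_integral_cong)
    fix Z assume Z: "Z \<in> space (LC {..<n})"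
    have "(\<lambda>y. indicator U (pz n \<rho> (Z, y)) :: ennreal) \<in> borel_measurable (Lw n)"
      by (rule measurable_compose[OF measurable_Pair1'[OF Z] Um])
    then show "(\<integral>\<^sup>+ y. indicator (slab n) Z * indicator U (pz n \<rho> (Z, y)) \<partial>Lw n) =
        indicator (slab n) Z * (\<integral>\<^sup>+ y. indicator U (dehom n Z, fst y, snd y, \<rho>) \<partial>Lw n)"
      by (subst nn_integral_cmult) (simp_all add: pz_def)
  qed
  also have "\<dots> = kappa n * nu n \<rho> U"
    unfolding nu_def by (rule slab_to_ball[OF n measurable_slice(2)[OF U]])
  finally show ?thesis .
qed

text \<open>The bounded set of the double count. phi has a bound of its own because choices of angle
  cost 4 pi c in \<open>recurrence\<close>; rho is left free.\<close>

definition cell :: "nat \<Rightarrow> nat \<Rightarrow> real \<Rightarrow> coords set" where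
  "cell n N r = {p \<in> space (coord_lebesgue n). 1 / real (Suc N) \<le> one_minus_normX2 n (coord_X p) \<and>
     (\<forall>k\<in>{..<n}. cmod (coord_w p k) \<le> N) \<and> \<bar>coord_phi p\<bar> \<le> r}"

lemma cell_sets: "cell n N r \<in> sets (coord_lebesgue n)"
proof -
  note m = measurable_coord_entries[OF measurable_ident_sets[OF refl, of "coord_lebesgue n"]]
  have "(\<lambda>p. one_minus_normX2 n (coord_X p)) \<in> borel_measurable (coord_lebesgue n)"
    by (rule measurable_compose[OF measurable_coords(1) measurable_one_minus])
  then have 1: "{p \<in> space (coord_lebesgue n). 1 / real (Suc N) \<le> one_minus_normX2 n (coord_X p)} \<in> sets (coord_lebesgue n)"
    by measurable
  have 2: "{p \<in> space (coord_lebesgue n). cmod (coord_w p k) \<le> N} \<in> sets (coord_lebesgue n)" if "k \<in> {..<n}" for k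
  proof -
    have "(\<lambda>p. coord_w p k) \<in> borel_measurable (coord_lebesgue n)"
      using that m(2) by simp
    then show ?thesis by measurable
  qed
  have 3: "{p \<in> space (coord_lebesgue n). \<bar>coord_phi p\<bar> \<le> r} \<in> sets (coord_lebesgue n)"
  proof -
    have "(\<lambda>p. coord_phi p) \<in> borel_measurable (coord_lebesgue n)"
      using m(3) by simp
    then show ?thesis by measurable
  qed
  show ?thesis
    unfolding cell_def by (intro sets.sets_Collect_conj sets.sets_Collect_finite_All' sets.sets_Collect_finite_All 1 2 3) auto
qed

text \<open>On the slab the form q has a value in [1, 2], and on the cell q / |Z^0|^2 >= 1 / (N +
  1). Hence |Z^0|^2 <= 2 (N + 1), and the other |Z^a|^2 are smaller, so everything lies in a
  box.\<close>

lemma slab_cell_finite: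
  assumes n: "1 \<le> n"
  shows "(\<integral>\<^sup>+ z. indicator (slab n) (fst z) * indicator (cell n N r) (pz n \<rho> z) \<partial>LZ n) < \<infinity>"
proof -
  define R where "R = sqrt (2 * real (Suc N))"
  let ?B = "PiE {..<n} (\<lambda>_. cball 0 R) \<times> PiE {..<n} (\<lambda>_. cball 0 (real N)) \<times> {- r..r} :: ((nat \<Rightarrow> complex) \<times> (nat \<Rightarrow> complex) \<times> real) set"
  have ind: "indicator (slab n) (fst z) * indicator (cell n N r) (pz n \<rho> z) \<le> (indicator ?B z :: ennreal)" if z: "z \<in> space (LZ n)" for z
  proof (cases "fst z \<in> slab n \<and> pz n \<rho> z \<in> cell n N r")
    case True
    let ?Z = "fst z"
    let ?q = "(cmod (?Z 0))\<^sup>2 - (\<Sum>a\<in>{1..<n}. (cmod (?Z a))\<^sup>2)"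
    have q: "1 \<le> ?q" "?q \<le> 2"
      using True by (auto simp: slab_def)
    have Z0: "0 < (cmod (?Z 0))\<^sup>2"
      using slab_Z0 True by auto
    have "1 / real (Suc N) \<le> ?q / (cmod (?Z 0))\<^sup>2"
      using True slab_dehom(1)[of ?Z n] by (auto simp: cell_def pz_def)
    also have "\<dots> \<le> 2 / (cmod (?Z 0))\<^sup>2"
      using q Z0 by (intro divide_right_mono) auto
    finally have R0: "(cmod (?Z 0))\<^sup>2 \<le> 2 * real (Suc N)"
      using Z0 by (simp add: field_simps)
    have Ra: "(cmod (?Z a))\<^sup>2 \<le> 2 * real (Suc N)" if "a < n" for a
    proof (cases "a = 0")
      case False
      then have "(cmod (?Z a))\<^sup>2 \<le> (\<Sum>a\<in>{1..<n}. (cmod (?Z a))\<^sup>2)"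
        using that by (intro member_le_sum) auto
      then show ?thesis
        using q R0 by linarith
    qed (use R0 in simp)
    have "cmod (?Z a) \<le> R" if "a < n" for a
      unfolding R_def by (rule real_le_rsqrt[OF Ra[OF that]])
    then have "z \<in> ?B"
      using True z by (auto simp: cell_def pz_def space_pair_measure space_PiM PiE_def)
    then show ?thesis
      by (auto simp: indicator_def)
  qed (auto simp: indicator_def)
  have fin: "emeasure (LC {..<n}) (PiE {..<n} (\<lambda>_. cball 0 x)) < \<infinity>" for x :: real
    using emeasure_lborel_cball_finite[of "0 :: complex" x] by (subst LC.emeasure_PiM) (auto simp: prod_constant power_less_top_ennreal)
  have sets: "PiE {..<n} (\<lambda>_. cball 0 x) \<in> sets (LC {..<n})" for x :: real
    by (intro sets_PiM_I_finite) auto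
  have "emeasure (LZ n) ?B = emeasure (LC {..<n}) (PiE {..<n} (\<lambda>_. cball 0 R)) *
      (emeasure (LC {..<n}) (PiE {..<n} (\<lambda>_. cball 0 (real N))) * emeasure lborel {- r..r})"
    by (subst sigma_finite_measure.emeasure_pair_measure_Times[OF sigma_finite_Lw], (use sets in auto)[2],
        subst sigma_finite_measure.emeasure_pair_measure_Times[OF sigma_finite_lborel]) (use sets in auto)
  also have "\<dots> < \<infinity>"
    using fin by (auto simp: ennreal_mult_less_top emeasure_lborel_Icc_eq)
  finally have B: "emeasure (LZ n) ?B < \<infinity>" .
  have "(\<integral>\<^sup>+ z. indicator (slab n) (fst z) * indicator (cell n N r) (pz n \<rho> z) \<partial>LZ n) \<le> (\<integral>\<^sup>+ z. indicator ?B z \<partial>LZ n)"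
    by (rule nn_integral_mono[OF ind])
  also have "\<dots> = emeasure (LZ n) ?B"
    using sets by (intro nn_integral_indicator pair_measureI) auto
  finally show ?thesis
    using B by simp
qed

lemma space_coord_lebesgue:
  "p \<in> space (coord_lebesgue n) \<longleftrightarrow> coord_X p \<in> extensional {1..<n} \<and> coord_w p \<in> extensional {..<n}"
  by (cases p) (auto simp: coord_lebesgue_def space_pair_measure space_PiM PiE_def)

lemma Nbar_space: "p \<in> Nbar n \<Longrightarrow> p \<in> space (coord_lebesgue n)"
  by (cases p) (simp add: space_coord_lebesgue Nbar_iff)

text \<open>Elements d1 = gamma d2 of one coset send p to points of one orbit, which coincide if
  both lie in U. Then gamma fixes that point up to a period, so by freeness gamma is itself a
  period, and equality of the two images makes this period 0. Hence the set on the left is one of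
  those over which the covolume is a supremum.\<close>

lemma lattice_count:
  assumes n: "1 \<le> n" and D: "subgroup D (SUHeis n)"
    and free: "acts_freely_on_Nhat n c (Gamma_hat n c D)"
    and h: "haar_measure (SUHeis n) (SUHeis_top n) \<mu>"
    and U: "U \<in> sets (coord_lebesgue n)" "U \<subseteq> Nbar n" "inj_on (orb n c D) U" and p: "p \<in> Nbar n"
  shows "emeasure \<mu> {d \<in> space \<mu>. qact n c d p \<in> U} \<le>
    quotient_volume \<mu> (\<lambda>g. D #>\<^bsub>SUHeis n\<^esub> g) (rcosets\<^bsub>SUHeis n\<^esub> D)"
proof -
  let ?G = "SUHeis n"
  let ?A = "{d \<in> space \<mu>. qact n c d p \<in> U}"
  note sp = haar_space[OF h]
  have DG: "D \<subseteq> carrier ?G"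
    using D by (rule subgroup.subset)
  have pm: "(\<lambda>_. p) \<in> measurable \<mu> (coord_lebesgue n)"
    using Nbar_space[OF p] by simp
  have A: "?A \<in> sets \<mu>"
    by (rule measurable_sets_Collect[OF measurable_qact[OF n haar_measurable_id[OF h] pm], of "\<lambda>x. x \<in> U", simplified])
      (use U(1) sets.sets_into_space[OF U(1)] in \<open>auto simp: Int_absorb1 Int_def[symmetric]\<close>)
  have inj: "inj_on (\<lambda>g. D #>\<^bsub>?G\<^esub> g) ?A"
  proof (rule inj_onI)
    fix d1 d2 assume d: "d1 \<in> ?A" "d2 \<in> ?A" and eq: "D #>\<^bsub>?G\<^esub> d1 = D #>\<^bsub>?G\<^esub> d2"
    have dG: "d1 \<in> carrier ?G" "d2 \<in> carrier ?G"
      using d by (auto simp: sp)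
    have "d1 \<in> D #>\<^bsub>?G\<^esub> d2"
      using group.rcos_self[OF group_SUHeis[OF n] dG(1) D] eq by simp
    then obtain \<gamma> where \<gamma>: "\<gamma> \<in> D" and d1: "d1 = \<gamma> \<otimes>\<^bsub>?G\<^esub> d2"
      by (auto simp: r_coset_def)
    have \<gamma>G: "\<gamma> \<in> carrier ?G"
      using \<gamma> DG by blast
    let ?q = "qact n c d2 p"
    have qN: "?q \<in> Nbar n"
      by (rule qact_Nbar[OF n SUHeis_UHeis[OF dG(2)] p])
    obtain k where "qact n c \<gamma> ?q = shift (period c k) (qact n c (\<gamma> \<otimes>\<^bsub>UHeis n\<^esub> d2) p)"
      by (rule qact_qact[OF n SUHeis_UHeis[OF dG(2)] SUHeis_UHeis[OF \<gamma>G] p])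
    then have k: "qact n c \<gamma> ?q = shift (period c k) (qact n c d1 p)"
      by (simp add: d1 SUHeis_mult_eq[OF \<gamma>G])
    then have "qact n c d1 p = shift (period c (- k)) (qact n c \<gamma> ?q)"
      by (simp add: period_def)
    then have "qact n c d1 p \<in> orb n c D ?q"
      unfolding orb_def using \<gamma> by blast
    then have "orb n c D (qact n c d1 p) = orb n c D ?q"
      by (rule orb_eq[OF n D qN])
    then have same: "qact n c d1 p = ?q"
      using U(3) d by (auto dest: inj_onD)
    obtain j where j: "\<gamma> = (1\<^sub>m n, (0\<^sub>v n, period c j))"
      by (rule free_action[OF n DG free \<gamma> qN k[unfolded same]])
    obtain g v t where d2: "d2 = (g, (v, t))" and g: "g \<in> carrier_mat n n" and v: "v \<in> carrier_vec n"
      using dG(2) by (auto simp: SUHeis_simps dest: U_carrier_mat[OF SU_U])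
    have "co n (1\<^sub>m n) *\<^sub>v v = v"
      using v by (simp add: co_one)
    moreover have "omega n (0\<^sub>v n) v = 0"
      using n by (simp add: omega_def)
    ultimately have d1': "d1 = (g, (v, t + period c j))"
      using g v by (simp add: d1 j d2 SUHeis_simps(2) add.commute)
    have "shift (period c j) ?q = shift 0 ?q"
      using same by (simp add: d1' d2 qact_central)
    then have "period c j = 0"
      by (rule shift_inject[THEN iffD1])
    then show "d1 = d2"
      by (simp add: d1' d2)
  qed
  have "(\<lambda>g. D #>\<^bsub>?G\<^esub> g) ` ?A \<subseteq> rcosets\<^bsub>?G\<^esub> D"
    by (auto simp: RCOSETS_def sp)
  then show ?thesis
    unfolding quotient_volume_def using A inj by (intro SUP_upper) auto
qed

text \<open>The translates \<open>s S\<close> of one set \<open>S\<close> of positive measure serve all points, because \<open>SU \<ltimes> Heis\<close> acts transitively.\<close>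

lemma recurrence:
  assumes n: "1 \<le> n" and c: "0 \<le> c" and h: "haar_measure (SUHeis n) (SUHeis_top n) \<mu>"
  obtains N m where "0 < m"
    "\<And>z. z \<in> Nbar n \<Longrightarrow> m \<le> emeasure \<mu> {d \<in> space \<mu>. qinv n c d z \<in> cell n N (N + 4 * pi * c)}"
proof -
  let ?G = "SUHeis n"
  note sp = haar_space[OF h]
  note id = haar_measurable_id[OF h]
  interpret G: group "UHeis n"
    by (rule group_UHeis[OF n])
  define o1 :: "real \<Rightarrow> coords" where "o1 \<rho> = (\<lambda>a\<in>{1..<n}. 0, \<lambda>k\<in>{..<n}. 0, 0, \<rho>)" for \<rho>
  have oN: "o1 \<rho> \<in> Nbar n" if "0 < \<rho>" for \<rho>
    using that by (simp add: o1_def Nbar_iff CH_ball_def)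
  \<comment> \<open>The angle is 0 here instead of a value of \<open>Theta\<close>, because this set
    must not depend on the point z that its translates serve.\<close>
  define S where "S N = {d \<in> space \<mu>. act n c (iinv n d) 0 (o1 1) \<in> cell n N N}" for N
  have Sm: "S N \<in> sets \<mu>" for N
  proof -
    have "(\<lambda>d. act n c (iinv n d) 0 (o1 1)) \<in> measurable \<mu> (coord_lebesgue n)"
      using Nbar_space[OF oN[of 1]] by (intro measurable_act[OF n measurable_iinv[OF n id]]) auto
    from measurable_sets[OF this cell_sets[of n N N]]
    show ?thesis
      by (simp add: S_def vimage_def Int_def conj_commute)
  qed
  have "(\<Union>N. S N) = space \<mu>"
  proof (intro equalityI subsetI)
    fix d assume d: "d \<in> space \<mu>"
    let ?p = "act n c (iinv n d) 0 (o1 1)"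
    have pN: "?p \<in> Nbar n"
      using d oN[of 1] iinv_UHeis(1)[OF n SUHeis_UHeis] by (intro act_Nbar[OF n]) (auto simp: sp)
    have Q: "0 < one_minus_normX2 n (coord_X ?p)"
      using Nbar_ball[OF pN] by (simp add: CH_ball_def one_minus_normX2_def)
    let ?M = "1 / one_minus_normX2 n (coord_X ?p) + (\<Sum>k<n. cmod (coord_w ?p k)) + \<bar>coord_phi ?p\<bar>"
    obtain N :: nat where N: "?M \<le> real N"
      using real_arch_simple by blast
    have s: "0 \<le> (\<Sum>k<n. cmod (coord_w ?p k))"
      by (intro sum_nonneg) auto
    have "cmod (coord_w ?p k) \<le> (\<Sum>k<n. cmod (coord_w ?p k))" if "k < n" for k
      using that by (intro member_le_sum) auto
    moreover have i0: "0 < 1 / one_minus_normX2 n (coord_X ?p)"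
      using Q by simp
    ultimately have w: "cmod (coord_w ?p k) \<le> N" if "k < n" for k
      using that N by (smt (verit))
    have "1 / one_minus_normX2 n (coord_X ?p) \<le> real (Suc N)"
      using N s by simp
    then have "1 / real (Suc N) \<le> one_minus_normX2 n (coord_X ?p)"
      using Q by (simp add: field_simps)
    moreover have "\<bar>coord_phi ?p\<bar> \<le> N"
      using N s i0 by linarith
    ultimately have "?p \<in> cell n N N"
      using w Nbar_space[OF pN] unfolding cell_def by blast
    then show "d \<in> (\<Union>N. S N)"
      using d by (auto simp: S_def)
  qed (auto simp: S_def)
  then have "emeasure \<mu> (\<Union>N. S N) \<noteq> 0"
    using h sp by (simp add: haar_measure_def)
  then obtain N where N: "emeasure \<mu> (S N) \<noteq> 0"
    using emeasure_UN_eq_0[of \<mu> S] Sm by auto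
  show ?thesis
  proof (rule that[of "emeasure \<mu> (S N)" N])
    show "0 < emeasure \<mu> (S N)"
      using N by (simp add: zero_less_iff_neq_zero)
    fix z assume z: "z \<in> Nbar n"
    obtain X w \<phi> \<rho> where zz: "z = (X, w, \<phi>, \<rho>)" and X: "X \<in> CH_ball n" "X \<in> extensional {1..<n}"
      and w: "w \<in> extensional {..<n}" and \<rho>: "0 < \<rho>"
      using z by (cases z) (auto simp: Nbar_iff)
    obtain s0 where s0: "s0 \<in> carrier (SU_group n)"
      "\<And>b. b \<in> {1..<n} \<Longrightarrow> mat_Z n s0 (\<lambda>a\<in>{1..<n}. 0) b / mat_Z n s0 (\<lambda>a\<in>{1..<n}. 0) 0 = X b"
      using SU_transitive[OF n X(1)] by blast
    \<comment> \<open>Twice w, since the action adds v / 2; the base point has w = 0 and phi =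
      0.\<close>
    define s where "s = (s0, (vec n (\<lambda>k. 2 * w k), \<phi>))"
    have s: "s \<in> carrier ?G"
      using s0 by (simp add: s_def SUHeis_simps)
    have zs: "act n c s 0 (o1 \<rho>) = z"
    proof -
      have mv0: "mv n (co n s0) (\<lambda>k\<in>{..<n}. 0) k = 0" for k
        unfolding mv_def by (rule sum.neutral) auto
      have "(\<lambda>b\<in>{1..<n}. mat_Z n s0 (\<lambda>a\<in>{1..<n}. 0) b / mat_Z n s0 (\<lambda>a\<in>{1..<n}. 0) 0) = X"
        using s0(2) X(2) by (auto simp: fun_eq_iff extensional_def)
      moreover have "(\<lambda>k\<in>{..<n}. mv n (co n s0) (\<lambda>k\<in>{..<n}. 0) k + vec n (\<lambda>k. 2 * w k) $ k / 2) = w"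
        using w unfolding mv0 by (auto simp: fun_eq_iff extensional_def)
      moreover have "omega n (vec n (\<lambda>k. 2 * w k)) (vec n (mv n (co n s0) (\<lambda>k\<in>{..<n}. 0))) = 0"
        unfolding omega_def using n by (simp add: mv0 del: restrict_apply)
      ultimately show ?thesis
        unfolding zz s_def o1_def act.simps by simp
    qed
    let ?B = "{d \<in> space \<mu>. qinv n c d z \<in> cell n N (N + 4 * pi * c)}"
    have "s <#\<^bsub>?G\<^esub> S N \<subseteq> ?B"
    proof
      fix d assume "d \<in> s <#\<^bsub>?G\<^esub> S N"
      then obtain d0 where d0: "d0 \<in> S N" and d: "d = s \<otimes>\<^bsub>?G\<^esub> d0"
        by (auto simp: l_coset_def)
      have d0G: "d0 \<in> carrier ?G"
        using d0 by (simp add: S_def sp)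
      have dG: "d \<in> carrier ?G"
        unfolding d using s d0G group_SUHeis[OF n] by (simp add: group.is_monoid monoid.m_closed)
      have U: "s \<in> carrier (UHeis n)" "d0 \<in> carrier (UHeis n)" "d \<in> carrier (UHeis n)"
        using s d0G dG by (auto intro: SUHeis_UHeis)
      have dU: "d = s \<otimes>\<^bsub>UHeis n\<^esub> d0"
        unfolding d by (rule SUHeis_mult_eq[OF s])
      have "inv\<^bsub>UHeis n\<^esub> d \<otimes>\<^bsub>UHeis n\<^esub> s = inv\<^bsub>UHeis n\<^esub> d0"
        unfolding dU using U by (simp add: G.inv_mult_group G.m_assoc)
      then have inv: "iinv n d \<otimes>\<^bsub>UHeis n\<^esub> s = iinv n d0"
        by (simp add: iinv_UHeis(4)[OF n] U)
      let ?\<theta> = "- Theta n (fst d) (projX n (adj n (fst d)) (coord_X z))"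
      have "qinv n c d z = act n c (iinv n d) ?\<theta> (act n c s 0 (o1 \<rho>))"
        by (simp add: qinv_def zs)
      also have "\<dots> = act n c (iinv n d0) ?\<theta> (o1 \<rho>)"
        by (subst act_act[OF n U(1) iinv_UHeis(1)[OF n U(3)] oN[OF \<rho>]]) (simp add: inv)
      finally have q: "qinv n c d z = act n c (iinv n d0) ?\<theta> (o1 \<rho>)" .
      let ?p = "act n c (iinv n d0) 0 (o1 1)"
      have e: "coord_X (qinv n c d z) = coord_X ?p" "coord_w (qinv n c d z) = coord_w ?p"
        "coord_phi (qinv n c d z) = coord_phi ?p - 2 * c * ?\<theta>"
        unfolding q act_eq by (simp_all add: o1_def)
      \<comment> \<open>The angle used by \<open>qinv\<close> differs from the angle 0 in
        \<open>S\<close> by at most 2 pi, which moves phi by at most 4 pi c.\<close>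
      have "2 * c * \<bar>?\<theta>\<bar> \<le> 2 * c * (2 * pi)"
        using c Theta_bound[of n "fst d" "projX n (adj n (fst d)) (coord_X z)"] by (intro mult_left_mono) auto
      then have "\<bar>2 * c * ?\<theta>\<bar> \<le> 2 * c * (2 * pi)"
        using c by (simp add: abs_mult)
      moreover have pb: "?p \<in> cell n N N"
        using d0 by (simp add: S_def)
      then have "\<bar>coord_phi ?p\<bar> \<le> N"
        unfolding cell_def by blast
      moreover have "2 * c * (2 * pi) = 4 * pi * c"
        by simp
      ultimately have "\<bar>coord_phi ?p - 2 * c * ?\<theta>\<bar> \<le> N + 4 * pi * c"
        using abs_triangle_ineq4[of "coord_phi ?p" "2 * c * ?\<theta>"] by linarith
      then have "qinv n c d z \<in> cell n N (N + 4 * pi * c)"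
        using pb unfolding cell_def mem_Collect_eq space_coord_lebesgue e by blast
      then show "d \<in> ?B"
        using dG by (simp add: sp)
    qed
    moreover have "?B \<in> sets \<mu>"
    proof -
      have "(\<lambda>d. qinv n c d z) \<in> measurable \<mu> (coord_lebesgue n)"
        using Nbar_space[OF z] by (intro measurable_qinv[OF n id]) auto
      from measurable_sets[OF this cell_sets[of n N "N + 4 * pi * c"]]
      show ?thesis
        by (simp add: vimage_def Int_def conj_commute)
    qed
    ultimately have "emeasure \<mu> (s <#\<^bsub>?G\<^esub> S N) \<le> emeasure \<mu> ?B"
      by (rule emeasure_mono)
    moreover have "emeasure \<mu> (s <#\<^bsub>?G\<^esub> S N) = emeasure \<mu> (S N)"
      using h s Sm unfolding haar_measure_def by blast
    ultimately show "emeasure \<mu> (S N) \<le> emeasure \<mu> ?B"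
      by simp
  qed
qed

lemma slice_bound:
  assumes n: "1 \<le> n" and c: "0 \<le> c" and lattice: "lattice_subgroup (SUHeis n) (SUHeis_top n) D"
    and free: "acts_freely_on_Nhat n c (Gamma_hat n c D)"
  obtains V where "V < \<infinity>"
    "\<And>\<rho> U. 0 < \<rho> \<Longrightarrow> U \<in> sets (coord_lebesgue n) \<Longrightarrow> U \<subseteq> Nbar n \<Longrightarrow> inj_on (orb n c D) U \<Longrightarrow> nu n \<rho> U \<le> V"
proof -
  have D: "subgroup D (SUHeis n)"
    using lattice by (simp add: lattice_subgroup_def discrete_subgroup_def)
  obtain \<mu> where h: "haar_measure (SUHeis n) (SUHeis_top n) \<mu>"
    and W: "quotient_volume \<mu> (\<lambda>g. D #>\<^bsub>SUHeis n\<^esub> g) (rcosets\<^bsub>SUHeis n\<^esub> D) < \<infinity>" (is "?W < _")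
    using lattice by (auto simp: lattice_subgroup_def)
  note sp = haar_space[OF h]
  note id = haar_measurable_id[OF h]
  obtain N m where m: "0 < m" and
    rec: "\<And>z. z \<in> Nbar n \<Longrightarrow> m \<le> emeasure \<mu> {d \<in> space \<mu>. qinv n c d z \<in> cell n N (N + 4 * pi * c)}"
    using recurrence[OF n c h] by blast
  let ?F = "cell n N (N + 4 * pi * c)"
  have "0 < m * kappa n"
    using m kappa_pos[of n] by (simp add: ennreal_zero_less_mult_iff)
  \<comment> \<open>A positive real number below \<open>m * kappa n\<close>, so that division by it
    makes sense in \<open>ennreal\<close>.\<close>
  then obtain e where e: "0 < e" "e < m * kappa n"
    using dense by blast
  have e': "e < \<infinity>"
    using e(2) by (simp add: less_le_trans[OF e(2)] order_less_le_trans)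
  obtain r where r: "e = ennreal r" "0 < r"
    using e(1) e' by (cases e) (auto simp: ennreal_less_zero_iff)
  define C where "C = (\<integral>\<^sup>+ z. indicator (slab n) (fst z) * indicator ?F (pz n 1 z) \<partial>LZ n)"
  have C: "C < \<infinity>"
    unfolding C_def by (rule slab_cell_finite[OF n])
  have main: "m * kappa n * nu n \<rho> U \<le> ?W * C"
    if \<rho>: "0 < \<rho>" and U: "U \<in> sets (coord_lebesgue n)" "U \<subseteq> Nbar n" "inj_on (orb n c D) U" for \<rho> U
  proof -
    interpret P: pair_sigma_finite \<mu> "LZ n"
      by (intro pair_sigma_finite.intro haar_sigma_finite[OF h] sigma_finite_LZ)
    let ?M = "\<mu> \<Otimes>\<^sub>M LZ n"
    let ?s = "\<lambda>z. indicator (slab n) (fst z) :: ennreal"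
    have sm: "?s \<in> borel_measurable (LZ n)"
      by (rule measurable_compose[OF measurable_fst pred_slab[OF n]])
    have pm: "(\<lambda>x. pz n \<rho> (snd x)) \<in> measurable ?M (coord_lebesgue n)"
      by (rule measurable_compose[OF measurable_snd measurable_pz[OF n]])
    have dm: "measurable_in_SUHeis n ?M fst"
      by (rule measurable_in_SUHeis_compose[OF id measurable_fst])
    note im = borel_measurable_indicator[OF U(1)] borel_measurable_indicator[OF cell_sets]
    note pzm = measurable_pz[OF n, of \<rho>]
    note Nb = pz_Nbar[OF _ _ \<rho>]
    \<comment> \<open>The cell does not restrict rho, so the constant C, computed at height 1,
      serves every height.\<close>
    have CF: "indicator ?F (pz n \<rho> z) = (indicator ?F (pz n 1 z) :: ennreal)" for z
      by (simp add: indicator_def cell_def pz_def space_coord_lebesgue)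
    have m1: "(\<lambda>(d, z). ?s z * indicator ?F (pz n \<rho> z) * indicator U (qact n c d (pz n \<rho> z))) \<in> borel_measurable ?M"
      unfolding case_prod_beta'
      by (intro borel_measurable_times_ennreal measurable_compose[OF measurable_snd sm] measurable_compose[OF pm im(2)]
          measurable_compose[OF measurable_qact[OF n dm pm] im(1)])
    have m2: "(\<lambda>(d, z). ?s z * indicator ?F (qinv n c d (pz n \<rho> z)) * indicator U (pz n \<rho> z)) \<in> borel_measurable ?M"
      unfolding case_prod_beta'
      by (intro borel_measurable_times_ennreal measurable_compose[OF measurable_snd sm] measurable_compose[OF pm im(1)]
          measurable_compose[OF measurable_qinv[OF n dm pm] im(2)])
    \<comment> \<open>For fixed d the image of z becomes the new variable: U is tested at the
      variable itself, and the cell at its preimage, which \<open>qinv\<close> computes on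
      images.\<close>
    have cv: "(\<integral>\<^sup>+ z. ?s z * indicator ?F (pz n \<rho> z) * indicator U (qact n c d (pz n \<rho> z)) \<partial>LZ n) =
        (\<integral>\<^sup>+ z. ?s z * indicator ?F (qinv n c d (pz n \<rho> z)) * indicator U (pz n \<rho> z) \<partial>LZ n)"
      if d: "d \<in> space \<mu>" for d
    proof -
      have dG: "d \<in> carrier (SUHeis n)" and g: "fst d \<in> carrier (SU_group n)"
        using d by (auto simp: sp SUHeis_simps)
      note dU = SUHeis_UHeis[OF dG]
      have cm: "measurable_in_SUHeis n (LZ n) (\<lambda>_. d)"
        using dG by (simp add: measurable_in_SUHeis_def)
      let ?H = "\<lambda>z. ?s z * indicator ?F (qinv n c d (pz n \<rho> z)) * indicator U (pz n \<rho> z)"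
      have Hm: "?H \<in> borel_measurable (LZ n)"
        by (intro borel_measurable_times_ennreal sm measurable_compose[OF pzm im(1)]
            measurable_compose[OF measurable_qinv[OF n cm pzm] im(2)])
      let ?b = "\<lambda>Z w. - 2 * c * Theta n (fst d) (dehom n Z) + omega n (fst (snd d)) (vec n (mv n (co n (fst d)) w)) + snd (snd d)"
      have bm: "(\<lambda>z. ?b (fst z) (fst (snd z))) \<in> borel_measurable (LZ n)"
      proof -
        have "(\<lambda>z. coord_phi (qact n c d (pz n \<rho> z)) - coord_phi (pz n \<rho> z)) \<in> borel_measurable (LZ n)"
          using measurable_coord_entries(3)[OF measurable_qact[OF n cm pzm]] measurable_coord_entries(3)[OF pzm]
          by (intro borel_measurable_diff)
        then show ?thesis
          by (simp add: qact_def act_eq pz_def algebra_simps)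
      qed
      let ?T = "\<lambda>z. (matvec n (fst d) (fst z), (\<lambda>k\<in>{..<n}. mv n (co n (fst d)) (fst (snd z)) k + fst (snd d) $ k / 2),
          snd (snd z) + ?b (fst z) (fst (snd z)))"
      have "(\<integral>\<^sup>+ z. ?s z * indicator ?F (pz n \<rho> z) * indicator U (qact n c d (pz n \<rho> z)) \<partial>LZ n) = (\<integral>\<^sup>+ z. ?H (?T z) \<partial>LZ n)"
      proof (rule nn_integral_cong)
        fix z assume z: "z \<in> space (LZ n)"
        show "?s z * indicator ?F (pz n \<rho> z) * indicator U (qact n c d (pz n \<rho> z)) = ?H (?T z)"
        proof (cases "fst z \<in> slab n")
          case True
          have "?s (?T z) = 1"
            using True slab_matvec[OF n SU_U[OF g]] by simp
          moreover have "?s z = 1"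
            using True by simp
          ultimately show ?thesis
            unfolding pz_qact[OF n dU True] qinv_qact[OF n dU Nb[OF True z]] by (simp only:)
        next
          case False
          then show ?thesis
            using slab_matvec[OF n SU_U[OF g]] by simp
        qed
      qed
      also have "\<dots> = (\<integral>\<^sup>+ z. ?H z \<partial>LZ n)"
        by (rule LZ_change_of_variables[OF n g Hm bm])
      finally show ?thesis .
    qed
    have "m * kappa n * nu n \<rho> U = m * (\<integral>\<^sup>+ z. ?s z * indicator U (pz n \<rho> z) \<partial>LZ n)"
      by (simp add: slab_nu[OF n U(1)] mult.assoc)
    also have "\<dots> = (\<integral>\<^sup>+ z. m * (?s z * indicator U (pz n \<rho> z)) \<partial>LZ n)"
      by (intro nn_integral_cmult[symmetric] borel_measurable_times_ennreal sm measurable_compose[OF pzm im(1)])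
    also have "\<dots> \<le> (\<integral>\<^sup>+ z. (\<integral>\<^sup>+ d. ?s z * indicator ?F (qinv n c d (pz n \<rho> z)) * indicator U (pz n \<rho> z) \<partial>\<mu>) \<partial>LZ n)"
    proof (rule nn_integral_mono)
      fix z assume z: "z \<in> space (LZ n)"
      show "m * (?s z * indicator U (pz n \<rho> z)) \<le>
          (\<integral>\<^sup>+ d. ?s z * indicator ?F (qinv n c d (pz n \<rho> z)) * indicator U (pz n \<rho> z) \<partial>\<mu>)"
      proof (cases "fst z \<in> slab n \<and> pz n \<rho> z \<in> U")
        case True
        then have N: "pz n \<rho> z \<in> Nbar n"
          using Nb z by blast
        have "(\<lambda>d. qinv n c d (pz n \<rho> z)) \<in> measurable \<mu> (coord_lebesgue n)"
          using Nbar_space[OF N] by (intro measurable_qinv[OF n id]) auto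
        from measurable_sets[OF this cell_sets[of n N "N + 4 * pi * c"]]
        have B: "{d \<in> space \<mu>. qinv n c d (pz n \<rho> z) \<in> ?F} \<in> sets \<mu>"
          by (simp add: vimage_def Int_def conj_commute)
        have "(\<integral>\<^sup>+ d. ?s z * indicator ?F (qinv n c d (pz n \<rho> z)) * indicator U (pz n \<rho> z) \<partial>\<mu>) =
            (\<integral>\<^sup>+ d. indicator {d \<in> space \<mu>. qinv n c d (pz n \<rho> z) \<in> ?F} d \<partial>\<mu>)"
          using True by (intro nn_integral_cong) (simp add: indicator_def)
        then show ?thesis
          using True rec[OF N] nn_integral_indicator[OF B] by simp
      qed auto
    qed
    also have "\<dots> = (\<integral>\<^sup>+ d. (\<integral>\<^sup>+ z. ?s z * indicator ?F (qinv n c d (pz n \<rho> z)) * indicator U (pz n \<rho> z) \<partial>LZ n) \<partial>\<mu>)"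
      by (rule P.Fubini'[OF m2])
    also have "\<dots> = (\<integral>\<^sup>+ d. (\<integral>\<^sup>+ z. ?s z * indicator ?F (pz n \<rho> z) * indicator U (qact n c d (pz n \<rho> z)) \<partial>LZ n) \<partial>\<mu>)"
      by (intro nn_integral_cong cv[symmetric])
    also have "\<dots> = (\<integral>\<^sup>+ z. (\<integral>\<^sup>+ d. ?s z * indicator ?F (pz n \<rho> z) * indicator U (qact n c d (pz n \<rho> z)) \<partial>\<mu>) \<partial>LZ n)"
      by (rule P.Fubini'[OF m1, symmetric])
    also have "\<dots> \<le> (\<integral>\<^sup>+ z. ?W * (?s z * indicator ?F (pz n 1 z)) \<partial>LZ n)"
    proof (rule nn_integral_mono)
      fix z assume z: "z \<in> space (LZ n)"
      show "(\<integral>\<^sup>+ d. ?s z * indicator ?F (pz n \<rho> z) * indicator U (qact n c d (pz n \<rho> z)) \<partial>\<mu>) \<le> ?W * (?s z * indicator ?F (pz n 1 z))"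
      proof (cases "fst z \<in> slab n \<and> pz n \<rho> z \<in> ?F")
        case True
        then have N: "pz n \<rho> z \<in> Nbar n"
          using Nb z by blast
        have "(\<lambda>d. qact n c d (pz n \<rho> z)) \<in> measurable \<mu> (coord_lebesgue n)"
          using Nbar_space[OF N] by (intro measurable_qact[OF n id]) auto
        from measurable_sets[OF this U(1)]
        have B: "{d \<in> space \<mu>. qact n c d (pz n \<rho> z) \<in> U} \<in> sets \<mu>"
          by (simp add: vimage_def Int_def conj_commute)
        have "(\<integral>\<^sup>+ d. ?s z * indicator ?F (pz n \<rho> z) * indicator U (qact n c d (pz n \<rho> z)) \<partial>\<mu>) =
            (\<integral>\<^sup>+ d. indicator {d \<in> space \<mu>. qact n c d (pz n \<rho> z) \<in> U} d \<partial>\<mu>)"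
          using True by (intro nn_integral_cong) (simp add: indicator_def)
        also have "\<dots> \<le> ?W"
          using nn_integral_indicator[OF B] lattice_count[OF n D free h U N] by simp
        finally show ?thesis
          using True CF[of z] by simp
      qed auto
    qed
    also have "\<dots> = ?W * C"
      unfolding C_def
      by (intro nn_integral_cmult borel_measurable_times_ennreal sm measurable_compose[OF measurable_pz[OF n] im(2)])
    finally show ?thesis .
  qed
  show ?thesis
  proof (rule that[of "ennreal (1 / r) * (?W * C)"])
    show "ennreal (1 / r) * (?W * C) < \<infinity>"
      using W C by (simp add: ennreal_mult_less_top)
    fix \<rho> :: real and U assume A: "0 < \<rho>" "U \<in> sets (coord_lebesgue n)" "U \<subseteq> Nbar n" "inj_on (orb n c D) U"
    have "ennreal r * nu n \<rho> U \<le> m * kappa n * nu n \<rho> U"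
      using e(2) unfolding r(1) by (intro mult_right_mono) auto
    also note main[OF A]
    finally have "ennreal (1 / r) * (ennreal r * nu n \<rho> U) \<le> ennreal (1 / r) * (?W * C)"
      by (intro mult_left_mono) auto
    moreover have "ennreal (1 / r) * ennreal r = 1"
      using r(2) by (simp add: ennreal_mult[symmetric])
    ultimately show "nu n \<rho> U \<le> ennreal (1 / r) * (?W * C)"
      by (simp add: mult.assoc[symmetric])
  qed
qed

section \<open>Proper discontinuity at the origin\<close>

definition near :: "nat \<Rightarrow> real \<Rightarrow> coords \<Rightarrow> bool" where
  "near n \<delta> p \<longleftrightarrow> (\<forall>a\<in>{1..<n}. cmod (coord_X p a) < \<delta>) \<and> (\<forall>k<n. cmod (coord_w p k) < \<delta>) \<and> \<bar>coord_phi p\<bar> < \<delta>"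

text \<open>Row 0 gives |g_00|^2 = 1 + the sum of the other |g_0k|^2, and column j bounds the
  entries below its top by 1 + |g_0j|^2. So the single entry g_00 controls the whole matrix.\<close>

lemma U_entries_bound:
  assumes n: "1 \<le> n" and g: "g \<in> carrier (U_group n)"
  shows "\<And>a. a < n \<Longrightarrow> cmod (g $$ (0, a)) \<le> cmod (g $$ (0, 0))"
    "\<And>i j. i < n \<Longrightarrow> j < n \<Longrightarrow> cmod (g $$ (i, j)) \<le> cmod (g $$ (0, 0)) + 1"
proof -
  have s: "{..<n} = insert 0 {1..<n}"
    using n by auto
  have herm_real: "(\<Sum>k<n. sg k * (x k * cnj (x k))) = complex_of_real ((\<Sum>k\<in>{1..<n}. (cmod (x k))\<^sup>2) - (cmod (x 0))\<^sup>2)" for x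
  proof -
    have "(\<Sum>k\<in>{1..<n}. sg k * (x k * cnj (x k))) = (\<Sum>k\<in>{1..<n}. complex_of_real ((cmod (x k))\<^sup>2))"
      by (intro sum.cong) (auto simp: sg_def complex_norm_square[symmetric])
    then show ?thesis
      unfolding s by (simp add: complex_norm_square[symmetric])
  qed
  have row: "(cmod (g $$ (0, 0)))\<^sup>2 = 1 + (\<Sum>k\<in>{1..<n}. (cmod (g $$ (0, k)))\<^sup>2)"
  proof -
    have "(\<Sum>k<n. sg k * (g $$ (0, k) * cnj (g $$ (0, k)))) = - 1"
      using U_entries_rows[OF g, of 0 0] n by simp
    then have "(\<Sum>k\<in>{1..<n}. (cmod (g $$ (0, k)))\<^sup>2) - (cmod (g $$ (0, 0)))\<^sup>2 = - 1"
      unfolding herm_real by (metis of_real_1 of_real_eq_iff of_real_minus)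
    then show ?thesis
      by simp
  qed
  have col: "(\<Sum>k\<in>{1..<n}. (cmod (g $$ (k, j)))\<^sup>2) \<le> 1 + (cmod (g $$ (0, j)))\<^sup>2" if j: "j < n" for j
  proof -
    have "(\<Sum>k<n. sg k * cnj (g $$ (k, j)) * g $$ (k, j)) = (if j = 0 then - 1 else 1)"
      using g j by (auto simp: U_iff_entries sg_def)
    moreover have "(\<Sum>k<n. sg k * cnj (g $$ (k, j)) * g $$ (k, j)) = (\<Sum>k<n. sg k * (g $$ (k, j) * cnj (g $$ (k, j))))"
      by (intro sum.cong) auto
    ultimately have "complex_of_real ((\<Sum>k\<in>{1..<n}. (cmod (g $$ (k, j)))\<^sup>2) - (cmod (g $$ (0, j)))\<^sup>2) = complex_of_real (if j = 0 then - 1 else 1)"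
      unfolding herm_real by simp
    then have "(\<Sum>k\<in>{1..<n}. (cmod (g $$ (k, j)))\<^sup>2) - (cmod (g $$ (0, j)))\<^sup>2 = (if j = 0 then - 1 else 1)"
      unfolding of_real_eq_iff .
    then show ?thesis
      by (simp split: if_splits)
  qed
  show a: "cmod (g $$ (0, a)) \<le> cmod (g $$ (0, 0))" if "a < n" for a
  proof (cases "a = 0")
    case False
    then have "(cmod (g $$ (0, a)))\<^sup>2 \<le> (\<Sum>k\<in>{1..<n}. (cmod (g $$ (0, k)))\<^sup>2)"
      using that by (intro member_le_sum) auto
    then have "(cmod (g $$ (0, a)))\<^sup>2 \<le> (cmod (g $$ (0, 0)))\<^sup>2"
      using row by simp
    then show ?thesis
      by (rule power2_le_imp_le) simp
  qed simp
  show "cmod (g $$ (i, j)) \<le> cmod (g $$ (0, 0)) + 1" if ij: "i < n" "j < n" for i j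
  proof (cases "i = 0")
    case False
    then have "(cmod (g $$ (i, j)))\<^sup>2 \<le> (\<Sum>k\<in>{1..<n}. (cmod (g $$ (k, j)))\<^sup>2)"
      using ij by (intro member_le_sum[of i _ "\<lambda>k. (cmod (g $$ (k, j)))\<^sup>2"]) auto
    also have "\<dots> \<le> 1 + (cmod (g $$ (0, 0)))\<^sup>2"
    proof -
      have "(cmod (g $$ (0, j)))\<^sup>2 \<le> (cmod (g $$ (0, 0)))\<^sup>2"
        by (rule power_mono[OF a[OF ij(2)]]) simp
      then show ?thesis
        using col[OF ij(2)] by linarith
    qed
    also have "\<dots> \<le> (cmod (g $$ (0, 0)) + 1)\<^sup>2"
      by (simp add: power2_sum)
    finally show ?thesis
      by (rule power2_le_imp_le) simp
  qed (use a[OF ij(2)] in simp)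
qed

text \<open>The squared modulus of (g Z)^0 is the ratio of 1 - |X|^2 at the point and at its image.
  Both points lie deep inside the ball, so this is bounded; it bounds g_00 and thereby g, then the
  w-coordinate bounds v and the phi-coordinate bounds t. The result is the boundedness behind the
  choice of a convergent subsequence.\<close>

lemma near_bound:
  assumes n: "1 \<le> n" and c: "0 \<le> c" and \<delta>: "0 < \<delta>" "real n * \<delta> \<le> 1 / 2" and d: "d \<in> carrier (UHeis n)"
    and p: "p \<in> Nbar n" "near n \<delta> p" "near n \<delta> (qact n c d p)"
  defines "R \<equiv> 16 * real n + 4 * pi * c + 10"
  shows "\<And>i j. i < n \<Longrightarrow> j < n \<Longrightarrow> cmod (fst d $$ (i, j)) \<le> R"
    "\<And>k. k < n \<Longrightarrow> cmod (fst (snd d) $ k) \<le> R" "\<bar>snd (snd d)\<bar> \<le> R"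
proof -
  obtain g v t where dd: "d = (g, (v, t))" and g: "g \<in> carrier (U_group n)" and v: "v \<in> carrier_vec n"
    using d by (auto simp: UHeis_simps)
  obtain X w \<phi> \<rho> where pp: "p = (X, w, \<phi>, \<rho>)" and X: "X \<in> CH_ball n"
    using p(1) by (cases p) (auto simp: Nbar_iff)
  have "1 * \<delta> \<le> real n * \<delta>"
    using \<delta>(1) n by (intro mult_right_mono) auto
  then have \<delta>1: "\<delta> \<le> 1 / 2"
    using \<delta>(2) by linarith
  have Xd: "cmod (X a) < \<delta>" if "a \<in> {1..<n}" for a
    using p(2) that by (auto simp: near_def pp)
  have wd: "cmod (w k) < \<delta>" if "k < n" for k
    using p(2) that by (auto simp: near_def pp)
  have small: "(\<Sum>a\<in>{1..<n}. (cmod (Y a))\<^sup>2) \<le> 1 / 4" if "\<And>a. a \<in> {1..<n} \<Longrightarrow> cmod (Y a) < \<delta>" for Y :: "nat \<Rightarrow> complex"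
  proof -
    have "(\<Sum>a\<in>{1..<n}. (cmod (Y a))\<^sup>2) \<le> (\<Sum>a\<in>{1..<n}. \<delta> * \<delta>)"
      using that \<delta>(1) by (intro sum_mono) (auto simp: power2_eq_square less_imp_le intro!: mult_mono)
    also have "\<dots> \<le> real n * \<delta> * \<delta>"
      using \<delta>(1) by (simp add: mult_right_mono)
    also have "\<dots> \<le> 1 / 2 * (1 / 2)"
      using \<delta> \<delta>1 by (intro mult_mono) auto
    finally show ?thesis
      by simp
  qed
  let ?J = "mat_Z n g X 0"
  let ?X' = "\<lambda>b\<in>{1..<n}. mat_Z n g X b / ?J"
  have X': "cmod (?X' a) < \<delta>" if "a \<in> {1..<n}" for a
    using p(3) that unfolding near_def qact_def act_eq by (simp add: pp dd)
  have J0: "0 < (cmod ?J)\<^sup>2"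
    using mat_Z0_nonzero[OF n g X] by simp
  have "3 / 4 \<le> one_minus_normX2 n ?X'"
    using small[of ?X'] X' by (simp add: one_minus_normX2_def)
  also have "\<dots> = one_minus_normX2 n X / (cmod ?J)\<^sup>2"
    by (rule CH_ball_act(2)[OF n g X])
  also have "\<dots> \<le> 1 / (cmod ?J)\<^sup>2"
    by (rule divide_right_mono) (auto simp: one_minus_normX2_def sum_nonneg)
  finally have "3 / 4 \<le> 1 / (cmod ?J)\<^sup>2" .
  then have "(cmod ?J)\<^sup>2 \<le> 2\<^sup>2"
    using J0 by (simp add: field_simps)
  then have J2: "cmod ?J \<le> 2"
    by (rule power2_le_imp_le) simp
  have s: "{..<n} = insert 0 {1..<n}"
    using n by auto
  have "?J = g $$ (0, 0) + (\<Sum>a\<in>{1..<n}. g $$ (0, a) * X a)"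
    unfolding mat_Z_def s by simp
  then have "g $$ (0, 0) = ?J - (\<Sum>a\<in>{1..<n}. g $$ (0, a) * X a)"
    by simp
  then have "cmod (g $$ (0, 0)) \<le> cmod ?J + cmod (\<Sum>a\<in>{1..<n}. g $$ (0, a) * X a)"
    by (metis norm_triangle_ineq4)
  moreover have "cmod (\<Sum>a\<in>{1..<n}. g $$ (0, a) * X a) \<le> (\<Sum>a\<in>{1..<n}. cmod (g $$ (0, 0)) * \<delta>)"
    using Xd U_entries_bound(1)[OF n g] by (intro sum_norm_le) (auto simp: norm_mult less_imp_le intro!: mult_mono)
  moreover have "(\<Sum>a\<in>{1..<n}. cmod (g $$ (0, 0)) * \<delta>) \<le> cmod (g $$ (0, 0)) * (1 / 2)"
  proof -
    have "(\<Sum>a\<in>{1..<n}. cmod (g $$ (0, 0)) * \<delta>) = cmod (g $$ (0, 0)) * (real (n - 1) * \<delta>)"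
      by simp
    also have "real (n - 1) * \<delta> \<le> 1 / 2"
      using \<delta> by (intro order_trans[OF mult_right_mono \<delta>(2)]) auto
    finally show ?thesis
      by (simp add: mult_left_mono)
  qed
  \<comment> \<open>From |g_00| <= 2 + |g_00| / 2.\<close>
  ultimately have g00: "cmod (g $$ (0, 0)) \<le> 4"
    using J2 by linarith
  have g5: "cmod (g $$ (i, j)) \<le> 5" if "i < n" "j < n" for i j
    using U_entries_bound(2)[OF n g that] g00 by simp
  have R5: "5 \<le> R" "6 \<le> R"
    using c by (auto simp: R_def)
  show "cmod (fst d $$ (i, j)) \<le> R" if "i < n" "j < n" for i j
    using g5[OF that] R5(1) by (simp add: dd)
  have co5: "cmod (co n g $$ (i, j)) \<le> 5" if "i < n" "j < n" for i j
    using g5[OF that] that by (auto simp: co_def sg_def norm_mult)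
  have cw: "cmod (mv n (co n g) w k) \<le> 5 / 2" if "k < n" for k
  proof -
    have "cmod (mv n (co n g) w k) \<le> (\<Sum>j<n. 5 * \<delta>)"
      unfolding mv_def using co5[OF that] wd by (intro sum_norm_le) (auto simp: norm_mult less_imp_le intro!: mult_mono)
    then show ?thesis
      using \<delta>(2) by (simp add: mult_ac)
  qed
  have v6: "cmod (v $ k) \<le> 6" if k: "k < n" for k
  proof -
    have "cmod (mv n (co n g) w k + v $ k / 2) < \<delta>"
      using p(3) k unfolding near_def qact_def act_eq by (simp add: pp dd)
    moreover have "cmod (v $ k / 2) \<le> cmod (mv n (co n g) w k + v $ k / 2) + cmod (mv n (co n g) w k)"
      using norm_triangle_ineq4[of "mv n (co n g) w k + v $ k / 2" "mv n (co n g) w k"] by simp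
    ultimately show ?thesis
      using cw[OF k] \<delta>1 by (simp add: norm_divide)
  qed
  then show "cmod (fst (snd d) $ k) \<le> R" if "k < n" for k
    using R5(2) that by (force simp: dd)
  let ?x = "vec n (mv n (co n g) w)"
  have "\<bar>omega n v ?x\<bar> \<le> cmod (herm n (($) v) (($) ?x))"
    unfolding omega_herm[OF n] abs_minus_cancel by (rule abs_Im_le_cmod)
  also have "\<dots> \<le> (\<Sum>k<n. 6 * (5 / 2))"
  proof -
    have "cmod (v $ k) * cmod (mv n (co n g) w k) \<le> 6 * (5 / 2)" if "k < n" for k
      using that by (intro mult_mono v6 cw) auto
    then show ?thesis
      unfolding herm_def by (intro sum_norm_le) (auto simp: norm_mult sg_def)
  qed
  finally have om: "\<bar>omega n v ?x\<bar> \<le> 15 * real n"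
    by simp
  have "\<bar>\<phi> - 2 * c * Theta n g X + omega n v ?x + t\<bar> < \<delta>"
    using p(3) unfolding near_def qact_def act_eq by (simp add: pp dd)
  moreover have "\<bar>\<phi>\<bar> < \<delta>"
    using p(2) by (simp add: near_def pp)
  moreover have "2 * c * \<bar>Theta n g X\<bar> \<le> 2 * c * (2 * pi)"
    using c Theta_bound[of n g X] by (intro mult_left_mono) auto
  then have "\<bar>2 * c * Theta n g X\<bar> \<le> 4 * pi * c"
    using c by (simp add: abs_mult mult_ac)
  \<comment> \<open>15 n bounds the \<open>omega\<close> term, as n times 6 for v times 5/2 for the
    transformed w; 4 pi c bounds the angle term; 1 covers the two phi-coordinates, each less than
    1/2.\<close>
  ultimately have "\<bar>t\<bar> \<le> 15 * real n + 4 * pi * c + 1"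
    using om \<delta>1 by linarith
  then show "\<bar>snd (snd d)\<bar> \<le> R"
    by (simp add: dd R_def)
qed

section \<open>Limits of group elements and discreteness modulo periods\<close>

lemma tendsto_fun_iff:
  fixes f :: "'a \<Rightarrow> 'b \<Rightarrow> 'c :: topological_space"
  shows "(f \<longlongrightarrow> l) F \<longleftrightarrow> (\<forall>i. ((\<lambda>x. f x i) \<longlongrightarrow> l i) F)"
  using limitin_componentwise[of "\<lambda>_. euclidean :: 'c topology" UNIV f l F]
  by (simp add: euclidean_product_topology)

lemma bounded_subsequence:
  fixes d :: "nat \<Rightarrow> complex mat \<times> heis"
  assumes "\<And>N i j. i < n \<Longrightarrow> j < n \<Longrightarrow> cmod (fst (d N) $$ (i, j)) \<le> R"
    "\<And>N k. k < n \<Longrightarrow> cmod (fst (snd (d N)) $ k) \<le> R" "\<And>N. \<bar>snd (snd (d N))\<bar> \<le> R"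
  obtains r G V T where "strict_mono (r :: nat \<Rightarrow> nat)"
    "\<And>i j. i < n \<Longrightarrow> j < n \<Longrightarrow> (\<lambda>N. fst (d (r N)) $$ (i, j)) \<longlonglongrightarrow> G (i, j)"
    "\<And>k. k < n \<Longrightarrow> (\<lambda>N. fst (snd (d (r N))) $ k) \<longlonglongrightarrow> V k" "(\<lambda>N. snd (snd (d (r N)))) \<longlonglongrightarrow> T"
proof -
  let ?K = "PiE ({..<n} \<times> {..<n}) (\<lambda>_. cball 0 R) \<times> PiE {..<n} (\<lambda>_. cball 0 R) \<times> cball 0 R
    :: ((nat \<times> nat \<Rightarrow> complex) \<times> (nat \<Rightarrow> complex) \<times> real) set"
  let ?e = "\<lambda>N. (\<lambda>ij\<in>{..<n} \<times> {..<n}. fst (d N) $$ ij, \<lambda>k\<in>{..<n}. fst (snd (d N)) $ k, snd (snd (d N)))"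
  have "seq_compact ?K"
    by (intro compact_imp_seq_compact compact_Times compact_PiE_cball compact_cball)
  moreover have "\<forall>N. ?e N \<in> ?K"
    using assms by (auto simp: restrict_PiE_iff)
  ultimately obtain l r where r: "strict_mono (r :: nat \<Rightarrow> nat)" and l: "(?e \<circ> r) \<longlonglongrightarrow> l"
    unfolding seq_compact_def by meson
  have 1: "(\<lambda>N. fst (?e (r N))) \<longlonglongrightarrow> fst l" "(\<lambda>N. fst (snd (?e (r N)))) \<longlonglongrightarrow> fst (snd l)"
    "(\<lambda>N. snd (snd (?e (r N)))) \<longlonglongrightarrow> snd (snd l)"
    using tendsto_fst[OF l] tendsto_fst[OF tendsto_snd[OF l]] tendsto_snd[OF tendsto_snd[OF l]]
    by (simp_all add: comp_def)
  show ?thesis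
  proof (rule that[OF r])
    show "(\<lambda>N. fst (d (r N)) $$ (i, j)) \<longlonglongrightarrow> fst l (i, j)" if "i < n" "j < n" for i j
      using 1(1)[unfolded tendsto_fun_iff, rule_format, of "(i, j)"] that by simp
    show "(\<lambda>N. fst (snd (d (r N))) $ k) \<longlonglongrightarrow> fst (snd l) k" if "k < n" for k
      using 1(2)[unfolded tendsto_fun_iff, rule_format, of k] that by simp
    show "(\<lambda>N. snd (snd (d (r N)))) \<longlonglongrightarrow> snd (snd l)"
      using 1(3) by simp
  qed
qed

text \<open>For a subset D of the group this is the full preimage of \<open>Gamma_hat\<close>.
  Absorbing the period into the group element lets a coincidence of orbits be written as q =
  \<open>qact n c d p\<close>.\<close>

definition with_periods :: "real \<Rightarrow> (complex mat \<times> heis) set \<Rightarrow> (complex mat \<times> heis) set" where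
  "with_periods c D = {(g, (v, t + period c k)) | g v t k. (g, (v, t)) \<in> D}"

lemma with_periods_iinv_mult:
  assumes n: "1 \<le> n" and D: "subgroup D (SUHeis n)" and d: "d1 \<in> with_periods c D" "d2 \<in> with_periods c D"
  shows "iinv n d1 \<otimes>\<^bsub>SUHeis n\<^esub> d2 \<in> with_periods c D"
proof -
  obtain g1 v1 t1 k1 where d1: "d1 = (g1, (v1, t1 + period c k1))" "(g1, (v1, t1)) \<in> D"
    using d(1) by (auto simp: with_periods_def)
  obtain g2 v2 t2 k2 where d2: "d2 = (g2, (v2, t2 + period c k2))" "(g2, (v2, t2)) \<in> D"
    using d(2) by (auto simp: with_periods_def)
  have dG: "(g1, (v1, t1)) \<in> carrier (SUHeis n)"
    using subgroup.subset[OF D] d1(2) by blast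
  have ga: "adj n g1 \<in> carrier (SU_group n)"
    using dG by (auto simp: SUHeis_simps intro: SU_adj)
  have "iinv n (g1, (v1, t1)) \<in> D"
    using subgroup.m_inv_closed[OF D d1(2)] iinv_SUHeis(2)[OF n dG] by simp
  then have "iinv n (g1, (v1, t1)) \<otimes>\<^bsub>SUHeis n\<^esub> (g2, (v2, t2)) \<in> D"
    using d2(2) by (rule subgroup.m_closed[OF D])
  then have "(adj n g1 * g2, (- (co n (adj n g1) *\<^sub>v v1) + co n (adj n g1) *\<^sub>v v2,
      - t1 + t2 + omega n (- (co n (adj n g1) *\<^sub>v v1)) (co n (adj n g1) *\<^sub>v v2) / 2)) \<in> D"
    unfolding iinv_def prod.case SUHeis_simps(2)[OF ga] .
  moreover have "iinv n d1 \<otimes>\<^bsub>SUHeis n\<^esub> d2 = (adj n g1 * g2, (- (co n (adj n g1) *\<^sub>v v1) + co n (adj n g1) *\<^sub>v v2,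
      - t1 + t2 + omega n (- (co n (adj n g1) *\<^sub>v v1)) (co n (adj n g1) *\<^sub>v v2) / 2 + period c (k2 - k1)))"
    unfolding d1 d2 iinv_def prod.case SUHeis_simps(2)[OF ga] by (simp flip: period_simps(3))
  ultimately show ?thesis
    unfolding with_periods_def by blast
qed

lemma coset_member:
  assumes n: "1 \<le> n" and V: "V \<in> carrier (Heis_group n Mod C_heis n c)" and x: "x \<in> V"
  shows "V = C_heis n c #>\<^bsub>Heis_group n\<^esub> x" "x \<in> carrier (Heis_group n)"
proof -
  obtain v t where v: "v \<in> carrier_vec n" and V: "V = C_heis n c #>\<^bsub>Heis_group n\<^esub> (v, t)"
    using V by (auto simp: FactGroup_def RCOSETS_def)
  have V': "V = {(v, t + period c k) | k. True}"
    unfolding V by (rule C_heis_coset[OF n v])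
  then obtain k where k: "x = (v, t + period c k)"
    using x by blast
  have "{(v, t + period c j) | j. True} = {(v, t + period c k + period c j) | j. True}"
  proof (intro equalityI subsetI)
    fix y assume "y \<in> {(v, t + period c j) | j. True}"
    then obtain j where "y = (v, t + period c j)"
      by blast
    then have "y = (v, t + period c k + period c (j - k))"
      by (simp add: add.assoc period_simps)
    then show "y \<in> {(v, t + period c k + period c j) | j. True}"
      by blast
  qed (auto simp: add.assoc period_simps)
  then show "V = C_heis n c #>\<^bsub>Heis_group n\<^esub> x"
    unfolding k C_heis_coset[OF n v] V' .
  show "x \<in> carrier (Heis_group n)"
    using v by (simp add: k)
qed

text \<open>The constructor \<open>topology\<close> yields the intended open sets only after the
  axioms are checked; closure under intersection uses that cosets with a common point
  coincide.\<close>

lemma openin_quotient_top: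
  assumes n: "1 \<le> n"
  shows "openin (quotient_top (Heis_group n) (Heis_top n) (C_heis n c)) B \<longleftrightarrow>
    B \<subseteq> carrier (Heis_group n Mod C_heis n c) \<and> openin (Heis_top n) (\<Union>B)"
proof -
  let ?Q = "carrier (Heis_group n Mod C_heis n c)"
  have "istopology (\<lambda>V. V \<subseteq> ?Q \<and> openin (Heis_top n) (\<Union>V))"
    unfolding istopology_def
  proof (intro conjI allI impI)
    fix S T assume S: "S \<subseteq> ?Q \<and> openin (Heis_top n) (\<Union>S)" and T: "T \<subseteq> ?Q \<and> openin (Heis_top n) (\<Union>T)"
    have "\<Union>(S \<inter> T) = \<Union>S \<inter> \<Union>T"
    proof (intro equalityI subsetI)
      fix x assume "x \<in> \<Union>S \<inter> \<Union>T"
      then obtain V W where V: "V \<in> S" "W \<in> T" "x \<in> V" "x \<in> W"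
        by blast
      have VQ: "V \<in> ?Q" "W \<in> ?Q"
        using V S T by auto
      have "V = W"
        using coset_member(1)[OF n VQ(1) V(3)] coset_member(1)[OF n VQ(2) V(4)] by simp
      then show "x \<in> \<Union>(S \<inter> T)"
        using V by blast
    qed auto
    then show "openin (Heis_top n) (\<Union>(S \<inter> T))"
      using S T openin_Int by metis
    show "S \<inter> T \<subseteq> ?Q"
      using S by blast
  next
    fix \<K> assume K: "\<forall>S\<in>\<K>. S \<subseteq> ?Q \<and> openin (Heis_top n) (\<Union>S)"
    then show "\<Union>\<K> \<subseteq> ?Q"
      by blast
    have "\<Union>(\<Union>\<K>) = (\<Union>S\<in>\<K>. \<Union>S)"
      by blast
    then show "openin (Heis_top n) (\<Union>(\<Union>\<K>))"
      using K by (metis (no_types, lifting) openin_Union imageE)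
  qed
  then show ?thesis
    unfolding quotient_top_def by (simp add: topology_inverse')
qed

lemma tendsto_SU_top:
  assumes g: "\<And>N. g N \<in> carrier (SU_group n)" "\<And>i j. i < n \<Longrightarrow> j < n \<Longrightarrow> (\<lambda>N. g N $$ (i, j)) \<longlonglongrightarrow> h $$ (i, j)"
    and A: "openin (SU_top n) A" "h \<in> A"
  shows "\<forall>\<^sub>F N in sequentially. g N \<in> A"
proof -
  let ?f = "\<lambda>g. \<lambda>ij\<in>{..<n} \<times> {..<n}. g $$ ij"
  obtain B where B: "open B" "A = ?f -` B \<inter> carrier (SU_group n)"
    using A(1) by (auto simp: SU_top_def openin_pullback_topology)
  have "(\<lambda>N. ?f (g N)) \<longlonglongrightarrow> ?f h"
    unfolding tendsto_fun_iff using g(2) by (auto simp: restrict_def)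
  from topological_tendstoD[OF this B(1)]
  have "\<forall>\<^sub>F N in sequentially. ?f (g N) \<in> B"
    using A(2) B(2) by blast
  then show ?thesis
    by (rule eventually_mono) (use g(1) B(2) in blast)
qed

lemma tendsto_Heis_top:
  assumes x: "\<And>N. x N \<in> carrier (Heis_group n)" "\<And>k. k < n \<Longrightarrow> (\<lambda>N. fst (x N) $ k) \<longlonglongrightarrow> fst y $ k"
    "(\<lambda>N. snd (x N)) \<longlonglongrightarrow> snd y"
    and A: "openin (Heis_top n) A" "y \<in> A"
  shows "\<forall>\<^sub>F N in sequentially. x N \<in> A"
proof -
  let ?f = "\<lambda>(v, t :: real). (\<lambda>k\<in>{..<n}. v $ k, t)"
  obtain B where B: "open B" "A = ?f -` B \<inter> carrier (Heis_group n)"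
    using A(1) by (auto simp: Heis_top_def openin_pullback_topology)
  have "(\<lambda>N. \<lambda>k\<in>{..<n}. fst (x N) $ k) \<longlonglongrightarrow> (\<lambda>k\<in>{..<n}. fst y $ k)"
    unfolding tendsto_fun_iff using x(2) by (auto simp: restrict_def)
  from tendsto_Pair[OF this x(3)]
  have "(\<lambda>N. ?f (x N)) \<longlonglongrightarrow> ?f y"
    by (simp add: case_prod_beta)
  from topological_tendstoD[OF this B(1)]
  have "\<forall>\<^sub>F N in sequentially. ?f (x N) \<in> B"
    using A(2) B(2) by blast
  then show ?thesis
    by (rule eventually_mono) (use x(1) B(2) in blast)
qed

lemma period_small: "0 \<le> c \<Longrightarrow> \<bar>period c k\<bar> < 4 * pi * c \<or> c = 0 \<Longrightarrow> period c k = 0"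
proof -
  assume c: "0 \<le> c" and k: "\<bar>period c k\<bar> < 4 * pi * c \<or> c = 0"
  show "period c k = 0"
  proof (cases "c = 0 \<or> k = 0")
    case False
    then have "1 \<le> \<bar>real_of_int k\<bar>"
      by linarith
    moreover have "0 < 4 * pi * c"
      using False c by simp
    ultimately have "4 * pi * c * 1 \<le> 4 * pi * c * \<bar>real_of_int k\<bar>"
      by (intro mult_left_mono) auto
    moreover have "\<bar>period c k\<bar> = 4 * pi * c * \<bar>real_of_int k\<bar>"
      using c by (simp add: period_def abs_mult)
    ultimately show ?thesis
      using k False by linarith
  qed (auto simp: period_def)
qed

text \<open>Discreteness is given modulo \<open>C_heis\<close>, so convergence to the identity first
  shows that the elements eventually lie in \<open>C_heis\<close>. Nonzero periods have modulus at
  least 4 pi c, so the remaining period, tending to 0, is eventually 0.\<close>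

lemma discrete_eventually_one:
  assumes n: "1 \<le> n" and c: "0 \<le> c" and D: "D \<subseteq> carrier (SUHeis n)"
    and discrete: "discrete_subgroup (SUHeis_mod_C n c) (SUHeis_mod_C_top n c) (Gamma_hat n c D)"
    and e: "\<And>N. e N \<in> with_periods c D"
    and lim: "\<And>i j. i < n \<Longrightarrow> j < n \<Longrightarrow> (\<lambda>N. fst (e N) $$ (i, j)) \<longlonglongrightarrow> (if i = j then 1 else 0)"
      "\<And>k. k < n \<Longrightarrow> (\<lambda>N. fst (snd (e N)) $ k) \<longlonglongrightarrow> 0" "(\<lambda>N. snd (snd (e N))) \<longlonglongrightarrow> 0"
  shows "\<forall>\<^sub>F N in sequentially. e N = (1\<^sub>m n, (0\<^sub>v n, 0))"
proof -
  let ?T = "SUHeis_mod_C_top n c" and ?\<Gamma> = "Gamma_hat n c D"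
  let ?Q = "quotient_top (Heis_group n) (Heis_top n) (C_heis n c)"
  let ?coset = "\<lambda>h. C_heis n c #>\<^bsub>Heis_group n\<^esub> h"
  have "\<one>\<^bsub>SUHeis_mod_C n c\<^esub> = (1\<^sub>m n, C_heis n c)"
    by (simp add: SUHeis_mod_C_def semidirect_def FactGroup_def)
  then have one: "(1\<^sub>m n, C_heis n c) \<in> ?\<Gamma>"
    using discrete subgroup.one_closed[of ?\<Gamma> "SUHeis_mod_C n c"] by (simp add: discrete_subgroup_def)
  have "openin (subtopology ?T ?\<Gamma>) {(1\<^sub>m n, C_heis n c)}"
    using discrete one by (simp add: discrete_subgroup_def)
  then obtain W where W: "openin ?T W" "{(1\<^sub>m n, C_heis n c)} = W \<inter> ?\<Gamma>"
    by (auto simp: openin_subtopology)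
  then have "(1\<^sub>m n, C_heis n c) \<in> W"
    by blast
  then obtain A B where A: "openin (SU_top n) A" "openin ?Q B" "1\<^sub>m n \<in> A" "C_heis n c \<in> B" "A \<times> B \<subseteq> W"
    using W(1) unfolding SUHeis_mod_C_top_def openin_prod_topology_alt by meson
  have B: "B \<subseteq> carrier (Heis_group n Mod C_heis n c)" "openin (Heis_top n) (\<Union>B)"
    using A(2) unfolding openin_quotient_top[OF n] by auto
  have eD: "\<exists>g v t k. e N = (g, (v, t + period c k)) \<and> (g, (v, t)) \<in> D \<and> g \<in> carrier (SU_group n) \<and> v \<in> carrier_vec n" for N
    using e[of N] D unfolding with_periods_def by (force simp: SUHeis_simps)
  have "(0\<^sub>v n, 0) \<in> C_heis n c"
    unfolding C_heis_eq[OF n] using period_simps(4)[of c] by (metis (mono_tags, lifting) mem_Collect_eq)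
  then have z: "(0\<^sub>v n, 0) \<in> \<Union>B"
    using A(4) by blast
  have 1: "\<forall>\<^sub>F N in sequentially. fst (e N) \<in> A"
  proof (rule tendsto_SU_top[OF _ _ A(1,3)])
    show "fst (e N) \<in> carrier (SU_group n)" for N
      using eD[of N] by auto
  qed (use lim(1) in simp)
  have 2: "\<forall>\<^sub>F N in sequentially. snd (e N) \<in> \<Union>B"
  proof (rule tendsto_Heis_top[OF _ _ _ B(2) z])
    show "snd (e N) \<in> carrier (Heis_group n)" for N
      using eD[of N] by auto
  qed (use lim(2,3) in auto)
  have 3: "\<forall>\<^sub>F N in sequentially. \<bar>snd (snd (e N))\<bar> < 4 * pi * c \<or> c = 0"
  proof (cases "c = 0")
    case False
    then have "0 < 4 * pi * c"
      using c by simp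
    then have "\<forall>\<^sub>F N in sequentially. \<bar>snd (snd (e N))\<bar> < 4 * pi * c"
      using tendstoD[OF lim(3)] by (simp add: dist_real_def)
    then show ?thesis
      by (rule eventually_mono) simp
  qed simp
  show ?thesis
    using 1 2 3
  proof eventually_elim
    case (elim N)
    obtain g v t k where eN: "e N = (g, (v, t + period c k))" and gD: "(g, (v, t)) \<in> D" and v: "v \<in> carrier_vec n"
      using eD[of N] by blast
    obtain V where V: "V \<in> B" "snd (e N) \<in> V"
      using elim(2) by blast
    have "V = ?coset (v, t + period c k)"
      using coset_member(1)[OF n _ V(2)] V(1) B(1) by (auto simp: eN)
    moreover have VQ: "?coset (v, t) = ?coset (v, t + period c k)"
    proof (rule coset_member(1)[OF n])
      show "?coset (v, t) \<in> carrier (Heis_group n Mod C_heis n c)"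
        using v by (auto simp: FactGroup_def RCOSETS_def)
      show "(v, t + period c k) \<in> ?coset (v, t)"
        unfolding C_heis_coset[OF n v] by blast
    qed
    ultimately have "(g, ?coset (v, t)) \<in> W"
      using A(5) elim(1) V(1) by (auto simp: eN)
    moreover have "(g, ?coset (v, t)) \<in> ?\<Gamma>"
      unfolding Gamma_hat_def using gD by force
    ultimately have g: "g = 1\<^sub>m n" and C: "?coset (v, t + period c k) = C_heis n c"
      using W(2) VQ by auto
    have "(v, t + period c k + period c 0) \<in> ?coset (v, t + period c k)"
      unfolding C_heis_coset[OF n v] by blast
    then have "(v, t + period c k) \<in> C_heis n c"
      unfolding C by (simp add: period_simps(4))
    then obtain j where "v = 0\<^sub>v n" and j: "t + period c k = period c j"
      unfolding C_heis_eq[OF n] by blast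
    moreover have "period c j = 0"
      using elim(3) period_small[OF c, of j] by (simp add: eN j)
    ultimately show ?case
      by (simp add: eN g)
  qed
qed

text \<open>No group element is formed from the limits G, V, T. Instead the identity saying that the
  inverse of d_N times d_N is 1 passes to the limit, and the same limit is that of the inverse of
  d_N times d_(N+1).\<close>

lemma iinv_mult_tendsto:
  fixes d :: "nat \<Rightarrow> complex mat \<times> heis"
  assumes n: "1 \<le> n" and d: "\<And>N. d N \<in> carrier (SUHeis n)"
    and G: "\<And>i j. i < n \<Longrightarrow> j < n \<Longrightarrow> (\<lambda>N. fst (d N) $$ (i, j)) \<longlonglongrightarrow> G (i, j)"
    and V: "\<And>k. k < n \<Longrightarrow> (\<lambda>N. fst (snd (d N)) $ k) \<longlonglongrightarrow> V k" and T: "(\<lambda>N. snd (snd (d N))) \<longlonglongrightarrow> T"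
  defines "e \<equiv> \<lambda>N. iinv n (d N) \<otimes>\<^bsub>SUHeis n\<^esub> d (Suc N)"
  shows "\<And>i j. i < n \<Longrightarrow> j < n \<Longrightarrow> (\<lambda>N. fst (e N) $$ (i, j)) \<longlonglongrightarrow> (if i = j then 1 else 0)"
    "\<And>k. k < n \<Longrightarrow> (\<lambda>N. fst (snd (e N)) $ k) \<longlonglongrightarrow> 0" "(\<lambda>N. snd (snd (e N))) \<longlonglongrightarrow> 0"
proof -
  let ?g = "\<lambda>N. fst (d N)" and ?v = "\<lambda>N. fst (snd (d N))" and ?t = "\<lambda>N. snd (snd (d N))"
  let ?a = "\<lambda>N. co n (adj n (?g N))"
  have g: "?g N \<in> carrier (SU_group n)" and v: "?v N \<in> carrier_vec n" for N
    using d[of N] by (auto simp: SUHeis_simps)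
  have gm: "?g N \<in> carrier_mat n n" and gU: "?g N \<in> carrier (U_group n)" for N
    using g[of N] by (auto intro: SU_U U_carrier_mat)
  have av: "?a N *\<^sub>v ?v M \<in> carrier_vec n" for N M
    using v by (intro mult_mat_vec_carrier) auto
  have e: "e N = (adj n (?g N) * ?g (Suc N), (- (?a N *\<^sub>v ?v N) + ?a N *\<^sub>v ?v (Suc N),
      ?t (Suc N) - ?t N - omega n (?v N) (?v (Suc N)) / 2))" for N
  proof -
    have "omega n (- (?a N *\<^sub>v ?v N)) (?a N *\<^sub>v ?v (Suc N)) = - omega n (?v N) (?v (Suc N))"
      unfolding omega_uminus_left[OF av n] by (simp add: omega_mult[OF n co_U[OF U_adj(3)[OF gU]] v v])
    then show ?thesis
      unfolding e_def iinv_def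
      using SUHeis_simps(2)[OF SU_adj[OF g[of N]], of _ _ "?g (Suc N)" "?v (Suc N)" "?t (Suc N)"] by (simp add: case_prod_beta)
  qed
  have adjG: "(\<lambda>N. adj n (?g N) $$ (i, l)) \<longlonglongrightarrow> sg i * sg l * cnj (G (l, i))" if "i < n" "l < n" for i l
    using that by (simp add: adj_def, intro tendsto_intros G)
  have prod: "(\<lambda>N. (adj n (?g N) * ?g (f N)) $$ (i, j)) \<longlonglongrightarrow> (\<Sum>l<n. sg i * sg l * cnj (G (l, i)) * G (l, j))"
    if ij: "i < n" "j < n" and f: "\<And>l. l < n \<Longrightarrow> (\<lambda>N. ?g (f N) $$ (l, j)) \<longlonglongrightarrow> G (l, j)" for i j f
  proof -
    have "(adj n (?g N) * ?g (f N)) $$ (i, j) = (\<Sum>l<n. adj n (?g N) $$ (i, l) * ?g (f N) $$ (l, j))" for N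
      using ij gm by (intro mult_mat_entry) auto
    then show ?thesis
      using ij by (simp only:) (intro tendsto_sum tendsto_mult adjG f; simp)
  qed
  show "(\<lambda>N. fst (e N) $$ (i, j)) \<longlonglongrightarrow> (if i = j then 1 else 0)" if ij: "i < n" "j < n" for i j
  proof -
    have "(\<lambda>N. (if i = j then 1 else 0 :: complex)) \<longlonglongrightarrow> (\<Sum>l<n. sg i * sg l * cnj (G (l, i)) * G (l, j))"
      using prod[OF ij, of "\<lambda>N. N"] G ij by (simp add: U_adj(1)[OF gU])
    then have "(\<Sum>l<n. sg i * sg l * cnj (G (l, i)) * G (l, j)) = (if i = j then 1 else 0)"
      by (simp add: LIMSEQ_const_iff)
    moreover have "(\<lambda>N. (adj n (?g N) * ?g (Suc N)) $$ (i, j)) \<longlonglongrightarrow> (\<Sum>l<n. sg i * sg l * cnj (G (l, i)) * G (l, j))"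
      using ij by (intro prod LIMSEQ_Suc[OF G]) auto
    ultimately show ?thesis
      by (simp add: e)
  qed
  have aG: "(\<lambda>N. ?a N $$ (k, l)) \<longlonglongrightarrow> G (l, k)" if "k < n" "l < n" for k l
  proof -
    have "?a N $$ (k, l) = ?g N $$ (l, k)" for N
      using that by (simp add: co_def adj_def sg_def)
    then show ?thesis
      using G that by simp
  qed
  have mvG: "(\<lambda>N. (?a N *\<^sub>v ?v (f N)) $ k) \<longlonglongrightarrow> (\<Sum>l<n. G (l, k) * V l)"
    if k: "k < n" and f: "\<And>l. l < n \<Longrightarrow> (\<lambda>N. ?v (f N) $ l) \<longlonglongrightarrow> V l" for k f
  proof -
    have "(?a N *\<^sub>v ?v (f N)) $ k = (\<Sum>l<n. ?a N $$ (k, l) * ?v (f N) $ l)" for N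
      unfolding mult_vec_index[OF co_carrier v k] mv_def ..
    then show ?thesis
      using k by (simp only:) (intro tendsto_sum tendsto_mult aG f; simp)
  qed
  show "(\<lambda>N. fst (snd (e N)) $ k) \<longlonglongrightarrow> 0" if k: "k < n" for k
  proof -
    have "(\<lambda>N. - ((?a N *\<^sub>v ?v N) $ k) + (?a N *\<^sub>v ?v (Suc N)) $ k) \<longlonglongrightarrow> - (\<Sum>l<n. G (l, k) * V l) + (\<Sum>l<n. G (l, k) * V l)"
      using mvG[OF k, of "\<lambda>N. N"] mvG[OF k, of Suc] V LIMSEQ_Suc[OF V] by (intro tendsto_add tendsto_minus) auto
    moreover have "fst (snd (e N)) $ k = - ((?a N *\<^sub>v ?v N) $ k) + (?a N *\<^sub>v ?v (Suc N)) $ k" for N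
      unfolding e using k by (simp del: index_mult_mat_vec)
    ultimately show ?thesis
      by simp
  qed
  have om: "(\<lambda>N. omega n (?v N) (?v (Suc N))) \<longlonglongrightarrow> Im (cnj (V 0) * V 0) - (\<Sum>a\<in>{1..<n}. Im (cnj (V a) * V a))"
    unfolding omega_def using n V LIMSEQ_Suc[OF V] by (intro tendsto_intros) auto
  have "Im (cnj z * z) = 0" for z
    by simp
  then have "(\<lambda>N. omega n (?v N) (?v (Suc N))) \<longlonglongrightarrow> 0"
    using om by simp
  then have "(\<lambda>N. ?t (Suc N) - ?t N - omega n (?v N) (?v (Suc N)) / 2) \<longlonglongrightarrow> T - T - 0 / 2"
    by (intro tendsto_diff tendsto_divide LIMSEQ_Suc[OF T] T tendsto_const) auto
  then show "(\<lambda>N. snd (snd (e N))) \<longlonglongrightarrow> 0"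
    by (simp add: e)
qed

text \<open>Continuity of \<open>qact n c d\<close> over X = 0 for fixed d, which the splitting in
  \<open>Theta\<close> provides. The heights rho of the points P need not converge; as the action
  ignores rho, the conclusion is placed at height 1.\<close>

lemma origin_fixed:
  assumes n: "1 \<le> n" and d: "d \<in> carrier (UHeis n)"
    and P: "\<And>a. a \<in> {1..<n} \<Longrightarrow> (\<lambda>N. coord_X (P N) a) \<longlonglongrightarrow> 0" "\<And>k. k < n \<Longrightarrow> (\<lambda>N. coord_w (P N) k) \<longlonglongrightarrow> 0"
      "(\<lambda>N. coord_phi (P N)) \<longlonglongrightarrow> 0"
    and Q: "\<And>a. a \<in> {1..<n} \<Longrightarrow> (\<lambda>N. coord_X (qact n c d (P N)) a) \<longlonglongrightarrow> 0"
      "\<And>k. k < n \<Longrightarrow> (\<lambda>N. coord_w (qact n c d (P N)) k) \<longlonglongrightarrow> 0" "(\<lambda>N. coord_phi (qact n c d (P N))) \<longlonglongrightarrow> 0"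
  shows "qact n c d (\<lambda>a\<in>{1..<n}. 0, \<lambda>k\<in>{..<n}. 0, 0, 1) = (\<lambda>a\<in>{1..<n}. 0, \<lambda>k\<in>{..<n}. 0, 0, 1)"
proof -
  obtain g v t where dd: "d = (g, (v, t))" and g: "g \<in> carrier (U_group n)" and v: "v \<in> carrier_vec n"
    using d by (auto simp: UHeis_simps)
  note g0 = U_entry00_nonzero[OF n g]
  have Arg_one: "Arg 1 = 0"
    by (simp add: Arg_eq_0_iff)
  have s: "{..<n} = insert 0 {1..<n}"
    using n by auto
  have J: "(\<lambda>N. mat_Z n g (coord_X (P N)) i) \<longlonglongrightarrow> g $$ (i, 0)" for i
  proof -
    have "(\<lambda>N. g $$ (i, 0) + (\<Sum>j\<in>{1..<n}. g $$ (i, j) * coord_X (P N) j)) \<longlonglongrightarrow> g $$ (i, 0) + (\<Sum>j\<in>{1..<n}. g $$ (i, j) * 0)"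
      using P(1) by (intro tendsto_intros) auto
    moreover have "mat_Z n g (coord_X (P N)) i = g $$ (i, 0) + (\<Sum>j\<in>{1..<n}. g $$ (i, j) * coord_X (P N) j)" for N
      unfolding mat_Z_def s by simp
    ultimately show ?thesis
      by simp
  qed
  have ga: "g $$ (a, 0) = 0" if a: "a \<in> {1..<n}" for a
  proof -
    have "(\<lambda>N. mat_Z n g (coord_X (P N)) a / mat_Z n g (coord_X (P N)) 0) \<longlonglongrightarrow> g $$ (a, 0) / g $$ (0, 0)"
      by (intro tendsto_divide J g0)
    moreover have "coord_X (qact n c d (P N)) a = mat_Z n g (coord_X (P N)) a / mat_Z n g (coord_X (P N)) 0" for N
      using a by (simp add: qact_def act_eq dd)
    ultimately have "(\<lambda>N. coord_X (qact n c d (P N)) a) \<longlonglongrightarrow> g $$ (a, 0) / g $$ (0, 0)"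
      by simp
    from LIMSEQ_unique[OF this Q(1)[OF a]] have "g $$ (a, 0) / g $$ (0, 0) = 0" .
    then show ?thesis
      using g0 by simp
  qed
  have mvw: "(\<lambda>N. mv n (co n g) (coord_w (P N)) k) \<longlonglongrightarrow> 0" for k
  proof -
    have "(\<lambda>N. \<Sum>j<n. co n g $$ (k, j) * coord_w (P N) j) \<longlonglongrightarrow> (\<Sum>j<n. co n g $$ (k, j) * 0)"
      using P(2) by (intro tendsto_intros) auto
    then show ?thesis
      by (simp add: mv_def)
  qed
  have vk: "v $ k = 0" if k: "k < n" for k
  proof -
    have "(\<lambda>N. mv n (co n g) (coord_w (P N)) k + v $ k / 2) \<longlonglongrightarrow> 0 + v $ k / 2"
      by (intro tendsto_add mvw tendsto_const)
    moreover have "coord_w (qact n c d (P N)) k = mv n (co n g) (coord_w (P N)) k + v $ k / 2" for N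
      using k by (simp add: qact_def act_eq dd)
    ultimately have "v $ k / 2 = 0"
      using Q(2)[OF k] LIMSEQ_unique by fastforce
    then show ?thesis
      by simp
  qed
  have om0: "omega n v x = 0" for x
    unfolding omega_def using vk n by simp
  have Th: "(\<lambda>N. Theta n g (coord_X (P N))) \<longlonglongrightarrow> Arg (g $$ (0, 0)) + Arg (g $$ (0, 0) / g $$ (0, 0))"
    unfolding Theta_def using g0 by (intro tendsto_add tendsto_const tendsto_Arg tendsto_divide J) auto
  have "t = 2 * c * Arg (g $$ (0, 0))"
  proof -
    have "(\<lambda>N. coord_phi (P N) - 2 * c * Theta n g (coord_X (P N)) + t) \<longlonglongrightarrow> 0 - 2 * c * Arg (g $$ (0, 0)) + t"
      using Th g0 by (intro tendsto_intros P(3)) (simp add: Arg_one)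
    moreover have "coord_phi (qact n c d (P N)) = coord_phi (P N) - 2 * c * Theta n g (coord_X (P N)) + t" for N
      by (simp add: qact_def act_eq dd om0)
    ultimately have "0 - 2 * c * Arg (g $$ (0, 0)) + t = 0"
      using Q(3) LIMSEQ_unique by fastforce
    then show ?thesis
      by simp
  qed
  moreover have Z: "mat_Z n g (\<lambda>a\<in>{1..<n}. 0) i = g $$ (i, 0)" for i
    unfolding mat_Z_def s by simp
  moreover have "mv n (co n g) (\<lambda>k\<in>{..<n}. 0) k = 0" for k
    unfolding mv_def by (rule sum.neutral) auto
  ultimately show ?thesis
    using g0 ga vk unfolding qact_def act_eq dd Theta_def
    by (auto simp: om0 fun_eq_iff Arg_one simp del: restrict_apply) (auto simp: restrict_def)
qed

text \<open>Only X, w and phi are required to be small in \<open>near\<close>, so one radius works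
  at all heights rho simultaneously, which the boxes of \<open>lower_bound\<close> exploit as rho
  tends to 0.\<close>

lemma local_injectivity:
  assumes n: "1 \<le> n" and c: "0 \<le> c" and D: "subgroup D (SUHeis n)"
    and discrete: "discrete_subgroup (SUHeis_mod_C n c) (SUHeis_mod_C_top n c) (Gamma_hat n c D)"
    and free: "acts_freely_on_Nhat n c (Gamma_hat n c D)"
  obtains \<delta> where "0 < \<delta>" "real n * \<delta> \<le> 1 / 2"
    "\<And>p q. p \<in> Nbar n \<Longrightarrow> q \<in> Nbar n \<Longrightarrow> near n \<delta> p \<Longrightarrow> near n \<delta> q \<Longrightarrow> orb n c D p = orb n c D q \<Longrightarrow> p = q"
proof (rule ccontr)
  assume "\<not> thesis"
  note none = that[THEN notE[OF this]]
  \<comment> \<open>Tends to 0, while n times it never exceeds 1/2, as \<open>near_bound\<close>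
    requires.\<close>
  define \<delta> where "\<delta> N = 1 / (2 * real n * real (Suc N))" for N
  have \<delta>: "0 < \<delta> N" "real n * \<delta> N \<le> 1 / 2" "\<delta> N \<le> inverse (real (Suc N))" for N
  proof -
    have n0: "0 < real n"
      using n by simp
    then show "0 < \<delta> N"
      by (simp add: \<delta>_def)
    have "real n * \<delta> N = 1 / (2 * real (Suc N))"
      using n0 by (simp add: \<delta>_def)
    also have "\<dots> \<le> 1 / 2"
      by (simp add: divide_simps)
    finally show "real n * \<delta> N \<le> 1 / 2" .
    have "1 * real (Suc N) \<le> (2 * real n) * real (Suc N)"
      using n by (intro mult_right_mono) auto
    then show "\<delta> N \<le> inverse (real (Suc N))"
      unfolding \<delta>_def inverse_eq_divide by (intro divide_left_mono) auto
  qed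
  have DG: "D \<subseteq> carrier (SUHeis n)"
    using D by (rule subgroup.subset)
  have "\<exists>p d. p \<in> Nbar n \<and> near n (\<delta> N) p \<and> near n (\<delta> N) (qact n c d p) \<and> p \<noteq> qact n c d p \<and> d \<in> with_periods c D" for N
  proof (rule ccontr)
    assume A: "\<nexists>p d. p \<in> Nbar n \<and> near n (\<delta> N) p \<and> near n (\<delta> N) (qact n c d p) \<and> p \<noteq> qact n c d p \<and> d \<in> with_periods c D"
    show False
    proof (rule none[OF \<delta>(1,2)])
      fix p q assume pq: "p \<in> Nbar n" "q \<in> Nbar n" "near n (\<delta> N) p" "near n (\<delta> N) q" "orb n c D p = orb n c D q"
      have "q \<in> orb n c D p"
        using orb_refl[OF n D pq(2)] pq(5) by simp
      then obtain k d where q: "q = shift (period c k) (qact n c d p)" and d: "d \<in> D"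
        unfolding orb_def by blast
      obtain g v t where dd: "d = (g, (v, t))"
        by (cases d) auto
      have "q = qact n c (g, (v, t + period c k)) p"
        unfolding q dd qact_central ..
      moreover have "(g, (v, t + period c k)) \<in> with_periods c D"
        using d unfolding dd with_periods_def by blast
      ultimately show "p = q"
        using A pq by blast
    qed
  qed
  then obtain P d where P: "\<And>N. P N \<in> Nbar n" "\<And>N. near n (\<delta> N) (P N)" "\<And>N. near n (\<delta> N) (qact n c (d N) (P N))"
    "\<And>N. P N \<noteq> qact n c (d N) (P N)" and d: "\<And>N. d N \<in> with_periods c D"
    by metis
  have dS: "d N \<in> carrier (SUHeis n)" for N
    using d[of N] DG unfolding with_periods_def by (force simp: SUHeis_simps)
  note dU = SUHeis_UHeis[OF dS]
  note bound = near_bound[OF n c \<delta>(1,2) dU P(1-3)]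
  obtain r G V T where r: "strict_mono (r :: nat \<Rightarrow> nat)" and lim:
    "\<And>i j. i < n \<Longrightarrow> j < n \<Longrightarrow> (\<lambda>N. fst (d (r N)) $$ (i, j)) \<longlonglongrightarrow> G (i, j)"
    "\<And>k. k < n \<Longrightarrow> (\<lambda>N. fst (snd (d (r N))) $ k) \<longlonglongrightarrow> V k" "(\<lambda>N. snd (snd (d (r N)))) \<longlonglongrightarrow> T"
    using bounded_subsequence[of n d, OF bound] by blast
  define e where "e N = iinv n (d (r N)) \<otimes>\<^bsub>SUHeis n\<^esub> d (r (Suc N))" for N
  have "\<forall>\<^sub>F N in sequentially. e N = (1\<^sub>m n, (0\<^sub>v n, 0))"
    using iinv_mult_tendsto[of n "\<lambda>N. d (r N)" G V T, OF n dS lim] with_periods_iinv_mult[OF n D d d]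
    unfolding e_def by (intro discrete_eventually_one[OF n c DG discrete]) auto
  then obtain M where M: "\<And>N. M \<le> N \<Longrightarrow> e N = \<one>\<^bsub>SUHeis n\<^esub>"
    unfolding eventually_sequentially by (auto simp: SUHeis_simps)
  interpret S: group "SUHeis n"
    by (rule group_SUHeis[OF n])
  \<comment> \<open>e N = 1 says that the inverse of d (r N) times d (r (Suc N)) is 1, that is, that
    the two agree.\<close>
  have step: "d (r (Suc N)) = d (r N)" if "M \<le> N" for N
    using M[OF that] iinv_SUHeis(2)[OF n dS, of "r N"] dS unfolding e_def
    by (metis S.inv_closed S.inv_equality S.inv_inv)
  have const: "d (r (N + M)) = d (r M)" for N
    by (induction N) (use step in auto)
  define a where "a = d (r M)"
  define P' where "P' N = P (r (N + M))" for N
  have Q': "qact n c (d (r (N + M))) (P (r (N + M))) = qact n c a (P' N)" for N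
    by (simp add: const a_def P'_def)
  have rN: "\<delta> (r (N + M)) \<le> inverse (real (Suc N))" for N
  proof -
    have "N \<le> r (N + M)"
      using seq_suble[OF r, of "N + M"] by simp
    then have "inverse (real (Suc (r (N + M)))) \<le> inverse (real (Suc N))"
      by (intro le_imp_inverse_le) auto
    then show ?thesis
      using \<delta>(3) order_trans by blast
  qed
  have lim0: "(x \<longlonglongrightarrow> 0)" if "\<And>N. norm (x N) < \<delta> (r (N + M))" for x :: "nat \<Rightarrow> 'z :: real_normed_vector"
    using that rN by (intro Lim_null_comparison[OF _ LIMSEQ_inverse_real_of_nat] always_eventually) (meson less_imp_le order_trans)
  have nP: "near n (\<delta> (r (N + M))) (P' N)" "near n (\<delta> (r (N + M))) (qact n c a (P' N))" for N
    using P(2) P(3)[of "r (N + M)"] by (auto simp: P'_def Q'[unfolded P'_def])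
  let ?o = "(\<lambda>a\<in>{1..<n}. 0, \<lambda>k\<in>{..<n}. 0, 0, 1) :: coords"
  have "qact n c a ?o = ?o"
    using nP unfolding near_def
    by (intro origin_fixed[where P = P', OF n dU[of "r M", folded a_def]]; intro lim0) auto
  moreover obtain g v t k where a: "a = (g, (v, t + period c k))" "(g, (v, t)) \<in> D"
    using d[of "r M", folded a_def] by (auto simp: with_periods_def)
  ultimately have fix0: "shift (period c k) (qact n c (g, (v, t)) ?o) = ?o"
    by (simp only: qact_central)
  have oN: "?o \<in> Nbar n"
    by (simp add: Nbar_iff CH_ball_def)
  have "qact n c (g, (v, t)) ?o = shift (period c (- k)) (shift (period c k) (qact n c (g, (v, t)) ?o))"
    by (simp only: shift_simps(6) period_simps(1)) (simp add: period_simps(4))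
  then have stab: "qact n c (g, (v, t)) ?o = shift (period c (- k)) ?o"
    unfolding fix0 .
  obtain j where j: "(g, (v, t)) = (1\<^sub>m n, (0\<^sub>v n, period c j))"
    by (rule free_action[OF n DG free a(2) oN stab])
  \<comment> \<open>The eventual value a is a pure phi-translation, and fixing the origin makes it
    trivial. It then fixes every point of the sequence, although the sequence was chosen with
    distinct images.\<close>
  have aj: "a = (1\<^sub>m n, (0\<^sub>v n, period c j + period c k))"
    using a j by simp
  have "shift (period c j + period c k) ?o = shift 0 ?o"
    using \<open>qact n c a ?o = ?o\<close> unfolding aj qact_one[OF n oN] by simp
  then have "period c j + period c k = 0"
    by (rule shift_inject[THEN iffD1])
  then have "qact n c a (P' 0) = P' 0"
    unfolding aj using qact_one[OF n, of "P' 0" c 0] P(1) by (simp add: P'_def)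
  then show False
    using P(4)[of "r (0 + M)"] by (simp add: P'_def a_def)
qed

section \<open>The volume\<close>

lemma Nbar_sets: "Nbar n \<in> sets (coord_lebesgue n)"
proof -
  have m: "(\<lambda>p. \<Sum>a\<in>{1..<n}. (cmod (coord_X p a))\<^sup>2) \<in> borel_measurable (coord_lebesgue n)"
    by (rule measurable_compose[OF measurable_coords(1) measurable_norms(1)])
  have "{p \<in> space (coord_lebesgue n). (\<Sum>a\<in>{1..<n}. (cmod (coord_X p a))\<^sup>2) < 1 \<and> 0 < coord_rho p} \<in> sets (coord_lebesgue n)"
    using m measurable_coords(4)[of n] by measurable
  also have "{p \<in> space (coord_lebesgue n). (\<Sum>a\<in>{1..<n}. (cmod (coord_X p a))\<^sup>2) < 1 \<and> 0 < coord_rho p} = Nbar n"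
    unfolding space_coord_lebesgue Nbar_def by auto
  finally show ?thesis .
qed

lemma sets_volume: "U \<in> sets (riemannian_volume n c) \<longleftrightarrow> U \<in> sets (coord_lebesgue n) \<and> U \<subseteq> Nbar n"
proof -
  have "Nbar n \<inter> space (coord_lebesgue n) \<in> sets (coord_lebesgue n)"
    by (simp add: Nbar_sets)
  then show ?thesis
    unfolding riemannian_volume_def by (auto simp: sets_restrict_space_iff)
qed

text \<open>Moves rho to the outermost integral, where the slice measures \<open>nu\<close> are
  estimated one height at a time.\<close>

lemma coord_lebesgue_iterated:
  assumes F: "F \<in> borel_measurable (coord_lebesgue n)"
  shows "(\<integral>\<^sup>+ p. F p \<partial>coord_lebesgue n) =
    (\<integral>\<^sup>+ \<rho>. (\<integral>\<^sup>+ X. (\<integral>\<^sup>+ y. F (X, fst y, snd y, \<rho>) \<partial>Lw n) \<partial>LC {1..<n}) \<partial>lborel)"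
proof -
  let ?X = "LC {1..<n}" and ?w = "LC {..<n}"
  let ?R = "lborel \<Otimes>\<^sub>M lborel :: (real \<times> real) measure"
  have sR: "sigma_finite_measure ?R"
    by (intro sigma_finite_pair_measure sigma_finite_lborel)
  have sT: "sigma_finite_measure (?w \<Otimes>\<^sub>M ?R)"
    by (intro sigma_finite_pair_measure sigma_finite_LC sR) simp
  have F': "F \<in> borel_measurable (?X \<Otimes>\<^sub>M (?w \<Otimes>\<^sub>M ?R))"
    using F by (simp add: coord_lebesgue_def)
  have in1: "(\<integral>\<^sup>+ z. F (X, z) \<partial>(?w \<Otimes>\<^sub>M ?R)) = (\<integral>\<^sup>+ y. (\<integral>\<^sup>+ \<rho>. F (X, fst y, snd y, \<rho>) \<partial>lborel) \<partial>Lw n)"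
    if X: "X \<in> space ?X" for X
  proof -
    have m1: "(\<lambda>z. F (X, z)) \<in> borel_measurable (?w \<Otimes>\<^sub>M ?R)"
      by (rule measurable_compose[OF measurable_Pair1'[OF X] F'])
    have m2: "(\<lambda>q. F (X, fst (fst q), snd (fst q), snd q)) \<in> borel_measurable (Lw n \<Otimes>\<^sub>M lborel)"
    proof -
      have "(\<lambda>q. (fst (fst q), snd (fst q), snd q)) \<in> measurable (Lw n \<Otimes>\<^sub>M lborel) (?w \<Otimes>\<^sub>M ?R)"
        by measurable
      from measurable_compose[OF this m1] show ?thesis .
    qed
    have m3: "(\<lambda>y. \<integral>\<^sup>+ \<rho>. F (X, fst y, snd y, \<rho>) \<partial>lborel) \<in> borel_measurable (Lw n)"
      by (rule sigma_finite_measure.borel_measurable_nn_integral[OF sigma_finite_lborel])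
        (use m2 in \<open>simp add: case_prod_beta'\<close>)
    have "(\<integral>\<^sup>+ z. F (X, z) \<partial>(?w \<Otimes>\<^sub>M ?R)) = (\<integral>\<^sup>+ w. (\<integral>\<^sup>+ t. F (X, w, t) \<partial>?R) \<partial>?w)"
      by (rule sigma_finite_measure.nn_integral_fst[OF sR m1, symmetric])
    also have "\<dots> = (\<integral>\<^sup>+ w. (\<integral>\<^sup>+ \<phi>. (\<integral>\<^sup>+ \<rho>. F (X, w, \<phi>, \<rho>) \<partial>lborel) \<partial>lborel) \<partial>?w)"
    proof (rule nn_integral_cong)
      fix w assume w: "w \<in> space ?w"
      have "(\<lambda>t. F (X, w, t)) \<in> borel_measurable ?R"
        by (rule measurable_compose[OF measurable_Pair1'[OF w] m1])
      then show "(\<integral>\<^sup>+ t. F (X, w, t) \<partial>?R) = (\<integral>\<^sup>+ \<phi>. (\<integral>\<^sup>+ \<rho>. F (X, w, \<phi>, \<rho>) \<partial>lborel) \<partial>lborel)"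
        by (rule sigma_finite_measure.nn_integral_fst[OF sigma_finite_lborel, symmetric])
    qed
    also have "\<dots> = (\<integral>\<^sup>+ y. (\<integral>\<^sup>+ \<rho>. F (X, fst y, snd y, \<rho>) \<partial>lborel) \<partial>Lw n)"
      by (subst sigma_finite_measure.nn_integral_fst[OF sigma_finite_lborel m3, symmetric]) simp
    finally show ?thesis .
  qed
  have in2: "(\<integral>\<^sup>+ y. (\<integral>\<^sup>+ \<rho>. F (X, fst y, snd y, \<rho>) \<partial>lborel) \<partial>Lw n) = (\<integral>\<^sup>+ \<rho>. (\<integral>\<^sup>+ y. F (X, fst y, snd y, \<rho>) \<partial>Lw n) \<partial>lborel)"
    if X: "X \<in> space ?X" for X
  proof -
    interpret pair_sigma_finite "lborel :: real measure" "Lw n"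
      by (intro pair_sigma_finite.intro sigma_finite_lborel sigma_finite_Lw)
    have "(\<lambda>q. (fst (snd q), snd (snd q), fst q)) \<in> measurable (lborel \<Otimes>\<^sub>M Lw n) (?w \<Otimes>\<^sub>M ?R)"
      by measurable
    from measurable_compose[OF this measurable_compose[OF measurable_Pair1'[OF X] F']]
    have "(\<lambda>(\<rho>, y). F (X, fst y, snd y, \<rho>)) \<in> borel_measurable (lborel \<Otimes>\<^sub>M Lw n)"
      by (simp add: case_prod_beta')
    then show ?thesis
      by (rule Fubini')
  qed
  have m4: "(\<lambda>(\<rho>, X). \<integral>\<^sup>+ y. F (X, fst y, snd y, \<rho>) \<partial>Lw n) \<in> borel_measurable (lborel \<Otimes>\<^sub>M ?X)"
    unfolding case_prod_beta'
  proof (rule sigma_finite_measure.borel_measurable_nn_integral[OF sigma_finite_Lw])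
    have "(\<lambda>q. (snd (fst q), fst (snd q), snd (snd q), fst (fst q))) \<in> measurable ((lborel \<Otimes>\<^sub>M ?X) \<Otimes>\<^sub>M Lw n) (?X \<Otimes>\<^sub>M (?w \<Otimes>\<^sub>M ?R))"
      by measurable
    from measurable_compose[OF this F']
    show "(\<lambda>(q, y). F (snd q, fst y, snd y, fst q)) \<in> borel_measurable ((lborel \<Otimes>\<^sub>M ?X) \<Otimes>\<^sub>M Lw n)"
      by (simp add: case_prod_beta')
  qed
  interpret P: pair_sigma_finite "lborel :: real measure" ?X
    by (intro pair_sigma_finite.intro sigma_finite_lborel sigma_finite_LC) simp
  have "(\<integral>\<^sup>+ p. F p \<partial>coord_lebesgue n) = (\<integral>\<^sup>+ X. (\<integral>\<^sup>+ z. F (X, z) \<partial>(?w \<Otimes>\<^sub>M ?R)) \<partial>?X)"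
    unfolding coord_lebesgue_def by (rule sigma_finite_measure.nn_integral_fst[OF sT F', symmetric])
  also have "\<dots> = (\<integral>\<^sup>+ X. (\<integral>\<^sup>+ \<rho>. (\<integral>\<^sup>+ y. F (X, fst y, snd y, \<rho>) \<partial>Lw n) \<partial>lborel) \<partial>?X)"
    by (intro nn_integral_cong) (simp add: in1 in2)
  also have "\<dots> = (\<integral>\<^sup>+ \<rho>. (\<integral>\<^sup>+ X. (\<integral>\<^sup>+ y. F (X, fst y, snd y, \<rho>) \<partial>Lw n) \<partial>?X) \<partial>lborel)"
    by (rule P.Fubini'[OF m4])
  finally show ?thesis .
qed

lemma measurable_rho_density: "rho_density n c \<in> borel_measurable borel"
  unfolding rho_density_def by measurable

lemma rho_density_nonneg: "0 \<le> c \<Longrightarrow> 0 < \<rho> \<Longrightarrow> 0 \<le> rho_density n c \<rho>"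
  by (simp add: rho_density_def)

lemma emeasure_volume:
  assumes n: "1 \<le> n" and c: "0 \<le> c" and U: "U \<in> sets (coord_lebesgue n)" "U \<subseteq> Nbar n"
  shows "emeasure (riemannian_volume n c) U = (\<integral>\<^sup>+ \<rho>. ennreal (rho_density n c \<rho>) * nu n \<rho> U \<partial>lborel)"
proof -
  let ?L = "coord_lebesgue n"
  let ?M = "restrict_space ?L (Nbar n)"
  let ?h = "\<lambda>p. ennreal (rho_density n c (coord_rho p) / one_minus_normX2 n (coord_X p) ^ n)"
  have NL: "Nbar n \<inter> space ?L \<in> sets ?L"
    by (simp add: Nbar_sets)
  have hm: "?h \<in> borel_measurable ?L"
    by (intro measurable_compose[OF _ measurable_ennreal] borel_measurable_divide borel_measurable_power
        measurable_compose[OF measurable_coords(4) measurable_rho_density] measurable_compose[OF measurable_coords(1) measurable_one_minus])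
  have hM: "?h \<in> borel_measurable ?M"
    by (rule measurable_restrict_space1[OF hm])
  have eq: "ennreal (sqrt (det (gram_matrix n c p))) = ?h p" if "p \<in> space ?M" for p
    using that det_gram_matrix[OF n c] by (cases p) (simp add: space_restrict_space)
  have "riemannian_volume n c = density ?M ?h"
    unfolding riemannian_volume_def
    by (rule density_cong) (use hM eq in \<open>simp_all cong: measurable_cong\<close>)
  then have "emeasure (riemannian_volume n c) U = (\<integral>\<^sup>+ p. ?h p * indicator U p \<partial>?M)"
    using U NL hM by (simp add: emeasure_density sets_restrict_space_iff)
  also have "\<dots> = (\<integral>\<^sup>+ p. ?h p * indicator U p * indicator (Nbar n) p \<partial>?L)"
    by (rule nn_integral_restrict_space[OF NL])
  also have "\<dots> = (\<integral>\<^sup>+ p. ?h p * indicator U p \<partial>?L)"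
    using U(2) by (intro nn_integral_cong) (auto simp: indicator_def)
  also have "\<dots> = (\<integral>\<^sup>+ \<rho>. (\<integral>\<^sup>+ X. (\<integral>\<^sup>+ y. ?h (X, fst y, snd y, \<rho>) * indicator U (X, fst y, snd y, \<rho>) \<partial>Lw n) \<partial>LC {1..<n}) \<partial>lborel)"
    by (intro coord_lebesgue_iterated borel_measurable_times_ennreal hm borel_measurable_indicator U(1))
  also have "\<dots> = (\<integral>\<^sup>+ \<rho>. ennreal (rho_density n c \<rho>) * nu n \<rho> U \<partial>lborel)"
  proof (rule nn_integral_cong)
    fix \<rho> :: real
    let ?k = "\<lambda>X. indicator (CH_ball n) X * ennreal (1 / one_minus_normX2 n X ^ n)"
    have "?h (X, fst y, snd y, \<rho>) * indicator U (X, fst y, snd y, \<rho>) =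
        ennreal (rho_density n c \<rho>) * (?k X * indicator U (X, fst y, snd y, \<rho>))" for X y
    proof (cases "(X, fst y, snd y, \<rho>) \<in> U")
      case True
      then have N: "X \<in> CH_ball n" "0 < \<rho>"
        using U(2) by (auto simp: Nbar_iff)
      then have "0 \<le> 1 / one_minus_normX2 n X ^ n"
        by (simp add: CH_ball_def one_minus_normX2_def)
      then show ?thesis
        using True N ennreal_mult[OF rho_density_nonneg[OF c N(2), of n], of "1 / one_minus_normX2 n X ^ n"] by simp
    qed simp
    note e = this
    have "(\<integral>\<^sup>+ X. (\<integral>\<^sup>+ y. ?h (X, fst y, snd y, \<rho>) * indicator U (X, fst y, snd y, \<rho>) \<partial>Lw n) \<partial>LC {1..<n}) =
        (\<integral>\<^sup>+ X. ennreal (rho_density n c \<rho>) * (?k X * (\<integral>\<^sup>+ y. indicator U (X, fst y, snd y, \<rho>) \<partial>Lw n)) \<partial>LC {1..<n})"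
    proof (rule nn_integral_cong)
      fix X assume X: "X \<in> space (LC {1..<n})"
      have m: "(\<lambda>y. indicator U (X, fst y, snd y, \<rho>) :: ennreal) \<in> borel_measurable (Lw n)"
        using measurable_compose[OF measurable_Pair1'[OF X] measurable_slice(1)[OF U(1), of \<rho>]] by simp
      then have "(\<lambda>y. ?k X * indicator U (X, fst y, snd y, \<rho>)) \<in> borel_measurable (Lw n)"
        by (intro borel_measurable_times_ennreal) auto
      then show "(\<integral>\<^sup>+ y. ?h (X, fst y, snd y, \<rho>) * indicator U (X, fst y, snd y, \<rho>) \<partial>Lw n) =
          ennreal (rho_density n c \<rho>) * (?k X * (\<integral>\<^sup>+ y. indicator U (X, fst y, snd y, \<rho>) \<partial>Lw n))"
        unfolding e using m by (simp only: nn_integral_cmult)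
    qed
    also have "\<dots> = ennreal (rho_density n c \<rho>) * nu n \<rho> U"
      unfolding nu_def
      by (intro nn_integral_cmult borel_measurable_times_ennreal measurable_ball_weight measurable_slice(2)[OF U(1)])
    finally show "(\<integral>\<^sup>+ X. (\<integral>\<^sup>+ y. ?h (X, fst y, snd y, \<rho>) * indicator U (X, fst y, snd y, \<rho>) \<partial>Lw n) \<partial>LC {1..<n}) =
        ennreal (rho_density n c \<rho>) * nu n \<rho> U" .
  qed
  finally show ?thesis .
qed

text \<open>For r >= rho_0 both r + c and r + 2 c are at most A r, so the density is of order
  r^(-n-2). It is estimated by the coarser K / r^2, whose antiderivative is elementary.\<close>

lemma nn_integral_rho_density:
  assumes n: "1 \<le> n" and c: "0 \<le> c" and \<rho>: "0 < \<rho>\<^sub>0"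
  shows "(\<integral>\<^sup>+ \<rho>. ennreal (rho_density n c \<rho>) * indicator {\<rho>\<^sub>0..} \<rho> \<partial>lborel) < \<infinity>"
proof -
  define A where "A = 1 + 2 * c / \<rho>\<^sub>0"
  have A: "1 \<le> A"
    using c \<rho> by (simp add: A_def)
  define K where "K = A ^ n * A / \<rho>\<^sub>0 ^ n"
  have K: "0 \<le> K"
    using A \<rho> by (simp add: K_def)
  have le: "rho_density n c r \<le> K / r\<^sup>2" if r: "\<rho>\<^sub>0 \<le> r" for r
  proof -
    have r0: "0 < r"
      using r \<rho> by simp
    have "c * \<rho>\<^sub>0 \<le> c * r"
      using c r by (rule mult_left_mono[rotated])
    then have 2: "r + 2 * c \<le> A * r"
      using \<rho> by (simp add: A_def field_simps)
    then have 1: "r + c \<le> A * r"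
      using c by linarith
    have "(r + c) ^ (n - 1) * (r + 2 * c) \<le> (A * r) ^ (n - 1) * (A * r)"
      using 1 2 c r0 A by (intro mult_mono power_mono) auto
    also have "\<dots> \<le> A ^ n * A * (r ^ (n - 1) * r)"
    proof -
      have "A ^ (n - 1) \<le> A ^ n"
        using A by (intro power_increasing) auto
      then have "A ^ (n - 1) * (A * (r ^ (n - 1) * r)) \<le> A ^ n * (A * (r ^ (n - 1) * r))"
        using A r0 by (intro mult_right_mono) auto
      then show ?thesis
        by (simp add: power_mult_distrib mult_ac)
    qed
    finally have num: "(r + c) ^ (n - 1) * (r + 2 * c) \<le> A ^ n * A * (r ^ (n - 1) * r)" .
    have rn: "r ^ (n - 1) * r * \<rho>\<^sub>0 ^ n * r\<^sup>2 \<le> 4 * r ^ (2 * n + 2)"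
    proof -
      have rr: "r ^ (n - 1) * r = r ^ n"
        by (rule power_minus_mult) (use n in simp)
      have "r ^ (n - 1) * r * \<rho>\<^sub>0 ^ n * r\<^sup>2 \<le> r ^ (n - 1) * r * r ^ n * r\<^sup>2"
        using r r0 \<rho> by (intro mult_right_mono mult_left_mono power_mono) auto
      also have "\<dots> = r ^ (2 * n + 2)"
        unfolding rr by (simp add: power_add mult_2 power2_eq_square)
      also have "\<dots> \<le> 4 * r ^ (2 * n + 2)"
        using r0 by simp
      finally show ?thesis .
    qed
    have "rho_density n c r \<le> A ^ n * A * (r ^ (n - 1) * r) / (4 * r ^ (2 * n + 2))"
      unfolding rho_density_def using num r0 by (intro divide_right_mono) auto
    also have "\<dots> \<le> K / r\<^sup>2"
    proof -
      define x R where "x = r ^ (n - 1) * r" and "R = 4 * r ^ (2 * n + 2)"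
      have R: "0 < R"
        using r0 by (simp add: R_def)
      have "A ^ n * A * x = A ^ n * A * (x * \<rho>\<^sub>0 ^ n * r\<^sup>2) / (\<rho>\<^sub>0 ^ n * r\<^sup>2)"
        using r0 \<rho> by simp
      also have "\<dots> \<le> A ^ n * A * R / (\<rho>\<^sub>0 ^ n * r\<^sup>2)"
        using rn A \<rho> unfolding x_def R_def by (intro divide_right_mono mult_left_mono) auto
      also have "\<dots> = K / r\<^sup>2 * R"
        by (simp add: K_def)
      finally have "A ^ n * A * x / R \<le> K / r\<^sup>2"
        using R by (simp only: pos_divide_le_eq)
      then show ?thesis
        by (simp only: x_def R_def)
    qed
    finally show ?thesis .
  qed
  have "(\<integral>\<^sup>+ \<rho>. ennreal (rho_density n c \<rho>) * indicator {\<rho>\<^sub>0..} \<rho> \<partial>lborel) \<le> (\<integral>\<^sup>+ r. ennreal (K / r\<^sup>2) * indicator {\<rho>\<^sub>0..} r \<partial>lborel)"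
    by (intro nn_integral_mono) (auto simp: indicator_def intro!: ennreal_leI le)
  also have "\<dots> = ennreal (0 - (- (K / \<rho>\<^sub>0)))"
  proof (rule nn_integral_FTC_atLeast)
    show "DERIV (\<lambda>r. - (K / r)) x :> K / x\<^sup>2" if "\<rho>\<^sub>0 \<le> x" for x
      using that \<rho> by (auto intro!: derivative_eq_intros simp: power2_eq_square)
    show "0 \<le> K / x\<^sup>2" for x
      using K by simp
    show "((\<lambda>r. - (K / r)) \<longlongrightarrow> 0) at_top"
      using tendsto_minus[OF tendsto_divide_0[OF tendsto_const filterlim_at_top_imp_at_infinity[OF filterlim_ident]], of K] by simp
  qed measurable
  finally show ?thesis
    by (rule order.strict_trans1) simp
qed

lemma orbit_rho:
  assumes "p \<in> orb n c D q"
  shows "coord_rho p = coord_rho q"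
  using assms by (auto simp: orb_def qact_def coord_act)

lemma upper_bound:
  assumes n: "1 \<le> n" and c: "0 \<le> c" and lattice: "lattice_subgroup (SUHeis n) (SUHeis_top n) D"
    and free: "acts_freely_on_Nhat n c (Gamma_hat n c D)" and \<rho>: "0 < \<rho>\<^sub>0"
  shows "vol_rho n c (Gamma_group n c D) {\<rho>\<^sub>0..} < \<infinity>"
proof -
  have D: "subgroup D (SUHeis n)"
    using lattice by (simp add: lattice_subgroup_def discrete_subgroup_def)
  let ?\<Gamma> = "Gamma_group n c D"
  note orb = Gamma_orbit[OF n subgroup.subset[OF D]]
  obtain V where V: "V < \<infinity>" "\<And>\<rho> U. 0 < \<rho> \<Longrightarrow> U \<in> sets (coord_lebesgue n) \<Longrightarrow> U \<subseteq> Nbar n \<Longrightarrow>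
      inj_on (orb n c D) U \<Longrightarrow> nu n \<rho> U \<le> V"
    using slice_bound[OF n c lattice free] by blast
  let ?I = "\<integral>\<^sup>+ \<rho>. ennreal (rho_density n c \<rho>) * indicator {\<rho>\<^sub>0..} \<rho> \<partial>lborel"
  have "vol_rho n c ?\<Gamma> {\<rho>\<^sub>0..} \<le> V * ?I"
    unfolding vol_rho_def quotient_volume_def
  proof (rule SUP_least)
    fix U assume "U \<in> {U \<in> sets (riemannian_volume n c). inj_on (orbit_of ?\<Gamma>) U \<and>
      orbit_of ?\<Gamma> ` U \<subseteq> orbit_of ?\<Gamma> ` {p \<in> Nbar n. coord_rho p \<in> {\<rho>\<^sub>0..}}}"
    then have U: "U \<in> sets (coord_lebesgue n)" "U \<subseteq> Nbar n" and inj: "inj_on (orbit_of ?\<Gamma>) U"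
      and sub: "orbit_of ?\<Gamma> ` U \<subseteq> orbit_of ?\<Gamma> ` {p \<in> Nbar n. coord_rho p \<in> {\<rho>\<^sub>0..}}"
      by (auto simp: sets_volume)
    have inj': "inj_on (orb n c D) U"
      using inj U(2) orb inj_on_cong[of U "orbit_of ?\<Gamma>" "orb n c D"] by blast
    \<comment> \<open>Membership in the region is known for the orbits only; as orbits preserve rho,
      it passes to the points of U themselves.\<close>
    have rho: "\<rho>\<^sub>0 \<le> coord_rho p" if p: "p \<in> U" for p
    proof -
      obtain q where q: "q \<in> Nbar n" "\<rho>\<^sub>0 \<le> coord_rho q" "orbit_of ?\<Gamma> p = orbit_of ?\<Gamma> q"
        using sub p by auto
      have pN: "p \<in> Nbar n"
        using p U(2) by blast
      have "p \<in> orb n c D p"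
        by (rule orb_refl[OF n D pN])
      then have "p \<in> orb n c D q"
        using q(3) unfolding orb[OF pN] orb[OF q(1)] by simp
      then show ?thesis
        using orbit_rho q(2) by metis
    qed
    have nu0: "nu n r U = 0" if "r < \<rho>\<^sub>0" for r
    proof -
      have "(X, fst y, snd y, r) \<notin> U" for X y
        using rho[of "(X, fst y, snd y, r)"] that by auto
      then show ?thesis
        by (simp add: nu_def)
    qed
    have "emeasure (riemannian_volume n c) U = (\<integral>\<^sup>+ \<rho>. ennreal (rho_density n c \<rho>) * nu n \<rho> U \<partial>lborel)"
      by (rule emeasure_volume[OF n c U])
    also have "\<dots> \<le> (\<integral>\<^sup>+ \<rho>. V * (ennreal (rho_density n c \<rho>) * indicator {\<rho>\<^sub>0..} \<rho>) \<partial>lborel)"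
    proof (rule nn_integral_mono)
      fix r :: real
      show "ennreal (rho_density n c r) * nu n r U \<le> V * (ennreal (rho_density n c r) * indicator {\<rho>\<^sub>0..} r)"
      proof (cases "r < \<rho>\<^sub>0")
        case True
        then show ?thesis
          by (simp add: nu0)
      next
        case False
        then show ?thesis
          using V(2)[OF _ U inj', of r] \<rho> by (simp add: mult.commute mult_right_mono)
      qed
    qed
    also have "\<dots> = V * ?I"
    proof (rule nn_integral_cmult)
      have "(\<lambda>\<rho>. ennreal (rho_density n c \<rho>)) \<in> borel_measurable lborel"
        using measurable_compose[OF measurable_rho_density measurable_ennreal] by simp
      then show "(\<lambda>\<rho>. ennreal (rho_density n c \<rho>) * indicator {\<rho>\<^sub>0..} \<rho>) \<in> borel_measurable lborel"
        by (intro borel_measurable_times_ennreal borel_measurable_indicator) auto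
    qed
    finally show "emeasure (riemannian_volume n c) U \<le> V * ?I" .
  qed
  also have "\<dots> < \<infinity>"
    using V(1) nn_integral_rho_density[OF n c \<rho>] by (simp add: ennreal_mult_less_top)
  finally show ?thesis .
qed

text \<open>Over the interval [rho, 2 rho] of length rho the box has slices of measure at least m,
  and the density is at least 1 / (16 rho^2), which together give m / (16 rho).\<close>

lemma lower_bound:
  assumes n: "1 \<le> n" and c: "0 \<le> c" and D: "subgroup D (SUHeis n)"
    and discrete: "discrete_subgroup (SUHeis_mod_C n c) (SUHeis_mod_C_top n c) (Gamma_hat n c D)"
    and free: "acts_freely_on_Nhat n c (Gamma_hat n c D)"
  obtains e where "0 < e" "\<And>\<rho> \<rho>\<^sub>0. 0 < \<rho> \<Longrightarrow> 2 * \<rho> \<le> \<rho>\<^sub>0 \<Longrightarrow> 2 * \<rho> \<le> 1 \<Longrightarrow>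
    ennreal (e / \<rho>) \<le> vol_rho n c (Gamma_group n c D) {\<rho>..\<rho>\<^sub>0}"
proof -
  let ?\<Gamma> = "Gamma_group n c D"
  note orb = Gamma_orbit[OF n subgroup.subset[OF D]]
  obtain \<delta> where \<delta>: "0 < \<delta>" "real n * \<delta> \<le> 1 / 2" and inj:
    "\<And>p q. p \<in> Nbar n \<Longrightarrow> q \<in> Nbar n \<Longrightarrow> near n \<delta> p \<Longrightarrow> near n \<delta> q \<Longrightarrow> orb n c D p = orb n c D q \<Longrightarrow> p = q"
    using local_injectivity[OF n c D discrete free] by blast
  let ?B = "ball (0 :: complex) \<delta>"
  let ?X = "PiE {1..<n} (\<lambda>_. ?B)" and ?w = "PiE {..<n} (\<lambda>_. ?B)"
  have \<delta>1: "\<delta> < 1"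
  proof -
    have "1 * \<delta> \<le> real n * \<delta>"
      using \<delta>(1) n by (intro mult_right_mono) auto
    then show ?thesis
      using \<delta>(2) by linarith
  qed
  have XB: "X \<in> CH_ball n" if X: "X \<in> ?X" for X
  proof -
    have "(\<Sum>a\<in>{1..<n}. (cmod (X a))\<^sup>2) \<le> (\<Sum>a\<in>{1..<n}. \<delta>)"
    proof (intro sum_mono)
      fix a assume "a \<in> {1..<n}"
      then have "cmod (X a) < \<delta>"
        using PiE_mem[OF X] by auto
      then have "(cmod (X a))\<^sup>2 \<le> \<delta> * 1"
        unfolding power2_eq_square using \<delta>(1) \<delta>1 by (intro mult_mono) auto
      then show "(cmod (X a))\<^sup>2 \<le> \<delta>"
        by simp
    qed
    also have "\<dots> \<le> real n * \<delta>"
      using \<delta>(1) by (simp add: mult_right_mono)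
    also have "\<dots> < 1"
      using \<delta>(2) by simp
    finally show ?thesis
      by (simp add: CH_ball_def)
  qed
  have sets: "?X \<in> sets (LC {1..<n})" "?w \<in> sets (LC {..<n})"
    by (intro sets_PiM_I_finite; simp)+
  have ws: "?w \<times> {- \<delta><..<\<delta>} \<in> sets (Lw n)"
    using sets by (intro pair_measureI) auto
  let ?m = "emeasure (LC {1..<n}) ?X * emeasure (Lw n) (?w \<times> {- \<delta><..<\<delta>})"
  have ball_pos: "emeasure lborel ?B \<noteq> 0"
    using emeasure_ball[of \<delta> "0 :: complex"] \<delta>(1) by (simp add: unit_ball_vol_2)
  have "emeasure (Lw n) (?w \<times> {- \<delta><..<\<delta>}) = emeasure (LC {..<n}) ?w * emeasure lborel {- \<delta><..<\<delta>}"
    using sets by (intro sigma_finite_measure.emeasure_pair_measure_Times[OF sigma_finite_lborel]) auto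
  moreover have "emeasure (LC I) (PiE I (\<lambda>_. ?B)) \<noteq> 0" if "finite I" for I
    using that ball_pos by (subst LC.emeasure_PiM) (auto simp: prod_constant)
  ultimately have "?m \<noteq> 0"
    using \<delta>(1) by simp
  \<comment> \<open>A positive real below the product measure, which is a value in
    \<open>ennreal\<close>.\<close>
  then obtain m where m: "0 < m" "ennreal m \<le> ?m"
  proof (cases ?m rule: ennreal_cases)
    case (real r)
    then show ?thesis
      using \<open>?m \<noteq> 0\<close> by (intro that[of r]) (auto simp: less_le)
  next
    case top
    then show ?thesis
      by (intro that[of 1]) auto
  qed
  show ?thesis
  proof (rule that[of "m / 16"])
    show "0 < m / 16"
      using m by simp
    fix \<rho> \<rho>\<^sub>0 :: real assume \<rho>: "0 < \<rho>" "2 * \<rho> \<le> \<rho>\<^sub>0" "2 * \<rho> \<le> 1"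
    define U :: "coords set" where "U = ?X \<times> ?w \<times> {- \<delta><..<\<delta>} \<times> {\<rho>..2 * \<rho>}"
    have U: "U \<in> sets (coord_lebesgue n)"
      unfolding U_def coord_lebesgue_def using sets by (intro pair_measureI) auto
    have UN: "U \<subseteq> Nbar n"
    proof
      fix p assume "p \<in> U"
      then show "p \<in> Nbar n"
        using XB \<rho> by (cases p) (auto simp: U_def Nbar_iff PiE_def)
    qed
    have near: "near n \<delta> p" if "p \<in> U" for p
      using that by (cases p) (auto simp: U_def near_def PiE_def Pi_def)
    have "U \<in> {U \<in> sets (riemannian_volume n c). inj_on (orbit_of ?\<Gamma>) U \<and>
      orbit_of ?\<Gamma> ` U \<subseteq> orbit_of ?\<Gamma> ` {p \<in> Nbar n. coord_rho p \<in> {\<rho>..\<rho>\<^sub>0}}}"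
    proof (intro CollectI conjI)
      show "U \<in> sets (riemannian_volume n c)"
        by (simp add: sets_volume U UN)
      show "inj_on (orbit_of ?\<Gamma>) U"
      proof (rule inj_onI)
        fix p q assume pq: "p \<in> U" "q \<in> U" "orbit_of ?\<Gamma> p = orbit_of ?\<Gamma> q"
        have N: "p \<in> Nbar n" "q \<in> Nbar n"
          using pq UN by auto
        show "p = q"
          by (rule inj[OF N near[OF pq(1)] near[OF pq(2)]]) (use pq(3) orb[OF N(1)] orb[OF N(2)] in simp)
      qed
      have "U \<subseteq> {p \<in> Nbar n. coord_rho p \<in> {\<rho>..\<rho>\<^sub>0}}"
      proof
        fix p assume "p \<in> U"
        then show "p \<in> {p \<in> Nbar n. coord_rho p \<in> {\<rho>..\<rho>\<^sub>0}}"
          using UN \<rho> by (cases p) (auto simp: U_def)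
      qed
      then show "orbit_of ?\<Gamma> ` U \<subseteq> orbit_of ?\<Gamma> ` {p \<in> Nbar n. coord_rho p \<in> {\<rho>..\<rho>\<^sub>0}}"
        by (rule image_mono)
    qed
    then have "emeasure (riemannian_volume n c) U \<le> vol_rho n c ?\<Gamma> {\<rho>..\<rho>\<^sub>0}"
      unfolding vol_rho_def quotient_volume_def by (rule SUP_upper)
    moreover have "ennreal (m / 16 / \<rho>) \<le> emeasure (riemannian_volume n c) U"
    proof -
      have nu: "ennreal m \<le> nu n r U" if r: "r \<in> {\<rho>..2 * \<rho>}" for r
      proof -
        have "?m = (\<integral>\<^sup>+ X. indicator ?X X * emeasure (Lw n) (?w \<times> {- \<delta><..<\<delta>}) \<partial>LC {1..<n})"
          using sets(1) by (simp add: nn_integral_multc)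
        also have "\<dots> \<le> nu n r U"
          unfolding nu_def
        proof (rule nn_integral_mono)
          fix X
          show "indicator ?X X * emeasure (Lw n) (?w \<times> {- \<delta><..<\<delta>}) \<le>
              indicator (CH_ball n) X * ennreal (1 / one_minus_normX2 n X ^ n) * (\<integral>\<^sup>+ y. indicator U (X, fst y, snd y, r) \<partial>Lw n)"
          proof (cases "X \<in> ?X")
            case True
            have "(\<lambda>y. indicator U (X, fst y, snd y, r) :: ennreal) = indicator (?w \<times> {- \<delta><..<\<delta>})"
              using True r by (auto simp: U_def indicator_def fun_eq_iff)
            then have "(\<integral>\<^sup>+ y. indicator U (X, fst y, snd y, r) \<partial>Lw n) = emeasure (Lw n) (?w \<times> {- \<delta><..<\<delta>})"
              using ws by simp
            moreover have "1 \<le> ennreal (1 / one_minus_normX2 n X ^ n)"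
            proof -
              have Q: "0 < one_minus_normX2 n X" "one_minus_normX2 n X \<le> 1"
                using XB[OF True] by (auto simp: CH_ball_def one_minus_normX2_def sum_nonneg)
              then have "one_minus_normX2 n X ^ n \<le> 1"
                by (intro power_le_one) auto
              then have "1 \<le> 1 / one_minus_normX2 n X ^ n"
                using Q by simp
              then show ?thesis
                by (simp add: ennreal_ge_1)
            qed
            then have "1 * emeasure (Lw n) (?w \<times> {- \<delta><..<\<delta>}) \<le>
                ennreal (1 / one_minus_normX2 n X ^ n) * emeasure (Lw n) (?w \<times> {- \<delta><..<\<delta>})"
              by (intro mult_right_mono) auto
            ultimately show ?thesis
              using True XB[OF True] by simp
          qed simp
        qed
        finally show ?thesis
          using m(2) by (rule order_trans[rotated])
      qed
      \<comment> \<open>Since r <= 2 rho <= 1, the power r^(2n+2) is at most r^n (2 rho)^2, while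
        the numerator is at least r^n; with the 4 of the density this makes 16.\<close>
      have dens: "1 / (16 * \<rho>\<^sup>2) \<le> rho_density n c r" if r: "r \<in> {\<rho>..2 * \<rho>}" for r
      proof -
        have r0: "0 < r" "r \<le> 1"
          using r \<rho> by auto
        have "r ^ (2 * n + 2) = r ^ n * (r ^ n * r\<^sup>2)"
          by (simp add: power_add mult_2 power2_eq_square)
        also have "\<dots> \<le> r ^ n * (1 * (2 * \<rho>)\<^sup>2)"
          using r0 r by (intro mult_left_mono mult_mono power_le_one power_mono) auto
        finally have le: "r ^ (2 * n + 2) \<le> r ^ n * (4 * \<rho>\<^sup>2)"
          by (simp add: power_mult_distrib)
        have "r ^ n = r ^ (n - 1) * r"
          by (rule power_minus_mult[symmetric]) (use n in simp)
        also have "\<dots> \<le> (r + c) ^ (n - 1) * (r + 2 * c)"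
          using r0 c by (intro mult_mono power_mono) auto
        finally have num: "r ^ n \<le> (r + c) ^ (n - 1) * (r + 2 * c)" .
        have "1 / (16 * \<rho>\<^sup>2) = r ^ n / (4 * (r ^ n * (4 * \<rho>\<^sup>2)))"
          using r0 by simp
        also have "\<dots> \<le> r ^ n / (4 * r ^ (2 * n + 2))"
          using le r0 \<rho> by (intro divide_left_mono) auto
        also have "\<dots> \<le> rho_density n c r"
          unfolding rho_density_def using num r0 by (intro divide_right_mono) auto
        finally show ?thesis .
      qed
      have "ennreal (m / 16 / \<rho>) = ennreal (1 / (16 * \<rho>\<^sup>2) * m) * ennreal \<rho>"
        using \<rho> m by (subst ennreal_mult[symmetric]) (auto simp: power2_eq_square)
      also have "\<dots> = (\<integral>\<^sup>+ r. ennreal (1 / (16 * \<rho>\<^sup>2) * m) * indicator {\<rho>..2 * \<rho>} r \<partial>lborel)"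
        using \<rho> by (subst nn_integral_cmult_indicator) auto
      also have "\<dots> \<le> (\<integral>\<^sup>+ r. ennreal (rho_density n c r) * nu n r U \<partial>lborel)"
      proof (rule nn_integral_mono)
        fix r :: real
        show "ennreal (1 / (16 * \<rho>\<^sup>2) * m) * indicator {\<rho>..2 * \<rho>} r \<le> ennreal (rho_density n c r) * nu n r U"
        proof (cases "r \<in> {\<rho>..2 * \<rho>}")
          case True
          have "ennreal (1 / (16 * \<rho>\<^sup>2) * m) = ennreal (1 / (16 * \<rho>\<^sup>2)) * ennreal m"
            using m by (intro ennreal_mult) auto
          also have "\<dots> \<le> ennreal (rho_density n c r) * nu n r U"
            by (intro mult_mono ennreal_leI dens nu True) auto
          finally show ?thesis
            using True by simp
        qed simp
      qed
      also have "\<dots> = emeasure (riemannian_volume n c) U"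
        by (rule emeasure_volume[OF n c U UN, symmetric])
      finally show ?thesis .
    qed
    ultimately show "ennreal (m / 16 / \<rho>) \<le> vol_rho n c ?\<Gamma> {\<rho>..\<rho>\<^sub>0}"
      by (rule order_trans[rotated])
  qed
qed

theorem theorem4p5:
  fixes n :: nat and c :: real and \<Gamma>\<^sub>t :: "(complex mat \<times> heis) set"
  assumes "n \<ge> 1" and "c \<ge> 0"
    and "lattice_subgroup (SUHeis n) (SUHeis_top n) \<Gamma>\<^sub>t"
    and "discrete_subgroup (SUHeis_mod_C n c) (SUHeis_mod_C_top n c) (Gamma_hat n c \<Gamma>\<^sub>t)"
    and "acts_freely_on_Nhat n c (Gamma_hat n c \<Gamma>\<^sub>t)"
  shows "\<forall>\<rho>\<^sub>0>0.
    vol_rho n c (Gamma_group n c \<Gamma>\<^sub>t) {\<rho>\<^sub>0..} < \<infinity> \<and>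
    ((\<lambda>\<rho>. vol_rho n c (Gamma_group n c \<Gamma>\<^sub>t) {\<rho>..\<rho>\<^sub>0}) \<longlongrightarrow> \<infinity>) (at_right 0)"
proof (intro allI impI conjI)
  fix \<rho>\<^sub>0 :: real assume \<rho>\<^sub>0: "0 < \<rho>\<^sub>0"
  show "vol_rho n c (Gamma_group n c \<Gamma>\<^sub>t) {\<rho>\<^sub>0..} < \<infinity>"
    by (rule upper_bound[OF assms(1-3,5) \<rho>\<^sub>0])
  have D: "subgroup \<Gamma>\<^sub>t (SUHeis n)"
    using assms(3) by (simp add: lattice_subgroup_def discrete_subgroup_def)
  obtain e where e: "0 < e" "\<And>\<rho> \<rho>\<^sub>0. 0 < \<rho> \<Longrightarrow> 2 * \<rho> \<le> \<rho>\<^sub>0 \<Longrightarrow> 2 * \<rho> \<le> 1 \<Longrightarrow>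
      ennreal (e / \<rho>) \<le> vol_rho n c (Gamma_group n c \<Gamma>\<^sub>t) {\<rho>..\<rho>\<^sub>0}"
    using lower_bound[OF assms(1,2) D assms(4,5)] by blast
  show "((\<lambda>\<rho>. vol_rho n c (Gamma_group n c \<Gamma>\<^sub>t) {\<rho>..\<rho>\<^sub>0}) \<longlongrightarrow> \<infinity>) (at_right 0)"
    unfolding infinity_ennreal_def tendsto_top_iff_ennreal
  proof (intro allI impI)
    fix l :: real assume l: "0 \<le> l"
    \<comment> \<open>The first two bounds give 2 rho <= rho_0 and 2 rho <= 1, as
      \<open>lower_bound\<close> asks; the third gives e / rho > l + 1.\<close>
    define b where "b = min (\<rho>\<^sub>0 / 2) (min (1 / 2) (e / (l + 1)))"
    have "0 < b"
      using \<rho>\<^sub>0 e(1) l by (simp add: b_def)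
    moreover have "ennreal l < vol_rho n c (Gamma_group n c \<Gamma>\<^sub>t) {\<rho>..\<rho>\<^sub>0}" if \<rho>: "0 < \<rho>" "\<rho> < b" for \<rho>
    proof -
      have "\<rho> < e / (l + 1)"
        using \<rho> by (simp add: b_def)
      then have "\<rho> * (l + 1) < e"
        using l by (simp add: field_simps)
      then have "l + 1 < e / \<rho>"
        using \<rho>(1) by (simp add: field_simps)
      then have "ennreal l < ennreal (e / \<rho>)"
        using l by (intro ennreal_lessI) auto
      also have "\<dots> \<le> vol_rho n c (Gamma_group n c \<Gamma>\<^sub>t) {\<rho>..\<rho>\<^sub>0}"
        using \<rho> by (intro e(2)) (auto simp: b_def)
      finally show ?thesis .
    qed
    ultimately show "\<forall>\<^sub>F \<rho> in at_right 0. ennreal l < vol_rho n c (Gamma_group n c \<Gamma>\<^sub>t) {\<rho>..\<rho>\<^sub>0}"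
      unfolding eventually_at_right_field by blast
  qed
qed

end
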